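(* Let $\Gamma$ be an abelian group and $A$ a $\Gamma$-graded field. Let $\mathcal{C}$ be the category of $\Gamma$-graded matricial $A$-algebras with graded $A$-algebra homomorphisms, and let $\mathcal{C}^{\mathrm{out}}$ be the quotient category with the same objects and with graded $A$-algebra homomorphisms modulo graded inner-automorphisms of degree zero as morphisms. Then $K_0^{\mathrm{gr}}:\mathcal{C}^{\mathrm{out}}\to\mathcal{P}_\Gamma$, $R\mapsto (K_0^{\mathrm{gr}}(R),[R])$, is a fully faithful functor. Namely: (1) (well-defined and faithful) For any graded matricial $A$-algebras $R$ and $S$ and $\phi,\psi\in\mathrm{Hom}_{\mathcal{C}}(R,S)$, there is an invertible homogeneous element $x$ of $S$ of degree zero with $\phi(r)=x\psi(r)x^{-1}$ for all $r\in R$ if and only if $K_0^{\mathrm{gr}}(\phi)=K_0^{\mathrm{gr}}(\psi)$. (2) (full) For any graded matricial $A$-algebras $R$ and $S$ and any morphism $f:(K_0^{\mathrm{gr}}(R),[R])\to(K_0^{\mathrm{gr}}(S),[S])$ in $\mathcal{P}_\Gamma$, there is $\phi\in\mathrm{Hom}_{\mathcal{C}}(R,S)$ such that $K_0^{\mathrm{gr}}(\phi)=f$.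
   Context: A $\Gamma$-graded field is a nonzero commutative $\Gamma$-graded ring in which every nonzero homogeneous element is invertible. All algebras and homomorphisms are unital; graded homomorphisms preserve degree. For $\overline{\delta}=(\delta_1,\dots,\delta_n)\in\Gamma^n$, $\mathbb{M}_n(A)(\overline{\delta})$ is the ring of $n\times n$ matrices over $A$ with grading whose $\lambda$-component consists of the matrices with $(i,j)$-entry in $A_{\lambda+\delta_j-\delta_i}$; thus $\deg(e_{ij}(a))=\deg(a)+\delta_i-\delta_j$. A $\Gamma$-graded matricial $A$-algebra is a graded $A$-algebra of the form $\mathbb{M}_{n_1}(A)(\overline{\delta}_1)\times\dots\times\mathbb{M}_{n_l}(A)(\overline{\delta}_l)$ with $\overline{\delta}_i\in\Gamma^{n_i}$. In $\mathcal{C}^{\mathrm{out}}$, graded homomorphisms $\phi,\psi\in\mathrm{Hom}_{\mathcal{C}}(R,S)$ represent the same morphism if there is an invertible homogeneous $x\in S$ with $\deg(x)=0$ such that $\phi=\theta\psi$, where $\theta(s)=xsx^{-1}$. For a $\Gamma$-graded ring $R$, $K_0^{\mathrm{gr}}(R)$ is the group completion of the monoid of isomorphism classes of graded finitely generated projective right $R$-modules (with degree-preserving homomorphisms); $\Gamma$ acts by $\alpha[P]=[P(\alpha)]$, where $P(\alpha)_\gamma=P_{\alpha+\gamma}$. It is pre-ordered with positive cone the set of classes $[P]$ of graded finitely generated projective modules, and $[R]$ is an order-unit. A graded ring homomorphism $\phi:R\to S$ induces $K_0^{\mathrm{gr}}(\phi):[P]\mapsto[P\otimes_RS]$. A $\Gamma$-pre-ordered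 group is a $\Gamma$-module $G$ with a reflexive transitive relation $\le$ compatible with addition and the $\Gamma$-action; $G^+=\{g\mid g\ge 0\}$. An order-unit is $u\in G^+$ such that for each $g\in G$ there are $\alpha_1,\dots,\alpha_n\in\Gamma$ with $g\le\sum_i\alpha_iu$. $\mathcal{P}_\Gamma$ is the category of pairs $(G,u)$, $G$ a $\Gamma$-pre-ordered abelian group and $u$ an order-unit, with morphisms $f:(G,u)\to(H,v)$ the $\Gamma$-module homomorphisms with $f(G^+)\subseteq H^+$ and $f(u)=v$. *)

theory Defs
  imports "HOL-Algebra.Ring" "HOL-Algebra.Generated_Groups" "HOL-Algebra.Free_Abelian_Groups"
begin

section \<open>Graded rings\<close>

text \<open>
  The grading group \<open>\<Gamma>\<close> is a type of class \<^class>\<open>ab_group_add\<close>. A grading of a commutative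
  group is a family of subgroups of which the group is the internal direct sum. As elsewhere in
  HOL-Algebra, bare commutative groups (also the additive groups of modules and \<open>K\<^sub>0\<close>-groups)
  are written with the operations of the record \<^type>\<open>monoid\<close>, so there \<open>\<otimes>\<close> denotes the sum
  and \<open>\<one>\<close> the zero element.
\<close>

definition grading :: "('m, 'b) monoid_scheme \<Rightarrow> ('g \<Rightarrow> 'm set) \<Rightarrow> bool" where
  "grading G D \<longleftrightarrow>
     (\<forall>\<gamma>. subgroup (D \<gamma>) G) \<and>
     (\<forall>x\<in>carrier G. \<exists>!f. (\<forall>\<gamma>. f \<gamma> \<in> D \<gamma>) \<and> finite {\<gamma>. f \<gamma> \<noteq> \<one>\<^bsub>G\<^esub>} \<and> x = gfinprod G f UNIV)"

record ('g, 'r) gring = "'r ring" +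
  grade :: "'g \<Rightarrow> 'r set"

locale gr_ring = ring R
  for R :: "('g::ab_group_add, 'r, 'x) gring_scheme" (structure) +
  assumes grading: "grading (add_monoid R) (grade R)"
    and grade_mult: "\<lbrakk>x \<in> grade R \<alpha>; y \<in> grade R \<beta>\<rbrakk> \<Longrightarrow> x \<otimes> y \<in> grade R (\<alpha> + \<beta>)"

locale gr_field = gr_ring A + cring A
  for A :: "('g::ab_group_add, 'a, 'x) gring_scheme" (structure) +
  assumes one_not_zero: "\<one> \<noteq> \<zero>"
    and homogeneous_Units: "\<lbrakk>x \<in> grade A \<gamma>; x \<noteq> \<zero>\<rbrakk> \<Longrightarrow> x \<in> Units A"


section \<open>Graded matricial algebras\<close>

record ('g, 'a, 'r) galg = "('g, 'r) gring" +
  scale :: "'a \<Rightarrow> 'r \<Rightarrow> 'r"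

text \<open>
  The matrix algebra \<open>M\<^sub>n(A)(\<delta>)\<close>, where \<open>n = length \<delta>\<close>; rows and columns are numbered from \<open>0\<close>.
\<close>

definition gr_mat :: "('g::ab_group_add, 'a) gring \<Rightarrow> 'g list \<Rightarrow> ('g, 'a, nat \<times> nat \<Rightarrow> 'a) galg" where
  "gr_mat A \<delta> =
    (let n = length \<delta>; I = {..<n} \<times> {..<n} in
     \<lparr>carrier = I \<rightarrow>\<^sub>E carrier A,
      monoid.mult = (\<lambda>x y. \<lambda>(i, j)\<in>I. \<Oplus>\<^bsub>A\<^esub>k\<in>{..<n}. x (i, k) \<otimes>\<^bsub>A\<^esub> y (k, j)),
      one = (\<lambda>(i, j)\<in>I. if i = j then \<one>\<^bsub>A\<^esub> else \<zero>\<^bsub>A\<^esub>),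
      ring.zero = (\<lambda>(i, j)\<in>I. \<zero>\<^bsub>A\<^esub>),
      add = (\<lambda>x y. \<lambda>(i, j)\<in>I. x (i, j) \<oplus>\<^bsub>A\<^esub> y (i, j)),
      grade = (\<lambda>\<gamma>. \<Pi>\<^sub>E (i, j)\<in>I. grade A (\<gamma> + \<delta> ! j - \<delta> ! i)),
      scale = (\<lambda>a x. \<lambda>(i, j)\<in>I. a \<otimes>\<^bsub>A\<^esub> x (i, j))\<rparr>)"

definition gr_prod :: "('g, 'a, 'r) galg list \<Rightarrow> ('g, 'a, nat \<Rightarrow> 'r) galg" where
  "gr_prod Rs =
    (let L = {..<length Rs} in
     \<lparr>carrier = (\<Pi>\<^sub>E k\<in>L. carrier (Rs ! k)),
      monoid.mult = (\<lambda>x y. \<lambda>k\<in>L. x k \<otimes>\<^bsub>Rs ! k\<^esub> y k),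
      one = (\<lambda>k\<in>L. \<one>\<^bsub>Rs ! k\<^esub>),
      ring.zero = (\<lambda>k\<in>L. \<zero>\<^bsub>Rs ! k\<^esub>),
      add = (\<lambda>x y. \<lambda>k\<in>L. x k \<oplus>\<^bsub>Rs ! k\<^esub> y k),
      grade = (\<lambda>\<gamma>. \<Pi>\<^sub>E k\<in>L. grade (Rs ! k) \<gamma>),
      scale = (\<lambda>a x. \<lambda>k\<in>L. scale (Rs ! k) a (x k))\<rparr>)"

type_synonym 'a blocks = "nat \<Rightarrow> nat \<times> nat \<Rightarrow> 'a"

definition matricial_algebras ::
  "('g::ab_group_add, 'a) gring \<Rightarrow> ('g, 'a, 'a blocks) galg set" where
  "matricial_algebras A = {gr_prod (map (gr_mat A) \<Delta>) | \<Delta>. \<Delta> \<noteq> [] \<and> [] \<notin> set \<Delta>}"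

text \<open>
  Maps between carriers are made extensional, so that morphisms are equal if and only if they agree
  on the carrier of their domain.
\<close>

definition gr_alg_hom ::
  "('g, 'a, 'x) gring_scheme \<Rightarrow> ('g, 'a, 'r) galg \<Rightarrow> ('g, 'a, 's) galg \<Rightarrow> ('r \<Rightarrow> 's) set" where
  "gr_alg_hom A R S =
     {\<phi> \<in> ring_hom R S \<inter> extensional (carrier R).
        (\<forall>\<gamma>. \<phi> ` grade R \<gamma> \<subseteq> grade S \<gamma>) \<and>
        (\<forall>a\<in>carrier A. \<forall>r\<in>carrier R. \<phi> (scale R a r) = scale S a (\<phi> r))}"


section \<open>Graded modules\<close>

record ('g, 'r, 'm) gmodule = "'m monoid" +
  ract :: "'m \<Rightarrow> 'r \<Rightarrow> 'm" (infixl \<open>\<star>\<index>\<close> 75)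
  mgrade :: "'g \<Rightarrow> 'm set"

locale gr_module = R?: gr_ring R + M?: comm_group M
  for R :: "('g::ab_group_add, 'r, 'x) gring_scheme" (structure)
    and M :: "('g, 'r, 'm, 'y) gmodule_scheme" (structure) +
  assumes ract_closed: "\<lbrakk>m \<in> carrier M; r \<in> carrier R\<rbrakk> \<Longrightarrow> m \<star>\<^bsub>M\<^esub> r \<in> carrier M"
    and ract_add_left: "\<lbrakk>m \<in> carrier M; m' \<in> carrier M; r \<in> carrier R\<rbrakk>
      \<Longrightarrow> (m \<otimes>\<^bsub>M\<^esub> m') \<star>\<^bsub>M\<^esub> r = m \<star>\<^bsub>M\<^esub> r \<otimes>\<^bsub>M\<^esub> m' \<star>\<^bsub>M\<^esub> r"
    and ract_add_right: "\<lbrakk>m \<in> carrier M; r \<in> carrier R; s \<in> carrier R\<rbrakk>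
      \<Longrightarrow> m \<star>\<^bsub>M\<^esub> (r \<oplus>\<^bsub>R\<^esub> s) = m \<star>\<^bsub>M\<^esub> r \<otimes>\<^bsub>M\<^esub> m \<star>\<^bsub>M\<^esub> s"
    and ract_mult: "\<lbrakk>m \<in> carrier M; r \<in> carrier R; s \<in> carrier R\<rbrakk>
      \<Longrightarrow> m \<star>\<^bsub>M\<^esub> (r \<otimes>\<^bsub>R\<^esub> s) = (m \<star>\<^bsub>M\<^esub> r) \<star>\<^bsub>M\<^esub> s"
    and ract_one: "m \<in> carrier M \<Longrightarrow> m \<star>\<^bsub>M\<^esub> \<one>\<^bsub>R\<^esub> = m"
    and module_grading: "grading M (mgrade M)"
    and grade_ract: "\<lbrakk>m \<in> mgrade M \<alpha>; r \<in> grade R \<beta>\<rbrakk> \<Longrightarrow> m \<star>\<^bsub>M\<^esub> r \<in> mgrade M (\<alpha> + \<beta>)"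

definition gr_module_hom ::
  "('g, 'r, 'x) gring_scheme \<Rightarrow> ('g, 'r, 'm) gmodule \<Rightarrow> ('g, 'r, 'n) gmodule \<Rightarrow> ('m \<Rightarrow> 'n) set" where
  "gr_module_hom R M N =
     {f \<in> hom M N.
        (\<forall>m\<in>carrier M. \<forall>r\<in>carrier R. f (m \<star>\<^bsub>M\<^esub> r) = f m \<star>\<^bsub>N\<^esub> r) \<and>
        (\<forall>\<gamma>. f ` mgrade M \<gamma> \<subseteq> mgrade N \<gamma>)}"

definition gr_isomorphic ::
  "('g, 'r, 'x) gring_scheme \<Rightarrow> ('g, 'r, 'm) gmodule \<Rightarrow> ('g, 'r, 'n) gmodule \<Rightarrow> bool" where
  "gr_isomorphic R M N \<longleftrightarrow> (\<exists>f\<in>gr_module_hom R M N. bij_betw f (carrier M) (carrier N))"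

definition regular_module :: "('g, 'r, 'x) gring_scheme \<Rightarrow> ('g, 'r, 'r) gmodule" where
  "regular_module R =
     \<lparr>carrier = carrier R, monoid.mult = add R, one = ring.zero R, ract = monoid.mult R, mgrade = grade R\<rparr>"

definition zero_module :: "('g, 'r, unit) gmodule" where
  "zero_module =
     \<lparr>carrier = {()}, monoid.mult = (\<lambda>_ _. ()), one = (), ract = (\<lambda>_ _. ()), mgrade = (\<lambda>_. {()})\<rparr>"

definition direct_sum ::
  "('g, 'r, 'm) gmodule \<Rightarrow> ('g, 'r, 'n) gmodule \<Rightarrow> ('g, 'r, 'm \<times> 'n) gmodule" where
  "direct_sum M N =
     \<lparr>carrier = carrier (M \<times>\<times> N), monoid.mult = monoid.mult (M \<times>\<times> N), one = one (M \<times>\<times> N),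
      ract = (\<lambda>(m, n) r. (m \<star>\<^bsub>M\<^esub> r, n \<star>\<^bsub>N\<^esub> r)), mgrade = (\<lambda>\<gamma>. mgrade M \<gamma> \<times> mgrade N \<gamma>)\<rparr>"

definition shift :: "'g::ab_group_add \<Rightarrow> ('g, 'r, 'm) gmodule \<Rightarrow> ('g, 'r, 'm) gmodule" where
  "shift \<alpha> M = M\<lparr>mgrade := (\<lambda>\<gamma>. mgrade M (\<alpha> + \<gamma>))\<rparr>"

text \<open>
  A module is finitely generated by \<open>X\<close> if every element is a finite sum of elements
  \<open>x \<star> r\<close> with \<open>x \<in> X\<close>; \<^const>\<open>generate\<close> is the generated subgroup.
\<close>

definition fin_generated :: "('g, 'r, 'x) gring_scheme \<Rightarrow> ('g, 'r, 'm) gmodule \<Rightarrow> bool" where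
  "fin_generated R M \<longleftrightarrow>
     (\<exists>X. finite X \<and> X \<subseteq> carrier M \<and>
          generate M {x \<star>\<^bsub>M\<^esub> r | x r. x \<in> X \<and> r \<in> carrier R} = carrier M)"

text \<open>
  Isomorphism classes need a fixed type of modules. The elements of a finitely generated graded
  projective \<open>R\<close>-module can be taken to be \<open>n\<close>-tuples over \<open>R\<close>, as it is isomorphic to a direct
  summand of some \<open>R(\<delta>\<^sub>1) \<oplus> \<dots> \<oplus> R(\<delta>\<^sub>n)\<close>; hence every such module is isomorphic to one with elements
  in the type \<open>nat \<Rightarrow> 'r\<close>. That type also suffices for testing the lifting property of a
  finitely generated module: lifting the identity along a surjection from some
  \<open>R(\<delta>\<^sub>1) \<oplus> \<dots> \<oplus> R(\<delta>\<^sub>n)\<close> already exhibits it as a direct summand, so that it has the lifting property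
  with respect to modules of any size.
\<close>

type_synonym ('g, 'r) tuple_module = "('g, 'r, nat \<Rightarrow> 'r) gmodule"

definition gr_projective :: "('g::ab_group_add, 'r, 'x) gring_scheme \<Rightarrow> ('g, 'r) tuple_module \<Rightarrow> bool" where
  "gr_projective R P \<longleftrightarrow>
     (\<forall>(M :: ('g, 'r) tuple_module) (N :: ('g, 'r) tuple_module). \<forall>g\<in>gr_module_hom R M N.
        \<forall>f\<in>gr_module_hom R P N.
        gr_module R M \<and> gr_module R N \<and> g ` carrier M = carrier N \<longrightarrow>
        (\<exists>h\<in>gr_module_hom R P M. \<forall>p\<in>carrier P. g (h p) = f p))"

definition gr_fgp :: "('g::ab_group_add, 'r, 'x) gring_scheme \<Rightarrow> ('g, 'r) tuple_module set" where
  "gr_fgp R = {P. gr_module R P \<and> fin_generated R P \<and> gr_projective R P}"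

definition iso_class ::
  "('g::ab_group_add, 'r, 'x) gring_scheme \<Rightarrow> ('g, 'r, 'm) gmodule \<Rightarrow> ('g, 'r) tuple_module set" where
  "iso_class R M = {Q \<in> gr_fgp R. gr_isomorphic R M Q}"


section \<open>Tensor products\<close>

text \<open>
  For a ring homomorphism \<open>\<phi> : R \<rightarrow> S\<close> and a right \<open>R\<close>-module \<open>P\<close>, the right \<open>S\<close>-module \<open>P \<otimes>\<^sub>R S\<close> is
  the quotient of the free abelian group on pairs \<open>(p, s)\<close> by the bilinearity relations and
  \<open>(p r, s) = (p, \<phi>(r) s)\<close>. Its component of degree \<open>\<gamma>\<close> is generated by the tensors \<open>p \<otimes> s\<close> with
  \<open>deg p + deg s = \<gamma>\<close>.
\<close>

definition tensor_free ::
  "('s, 'y) ring_scheme \<Rightarrow> ('g, 'r, 'm) gmodule \<Rightarrow> ('m \<times> 's \<Rightarrow>\<^sub>0 int) monoid" where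
  "tensor_free S P = free_Abelian_group (carrier P \<times> carrier S)"

definition tensor_relations ::
  "('r, 'x) ring_scheme \<Rightarrow> ('s, 'y) ring_scheme \<Rightarrow> ('r \<Rightarrow> 's) \<Rightarrow> ('g, 'r, 'm) gmodule
     \<Rightarrow> ('m \<times> 's \<Rightarrow>\<^sub>0 int) set" where
  "tensor_relations R S \<phi> P =
     {frag_of (p \<otimes>\<^bsub>P\<^esub> q, s) - frag_of (p, s) - frag_of (q, s) | p q s.
        p \<in> carrier P \<and> q \<in> carrier P \<and> s \<in> carrier S} \<union>
     {frag_of (p, s \<oplus>\<^bsub>S\<^esub> t) - frag_of (p, s) - frag_of (p, t) | p s t.
        p \<in> carrier P \<and> s \<in> carrier S \<and> t \<in> carrier S} \<union>
     {frag_of (p \<star>\<^bsub>P\<^esub> r, s) - frag_of (p, \<phi> r \<otimes>\<^bsub>S\<^esub> s) | p r s.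
        p \<in> carrier P \<and> r \<in> carrier R \<and> s \<in> carrier S}"

definition tensor ::
  "('g::ab_group_add, 'r, 'x) gring_scheme \<Rightarrow> ('g, 's, 'y) gring_scheme \<Rightarrow> ('r \<Rightarrow> 's)
     \<Rightarrow> ('g, 'r, 'm) gmodule \<Rightarrow> ('g, 's, ('m \<times> 's \<Rightarrow>\<^sub>0 int) set) gmodule" where
  "tensor R S \<phi> P =
    (let F = tensor_free S P;
         N = generate F (tensor_relations R S \<phi> P);
         T = F Mod N
     in \<lparr>carrier = carrier T, monoid.mult = monoid.mult T, one = one T,
         ract = (\<lambda>C t. \<Union>c\<in>C. N #>\<^bsub>F\<^esub> frag_extend (\<lambda>(p, s). frag_of (p, s \<otimes>\<^bsub>S\<^esub> t)) c),
         mgrade = (\<lambda>\<gamma>. generate T {N #>\<^bsub>F\<^esub> frag_of (p, s) | p s \<alpha> \<beta>.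
                      p \<in> mgrade P \<alpha> \<and> s \<in> grade S \<beta> \<and> \<alpha> + \<beta> = \<gamma>})\<rparr>)"


section \<open>Group completion\<close>

definition gc_rel :: "('v, 'x) monoid_scheme \<Rightarrow> (('v \<times> 'v) \<times> ('v \<times> 'v)) set" where
  "gc_rel M =
     {((a, b), (c, d)). a \<in> carrier M \<and> b \<in> carrier M \<and> c \<in> carrier M \<and> d \<in> carrier M \<and>
        (\<exists>e\<in>carrier M. a \<otimes>\<^bsub>M\<^esub> d \<otimes>\<^bsub>M\<^esub> e = c \<otimes>\<^bsub>M\<^esub> b \<otimes>\<^bsub>M\<^esub> e)}"

definition group_completion :: "('v, 'x) monoid_scheme \<Rightarrow> ('v \<times> 'v) set monoid" where
  "group_completion M =
     \<lparr>carrier = (carrier M \<times> carrier M) // gc_rel M,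
      monoid.mult = (\<lambda>X Y. \<Union>(a, b)\<in>X. \<Union>(c, d)\<in>Y. gc_rel M `` {(a \<otimes>\<^bsub>M\<^esub> c, b \<otimes>\<^bsub>M\<^esub> d)}),
      one = gc_rel M `` {(\<one>\<^bsub>M\<^esub>, \<one>\<^bsub>M\<^esub>)}\<rparr>"

definition gc_inj :: "('v, 'x) monoid_scheme \<Rightarrow> 'v \<Rightarrow> ('v \<times> 'v) set" where
  "gc_inj M a = gc_rel M `` {(a, \<one>\<^bsub>M\<^esub>)}"

text \<open>The map of group completions induced by a monoid homomorphism into \<open>N\<close>.\<close>

definition gc_map :: "('w, 'y) monoid_scheme \<Rightarrow> ('v \<Rightarrow> 'w) \<Rightarrow> ('v \<times> 'v) set \<Rightarrow> ('w \<times> 'w) set" where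
  "gc_map N h X = (\<Union>(a, b)\<in>X. gc_rel N `` {(h a, h b)})"


section \<open>Pre-ordered groups with an action of the grading group\<close>

record ('g, 'k) pogroup = "'k monoid" +
  act :: "'g \<Rightarrow> 'k \<Rightarrow> 'k"
  le :: "'k \<Rightarrow> 'k \<Rightarrow> bool" (infix \<open>\<preceq>\<index>\<close> 50)

locale preordered_group = comm_group G
  for G :: "('g::ab_group_add, 'k) pogroup" (structure) +
  assumes act_closed: "x \<in> carrier G \<Longrightarrow> act G \<alpha> x \<in> carrier G"
    and act_add: "\<lbrakk>x \<in> carrier G; y \<in> carrier G\<rbrakk> \<Longrightarrow> act G \<alpha> (x \<otimes> y) = act G \<alpha> x \<otimes> act G \<alpha> y"
    and act_zero: "x \<in> carrier G \<Longrightarrow> act G 0 x = x"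
    and act_act: "x \<in> carrier G \<Longrightarrow> act G (\<alpha> + \<beta>) x = act G \<alpha> (act G \<beta> x)"
    and le_refl: "x \<in> carrier G \<Longrightarrow> x \<preceq> x"
    and le_trans: "\<lbrakk>x \<in> carrier G; y \<in> carrier G; z \<in> carrier G; x \<preceq> y; y \<preceq> z\<rbrakk> \<Longrightarrow> x \<preceq> z"
    and le_add: "\<lbrakk>x \<in> carrier G; y \<in> carrier G; z \<in> carrier G; x \<preceq> y\<rbrakk> \<Longrightarrow> x \<otimes> z \<preceq> y \<otimes> z"
    and le_act: "\<lbrakk>x \<in> carrier G; y \<in> carrier G; x \<preceq> y\<rbrakk> \<Longrightarrow> act G \<alpha> x \<preceq> act G \<alpha> y"

definition pos_cone :: "('g, 'k) pogroup \<Rightarrow> 'k set" where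
  "pos_cone G = {x \<in> carrier G. \<one>\<^bsub>G\<^esub> \<preceq>\<^bsub>G\<^esub> x}"

definition order_unit :: "('g, 'k) pogroup \<Rightarrow> 'k \<Rightarrow> bool" where
  "order_unit G u \<longleftrightarrow>
     u \<in> pos_cone G \<and>
     (\<forall>x\<in>carrier G. \<exists>\<alpha>s. x \<preceq>\<^bsub>G\<^esub> finprod G (\<lambda>i. act G (\<alpha>s ! i) u) {..<length \<alpha>s})"

definition pogroup_hom :: "('g, 'k) pogroup \<times> 'k \<Rightarrow> ('g, 'l) pogroup \<times> 'l \<Rightarrow> ('k \<Rightarrow> 'l) set" where
  "pogroup_hom = (\<lambda>(G, u) (H, v).
     {f \<in> hom G H \<inter> extensional (carrier G).
        (\<forall>\<alpha>. \<forall>x\<in>carrier G. f (act G \<alpha> x) = act H \<alpha> (f x)) \<and>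
        f ` pos_cone G \<subseteq> pos_cone H \<and>
        f u = v})"


section \<open>The graded Grothendieck group\<close>

text \<open>
  The operations on isomorphism classes are given as unions over representatives; all the classes
  in such a union coincide.
\<close>

definition V_gr :: "('g::ab_group_add, 'r, 'x) gring_scheme \<Rightarrow> ('g, 'r) tuple_module set monoid" where
  "V_gr R =
     \<lparr>carrier = iso_class R ` gr_fgp R,
      monoid.mult = (\<lambda>X Y. \<Union>P\<in>X. \<Union>Q\<in>Y. iso_class R (direct_sum P Q)),
      one = iso_class R zero_module\<rparr>"

definition V_shift ::
  "('g::ab_group_add, 'r, 'x) gring_scheme \<Rightarrow> 'g \<Rightarrow> ('g, 'r) tuple_module set
     \<Rightarrow> ('g, 'r) tuple_module set" where
  "V_shift R \<alpha> X = (\<Union>P\<in>X. iso_class R (shift \<alpha> P))"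

definition V_map ::
  "('g::ab_group_add, 'r, 'x) gring_scheme \<Rightarrow> ('g, 's, 'y) gring_scheme \<Rightarrow> ('r \<Rightarrow> 's)
     \<Rightarrow> ('g, 'r) tuple_module set \<Rightarrow> ('g, 's) tuple_module set" where
  "V_map R S \<phi> X = (\<Union>P\<in>X. iso_class S (tensor R S \<phi> P))"

type_synonym ('g, 'r) K0_elem = "(('g, 'r) tuple_module set \<times> ('g, 'r) tuple_module set) set"

definition K0_class ::
  "('g::ab_group_add, 'r, 'x) gring_scheme \<Rightarrow> ('g, 'r, 'm) gmodule \<Rightarrow> ('g, 'r) K0_elem" where
  "K0_class R P = gc_inj (V_gr R) (iso_class R P)"

definition K0_group ::
  "('g::ab_group_add, 'r, 'x) gring_scheme \<Rightarrow> ('g, ('g, 'r) K0_elem) pogroup" where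
  "K0_group R =
    (let G = group_completion (V_gr R) in
     \<lparr>carrier = carrier G, monoid.mult = monoid.mult G, one = one G,
      act = (\<lambda>\<alpha>. gc_map (V_gr R) (V_shift R \<alpha>)),
      le = (\<lambda>x y. y \<otimes>\<^bsub>G\<^esub> inv\<^bsub>G\<^esub> x \<in> K0_class R ` gr_fgp R)\<rparr>)"

definition K0_obj ::
  "('g::ab_group_add, 'r, 'x) gring_scheme \<Rightarrow> ('g, ('g, 'r) K0_elem) pogroup \<times> ('g, 'r) K0_elem" where
  "K0_obj R = (K0_group R, K0_class R (regular_module R))"

definition K0_map ::
  "('g::ab_group_add, 'r, 'x) gring_scheme \<Rightarrow> ('g, 's, 'y) gring_scheme \<Rightarrow> ('r \<Rightarrow> 's)
     \<Rightarrow> ('g, 'r) K0_elem \<Rightarrow> ('g, 's) K0_elem" where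
  "K0_map R S \<phi> = restrict (gc_map (V_gr S) (V_map R S \<phi>)) (carrier (K0_group R))"


section \<open>Categories and functors\<close>

text \<open>Hom-sets need not be disjoint, so composition takes the three objects as parameters.\<close>

record ('o, 'm) cat =
  Obj :: "'o set"
  Hom :: "'o \<Rightarrow> 'o \<Rightarrow> 'm set"
  Ident :: "'o \<Rightarrow> 'm"
  Comp :: "'o \<Rightarrow> 'o \<Rightarrow> 'o \<Rightarrow> 'm \<Rightarrow> 'm \<Rightarrow> 'm"

locale category =
  fixes C :: "('o, 'm) cat"
  assumes Ident_Hom: "X \<in> Obj C \<Longrightarrow> Ident C X \<in> Hom C X X"
    and Comp_Hom: "\<lbrakk>X \<in> Obj C; Y \<in> Obj C; Z \<in> Obj C; f \<in> Hom C X Y; g \<in> Hom C Y Z\<rbrakk>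
      \<Longrightarrow> Comp C X Y Z g f \<in> Hom C X Z"
    and Comp_Ident: "\<lbrakk>X \<in> Obj C; Y \<in> Obj C; f \<in> Hom C X Y\<rbrakk> \<Longrightarrow> Comp C X X Y f (Ident C X) = f"
    and Ident_Comp: "\<lbrakk>X \<in> Obj C; Y \<in> Obj C; f \<in> Hom C X Y\<rbrakk> \<Longrightarrow> Comp C X Y Y (Ident C Y) f = f"
    and Comp_assoc: "\<lbrakk>W \<in> Obj C; X \<in> Obj C; Y \<in> Obj C; Z \<in> Obj C;
        f \<in> Hom C W X; g \<in> Hom C X Y; h \<in> Hom C Y Z\<rbrakk>
      \<Longrightarrow> Comp C W Y Z h (Comp C W X Y g f) = Comp C W X Z (Comp C X Y Z h g) f"

locale cat_functor = C: category C + D: category D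
  for C :: "('o, 'm) cat" and D :: "('p, 'n) cat" +
  fixes Fo :: "'o \<Rightarrow> 'p" and Fm :: "'o \<Rightarrow> 'o \<Rightarrow> 'm \<Rightarrow> 'n"
  assumes Fo_Obj: "X \<in> Obj C \<Longrightarrow> Fo X \<in> Obj D"
    and Fm_Hom: "\<lbrakk>X \<in> Obj C; Y \<in> Obj C; f \<in> Hom C X Y\<rbrakk> \<Longrightarrow> Fm X Y f \<in> Hom D (Fo X) (Fo Y)"
    and Fm_Ident: "X \<in> Obj C \<Longrightarrow> Fm X X (Ident C X) = Ident D (Fo X)"
    and Fm_Comp: "\<lbrakk>X \<in> Obj C; Y \<in> Obj C; Z \<in> Obj C; f \<in> Hom C X Y; g \<in> Hom C Y Z\<rbrakk>
      \<Longrightarrow> Fm X Z (Comp C X Y Z g f) = Comp D (Fo X) (Fo Y) (Fo Z) (Fm Y Z g) (Fm X Y f)"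

locale fully_faithful_functor = cat_functor +
  assumes faithful: "\<lbrakk>X \<in> Obj C; Y \<in> Obj C\<rbrakk> \<Longrightarrow> inj_on (Fm X Y) (Hom C X Y)"
    and full: "\<lbrakk>X \<in> Obj C; Y \<in> Obj C\<rbrakk> \<Longrightarrow> Fm X Y ` Hom C X Y = Hom D (Fo X) (Fo Y)"

definition matricial_cat ::
  "('g::ab_group_add, 'a) gring \<Rightarrow> (('g, 'a, 'a blocks) galg, 'a blocks \<Rightarrow> 'a blocks) cat" where
  "matricial_cat A =
     \<lparr>Obj = matricial_algebras A,
      Hom = gr_alg_hom A,
      Ident = (\<lambda>R. \<lambda>r\<in>carrier R. r),
      Comp = (\<lambda>R S T g f. compose (carrier R) g f)\<rparr>"

definition inner_rel ::
  "('g::ab_group_add, 'a) gring \<Rightarrow> ('g, 'a, 'r) galg \<Rightarrow> ('g, 'a, 's) galg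
     \<Rightarrow> (('r \<Rightarrow> 's) \<times> ('r \<Rightarrow> 's)) set" where
  "inner_rel A R S =
     {(\<phi>, \<psi>). \<phi> \<in> gr_alg_hom A R S \<and> \<psi> \<in> gr_alg_hom A R S \<and>
        (\<exists>x\<in>Units S \<inter> grade S 0. \<forall>r\<in>carrier R. \<phi> r = x \<otimes>\<^bsub>S\<^esub> \<psi> r \<otimes>\<^bsub>S\<^esub> inv\<^bsub>S\<^esub> x)}"

text \<open>The quotient category, whose morphisms are the classes of \<^const>\<open>inner_rel\<close>.\<close>

definition matricial_cat_out ::
  "('g::ab_group_add, 'a) gring \<Rightarrow> (('g, 'a, 'a blocks) galg, ('a blocks \<Rightarrow> 'a blocks) set) cat" where
  "matricial_cat_out A =
    (let C = matricial_cat A in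
     \<lparr>Obj = Obj C,
      Hom = (\<lambda>R S. Hom C R S // inner_rel A R S),
      Ident = (\<lambda>R. inner_rel A R R `` {Ident C R}),
      Comp = (\<lambda>R S T Y X. \<Union>g\<in>Y. \<Union>f\<in>X. inner_rel A R T `` {Comp C R S T g f})\<rparr>)"

definition pogroup_cat :: "(('g::ab_group_add, 'k) pogroup \<times> 'k, 'k \<Rightarrow> 'k) cat" where
  "pogroup_cat =
     \<lparr>Obj = {(G, u). preordered_group G \<and> order_unit G u},
      Hom = pogroup_hom,
      Ident = (\<lambda>(G, u). \<lambda>x\<in>carrier G. x),
      Comp = (\<lambda>(G, u) (H, v) (K, w) g f. compose (carrier G) g f)\<rparr>"

text \<open>
  The value on a class of homomorphisms is the common value of \<^const>\<open>K0_map\<close> on its members; it is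
  meaningful because \<^const>\<open>K0_map\<close> is constant on the classes of \<^const>\<open>inner_rel\<close>, which is part
  of the claim.
\<close>

definition K0_map_out ::
  "('g::ab_group_add, 'r, 'x) gring_scheme \<Rightarrow> ('g, 's, 'y) gring_scheme \<Rightarrow> ('r \<Rightarrow> 's) set
     \<Rightarrow> ('g, 'r) K0_elem \<Rightarrow> ('g, 's) K0_elem" where
  "K0_map_out R S X = the_elem (K0_map R S ` X)"

end

theory Submission
  imports Defs
begin

text \<open>
  A finitely generated graded module is projective if and only if it has a finite homogeneous dual
  basis, and scalar extension along a graded ring homomorphism carries dual bases to dual bases; all
  of functoriality rests on this. Over a matricial algebra \<open>S\<close>, the regular module is a direct sum of
  row modules, whose nonzero degree-preserving endomorphisms are scalars from the graded field and
  hence invertible. Modules of this kind cancel from direct sums and are prime for direct summands, so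
  the monoid of isomorphism classes is cancellative and is generated by the shifted row modules;
  in particular equal classes in \<open>K\<^sub>0\<close> belong to isomorphic modules.

  For faithfulness, let \<open>e\<close> and \<open>f\<close> be the images of the matrix units of \<open>R\<close> under two homomorphisms into
  \<open>S\<close>. If these agree on \<open>K\<^sub>0\<close>, then \<open>e\<^sub>k\<^sub>0\<^sub>0 S\<close> and \<open>f\<^sub>k\<^sub>0\<^sub>0 S\<close> are isomorphic for each block \<open>k\<close>, by left
  multiplication with some \<open>x\<^sub>k\<close> and \<open>y\<^sub>k\<close>, and \<open>\<Sum> e\<^sub>k\<^sub>i\<^sub>0 x\<^sub>k f\<^sub>k\<^sub>0\<^sub>i\<close> is a unit of degree zero that conjugates one
  homomorphism into the other. For fullness, a morphism on \<open>K\<^sub>0\<close> sends the class of the first row of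
  block \<open>k\<close> to that of some module \<open>Q\<^sub>k\<close>, and by cancellation \<open>S\<close> is isomorphic to the direct sum of suitable
  shifts of the \<open>Q\<^sub>k\<close>. The endomorphisms of \<open>S\<close> that carry one summand coming from \<open>Q\<^sub>k\<close> onto another are left
  multiplications by elements of \<open>S\<close>, which are the images of the matrix units of \<open>R\<close>.
\<close>

section \<open>Homogeneous components, graded modules and the constructions with them\<close>

section \<open>Graded groups\<close>

text \<open>Only degree-preserving maps count: the endomorphism ring of a shifted row module is the
  degree-zero part of \<open>A\<close>, a field even if \<open>A\<close> itself is far from being
  one. Which shifted rows are isomorphic depends on the degrees in which \<open>A\<close> is
  nonzero; the argument never decides this. It needs each such module to be cancellable and prime
  for direct summands, and these two properties already make stably isomorphic modules isomorphic,
  while equality in a group completion gives stable isomorphism at first. Within one block all rows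
  are shifts of the first, since e_ij has degree \<delta>_i - \<delta>_j. Hence a map of
  \<Gamma>-modules out of K0 of R is fixed by one class per block, and one pair of elements x, y per
  block suffices for faithfulness. For fullness the three conditions on a morphism are spent
  separately: positivity yields the modules Q_k, the \<Gamma>-action their shifts, and the
  order-unit the isomorphism with the regular module, which makes the constructed homomorphism
  unital.\<close>

lemma finprod_struct_cong:
  fixes G :: "('a, 'b) monoid_scheme" and H :: "('a, 'c) monoid_scheme"
  assumes "carrier G = carrier H" "monoid.mult G = monoid.mult H" "one G = one H"
  shows "finprod G f A = finprod H f A"
  by (simp add: finprod_def assms)

text \<open>The shift, the regular module, the tensor product and \<open>K0_group\<close> are new
  records over the operations of an old group. Notions such as \<open>finprod\<close>,
  \<open>m_inv\<close> and \<open>grading\<close> depend only on carrier, product and unit, so facts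
  pass between such records although their types differ.\<close>

lemma comm_group_struct_cong:
  fixes G :: "('a, 'b) monoid_scheme" and H :: "('a, 'c) monoid_scheme"
  assumes "carrier G = carrier H" "monoid.mult G = monoid.mult H" "one G = one H"
  shows "comm_group G \<longleftrightarrow> comm_group H"
  unfolding comm_group_def comm_monoid_def comm_monoid_axioms_def group_def group_axioms_def
      monoid_def Units_def assms by (rule refl)

lemma m_inv_struct_cong:
  fixes G :: "('a, 'b) monoid_scheme" and H :: "('a, 'c) monoid_scheme"
  assumes "carrier G = carrier H" "monoid.mult G = monoid.mult H" "one G = one H"
  shows "m_inv G = m_inv H"
  by (intro ext) (simp add: m_inv_def assms)

lemma grading_struct_cong:
  fixes G :: "('a, 'b) monoid_scheme" and H :: "('a, 'c) monoid_scheme"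
  assumes "carrier G = carrier H" "monoid.mult G = monoid.mult H" "one G = one H"
  shows "grading G D \<longleftrightarrow> grading H D"
proof -
  have "gfinprod G f A = gfinprod H f A" for f :: "'d \<Rightarrow> 'a" and A
    by (simp add: gfinprod_def assms finprod_struct_cong[OF assms])
  moreover have "subgroup K G \<longleftrightarrow> subgroup K H" for K
    by (simp add: subgroup_def assms m_inv_struct_cong[OF assms])
  ultimately show ?thesis
    by (simp add: grading_def assms)
qed

lemma hom_finprod:
  assumes "comm_group G" "comm_group H" "h \<in> hom G H" "f \<in> I \<rightarrow> carrier G"
  shows "h (finprod G f I) = finprod H (\<lambda>i. h (f i)) I"
proof -
  interpret G: comm_group G by fact
  interpret H: comm_group H by fact
  have h1: "h \<one>\<^bsub>G\<^esub> = \<one>\<^bsub>H\<^esub>"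
    by (rule hom_one[OF assms(3)]) unfold_locales
  show ?thesis
    using assms(4)
  proof (induction I rule: infinite_finite_induct)
    case (insert i I)
    then have f: "f i \<in> carrier G" "f \<in> I \<rightarrow> carrier G" "(\<lambda>i. h (f i)) \<in> I \<rightarrow> carrier H" "h (f i) \<in> carrier H"
      using assms(3) by (auto simp: hom_def)
    have "h (finprod G f (insert i I)) = h (f i \<otimes>\<^bsub>G\<^esub> finprod G f I)"
      using f insert.hyps by (subst G.finprod_insert) auto
    also have "\<dots> = h (f i) \<otimes>\<^bsub>H\<^esub> h (finprod G f I)"
      using f by (intro hom_mult[OF assms(3)] G.finprod_closed)
    also have "\<dots> = finprod H (\<lambda>i. h (f i)) (insert i I)"
      using f insert.hyps insert.IH by (subst H.finprod_insert) auto
    finally show ?case .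
  next
    case (infinite I)
    show ?case by (simp only: G.finprod_infinite[OF infinite.hyps] H.finprod_infinite[OF infinite.hyps] h1)
  next
    case empty
    show ?case by (simp only: G.finprod_empty H.finprod_empty h1)
  qed
qed

text \<open>The homogeneous component of degree \<gamma>. The description picks the whole family of
  components, since it is for the family that \<open>grading\<close> asserts existence and
  uniqueness.\<close>

definition gcomp :: "('m, 'b) monoid_scheme \<Rightarrow> ('g \<Rightarrow> 'm set) \<Rightarrow> 'g \<Rightarrow> 'm \<Rightarrow> 'm" where
  "gcomp G D \<gamma> x = (THE f. (\<forall>\<gamma>. f \<gamma> \<in> D \<gamma>) \<and> finite {\<gamma>. f \<gamma> \<noteq> \<one>\<^bsub>G\<^esub>} \<and> x = gfinprod G f UNIV) \<gamma>"

locale graded_group = comm_group G for G (structure) +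
  fixes D :: "'g \<Rightarrow> 'm set"
  assumes grading: "grading G D"
begin

lemma D_subgroup: "subgroup (D \<gamma>) G"
  using grading by (simp add: grading_def)

lemma D_carrier: "x \<in> D \<gamma> \<Longrightarrow> x \<in> carrier G"
  by (rule subgroup.mem_carrier[OF D_subgroup])

lemma D_one: "\<one> \<in> D \<gamma>" and D_mult: "\<lbrakk>x \<in> D \<gamma>; y \<in> D \<gamma>\<rbrakk> \<Longrightarrow> x \<otimes> y \<in> D \<gamma>" and D_inv: "x \<in> D \<gamma> \<Longrightarrow> inv x \<in> D \<gamma>"
  using D_subgroup[of \<gamma>] by (auto simp: subgroup_def)

lemma D_finprod: "(\<And>i. i \<in> I \<Longrightarrow> f i \<in> D \<gamma>) \<Longrightarrow> finprod G f I \<in> D \<gamma>"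
proof (induction I rule: infinite_finite_induct)
  case (insert i I)
  then show ?case
    by (subst finprod_insert) (auto intro: D_mult D_carrier)
qed (auto simp: D_one)

lemma gfinprod_finprod:
  assumes "\<And>\<gamma>. f \<gamma> \<in> D \<gamma>" "finite I" "\<And>\<gamma>. \<gamma> \<notin> I \<Longrightarrow> f \<gamma> = \<one>"
  shows "gfinprod G f UNIV = finprod G f I"
proof -
  have "gfinprod G f UNIV = gfinprod G f I"
    using assms by (intro gfinprod_mono_neutral_cong_right) (auto intro: D_carrier rev_finite_subset)
  then show ?thesis
    using assms(2) gfinprod_eq_finprod[of I f] D_carrier[OF assms(1)] by simp
qed

lemma gcomp_unique:
  assumes "\<And>\<gamma>. f \<gamma> \<in> D \<gamma>" "finite I" "\<And>\<gamma>. \<gamma> \<notin> I \<Longrightarrow> f \<gamma> = \<one>" "x = finprod G f I"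
  shows "gcomp G D \<gamma> x = f \<gamma>"
proof -
  have x: "x \<in> carrier G"
    using assms by (auto intro: finprod_closed D_carrier)
  have "finite {\<gamma>. f \<gamma> \<noteq> \<one>}"
    using assms(3) by (intro finite_subset[OF _ assms(2)]) auto
  then have f: "(\<forall>\<gamma>. f \<gamma> \<in> D \<gamma>) \<and> finite {\<gamma>. f \<gamma> \<noteq> \<one>} \<and> x = gfinprod G f UNIV"
    using assms gfinprod_finprod[of f I] by simp
  have "\<exists>!f. (\<forall>\<gamma>. f \<gamma> \<in> D \<gamma>) \<and> finite {\<gamma>. f \<gamma> \<noteq> \<one>} \<and> x = gfinprod G f UNIV"
    using grading x by (simp add: grading_def)
  then have "(THE f. (\<forall>\<gamma>. f \<gamma> \<in> D \<gamma>) \<and> finite {\<gamma>. f \<gamma> \<noteq> \<one>} \<and> x = gfinprod G f UNIV) = f"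
    by (rule the1_equality) (rule f)
  then show ?thesis
    by (simp add: gcomp_def)
qed

lemma gcomp_all:
  assumes "x \<in> carrier G"
  shows "(\<forall>\<gamma>. gcomp G D \<gamma> x \<in> D \<gamma>) \<and> finite {\<gamma>. gcomp G D \<gamma> x \<noteq> \<one>} \<and>
    x = gfinprod G (\<lambda>\<gamma>. gcomp G D \<gamma> x) UNIV"
proof -
  have "\<exists>!f. (\<forall>\<gamma>. f \<gamma> \<in> D \<gamma>) \<and> finite {\<gamma>. f \<gamma> \<noteq> \<one>} \<and> x = gfinprod G f UNIV"
    using grading assms by (simp add: grading_def)
  from theI'[OF this] show ?thesis
    unfolding gcomp_def by simp
qed

lemma gcomp_in: "x \<in> carrier G \<Longrightarrow> gcomp G D \<gamma> x \<in> D \<gamma>"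
  and gcomp_finite: "x \<in> carrier G \<Longrightarrow> finite {\<gamma>. gcomp G D \<gamma> x \<noteq> \<one>}"
  using gcomp_all by blast+

lemma gcomp_carrier: "x \<in> carrier G \<Longrightarrow> gcomp G D \<gamma> x \<in> carrier G"
  using gcomp_in D_carrier by blast

lemma gcomp_sum:
  assumes "x \<in> carrier G" "finite I" "\<And>\<gamma>. \<gamma> \<notin> I \<Longrightarrow> gcomp G D \<gamma> x = \<one>"
  shows "finprod G (\<lambda>\<gamma>. gcomp G D \<gamma> x) I = x"
  using gcomp_all[OF assms(1)] gfinprod_finprod[of "\<lambda>\<gamma>. gcomp G D \<gamma> x" I] assms by auto

lemma gcomp_mult:
  assumes "x \<in> carrier G" "y \<in> carrier G"
  shows "gcomp G D \<gamma> (x \<otimes> y) = gcomp G D \<gamma> x \<otimes> gcomp G D \<gamma> y"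
proof -
  define I where "I = {\<gamma>. gcomp G D \<gamma> x \<noteq> \<one>} \<union> {\<gamma>. gcomp G D \<gamma> y \<noteq> \<one>}"
  have I: "finite I"
    using assms gcomp_finite by (simp add: I_def)
  have "x \<otimes> y = finprod G (\<lambda>\<gamma>. gcomp G D \<gamma> x) I \<otimes> finprod G (\<lambda>\<gamma>. gcomp G D \<gamma> y) I"
    using assms I by (subst (1 2) gcomp_sum) (auto simp: I_def)
  also have "\<dots> = finprod G (\<lambda>\<gamma>. gcomp G D \<gamma> x \<otimes> gcomp G D \<gamma> y) I"
    by (rule finprod_multf[symmetric]) (auto simp: assms gcomp_carrier)
  finally show ?thesis
    using assms I by (intro gcomp_unique[where I=I]) (auto simp: I_def intro: D_mult gcomp_in)
qed

lemma gcomp_homogeneous: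
  assumes "x \<in> D \<gamma>"
  shows "gcomp G D \<gamma>' x = (if \<gamma>' = \<gamma> then x else \<one>)"
  using assms by (intro gcomp_unique[where I="{\<gamma>}" and f="\<lambda>\<gamma>'. if \<gamma>' = \<gamma> then x else \<one>"])
    (auto simp: D_one D_carrier)

lemma gcomp_eqI:
  assumes "x \<in> carrier G" "y \<in> carrier G" "\<And>\<gamma>. gcomp G D \<gamma> x = gcomp G D \<gamma> y"
  shows "x = y"
proof -
  have "finprod G (\<lambda>\<gamma>. gcomp G D \<gamma> x) {\<gamma>. gcomp G D \<gamma> x \<noteq> \<one>} = finprod G (\<lambda>\<gamma>. gcomp G D \<gamma> y) {\<gamma>. gcomp G D \<gamma> y \<noteq> \<one>}"
    by (simp add: assms(3))
  then show ?thesis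
    using assms gcomp_sum[OF assms(1) gcomp_finite[OF assms(1)]] gcomp_sum[OF assms(2) gcomp_finite[OF assms(2)]]
    by simp
qed

lemma gcomp_one: "gcomp G D \<gamma> \<one> = \<one>"
  using gcomp_homogeneous[OF D_one[of \<gamma>], of \<gamma>] by simp

end

text \<open>The images of the components of x are a homogeneous decomposition of h x, and that
  decomposition is unique. This is the source of homogeneous preimages and of homogeneous kernels
  later on.\<close>

lemma gcomp_hom:
  assumes "graded_group G D" "graded_group H D'" "h \<in> hom G H" "\<And>\<gamma>. h ` D \<gamma> \<subseteq> D' \<gamma>" "x \<in> carrier G"
  shows "gcomp H D' \<gamma> (h x) = h (gcomp G D \<gamma> x)"
proof -
  interpret G: graded_group G D by fact
  interpret H: graded_group H D' by fact
  have 1: "h \<one>\<^bsub>G\<^esub> = \<one>\<^bsub>H\<^esub>"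
    by (rule hom_one[OF assms(3)]) unfold_locales
  let ?I = "{\<gamma>. gcomp G D \<gamma> x \<noteq> \<one>\<^bsub>G\<^esub>}"
  have "h x = h (finprod G (\<lambda>\<gamma>. gcomp G D \<gamma> x) ?I)"
    using assms(5) by (subst G.gcomp_sum) (auto simp: G.gcomp_finite)
  also have "\<dots> = finprod H (\<lambda>\<gamma>. h (gcomp G D \<gamma> x)) ?I"
    using assms by (intro hom_finprod) (auto simp: G.comm_group_axioms H.comm_group_axioms G.gcomp_carrier)
  finally show ?thesis
    using assms 1 by (intro H.gcomp_unique[where I="?I"]) (auto simp: G.gcomp_finite G.gcomp_in image_subset_iff)
qed

text \<open>A family of additive candidate projections \<open>c\<close> replaces the
  unique-existence clause. Existence: x minus the sum of its projections is killed by every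
  projection, hence zero by \<open>inj\<close>. Uniqueness: applying \<open>c \<gamma>\<close> to
  any homogeneous decomposition returns its summand of degree \<gamma>.\<close>

lemma gradingI:
  assumes "comm_group G" and sub: "\<And>\<gamma>. subgroup (D \<gamma>) G"
    and cin: "\<And>\<gamma> x. x \<in> carrier G \<Longrightarrow> c \<gamma> x \<in> D \<gamma>"
    and fin: "\<And>x. x \<in> carrier G \<Longrightarrow> finite {\<gamma>. c \<gamma> x \<noteq> \<one>\<^bsub>G\<^esub>}"
    and mult: "\<And>\<gamma> x y. \<lbrakk>x \<in> carrier G; y \<in> carrier G\<rbrakk> \<Longrightarrow> c \<gamma> (x \<otimes>\<^bsub>G\<^esub> y) = c \<gamma> x \<otimes>\<^bsub>G\<^esub> c \<gamma> y"
    and homog: "\<And>\<gamma> \<gamma>' x. x \<in> D \<gamma> \<Longrightarrow> c \<gamma>' x = (if \<gamma>' = \<gamma> then x else \<one>\<^bsub>G\<^esub>)"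
    and inj: "\<And>x. \<lbrakk>x \<in> carrier G; \<And>\<gamma>. c \<gamma> x = \<one>\<^bsub>G\<^esub>\<rbrakk> \<Longrightarrow> x = \<one>\<^bsub>G\<^esub>"
  shows "grading G D"
  unfolding grading_def
proof (intro conjI allI ballI sub)
  interpret comm_group G by fact
  have D: "y \<in> D \<gamma> \<Longrightarrow> y \<in> carrier G" for y \<gamma>
    by (rule subgroup.mem_carrier[OF sub])
  have c_hom: "c \<gamma> \<in> hom G G" for \<gamma>
    using cin D by (auto simp: hom_def mult)
  have c_fin: "c \<gamma> (finprod G f I) = f \<gamma>" if "finite I" "\<And>\<gamma>. f \<gamma> \<in> D \<gamma>" "\<And>\<gamma>. \<gamma> \<notin> I \<Longrightarrow> f \<gamma> = \<one>\<^bsub>G\<^esub>" for f I \<gamma>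
  proof -
    have f: "f \<gamma> \<in> carrier G" for \<gamma>
      using that D by blast
    have "c \<gamma> (finprod G f I) = finprod G (\<lambda>\<gamma>'. c \<gamma> (f \<gamma>')) I"
      using c_hom f by (intro hom_finprod) (auto simp: comm_group_axioms)
    also have "\<dots> = finprod G (\<lambda>\<gamma>'. if \<gamma> = \<gamma>' then f \<gamma>' else \<one>\<^bsub>G\<^esub>) I"
      using f that(2) by (intro finprod_cong') (auto simp: homog)
    also have "\<dots> = f \<gamma>"
      using f that by (cases "\<gamma> \<in> I") (auto simp: finprod_singleton intro!: finprod_one_eqI)
    finally show ?thesis .
  qed
  have gfin: "gfinprod G f UNIV = finprod G f {\<gamma>. f \<gamma> \<noteq> \<one>\<^bsub>G\<^esub>}" if "finite {\<gamma>. f \<gamma> \<noteq> \<one>\<^bsub>G\<^esub>}" for f :: "'c \<Rightarrow> 'a"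
    using that by (simp add: gfinprod_def)
  fix x assume x: "x \<in> carrier G"
  let ?f = "\<lambda>\<gamma>. c \<gamma> x" and ?I = "{\<gamma>. c \<gamma> x \<noteq> \<one>\<^bsub>G\<^esub>}"
  let ?y = "finprod G ?f ?I"
  have y: "?y \<in> carrier G"
    using cin[OF x] D by (intro finprod_closed) auto
  have "x \<otimes>\<^bsub>G\<^esub> inv\<^bsub>G\<^esub> ?y = \<one>\<^bsub>G\<^esub>"
  proof (rule inj)
    fix \<gamma>
    interpret c: group_hom G G "c \<gamma>"
      by unfold_locales (rule c_hom)
    have "c \<gamma> ?y = c \<gamma> x"
      by (rule c_fin[OF fin[OF x] cin[OF x]]) simp
    then have "c \<gamma> (x \<otimes>\<^bsub>G\<^esub> inv\<^bsub>G\<^esub> ?y) = c \<gamma> x \<otimes>\<^bsub>G\<^esub> inv\<^bsub>G\<^esub> (c \<gamma> x)"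
      using x y by (simp add: c.hom_mult c.hom_inv)
    also have "\<dots> = \<one>\<^bsub>G\<^esub>"
      using x by simp
    finally show "c \<gamma> (x \<otimes>\<^bsub>G\<^esub> inv\<^bsub>G\<^esub> ?y) = \<one>\<^bsub>G\<^esub>" .
  qed (use x y in auto)
  then have xy: "x = ?y"
    using x y inv_equality[of x "inv\<^bsub>G\<^esub> ?y"] by simp
  show "\<exists>!f. (\<forall>\<gamma>. f \<gamma> \<in> D \<gamma>) \<and> finite {\<gamma>. f \<gamma> \<noteq> \<one>\<^bsub>G\<^esub>} \<and> x = gfinprod G f UNIV"
  proof (rule ex1I[of _ ?f])
    show "(\<forall>\<gamma>. ?f \<gamma> \<in> D \<gamma>) \<and> finite {\<gamma>. ?f \<gamma> \<noteq> \<one>\<^bsub>G\<^esub>} \<and> x = gfinprod G ?f UNIV"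
      using x cin fin xy gfin[of ?f] by simp
  next
    fix f assume f: "(\<forall>\<gamma>. f \<gamma> \<in> D \<gamma>) \<and> finite {\<gamma>. f \<gamma> \<noteq> \<one>\<^bsub>G\<^esub>} \<and> x = gfinprod G f UNIV"
    then have xf: "x = finprod G f {\<gamma>. f \<gamma> \<noteq> \<one>\<^bsub>G\<^esub>}"
      using gfin[of f] by metis
    have "c \<gamma> x = f \<gamma>" for \<gamma>
      by (subst xf, rule c_fin) (use f in auto)
    then show "f = ?f" by auto
  qed
qed

text \<open>The projections are \<open>r (gcomp H D' \<gamma> (i x))\<close>. If all of them vanish,
  so do the components of i x, because the idempotent i r preserves degrees and fixes i x, hence
  commutes with taking components. Directness is thus inherited from \<open>H\<close>, without an
  argument inside \<open>G\<close>.\<close>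

lemma grading_retract:
  assumes "comm_group G" and "graded_group H D'" and sub: "\<And>\<gamma>. subgroup (D \<gamma>) G"
    and i: "i \<in> hom G H" "\<And>\<gamma>. i ` D \<gamma> \<subseteq> D' \<gamma>" and r: "r \<in> hom H G" "\<And>\<gamma>. r ` D' \<gamma> \<subseteq> D \<gamma>"
    and ri: "\<And>x. x \<in> carrier G \<Longrightarrow> r (i x) = x"
  shows "grading G D"
proof -
  interpret G: comm_group G by fact
  interpret H: graded_group H D' by fact
  interpret i: group_hom G H i by unfold_locales (rule i)
  interpret r: group_hom H G r by unfold_locales (rule r)
  have D: "y \<in> D \<gamma> \<Longrightarrow> y \<in> carrier G" for y \<gamma>
    by (rule subgroup.mem_carrier[OF sub])
  define c where "c \<gamma> x = r (gcomp H D' \<gamma> (i x))" for \<gamma> x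
  show ?thesis
  proof (rule gradingI[where c=c])
    show "c \<gamma> x \<in> D \<gamma>" if "x \<in> carrier G" for \<gamma> x
      using r(2)[of \<gamma>] H.gcomp_in[of "i x" \<gamma>] that by (auto simp: c_def)
    show "finite {\<gamma>. c \<gamma> x \<noteq> \<one>\<^bsub>G\<^esub>}" if "x \<in> carrier G" for x
      by (rule finite_subset[OF _ H.gcomp_finite[of "i x"]]) (use that in \<open>auto simp: c_def\<close>)
    show "c \<gamma> (x \<otimes>\<^bsub>G\<^esub> y) = c \<gamma> x \<otimes>\<^bsub>G\<^esub> c \<gamma> y" if "x \<in> carrier G" "y \<in> carrier G" for \<gamma> x y
      using that by (simp add: c_def H.gcomp_mult H.gcomp_carrier)
    show "c \<gamma>' x = (if \<gamma>' = \<gamma> then x else \<one>\<^bsub>G\<^esub>)" if "x \<in> D \<gamma>" for x \<gamma> \<gamma>'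
      using i(2)[of \<gamma>] that D[OF that] by (auto simp: c_def H.gcomp_homogeneous[of _ \<gamma>] ri)
    show "x = \<one>\<^bsub>G\<^esub>" if x: "x \<in> carrier G" and "\<And>\<gamma>. c \<gamma> x = \<one>\<^bsub>G\<^esub>" for x
    proof -
      have ir: "(\<lambda>y. i (r y)) \<in> hom H H"
        using i(1) r(1) by (auto simp: hom_def)
      have "gcomp H D' \<gamma> (i x) = \<one>\<^bsub>H\<^esub>" for \<gamma>
      proof -
        have "gcomp H D' \<gamma> (i (r (i x))) = i (r (gcomp H D' \<gamma> (i x)))"
          by (rule gcomp_hom[OF H.graded_group_axioms H.graded_group_axioms ir])
          (use i(2) r(2) x in \<open>auto simp: image_subset_iff\<close>)
        then show ?thesis
          using that(2)[of \<gamma>] x by (simp add: ri c_def)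
      qed
      then have "i x = \<one>\<^bsub>H\<^esub>"
        using x by - (rule H.gcomp_eqI, auto simp: H.gcomp_one)
      then show ?thesis
        using ri[OF x] by simp
    qed
  qed (use sub in \<open>auto simp: G.comm_group_axioms\<close>)
qed

section \<open>Graded modules\<close>

sublocale gr_module \<subseteq> MG: graded_group M "mgrade M"
  by unfold_locales (rule module_grading)

sublocale gr_ring \<subseteq> RG: graded_group "add_monoid R" "grade R"
  by (intro graded_group.intro graded_group_axioms.intro a_comm_group grading)

lemmas (in gr_ring) grade_carrier = RG.D_carrier[simplified]
  and grade_zero = RG.D_one[simplified]
  and grade_add = RG.D_mult[simplified]
  and grade_minus = RG.D_inv[folded a_inv_def]

text \<open>The identity is not assumed homogeneous. Comparing components of degree \<beta> in x = x
  1 shows that a homogeneous x is fixed by right multiplication with the degree-zero component of 1;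
  adding this up over the components x of 1 shows that this component is 1.\<close>

lemma (in gr_ring) one_grade: "\<one> \<in> grade R 0"
proof -
  let ?c = "gcomp (add_monoid R) (grade R)"
  let ?I = "{\<gamma>. ?c \<gamma> \<one> \<noteq> \<zero>}"
  have fin: "finite ?I" using RG.gcomp_finite[of \<one>] by simp
  have s: "(\<Oplus>\<gamma>\<in>?I. ?c \<gamma> \<one>) = \<one>"
    unfolding finsum_def by (rule RG.gcomp_sum) (use fin in auto)
  have c1: "?c 0 \<one> \<in> carrier R"
    using RG.gcomp_carrier[of \<one> 0] by simp
  have h: "x \<otimes> ?c 0 \<one> = x" if x: "x \<in> grade R \<beta>" for x \<beta>
  proof -
    have xc: "x \<in> carrier R" using x by (rule grade_carrier)
    \<comment> \<open>The product of x with the component of 1 of degree \<delta> - \<beta> has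
      degree \<delta>, so \<open>?f\<close> is the homogeneous decomposition of x; its member at
      \<beta> is the product with the degree-zero component.\<close>
    let ?f = "\<lambda>\<delta>. x \<otimes> ?c (\<delta> - \<beta>) \<one>"
    have f: "?f \<delta> \<in> grade R \<delta>" for \<delta>
      using grade_mult[OF x, of "?c (\<delta> - \<beta>) \<one>" "\<delta> - \<beta>"] RG.gcomp_in[of \<one> "\<delta>-\<beta>"] by simp
    have fc: "?f \<delta> \<in> carrier R" for \<delta>
      by (rule grade_carrier[OF f])
    have "x = x \<otimes> (\<Oplus>\<gamma>\<in>?I. ?c \<gamma> \<one>)"
      unfolding s by (simp add: xc)
    also have "\<dots> = (\<Oplus>\<gamma>\<in>?I. x \<otimes> ?c \<gamma> \<one>)"
      using fin xc RG.gcomp_carrier[of \<one>] by (intro finsum_rdistr) auto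
    also have "\<dots> = (\<Oplus>\<gamma>\<in>?I. ?f (\<gamma> + \<beta>))"
      by simp
    also have "\<dots> = (\<Oplus>\<delta>\<in>(\<lambda>\<gamma>. \<gamma> + \<beta>) ` ?I. ?f \<delta>)"
      using fc by (subst finsum_reindex) (auto simp: inj_on_def)
    finally have "x = finprod (add_monoid R) ?f ((\<lambda>\<gamma>. \<gamma> + \<beta>) ` ?I)"
      by (simp add: finsum_def)
    then have "?c \<beta> x = ?f \<beta>"
    proof (rule RG.gcomp_unique[rotated 3])
      fix \<gamma> assume "\<gamma> \<notin> (\<lambda>\<gamma>. \<gamma> + \<beta>) ` ?I"
      then have "\<gamma> - \<beta> \<notin> ?I" by force
      then show "?f \<gamma> = \<one>\<^bsub>add_monoid R\<^esub>" using xc by simp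
    qed (use f fin in auto)
    then show ?thesis
      using RG.gcomp_homogeneous[OF x, of \<beta>] by simp
  qed

  have "?c 0 \<one> = (\<Oplus>\<gamma>\<in>?I. ?c \<gamma> \<one>) \<otimes> ?c 0 \<one>"
    using c1 s by simp
  also have "\<dots> = (\<Oplus>\<gamma>\<in>?I. ?c \<gamma> \<one> \<otimes> ?c 0 \<one>)"
    using fin c1 RG.gcomp_carrier[of \<one>] by (intro finsum_ldistr) auto
  also have "\<dots> = (\<Oplus>\<gamma>\<in>?I. ?c \<gamma> \<one>)"
    using RG.gcomp_in[of \<one>] RG.gcomp_carrier[of \<one>] by (intro finsum_cong') (auto intro: h)
  finally show ?thesis
    using s RG.gcomp_in[of \<one> 0] by simp
qed

context gr_module
begin

lemma ract_left_hom: "r \<in> carrier R \<Longrightarrow> (\<lambda>m. m \<star>\<^bsub>M\<^esub> r) \<in> hom M M"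
  by (auto simp: hom_def ract_closed ract_add_left)

lemma ract_right_hom: "m \<in> carrier M \<Longrightarrow> (\<lambda>r. m \<star>\<^bsub>M\<^esub> r) \<in> hom (add_monoid R) M"
  by (auto simp: hom_def ract_closed ract_add_right)

lemma one_ract: "r \<in> carrier R \<Longrightarrow> \<one>\<^bsub>M\<^esub> \<star>\<^bsub>M\<^esub> r = \<one>\<^bsub>M\<^esub>"
  using hom_one[OF ract_left_hom M.is_group M.is_group] by simp

lemma ract_zero: "m \<in> carrier M \<Longrightarrow> m \<star>\<^bsub>M\<^esub> \<zero>\<^bsub>R\<^esub> = \<one>\<^bsub>M\<^esub>"
  using hom_one[OF ract_right_hom R.add.is_group M.is_group] by simp

lemma finprod_ract:
  "\<lbrakk>f \<in> I \<rightarrow> carrier M; r \<in> carrier R\<rbrakk> \<Longrightarrow> finprod M f I \<star>\<^bsub>M\<^esub> r = finprod M (\<lambda>i. f i \<star>\<^bsub>M\<^esub> r) I"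
  using hom_finprod[OF M.comm_group_axioms M.comm_group_axioms ract_left_hom] by blast



end

lemma gr_module_homI:
  assumes "\<And>m. m \<in> carrier M \<Longrightarrow> f m \<in> carrier N"
    and "\<And>m m'. \<lbrakk>m \<in> carrier M; m' \<in> carrier M\<rbrakk> \<Longrightarrow> f (m \<otimes>\<^bsub>M\<^esub> m') = f m \<otimes>\<^bsub>N\<^esub> f m'"
    and "\<And>m r. \<lbrakk>m \<in> carrier M; r \<in> carrier R\<rbrakk> \<Longrightarrow> f (m \<star>\<^bsub>M\<^esub> r) = f m \<star>\<^bsub>N\<^esub> r"
    and "\<And>m \<gamma>. m \<in> mgrade M \<gamma> \<Longrightarrow> f m \<in> mgrade N \<gamma>"
  shows "f \<in> gr_module_hom R M N"
  using assms by (auto simp: gr_module_hom_def hom_def)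

lemma
  assumes "f \<in> gr_module_hom R M N"
  shows gmh_hom: "f \<in> hom M N"
    and gmh_closed: "m \<in> carrier M \<Longrightarrow> f m \<in> carrier N"
    and gmh_mult: "\<lbrakk>m \<in> carrier M; m' \<in> carrier M\<rbrakk> \<Longrightarrow> f (m \<otimes>\<^bsub>M\<^esub> m') = f m \<otimes>\<^bsub>N\<^esub> f m'"
    and gmh_ract: "\<lbrakk>m \<in> carrier M; r \<in> carrier R\<rbrakk> \<Longrightarrow> f (m \<star>\<^bsub>M\<^esub> r) = f m \<star>\<^bsub>N\<^esub> r"
    and gmh_grade: "m \<in> mgrade M \<gamma> \<Longrightarrow> f m \<in> mgrade N \<gamma>"
  using assms by (auto simp: gr_module_hom_def hom_def image_subset_iff)

lemma gmh_one: "\<lbrakk>f \<in> gr_module_hom R M N; gr_module R M; gr_module R N\<rbrakk> \<Longrightarrow> f \<one>\<^bsub>M\<^esub> = \<one>\<^bsub>N\<^esub>"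
  by (meson gmh_hom hom_one gr_module.axioms comm_group.axioms)

lemma gmh_inv: "\<lbrakk>f \<in> gr_module_hom R M N; gr_module R M; gr_module R N; m \<in> carrier M\<rbrakk> \<Longrightarrow> f (inv\<^bsub>M\<^esub> m) = inv\<^bsub>N\<^esub> f m"
  by (meson gmh_hom group_hom.hom_inv group_hom.intro group_hom_axioms.intro gr_module.axioms comm_group.axioms)

lemma gmh_finprod:
  "\<lbrakk>f \<in> gr_module_hom R M N; gr_module R M; gr_module R N; x \<in> I \<rightarrow> carrier M\<rbrakk>
    \<Longrightarrow> f (finprod M x I) = finprod N (\<lambda>i. f (x i)) I"
  by (rule hom_finprod[OF gr_module.axioms(2) gr_module.axioms(2) gmh_hom])

lemma gmh_comp: "\<lbrakk>f \<in> gr_module_hom R M N; g \<in> gr_module_hom R N P\<rbrakk> \<Longrightarrow> (\<lambda>m. g (f m)) \<in> gr_module_hom R M P"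
  by (rule gr_module_homI) (simp_all add: gmh_closed gmh_mult gmh_ract gmh_grade)

lemma gmh_id: "(\<lambda>m. m) \<in> gr_module_hom R M M"
  by (rule gr_module_homI) simp_all

lemma gmh_const_one: "gr_module R N \<Longrightarrow> (\<lambda>m. \<one>\<^bsub>N\<^esub>) \<in> gr_module_hom R M N"
proof -
  assume "gr_module R N"
  then interpret N: gr_module R N .
  show ?thesis
    by (rule gr_module_homI) (auto simp: N.one_ract N.MG.D_one)
qed

lemma gmh_uminus:
  assumes N: "gr_module R N" and f: "f \<in> gr_module_hom R M N"
  shows "(\<lambda>m. inv\<^bsub>N\<^esub> f m) \<in> gr_module_hom R M N"
proof -
  interpret N: gr_module R N by fact
  show ?thesis
  proof (rule gr_module_homI)
    fix x r assume "x \<in> carrier M" "r \<in> carrier R"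
    moreover have "inv\<^bsub>N\<^esub> (y \<star>\<^bsub>N\<^esub> r) = inv\<^bsub>N\<^esub> y \<star>\<^bsub>N\<^esub> r" if "y \<in> carrier N" "r \<in> carrier R" for y r
      using that N.ract_add_left[of "inv\<^bsub>N\<^esub> y" y r]
      by (intro N.M.inv_equality) (simp_all add: N.ract_closed N.one_ract)
    ultimately show "inv\<^bsub>N\<^esub> f (x \<star>\<^bsub>M\<^esub> r) = inv\<^bsub>N\<^esub> f x \<star>\<^bsub>N\<^esub> r"
      by (simp add: gmh_ract[OF f] gmh_closed[OF f])
  qed (auto simp: gmh_closed[OF f] gmh_mult[OF f] gmh_grade[OF f] N.M.inv_mult N.MG.D_inv)
qed

lemma gr_module_hom_cong:
  assumes "gr_module R M" "\<And>m. m \<in> carrier M \<Longrightarrow> f m = g m"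
  shows "f \<in> gr_module_hom R M N \<longleftrightarrow> g \<in> gr_module_hom R M N"
proof -
  interpret M: gr_module R M by fact
  have "\<And>m \<gamma>. m \<in> mgrade M \<gamma> \<Longrightarrow> f m = g m"
    using assms(2) M.MG.D_carrier by metis
  then show ?thesis
    using assms(2) by (auto simp: gr_module_hom_def hom_def image_subset_iff M.ract_closed Pi_iff)
qed

lemma gmh_prod:
  assumes "gr_module R N" "f \<in> gr_module_hom R M N" "g \<in> gr_module_hom R M N"
  shows "(\<lambda>m. f m \<otimes>\<^bsub>N\<^esub> g m) \<in> gr_module_hom R M N"
proof -
  interpret N: gr_module R N by fact
  show ?thesis
    using assms(2,3)
    by (intro gr_module_homI)
      (auto simp: gmh_closed gmh_mult gmh_ract gmh_grade N.ract_add_left N.MG.D_mult N.M.m_ac)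
qed

lemma gmh_sum:
  assumes "gr_module R M" "gr_module R N" "\<And>i. i \<in> I \<Longrightarrow> f i \<in> gr_module_hom R M N"
  shows "(\<lambda>m. finprod N (\<lambda>i. f i m) I) \<in> gr_module_hom R M N"
  using assms(3)
proof (induction I rule: infinite_finite_induct)
  case (infinite I)
  interpret N: gr_module R N by fact
  show ?case using gmh_const_one[OF assms(2)] infinite.hyps by simp
next
  case empty
  interpret N: gr_module R N by fact
  show ?case using gmh_const_one[OF assms(2)] by simp
next
  case (insert i I)
  interpret N: gr_module R N by fact
  have 1: "(\<lambda>m. f i m \<otimes>\<^bsub>N\<^esub> finprod N (\<lambda>i. f i m) I) \<in> gr_module_hom R M N"
    using insert by (intro gmh_prod assms(2)) auto
  have 2: "finprod N (\<lambda>i. f i m) (insert i I) = f i m \<otimes>\<^bsub>N\<^esub> finprod N (\<lambda>i. f i m) I" if "m \<in> carrier M" for m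
    using insert.hyps gmh_closed[OF insert.prems that] by (subst N.M.finprod_insert) auto
  have "(\<lambda>m. finprod N (\<lambda>i. f i m) (insert i I)) \<in> gr_module_hom R M N
    \<longleftrightarrow> (\<lambda>m. f i m \<otimes>\<^bsub>N\<^esub> finprod N (\<lambda>i. f i m) I) \<in> gr_module_hom R M N"
    by (rule gr_module_hom_cong[OF assms(1) 2])
  then show ?case
    using 1 by simp
qed

lemma gmh_gcomp:
  assumes "gr_module R M" "gr_module R N" "f \<in> gr_module_hom R M N" "m \<in> carrier M"
  shows "gcomp N (mgrade N) \<gamma> (f m) = f (gcomp M (mgrade M) \<gamma> m)"
proof -
  interpret M: gr_module R M by fact
  interpret N: gr_module R N by fact
  show ?thesis
    using assms by (intro gcomp_hom M.MG.graded_group_axioms N.MG.graded_group_axioms) (auto simp: gmh_hom gmh_grade)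
qed

section \<open>Isomorphisms and transport of structure\<close>

lemma gr_isomorphicI:
  assumes "f \<in> gr_module_hom R M N" "bij_betw f (carrier M) (carrier N)"
  shows "gr_isomorphic R M N"
  using assms by (auto simp: gr_isomorphic_def)

text \<open>Only the degree of the inverse needs an argument: f commutes with components, so for n
  of degree \<gamma> the element g n and its component of degree \<gamma> have the same image, and
  injectivity makes them equal.\<close>

lemma gmh_inverse:
  assumes "gr_module R M" "gr_module R N"
    and f: "f \<in> gr_module_hom R M N" and b: "bij_betw f (carrier M) (carrier N)"
  obtains g where "g \<in> gr_module_hom R N M"
    "\<And>m. m \<in> carrier M \<Longrightarrow> g (f m) = m" "\<And>n. n \<in> carrier N \<Longrightarrow> f (g n) = n"
proof -
  interpret M: gr_module R M by fact
  interpret N: gr_module R N by fact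
  define g where "g = inv_into (carrier M) f"
  have gf: "g (f m) = m" if "m \<in> carrier M" for m
    using that b by (simp add: g_def bij_betw_def)
  have fg: "f (g n) = n" and gc: "g n \<in> carrier M" if "n \<in> carrier N" for n
    using that b by (auto simp: g_def bij_betw_def f_inv_into_f inv_into_into)
  have inj: "m = m'" if "f m = f m'" "m \<in> carrier M" "m' \<in> carrier M" for m m'
    using that b by (auto simp: bij_betw_def inj_on_def)
  have "g \<in> gr_module_hom R N M"
  proof (rule gr_module_homI)
    fix n \<gamma> assume n: "n \<in> mgrade N \<gamma>"
    then have nc: "n \<in> carrier N" by (rule N.MG.D_carrier)
    have "f (gcomp M (mgrade M) \<gamma> (g n)) = gcomp N (mgrade N) \<gamma> (f (g n))"
      using gmh_gcomp[OF assms(1,2) f gc[OF nc]] by simp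
    also have "\<dots> = f (g n)"
      using N.MG.gcomp_homogeneous[OF n, of \<gamma>] by (simp add: fg nc)
    finally have "gcomp M (mgrade M) \<gamma> (g n) = g n"
      using gc[OF nc] by (intro inj) (auto simp: M.MG.gcomp_carrier)
    then show "g n \<in> mgrade M \<gamma>"
      using M.MG.gcomp_in[OF gc[OF nc], of \<gamma>] by simp
  qed (auto intro!: inj simp: gc fg gmh_mult[OF f] gmh_ract[OF f] M.ract_closed N.ract_closed)
  with gf fg that show ?thesis by blast
qed

lemma gr_isomorphicE:
  assumes "gr_isomorphic R M N" "gr_module R M" "gr_module R N"
  obtains f g where "f \<in> gr_module_hom R M N" "g \<in> gr_module_hom R N M"
    "\<And>m. m \<in> carrier M \<Longrightarrow> g (f m) = m" "\<And>n. n \<in> carrier N \<Longrightarrow> f (g n) = n"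
proof -
  obtain f where "f \<in> gr_module_hom R M N" "bij_betw f (carrier M) (carrier N)"
    using assms(1) by (auto simp: gr_isomorphic_def)
  then show ?thesis
    using gmh_inverse[OF assms(2,3)] that by metis
qed

lemma gr_isomorphicI2:
  assumes "f \<in> gr_module_hom R M N" "g \<in> gr_module_hom R N M"
    "\<And>m. m \<in> carrier M \<Longrightarrow> g (f m) = m" "\<And>n. n \<in> carrier N \<Longrightarrow> f (g n) = n"
  shows "gr_isomorphic R M N"
  using assms by (intro gr_isomorphicI[of f] bij_betwI[of _ _ _ g]) (auto simp: gmh_closed)



lemma gr_isomorphic_sym: "\<lbrakk>gr_isomorphic R M N; gr_module R M; gr_module R N\<rbrakk> \<Longrightarrow> gr_isomorphic R N M"
  by (erule (2) gr_isomorphicE) (rule gr_isomorphicI2)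

lemma gr_isomorphic_trans: "\<lbrakk>gr_isomorphic R M N; gr_isomorphic R N P\<rbrakk> \<Longrightarrow> gr_isomorphic R M P"
  unfolding gr_isomorphic_def
  by (auto intro: gmh_comp bij_betw_trans[unfolded comp_def])

text \<open>Needed because isomorphism classes live in a fixed type of modules: a module over any
  type is moved along an injection of its carrier, and the operations are read off through the
  inverse of that injection.\<close>

definition transport :: "('m \<Rightarrow> 'n) \<Rightarrow> ('g, 'r, 'm) gmodule \<Rightarrow> ('g, 'r, 'n) gmodule" where
  "transport h M = (let k = inv_into (carrier M) h in
    \<lparr>carrier = h ` carrier M, monoid.mult = (\<lambda>x y. h (k x \<otimes>\<^bsub>M\<^esub> k y)), one = h \<one>\<^bsub>M\<^esub>,
     ract = (\<lambda>x r. h (k x \<star>\<^bsub>M\<^esub> r)), mgrade = (\<lambda>\<gamma>. h ` mgrade M \<gamma>)\<rparr>)"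

lemma
  assumes "gr_module R M" "inj_on h (carrier M)"
  shows gr_module_transport: "gr_module R (transport h M)"
    and transport_iso: "gr_isomorphic R M (transport h M)"
proof -
  interpret M: gr_module R M by fact
  let ?T = "transport h M"
  have k: "inv_into (carrier M) h (h x) = x" if "x \<in> carrier M" for x
    using assms(2) that by simp
  have T: "carrier ?T = h ` carrier M" "one ?T = h \<one>\<^bsub>M\<^esub>" "mgrade ?T \<gamma> = h ` mgrade M \<gamma>" for \<gamma>
    by (simp_all add: transport_def Let_def)
  have m: "h x \<otimes>\<^bsub>?T\<^esub> h y = h (x \<otimes>\<^bsub>M\<^esub> y)" if "x \<in> carrier M" "y \<in> carrier M" for x y
    using that by (simp add: transport_def Let_def k)
  have r: "h x \<star>\<^bsub>?T\<^esub> r = h (x \<star>\<^bsub>M\<^esub> r)" if "x \<in> carrier M" for x r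
    using that by (simp add: transport_def Let_def k)
  have inj: "h x = h y \<longleftrightarrow> x = y" if "x \<in> carrier M" "y \<in> carrier M" for x y
    using assms(2) that by (auto simp: inj_on_def)
  have T_group: "comm_group ?T"
  proof (rule comm_groupI)
    fix x assume "x \<in> carrier ?T"
    then obtain x' where "x' \<in> carrier M" "x = h x'" by (auto simp: T)
    then show "\<exists>y\<in>carrier ?T. y \<otimes>\<^bsub>?T\<^esub> x = \<one>\<^bsub>?T\<^esub>"
      by (intro bexI[of _ "h (inv\<^bsub>M\<^esub> x')"]) (auto simp: T m)
  qed (auto simp: T m M.M.m_ac)
  interpret T: comm_group ?T by fact
  have hom: "h \<in> hom M ?T"
    by (auto simp: hom_def T m)
  have homg: "h \<in> gr_module_hom R M ?T"
    by (rule gr_module_homI) (auto simp: T m r)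
  have kk: "inv_into (carrier M) h (h x) = x" if "x \<in> mgrade M \<gamma>" for x \<gamma>
    by (rule k[OF M.MG.D_carrier[OF that]])
  have gr: "grading ?T (mgrade ?T)"
  proof (rule grading_retract[where H = M and D' = "mgrade M" and i = "inv_into (carrier M) h" and r = h])
    show "subgroup (mgrade ?T \<gamma>) ?T" for \<gamma>
      using group_hom.subgroup_img_is_subgroup[of M ?T h, OF _ M.MG.D_subgroup[of \<gamma>]] hom
      by (auto simp: T group_hom_def group_hom_axioms_def M.M.is_group T.is_group)
    show "inv_into (carrier M) h \<in> hom ?T M"
      by (auto simp: hom_def T m k)
    show "inv_into (carrier M) h ` mgrade ?T \<gamma> \<subseteq> mgrade M \<gamma>" for \<gamma>
      by (auto simp: T kk)
  qed (auto simp: T_group M.MG.graded_group_axioms hom T k)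
  show "gr_module R ?T"
  proof (intro gr_module.intro M.R.gr_ring_axioms T_group gr_module_axioms.intro gr)
    fix x r \<alpha> \<beta> assume "x \<in> mgrade ?T \<alpha>" "r \<in> grade R \<beta>"
    then show "x \<star>\<^bsub>?T\<^esub> r \<in> mgrade ?T (\<alpha> + \<beta>)"
      using M.MG.D_carrier by (auto simp: T r M.grade_ract)
  qed (auto simp: T m r M.ract_closed M.ract_add_left M.ract_add_right M.ract_mult M.ract_one)
  show "gr_isomorphic R M ?T"
    by (rule gr_isomorphicI[OF homg]) (use assms(2) in \<open>auto simp: bij_betw_def T\<close>)
qed

section \<open>Constructions of graded modules\<close>

lemma (in group) subgroup_finprod:
  assumes "comm_group G" "subgroup K G" "\<And>i. i \<in> I \<Longrightarrow> f i \<in> K"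
  shows "finprod G f I \<in> K"
proof -
  interpret comm_group G by fact
  have K: "K \<subseteq> carrier G" "\<one> \<in> K" "\<And>x y. \<lbrakk>x \<in> K; y \<in> K\<rbrakk> \<Longrightarrow> x \<otimes> y \<in> K"
    using assms(2) by (auto simp: subgroup_def)
  show ?thesis
    using assms(3)
  proof (induction I rule: infinite_finite_induct)
    case (insert i I)
    then have "finprod G f (insert i I) = f i \<otimes> finprod G f I"
      using K(1) by (intro finprod_insert) auto
    then show ?case
      using insert K(3) by auto
  qed (simp_all add: K(2))
qed

lemma regular_module_simps [simp]:
  "carrier (regular_module R) = carrier R" "monoid.mult (regular_module R) = add R"
  "one (regular_module R) = ring.zero R" "ract (regular_module R) = monoid.mult R"
  "mgrade (regular_module R) = grade R"
  by (simp_all add: regular_module_def)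

lemma finprod_regular: "finprod (regular_module R) f I = finsum R f I"
  unfolding finsum_def by (rule finprod_struct_cong) simp_all

lemma gr_module_regular:
  assumes "gr_ring R"
  shows "gr_module R (regular_module R)"
proof -
  interpret gr_ring R by fact
  have g: "comm_group (regular_module R) = comm_group (add_monoid R)"
    by (rule comm_group_struct_cong) simp_all
  have gr: "grading (regular_module R) (grade R) = grading (add_monoid R) (grade R)"
    by (rule grading_struct_cong) simp_all
  show ?thesis
    using g gr a_comm_group
    by (intro gr_module.intro gr_module_axioms.intro assms)
      (auto simp: l_distr r_distr m_assoc grading grade_mult)
qed

lemma shift_simps [simp]:
  "carrier (shift \<alpha> M) = carrier M" "monoid.mult (shift \<alpha> M) = monoid.mult M"
  "one (shift \<alpha> M) = one M" "ract (shift \<alpha> M) = ract M" "mgrade (shift \<alpha> M) \<gamma> = mgrade M (\<alpha> + \<gamma>)"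
  by (simp_all add: shift_def)

lemma finprod_shift [simp]: "finprod (shift \<alpha> M) f I = finprod M f I"
  by (rule finprod_struct_cong) simp_all

lemma shift_shift: "shift \<alpha> (shift \<beta> M) = shift (\<alpha> + \<beta>) M"
  by (simp add: shift_def add.assoc add.left_commute)

lemma shift_zero: "shift 0 M = M"
  by (simp add: shift_def)

lemma gr_module_shift:
  assumes "gr_module R M"
  shows "gr_module R (shift \<alpha> M)"
proof -
  interpret gr_module R M by fact
  have g: "comm_group (shift \<alpha> M) = comm_group M"
    by (rule comm_group_struct_cong) simp_all
  have "grading M (\<lambda>\<gamma>. mgrade M (\<alpha> + \<gamma>))"
  proof (rule gradingI[where c = "\<lambda>\<gamma>. gcomp M (mgrade M) (\<alpha> + \<gamma>)"])
    show "finite {\<gamma>. gcomp M (mgrade M) (\<alpha> + \<gamma>) x \<noteq> \<one>\<^bsub>M\<^esub>}" if "x \<in> carrier M" for x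
      using finite_vimageI[OF MG.gcomp_finite[OF that], of "\<lambda>\<gamma>. \<alpha> + \<gamma>"] by (simp add: vimage_def)
    show "x = \<one>\<^bsub>M\<^esub>" if x: "x \<in> carrier M" and 1: "\<And>\<gamma>. gcomp M (mgrade M) (\<alpha> + \<gamma>) x = \<one>\<^bsub>M\<^esub>" for x
    proof (rule MG.gcomp_eqI[OF x])
      show "gcomp M (mgrade M) \<gamma> x = gcomp M (mgrade M) \<gamma> \<one>\<^bsub>M\<^esub>" for \<gamma>
        using 1[of "\<gamma> - \<alpha>"] by (simp add: MG.gcomp_one)
    qed simp
    show "gcomp M (mgrade M) (\<alpha> + \<gamma>') x = (if \<gamma>' = \<gamma> then x else \<one>\<^bsub>M\<^esub>)" if "x \<in> mgrade M (\<alpha> + \<gamma>)" for x \<gamma> \<gamma>'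
      using MG.gcomp_homogeneous[OF that, of "\<alpha> + \<gamma>'"] by simp
  qed (auto simp: M.comm_group_axioms MG.D_subgroup MG.gcomp_in MG.gcomp_mult)
  moreover have "grading (shift \<alpha> M) (mgrade (shift \<alpha> M)) = grading M (mgrade (shift \<alpha> M))"
    by (rule grading_struct_cong) simp_all
  moreover have "mgrade (shift \<alpha> M) = (\<lambda>\<gamma>. mgrade M (\<alpha> + \<gamma>))"
    by auto
  ultimately have gr: "grading (shift \<alpha> M) (mgrade (shift \<alpha> M))"
    by simp
  show ?thesis
    using g gr M.comm_group_axioms
    by (intro gr_module.intro gr_module_axioms.intro R.gr_ring_axioms)
      (auto simp: ract_closed ract_add_left ract_add_right ract_mult ract_one
        grade_ract add.assoc[symmetric])
qed

lemma gmh_shift: "f \<in> gr_module_hom R M N \<Longrightarrow> f \<in> gr_module_hom R (shift \<alpha> M) (shift \<alpha> N)"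
  by (rule gr_module_homI) (auto simp: gmh_closed gmh_mult gmh_ract gmh_grade)

lemma gr_isomorphic_shift: "gr_isomorphic R M N \<Longrightarrow> gr_isomorphic R (shift \<alpha> M) (shift \<alpha> N)"
  unfolding gr_isomorphic_def using gmh_shift by fastforce

text \<open>In degree \<gamma> the module shifted by -d has the component of R of degree \<gamma> -
  d, which x raises to \<gamma>. The same sign appears in every dual basis.\<close>

lemma gmh_ract_right:
  assumes "gr_module R M" "x \<in> mgrade M d"
  shows "(\<lambda>r. x \<star>\<^bsub>M\<^esub> r) \<in> gr_module_hom R (shift (- d) (regular_module R)) M"
proof -
  interpret gr_module R M by fact
  have x: "x \<in> carrier M" using assms(2) by (rule MG.D_carrier)
  show ?thesis
  proof (rule gr_module_homI)
    fix r \<gamma> assume "r \<in> mgrade (shift (- d) (regular_module R)) \<gamma>"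
    then show "x \<star>\<^bsub>M\<^esub> r \<in> mgrade M \<gamma>"
      using grade_ract[OF assms(2), of r "- d + \<gamma>"] by simp
  qed (auto simp: x ract_closed ract_add_right ract_mult)
qed

lemma direct_sum_simps [simp]:
  "carrier (direct_sum M N) = carrier M \<times> carrier N" "one (direct_sum M N) = (one M, one N)"
  "(m, n) \<otimes>\<^bsub>direct_sum M N\<^esub> (m', n') = (m \<otimes>\<^bsub>M\<^esub> m', n \<otimes>\<^bsub>N\<^esub> n')"
  "(m, n) \<star>\<^bsub>direct_sum M N\<^esub> r = (m \<star>\<^bsub>M\<^esub> r, n \<star>\<^bsub>N\<^esub> r)"
  "mgrade (direct_sum M N) \<gamma> = mgrade M \<gamma> \<times> mgrade N \<gamma>"
  by (simp_all add: direct_sum_def)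

lemma gr_module_direct_sum:
  assumes "gr_module R M" "gr_module R N"
  shows "gr_module R (direct_sum M N)"
proof -
  interpret M: gr_module R M by fact
  interpret N: gr_module R N by fact
  let ?S = "direct_sum M N"
  have g: "comm_group ?S"
  proof (rule comm_groupI)
    fix x assume "x \<in> carrier ?S"
    then show "\<exists>y\<in>carrier ?S. y \<otimes>\<^bsub>?S\<^esub> x = \<one>\<^bsub>?S\<^esub>"
      by (intro bexI[of _ "(inv\<^bsub>M\<^esub> (fst x), inv\<^bsub>N\<^esub> (snd x))"]) (auto simp: M.M.l_inv N.M.l_inv)
  qed (auto simp: M.M.m_ac N.M.m_ac)
  interpret S: comm_group ?S by fact
  have inv: "inv\<^bsub>?S\<^esub> (m, n) = (inv\<^bsub>M\<^esub> m, inv\<^bsub>N\<^esub> n)" if "m \<in> carrier M" "n \<in> carrier N" for m n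
    using that by (intro S.inv_equality) auto
  have gr: "grading ?S (mgrade ?S)"
  proof (rule gradingI[where c = "\<lambda>\<gamma> x. (gcomp M (mgrade M) \<gamma> (fst x), gcomp N (mgrade N) \<gamma> (snd x))"])
    show "subgroup (mgrade ?S \<gamma>) ?S" for \<gamma>
      by (rule S.subgroupI)
        (auto simp: inv M.MG.D_carrier N.MG.D_carrier M.MG.D_mult N.MG.D_mult M.MG.D_inv N.MG.D_inv
          intro: M.MG.D_one N.MG.D_one)
    show "finite {\<gamma>. (gcomp M (mgrade M) \<gamma> (fst x), gcomp N (mgrade N) \<gamma> (snd x)) \<noteq> \<one>\<^bsub>?S\<^esub>}"
      if "x \<in> carrier ?S" for x
      by (rule finite_subset[of _ "{\<gamma>. gcomp M (mgrade M) \<gamma> (fst x) \<noteq> \<one>\<^bsub>M\<^esub>} \<union> {\<gamma>. gcomp N (mgrade N) \<gamma> (snd x) \<noteq> \<one>\<^bsub>N\<^esub>}"])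
        (use that in \<open>auto simp: M.MG.gcomp_finite N.MG.gcomp_finite\<close>)
    show "x = \<one>\<^bsub>?S\<^esub>" if "x \<in> carrier ?S"
      "\<And>\<gamma>. (gcomp M (mgrade M) \<gamma> (fst x), gcomp N (mgrade N) \<gamma> (snd x)) = \<one>\<^bsub>?S\<^esub>" for x
    proof -
      have "fst x = \<one>\<^bsub>M\<^esub>" using that by - (rule M.MG.gcomp_eqI, auto simp: M.MG.gcomp_one)
      moreover have "snd x = \<one>\<^bsub>N\<^esub>" using that by - (rule N.MG.gcomp_eqI, auto simp: N.MG.gcomp_one)
      ultimately show ?thesis by (simp add: prod_eq_iff)
    qed
  qed (auto simp: g M.MG.gcomp_in N.MG.gcomp_in M.MG.gcomp_mult N.MG.gcomp_mult
      M.MG.gcomp_homogeneous N.MG.gcomp_homogeneous)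
  show ?thesis
    by (intro gr_module.intro gr_module_axioms.intro M.R.gr_ring_axioms g gr)
      (auto simp: M.ract_closed N.ract_closed M.ract_add_left N.ract_add_left M.ract_add_right N.ract_add_right
        M.ract_mult N.ract_mult M.ract_one N.ract_one M.grade_ract N.grade_ract)
qed

lemma gmh_fst: "fst \<in> gr_module_hom R (direct_sum M N) M"
  and gmh_snd: "snd \<in> gr_module_hom R (direct_sum M N) N"
  by (rule gr_module_homI; auto)+

lemma gmh_inl: "gr_module R N \<Longrightarrow> (\<lambda>m. (m, \<one>\<^bsub>N\<^esub>)) \<in> gr_module_hom R M (direct_sum M N)"
proof -
  assume "gr_module R N"
  then interpret N: gr_module R N .
  show ?thesis
    by (rule gr_module_homI) (auto simp: N.one_ract N.MG.D_one)
qed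

lemma gmh_inr: "gr_module R M \<Longrightarrow> (\<lambda>n. (\<one>\<^bsub>M\<^esub>, n)) \<in> gr_module_hom R N (direct_sum M N)"
proof -
  assume "gr_module R M"
  then interpret M: gr_module R M .
  show ?thesis
    by (rule gr_module_homI) (auto simp: M.one_ract M.MG.D_one)
qed

lemma gmh_direct_sum:
  "\<lbrakk>f \<in> gr_module_hom R M M'; g \<in> gr_module_hom R N N'\<rbrakk>
    \<Longrightarrow> map_prod f g \<in> gr_module_hom R (direct_sum M N) (direct_sum M' N')"
  by (rule gr_module_homI) (auto simp: gmh_closed gmh_mult gmh_ract gmh_grade)

lemma gr_isomorphic_direct_sum:
  assumes "gr_isomorphic R M M'" "gr_isomorphic R N N'"
  shows "gr_isomorphic R (direct_sum M N) (direct_sum M' N')"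
proof -
  obtain f g where "f \<in> gr_module_hom R M M'" "bij_betw f (carrier M) (carrier M')"
    "g \<in> gr_module_hom R N N'" "bij_betw g (carrier N) (carrier N')"
    using assms by (auto simp: gr_isomorphic_def)
  then show ?thesis
    by (intro gr_isomorphicI[of "map_prod f g"] gmh_direct_sum)
      (simp_all add: bij_betw_def map_prod_inj_on map_prod_surj_on)
qed

lemma direct_sum_comm: "gr_isomorphic R (direct_sum M N) (direct_sum N M)"
  by (rule gr_isomorphicI2[of "\<lambda>(m, n). (n, m)" _ _ _ "\<lambda>(n, m). (m, n)"]; (rule gr_module_homI)?; auto)

lemma direct_sum_assoc:
  "gr_isomorphic R (direct_sum (direct_sum M N) P) (direct_sum M (direct_sum N P))"
  by (rule gr_isomorphicI2[of "\<lambda>((m, n), p). (m, n, p)" _ _ _ "\<lambda>(m, n, p). ((m, n), p)"]; (rule gr_module_homI)?; auto)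

lemma shift_direct_sum: "shift \<alpha> (direct_sum M N) = direct_sum (shift \<alpha> M) (shift \<alpha> N)"
  by (simp add: shift_def direct_sum_def DirProd_def)

lemma gr_module_zero:
  fixes R :: "('g::ab_group_add, 'r, 'x) gring_scheme"
  assumes "gr_ring R"
  shows "gr_module R zero_module"
proof -
  interpret gr_ring R by fact
  let ?Z = "zero_module :: ('g, 'r, unit) gmodule"
  have s: "x \<otimes>\<^bsub>?Z\<^esub> y = ()" "\<one>\<^bsub>?Z\<^esub> = ()" "carrier ?Z = {()}" "mgrade ?Z \<gamma> = {()}" "x \<star>\<^bsub>?Z\<^esub> r = ()" for x y \<gamma> r
    by (simp_all add: zero_module_def)
  have g: "comm_group ?Z"
    by (rule comm_groupI) (auto simp: s)
  then interpret Z: comm_group ?Z .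
  have gr: "grading ?Z (mgrade ?Z)"
    by (rule gradingI[where c="\<lambda>_ _. ()"]) (auto simp: s g intro!: Z.subgroupI)
  show ?thesis
    by (intro gr_module.intro gr_module_axioms.intro gr_ring_axioms g gr) (auto simp: s)
qed

lemma direct_sum_zero:
  assumes "gr_module R M"
  shows "gr_isomorphic R (direct_sum M zero_module) M"
proof (rule gr_isomorphicI2[OF gmh_fst])
  interpret gr_module R M by fact
  show "(\<lambda>m. (m, ())) \<in> gr_module_hom R M (direct_sum M zero_module)"
    by (rule gr_module_homI) (auto simp: zero_module_def)
qed (auto simp: zero_module_def)

text \<open>Extensional functions give equality componentwise and need all summands over one element
  type; with regular summands indexed by \<open>nat\<close> this is the type of a
  \<open>tuple_module\<close>. The binary \<open>direct_sum\<close>, which may mix types, is linked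
  to it by \<open>dsum_insert\<close>.\<close>

definition dsum :: "'i set \<Rightarrow> ('i \<Rightarrow> ('g, 'r, 'm) gmodule) \<Rightarrow> ('g, 'r, 'i \<Rightarrow> 'm) gmodule" where
  "dsum I M =
    \<lparr>carrier = (\<Pi>\<^sub>E i\<in>I. carrier (M i)), monoid.mult = (\<lambda>x y. \<lambda>i\<in>I. x i \<otimes>\<^bsub>M i\<^esub> y i),
     one = (\<lambda>i\<in>I. \<one>\<^bsub>M i\<^esub>), ract = (\<lambda>x r. \<lambda>i\<in>I. x i \<star>\<^bsub>M i\<^esub> r), mgrade = (\<lambda>\<gamma>. \<Pi>\<^sub>E i\<in>I. mgrade (M i) \<gamma>)\<rparr>"

lemma dsum_simps [simp]:
  "carrier (dsum I M) = (\<Pi>\<^sub>E i\<in>I. carrier (M i))" "one (dsum I M) = (\<lambda>i\<in>I. \<one>\<^bsub>M i\<^esub>)"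
  "x \<otimes>\<^bsub>dsum I M\<^esub> y = (\<lambda>i\<in>I. x i \<otimes>\<^bsub>M i\<^esub> y i)" "x \<star>\<^bsub>dsum I M\<^esub> r = (\<lambda>i\<in>I. x i \<star>\<^bsub>M i\<^esub> r)"
  "mgrade (dsum I M) \<gamma> = (\<Pi>\<^sub>E i\<in>I. mgrade (M i) \<gamma>)"
  by (simp_all add: dsum_def)

text \<open>Finiteness of I enters through the grading: the support of a tuple is contained in the
  union of the supports of its coordinates.\<close>

lemma gr_module_dsum:
  assumes "gr_ring R" "finite I" and M: "\<And>i. i \<in> I \<Longrightarrow> gr_module R (M i)"
  shows "gr_module R (dsum I M)"
proof -
  interpret R: gr_ring R by fact
  let ?S = "dsum I M"
  note ma = M[THEN gr_module.axioms(2)] M[THEN gr_module.axioms(3), unfolded gr_module_axioms_def]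
  note cg = ma(1)
  note grp = comm_group.axioms(2)[OF cg]
  note mon = group.is_monoid[OF grp]
  have gg: "graded_group (M i) (mgrade (M i))" if "i \<in> I" for i
    using ma[OF that] by (simp add: graded_group_def graded_group_axioms_def)
  note G = graded_group.gcomp_in[OF gg] graded_group.gcomp_mult[OF gg] graded_group.gcomp_homogeneous[OF gg]
    graded_group.D_one[OF gg] graded_group.D_mult[OF gg] graded_group.D_inv[OF gg] graded_group.D_carrier[OF gg]
  have g: "comm_group ?S"
  proof (rule comm_groupI)
    fix x assume x: "x \<in> carrier ?S"
    show "\<exists>y\<in>carrier ?S. y \<otimes>\<^bsub>?S\<^esub> x = \<one>\<^bsub>?S\<^esub>"
      by (rule bexI[of _ "\<lambda>i\<in>I. inv\<^bsub>M i\<^esub> (x i)"])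
        (use x in \<open>auto simp: group.l_inv[OF grp] PiE_iff intro!: restrict_ext group.inv_closed[OF grp]\<close>)
  next
    fix x y assume "x \<in> carrier ?S" "y \<in> carrier ?S"
    then show "x \<otimes>\<^bsub>?S\<^esub> y = y \<otimes>\<^bsub>?S\<^esub> x"
      by (auto intro!: restrict_ext comm_monoid.m_comm[OF comm_group.axioms(1)[OF cg]])
  next
    fix x assume "x \<in> carrier ?S"
    then show "\<one>\<^bsub>?S\<^esub> \<otimes>\<^bsub>?S\<^esub> x = x"
      by (auto simp: PiE_iff monoid.l_one[OF mon] extensional_def)
  qed (auto simp: PiE_iff monoid.m_assoc[OF mon] intro!: restrict_ext monoid.one_closed[OF mon] monoid.m_closed[OF mon])
  interpret S: comm_group ?S by fact
  have inv: "inv\<^bsub>?S\<^esub> x = (\<lambda>i\<in>I. inv\<^bsub>M i\<^esub> (x i))" if "x \<in> carrier ?S" for x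
    by (rule S.inv_equality)
      (use that in \<open>auto simp: group.l_inv[OF grp] PiE_iff intro!: restrict_ext group.inv_closed[OF grp]\<close>)
  let ?c = "\<lambda>\<gamma> x. \<lambda>i\<in>I. gcomp (M i) (mgrade (M i)) \<gamma> (x i)"
  have gr: "grading ?S (mgrade ?S)"
  proof (rule gradingI[where c = ?c])
    show "subgroup (mgrade ?S \<gamma>) ?S" for \<gamma>
    proof (rule S.subgroupI)
      show "mgrade ?S \<gamma> \<subseteq> carrier ?S"
        using G(7)[of _ _ \<gamma>] by (auto simp: PiE_iff)
      show "mgrade ?S \<gamma> \<noteq> {}"
        using G(4) by (auto simp: PiE_eq_empty_iff)
      show "inv\<^bsub>?S\<^esub> x \<in> mgrade ?S \<gamma>" if "x \<in> mgrade ?S \<gamma>" for x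
        using that by (subst inv) (auto simp: PiE_iff G(6,7))
    qed (auto simp: PiE_iff G(5))
    show "finite {\<gamma>. ?c \<gamma> x \<noteq> \<one>\<^bsub>?S\<^esub>}" if "x \<in> carrier ?S" for x
    proof (rule finite_subset)
      show "{\<gamma>. ?c \<gamma> x \<noteq> \<one>\<^bsub>?S\<^esub>} \<subseteq> (\<Union>i\<in>I. {\<gamma>. gcomp (M i) (mgrade (M i)) \<gamma> (x i) \<noteq> \<one>\<^bsub>M i\<^esub>})"
        by (auto simp: fun_eq_iff restrict_def)
      show "finite \<dots>"
        using assms(2) that graded_group.gcomp_finite[OF gg] by (auto simp: PiE_iff)
    qed
    show "x = \<one>\<^bsub>?S\<^esub>" if x: "x \<in> carrier ?S" and c: "\<And>\<gamma>. ?c \<gamma> x = \<one>\<^bsub>?S\<^esub>" for x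
    proof -
      have "x i = \<one>\<^bsub>M i\<^esub>" if i: "i \<in> I" for i
      proof (rule graded_group.gcomp_eqI[OF gg[OF i]])
        show "gcomp (M i) (mgrade (M i)) \<gamma> (x i) = gcomp (M i) (mgrade (M i)) \<gamma> \<one>\<^bsub>M i\<^esub>" for \<gamma>
          using fun_cong[OF c[of \<gamma>], of i] i by (simp add: graded_group.gcomp_one[OF gg])
      qed (use x i in \<open>auto intro: monoid.one_closed[OF mon]\<close>)
      then show ?thesis
        using x by (auto simp: PiE_iff extensional_def restrict_def fun_eq_iff)
    qed
    show "?c \<gamma>' x = (if \<gamma>' = \<gamma> then x else \<one>\<^bsub>?S\<^esub>)" if "x \<in> mgrade ?S \<gamma>" for x \<gamma> \<gamma>'
      using that by (auto simp: PiE_iff G(3)[of _ "x _" \<gamma>] extensional_def restrict_def fun_eq_iff)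
  qed (auto simp: g PiE_iff G(1,2) intro!: restrict_ext)
  show ?thesis
  proof (intro gr_module.intro gr_module_axioms.intro R.gr_ring_axioms g gr)
    fix m r assume "m \<in> carrier ?S" "r \<in> carrier R"
    then show "m \<star>\<^bsub>?S\<^esub> r \<in> carrier ?S"
      using ma(2) by (auto simp: PiE_iff)
  next
    fix m assume "m \<in> carrier ?S"
    then show "m \<star>\<^bsub>?S\<^esub> \<one>\<^bsub>R\<^esub> = m"
      using ma(2) by (auto simp: PiE_iff extensional_def restrict_def fun_eq_iff)
  next
    fix m r \<alpha> \<beta> assume "m \<in> mgrade ?S \<alpha>" "r \<in> grade R \<beta>"
    then show "m \<star>\<^bsub>?S\<^esub> r \<in> mgrade ?S (\<alpha> + \<beta>)"
      using ma(2) by (auto simp: PiE_iff)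
  next
    fix m r s assume "m \<in> carrier ?S" "r \<in> carrier R" "s \<in> carrier R"
    then show "m \<star>\<^bsub>?S\<^esub> (r \<otimes>\<^bsub>R\<^esub> s) = m \<star>\<^bsub>?S\<^esub> r \<star>\<^bsub>?S\<^esub> s" "m \<star>\<^bsub>?S\<^esub> (r \<oplus>\<^bsub>R\<^esub> s) = m \<star>\<^bsub>?S\<^esub> r \<otimes>\<^bsub>?S\<^esub> m \<star>\<^bsub>?S\<^esub> s"
      using ma(2) by (auto simp: PiE_iff intro!: restrict_ext)
  next
    fix m m' r assume "m \<in> carrier ?S" "m' \<in> carrier ?S" "r \<in> carrier R"
    then show "(m \<otimes>\<^bsub>?S\<^esub> m') \<star>\<^bsub>?S\<^esub> r = m \<star>\<^bsub>?S\<^esub> r \<otimes>\<^bsub>?S\<^esub> m' \<star>\<^bsub>?S\<^esub> r"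
      using ma(2) by (auto simp: PiE_iff intro!: restrict_ext)
  qed
qed

lemma gmh_dproj: "i \<in> I \<Longrightarrow> (\<lambda>x. x i) \<in> gr_module_hom R (dsum I M) (M i)"
  by (rule gr_module_homI) auto

lemma gmh_dsum:
  assumes "\<And>i. i \<in> I \<Longrightarrow> f i \<in> gr_module_hom R P (M i)"
  shows "(\<lambda>p. \<lambda>i\<in>I. f i p) \<in> gr_module_hom R P (dsum I M)"
  by (intro gr_module_homI)
    (auto simp: gmh_closed[OF assms] gmh_mult[OF assms] gmh_ract[OF assms] gmh_grade[OF assms] intro!: restrict_ext)

lemma gmh_dinj:
  assumes "\<And>i. i \<in> I \<Longrightarrow> gr_module R (M i)" "i \<in> I"
  shows "(\<lambda>m. \<lambda>j\<in>I. if j = i then m else \<one>\<^bsub>M j\<^esub>) \<in> gr_module_hom R (M i) (dsum I M)"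
proof (rule gmh_dsum)
  fix j assume "j \<in> I"
  then show "(\<lambda>m. if j = i then m else \<one>\<^bsub>M j\<^esub>) \<in> gr_module_hom R (M i) (M j)"
    using gmh_const_one[OF assms(1)] gmh_id by (cases "j = i") auto
qed

lemma dsum_insert:
  assumes "i \<notin> I"
  shows "gr_isomorphic R (dsum (insert i I) M) (direct_sum (M i) (dsum I M))"
proof (rule gr_isomorphicI2)
  show "(\<lambda>x. (x i, restrict x I)) \<in> gr_module_hom R (dsum (insert i I) M) (direct_sum (M i) (dsum I M))"
    by (rule gr_module_homI) (auto simp: fun_eq_iff)
  show "(\<lambda>(a, x). x(i := a)) \<in> gr_module_hom R (direct_sum (M i) (dsum I M)) (dsum (insert i I) M)"
    using assms by (intro gr_module_homI) (auto simp: fun_eq_iff PiE_iff extensional_def)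
qed (use assms in \<open>auto simp: fun_eq_iff PiE_iff extensional_def restrict_def\<close>)

lemma dsum_empty: "gr_isomorphic R (dsum {} M) zero_module"
  by (rule gr_isomorphicI2[of "\<lambda>_. ()" _ _ _ "\<lambda>_. \<lambda>i. undefined"]; (rule gr_module_homI)?)
    (auto simp: zero_module_def)

text \<open>One construction covers two needs: against a constant map it is a kernel, and with left
  multiplication by e against the identity it is the right ideal eR of an idempotent e.\<close>

definition equalizer :: "('g, 'r, 'm) gmodule \<Rightarrow> ('m \<Rightarrow> 'n) \<Rightarrow> ('m \<Rightarrow> 'n) \<Rightarrow> ('g, 'r, 'm) gmodule" where
  "equalizer M f g = M\<lparr>carrier := {m \<in> carrier M. f m = g m},
    mgrade := (\<lambda>\<gamma>. mgrade M \<gamma> \<inter> {m \<in> carrier M. f m = g m})\<rparr>"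

lemma equalizer_simps [simp]:
  "carrier (equalizer M f g) = {m \<in> carrier M. f m = g m}"
  "monoid.mult (equalizer M f g) = monoid.mult M" "one (equalizer M f g) = one M"
  "ract (equalizer M f g) = ract M" "mgrade (equalizer M f g) \<gamma> = mgrade M \<gamma> \<inter> {m \<in> carrier M. f m = g m}"
  by (simp_all add: equalizer_def)

text \<open>The point is the grading: since f and g both commute with taking components, a component
  of an element of the equalizer lies in the equalizer again, and the components of \<open>M\<close>
  restrict.\<close>

lemma gr_module_equalizer:
  assumes "gr_module R M" "gr_module R N" and f: "f \<in> gr_module_hom R M N" and g: "g \<in> gr_module_hom R M N"
  shows "gr_module R (equalizer M f g)"
proof -
  interpret M: gr_module R M by fact
  interpret N: gr_module R N by fact
  let ?E = "equalizer M f g"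
  have 1: "f \<one>\<^bsub>M\<^esub> = g \<one>\<^bsub>M\<^esub>"
    by (simp add: gmh_one[OF f assms(1,2)] gmh_one[OF g assms(1,2)])
  have i: "f (inv\<^bsub>M\<^esub> m) = g (inv\<^bsub>M\<^esub> m)" if "m \<in> carrier M" "f m = g m" for m
    using that by (simp add: gmh_inv[OF f assms(1,2)] gmh_inv[OF g assms(1,2)])
  have cc: "f (gcomp M (mgrade M) \<gamma> m) = g (gcomp M (mgrade M) \<gamma> m)" if "m \<in> carrier M" "f m = g m" for m \<gamma>
    using gmh_gcomp[OF assms(1,2) f that(1), of \<gamma>] gmh_gcomp[OF assms(1,2) g that(1), of \<gamma>] that(2) by simp
  have E: "comm_group ?E"
  proof (rule comm_groupI)
    fix x assume "x \<in> carrier ?E"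
    then show "\<exists>y\<in>carrier ?E. y \<otimes>\<^bsub>?E\<^esub> x = \<one>\<^bsub>?E\<^esub>"
      by (intro bexI[of _ "inv\<^bsub>M\<^esub> x"]) (auto simp: i)
  qed (auto simp: M.M.m_ac gmh_mult[OF f] gmh_mult[OF g] 1)
  interpret E: comm_group ?E by fact
  have inv: "inv\<^bsub>?E\<^esub> m = inv\<^bsub>M\<^esub> m" if "m \<in> carrier ?E" for m
    using that by (intro E.inv_equality) (auto simp: i)
  have gr: "grading ?E (mgrade ?E)"
  proof (rule gradingI[where c = "gcomp M (mgrade M)"])
    show "subgroup (mgrade ?E \<gamma>) ?E" for \<gamma>
    proof (rule E.subgroupI)
      show "mgrade ?E \<gamma> \<noteq> {}" using M.MG.D_one[of \<gamma>] 1 by auto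
      show "inv\<^bsub>?E\<^esub> x \<in> mgrade ?E \<gamma>" if "x \<in> mgrade ?E \<gamma>" for x
        using that by (subst inv) (auto simp: M.MG.D_inv i)
    qed (auto simp: M.MG.D_mult gmh_mult[OF f] gmh_mult[OF g])
    show "x = \<one>\<^bsub>?E\<^esub>" if "x \<in> carrier ?E" "\<And>\<gamma>. gcomp M (mgrade M) \<gamma> x = \<one>\<^bsub>?E\<^esub>" for x
      using that M.MG.gcomp_eqI[of x "\<one>\<^bsub>M\<^esub>"] by (auto simp: M.MG.gcomp_one)
  qed (auto simp: E M.MG.gcomp_in M.MG.gcomp_carrier cc M.MG.gcomp_finite M.MG.gcomp_mult M.MG.gcomp_homogeneous)
  show ?thesis
    by (intro gr_module.intro gr_module_axioms.intro M.R.gr_ring_axioms E gr)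
      (auto simp: M.ract_closed M.ract_add_left M.ract_add_right M.ract_mult M.ract_one M.grade_ract
         gmh_ract[OF f] gmh_ract[OF g] dest: M.R.grade_carrier)
qed

lemma gmh_equalizer_incl: "(\<lambda>m. m) \<in> gr_module_hom R (equalizer M f g) M"
  by (rule gr_module_homI) auto

lemma gmh_into_equalizer:
  "\<lbrakk>gr_module R P; h \<in> gr_module_hom R P M; \<And>p. p \<in> carrier P \<Longrightarrow> f (h p) = g (h p)\<rbrakk>
    \<Longrightarrow> h \<in> gr_module_hom R P (equalizer M f g)"
proof -
  assume a: "gr_module R P" "h \<in> gr_module_hom R P M" "\<And>p. p \<in> carrier P \<Longrightarrow> f (h p) = g (h p)"
  interpret P: gr_module R P by fact
  show ?thesis
    using a(2,3) by (intro gr_module_homI) (auto simp: gmh_closed gmh_mult gmh_ract gmh_grade P.MG.D_carrier)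
qed

section \<open>Finitely generated projective modules and their isomorphism classes\<close>

section \<open>Dual bases and finitely generated projective modules\<close>

text \<open>The datum of the dual basis lemma in graded form: x and f present \<open>M\<close> as a
  direct summand of the sum of the modules R(-d i). Being given by equations, it transfers along
  retracts, sums and ring homomorphisms, and it makes sense for modules over any type.\<close>

definition dual_basis ::
  "('g::ab_group_add, 'r, 'x) gring_scheme \<Rightarrow> ('g, 'r, 'm) gmodule \<Rightarrow> 'i set \<Rightarrow> ('i \<Rightarrow> 'm) \<Rightarrow> ('i \<Rightarrow> 'g)
    \<Rightarrow> ('i \<Rightarrow> 'm \<Rightarrow> 'r) \<Rightarrow> bool" where
  "dual_basis R M I x d f \<longleftrightarrow> finite I \<and>
    (\<forall>i\<in>I. x i \<in> mgrade M (d i) \<and> f i \<in> gr_module_hom R M (shift (- d i) (regular_module R))) \<and>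
    (\<forall>m\<in>carrier M. m = finprod M (\<lambda>i. x i \<star>\<^bsub>M\<^esub> f i m) I)"

text \<open>Plays the role of \<open>gr_fgp\<close> for modules over any type;
  \<open>gr_fgp_iff\<close> identifies the two on tuple modules. Indices are natural numbers because
  a definition cannot quantify over index types; \<open>fgprojI\<close> accepts any finite index
  set.\<close>

definition fgproj :: "('g::ab_group_add, 'r, 'x) gring_scheme \<Rightarrow> ('g, 'r, 'm) gmodule \<Rightarrow> bool" where
  "fgproj R M \<longleftrightarrow> gr_module R M \<and> (\<exists>(n::nat) x d f. dual_basis R M {..<n} x d f)"

lemma fgproj_module: "fgproj R M \<Longrightarrow> gr_module R M"
  by (simp add: fgproj_def)

lemma dual_basisD:
  assumes "dual_basis R M I x d f"
  shows "finite I" "i \<in> I \<Longrightarrow> x i \<in> mgrade M (d i)"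
    "i \<in> I \<Longrightarrow> f i \<in> gr_module_hom R M (shift (- d i) (regular_module R))"
    "m \<in> carrier M \<Longrightarrow> finprod M (\<lambda>i. x i \<star>\<^bsub>M\<^esub> f i m) I = m"
  using assms by (auto simp: dual_basis_def)

lemma dual_basis_facts:
  assumes "dual_basis R M I x d f" "gr_module R M" "i \<in> I"
  shows "x i \<in> carrier M" "m \<in> carrier M \<Longrightarrow> f i m \<in> carrier R"
    "m \<in> carrier M \<Longrightarrow> m' \<in> carrier M \<Longrightarrow> f i (m \<otimes>\<^bsub>M\<^esub> m') = f i m \<oplus>\<^bsub>R\<^esub> f i m'"
    "m \<in> carrier M \<Longrightarrow> r \<in> carrier R \<Longrightarrow> f i (m \<star>\<^bsub>M\<^esub> r) = f i m \<otimes>\<^bsub>R\<^esub> r"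
    "m \<in> mgrade M \<gamma> \<Longrightarrow> f i m \<in> grade R (\<gamma> - d i)"
    "f i \<in> hom M (add_monoid R)"
proof -
  interpret gr_module R M by fact
  note f = dual_basisD(3)[OF assms(1,3)]
  show "x i \<in> carrier M"
    using dual_basisD(2)[OF assms(1,3)] by (rule MG.D_carrier)
  show c: "f i m \<in> carrier R" if "m \<in> carrier M" for m
    using gmh_closed[OF f that] by simp
  show a: "f i (m \<otimes>\<^bsub>M\<^esub> m') = f i m \<oplus>\<^bsub>R\<^esub> f i m'" if "m \<in> carrier M" "m' \<in> carrier M" for m m'
    using gmh_mult[OF f that] by simp
  show "m \<in> carrier M \<Longrightarrow> r \<in> carrier R \<Longrightarrow> f i (m \<star>\<^bsub>M\<^esub> r) = f i m \<otimes>\<^bsub>R\<^esub> r"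
    using gmh_ract[OF f, of m r] by simp
  show "m \<in> mgrade M \<gamma> \<Longrightarrow> f i m \<in> grade R (\<gamma> - d i)"
    using gmh_grade[OF f, of m \<gamma>] by simp
  show "f i \<in> hom M (add_monoid R)"
    using a c by (auto simp: hom_def)
qed

lemma dual_basis_reindex:
  assumes B: "dual_basis R M (e ` J) x d f" and M: "gr_module R M" and J: "finite J" "inj_on e J"
  shows "dual_basis R M J (\<lambda>i. x (e i)) (\<lambda>i. d (e i)) (\<lambda>i. f (e i))"
  unfolding dual_basis_def
proof (intro conjI ballI)
  interpret gr_module R M by fact
  fix m assume m: "m \<in> carrier M"
  have "finprod M (\<lambda>i. x i \<star>\<^bsub>M\<^esub> f i m) (e ` J) = finprod M (\<lambda>i. x (e i) \<star>\<^bsub>M\<^esub> f (e i) m) J"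
    using J by (intro M.finprod_reindex) (auto simp: ract_closed dual_basis_facts[OF B M] m)
  then show "m = finprod M (\<lambda>i. x (e i) \<star>\<^bsub>M\<^esub> f (e i) m) J"
    using dual_basisD(4)[OF B m] by simp
qed (use J dual_basisD[OF B] in auto)

text \<open>Apply r to the expansion of i n: generators are pushed forward by r and functionals
  pulled back along i.\<close>

lemma dual_basis_retract:
  assumes B: "dual_basis R M I x d f" and M: "gr_module R M" and N: "gr_module R N"
    and i: "i \<in> gr_module_hom R N M" and r: "r \<in> gr_module_hom R M N"
    and ri: "\<And>n. n \<in> carrier N \<Longrightarrow> r (i n) = n"
  shows "dual_basis R N I (\<lambda>j. r (x j)) d (\<lambda>j n. f j (i n))"
  unfolding dual_basis_def
proof (intro conjI ballI)
  interpret M: gr_module R M by fact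
  interpret N: gr_module R N by fact
  note F = dual_basis_facts[OF B M]
  show "finite I" using B by (rule dual_basisD)
  fix n assume n: "n \<in> carrier N"
  have c: "i n \<in> carrier M" using gmh_closed[OF i n] .
  have "n = r (finprod M (\<lambda>j. x j \<star>\<^bsub>M\<^esub> f j (i n)) I)"
    using dual_basisD(4)[OF B c] ri[OF n] by simp
  also have "\<dots> = finprod N (\<lambda>j. r (x j \<star>\<^bsub>M\<^esub> f j (i n))) I"
    by (rule gmh_finprod[OF r M N]) (auto simp: M.ract_closed F c)
  also have "\<dots> = finprod N (\<lambda>j. r (x j) \<star>\<^bsub>N\<^esub> f j (i n)) I"
    by (rule N.M.finprod_cong') (auto simp: gmh_ract[OF r] F c N.ract_closed gmh_closed[OF r])
  finally show "n = finprod N (\<lambda>j. r (x j) \<star>\<^bsub>N\<^esub> f j (i n)) I" .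
next
  fix j assume j: "j \<in> I"
  show "r (x j) \<in> mgrade N (d j)"
    using gmh_grade[OF r dual_basisD(2)[OF B j]] .
  show "(\<lambda>n. f j (i n)) \<in> gr_module_hom R N (shift (- d j) (regular_module R))"
    using gmh_comp[OF i dual_basisD(3)[OF B j]] .
qed

lemma fgprojI:
  fixes I :: "'i set"
  assumes M: "gr_module R M" and B: "dual_basis R M I x d f"
  shows "fgproj R M"
proof -
  have "finite I" using B by (rule dual_basisD)
  then obtain n :: nat and e where "I = e ` {i. i < n}" "inj_on e {i. i < n}"
    using finite_imp_nat_seg_image_inj_on by metis
  then have "I = e ` {..<n}" "inj_on e {..<n}"
    by (simp_all add: lessThan_def)
  then show ?thesis
    using dual_basis_reindex[of R M e "{..<n}" x d f] B M by (auto simp: fgproj_def)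
qed

lemma fgproj_retract:
  assumes M: "fgproj R M" and N: "gr_module R N" and i: "i \<in> gr_module_hom R N M" and r: "r \<in> gr_module_hom R M N"
    and ri: "\<And>n. n \<in> carrier N \<Longrightarrow> r (i n) = n"
  shows "fgproj R N"
proof -
  obtain n x d f where B: "dual_basis R M {..<n::nat} x d f"
    using M by (auto simp: fgproj_def)
  have "dual_basis R N {..<n} (\<lambda>j. r (x j)) d (\<lambda>j n. f j (i n))"
    by (rule dual_basis_retract[OF B fgproj_module[OF M] N i r]) (rule ri)
  then show ?thesis using N by (auto simp: fgproj_def)
qed

lemma fgproj_iso: "\<lbrakk>fgproj R M; gr_module R N; gr_isomorphic R M N\<rbrakk> \<Longrightarrow> fgproj R N"
  by (metis gr_isomorphicE fgproj_retract fgproj_module)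

lemma fgproj_regular:
  assumes "gr_ring R"
  shows "fgproj R (regular_module R)"
proof -
  interpret gr_ring R by fact
  interpret M: gr_module R "regular_module R" by (rule gr_module_regular) fact
  have "dual_basis R (regular_module R) {()} (\<lambda>_. \<one>\<^bsub>R\<^esub>) (\<lambda>_. 0) (\<lambda>_ r. r)"
    using one_grade by (auto simp: dual_basis_def finprod_regular shift_zero gmh_id)
  then show ?thesis
    using fgprojI M.gr_module_axioms by blast
qed

lemma fgproj_shift:
  assumes "fgproj R M"
  shows "fgproj R (shift \<alpha> M)"
proof -
  obtain n x d f where B: "dual_basis R M {..<n::nat} x d f" and M: "gr_module R M"
    using assms by (auto simp: fgproj_def)
  have "dual_basis R (shift \<alpha> M) {..<n} x (\<lambda>i. d i - \<alpha>) f"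
    unfolding dual_basis_def
  proof (intro conjI ballI)
    fix i assume i: "i \<in> {..<n}"
    show "x i \<in> mgrade (shift \<alpha> M) (d i - \<alpha>)"
      using dual_basisD(2)[OF B i] by simp
    have "f i \<in> gr_module_hom R (shift \<alpha> M) (shift \<alpha> (shift (- d i) (regular_module R)))"
      by (rule gmh_shift[OF dual_basisD(3)[OF B i]])
    then show "f i \<in> gr_module_hom R (shift \<alpha> M) (shift (- (d i - \<alpha>)) (regular_module R))"
      by (simp add: shift_shift)
  qed (use dual_basisD[OF B] in auto)
  then show ?thesis
    using M gr_module_shift by (auto simp: fgproj_def)
qed

lemma dual_basis_biproduct:
  assumes M: "dual_basis R M I x d f" "gr_module R M" and N: "dual_basis R N J y c g" "gr_module R N"
    and P: "gr_module R P"
    and i1: "i1 \<in> gr_module_hom R M P" and i2: "i2 \<in> gr_module_hom R N P"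
    and p1: "p1 \<in> gr_module_hom R P M" and p2: "p2 \<in> gr_module_hom R P N"
    and s: "\<And>p. p \<in> carrier P \<Longrightarrow> i1 (p1 p) \<otimes>\<^bsub>P\<^esub> i2 (p2 p) = p"
  shows "dual_basis R P (I <+> J) (case_sum (\<lambda>i. i1 (x i)) (\<lambda>j. i2 (y j))) (case_sum d c)
    (case_sum (\<lambda>i p. f i (p1 p)) (\<lambda>j p. g j (p2 p)))"
  unfolding dual_basis_def
proof (intro conjI ballI)
  interpret M: gr_module R M by fact
  interpret N: gr_module R N by fact
  interpret P: gr_module R P by fact
  show fin: "finite (I <+> J)"
    using dual_basisD(1)[OF M(1)] dual_basisD(1)[OF N(1)] by simp
  note F = dual_basis_facts[OF M] dual_basis_facts[OF N]
  fix p assume p: "p \<in> carrier P"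
  let ?x = "case_sum (\<lambda>i. i1 (x i)) (\<lambda>j. i2 (y j))" and ?f = "case_sum (\<lambda>i p. f i (p1 p)) (\<lambda>j p. g j (p2 p))"
  have c: "p1 p \<in> carrier M" "p2 p \<in> carrier N"
    using p by (simp_all add: gmh_closed[OF p1] gmh_closed[OF p2])
  have 1: "i1 (p1 p) = finprod P (\<lambda>i. i1 (x i) \<star>\<^bsub>P\<^esub> f i (p1 p)) I"
  proof -
    have "i1 (finprod M (\<lambda>i. x i \<star>\<^bsub>M\<^esub> f i (p1 p)) I) = finprod P (\<lambda>i. i1 (x i \<star>\<^bsub>M\<^esub> f i (p1 p))) I"
      by (rule gmh_finprod[OF i1 M(2) P]) (auto simp: M.ract_closed F c)
    also have "\<dots> = finprod P (\<lambda>i. i1 (x i) \<star>\<^bsub>P\<^esub> f i (p1 p)) I"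
      by (rule P.M.finprod_cong') (auto simp: gmh_ract[OF i1] F c P.ract_closed gmh_closed[OF i1])
    finally show ?thesis by (simp add: dual_basisD(4)[OF M(1)] c)
  qed
  have 2: "i2 (p2 p) = finprod P (\<lambda>i. i2 (y i) \<star>\<^bsub>P\<^esub> g i (p2 p)) J"
  proof -
    have "i2 (finprod N (\<lambda>i. y i \<star>\<^bsub>N\<^esub> g i (p2 p)) J) = finprod P (\<lambda>i. i2 (y i \<star>\<^bsub>N\<^esub> g i (p2 p))) J"
      by (rule gmh_finprod[OF i2 N(2) P]) (auto simp: N.ract_closed F c)
    also have "\<dots> = finprod P (\<lambda>i. i2 (y i) \<star>\<^bsub>P\<^esub> g i (p2 p)) J"
      by (rule P.M.finprod_cong') (auto simp: gmh_ract[OF i2] F c P.ract_closed gmh_closed[OF i2])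
    finally show ?thesis by (simp add: dual_basisD(4)[OF N(1)] c)
  qed
  let ?h = "\<lambda>i. ?x i \<star>\<^bsub>P\<^esub> ?f i p"
  have h: "?h (Inl i) \<in> carrier P" if "i \<in> I" for i
    using that by (simp add: P.ract_closed gmh_closed[OF i1] F c)
  have h': "?h (Inr j) \<in> carrier P" if "j \<in> J" for j
    using that by (simp add: P.ract_closed gmh_closed[OF i2] F c)
  have "finprod P ?h (I <+> J) = finprod P ?h (Inl ` I) \<otimes>\<^bsub>P\<^esub> finprod P ?h (Inr ` J)"
    unfolding Plus_def using dual_basisD(1)[OF M(1)] dual_basisD(1)[OF N(1)] h h'
    by (intro P.M.finprod_Un_disjoint) auto
  also have "finprod P ?h (Inl ` I) = finprod P (\<lambda>i. ?h (Inl i)) I"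
    using h by (intro P.M.finprod_reindex) auto
  also have "finprod P ?h (Inr ` J) = finprod P (\<lambda>i. ?h (Inr i)) J"
    using h' by (intro P.M.finprod_reindex) auto
  finally show "p = finprod P ?h (I <+> J)"
    using s[OF p] by (simp add: 1 2)
next
  fix k assume "k \<in> I <+> J"
  then show "case_sum (\<lambda>i. i1 (x i)) (\<lambda>j. i2 (y j)) k \<in> mgrade P (case_sum d c k)"
    "case_sum (\<lambda>i p. f i (p1 p)) (\<lambda>j p. g j (p2 p)) k \<in> gr_module_hom R P (shift (- case_sum d c k) (regular_module R))"
    using gmh_grade[OF i1 dual_basisD(2)[OF M(1)]] gmh_grade[OF i2 dual_basisD(2)[OF N(1)]]
      gmh_comp[OF p1 dual_basisD(3)[OF M(1)]] gmh_comp[OF p2 dual_basisD(3)[OF N(1)]]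
    by auto
qed

lemma dual_basis_direct_sum:
  assumes M: "dual_basis R M I x d f" "gr_module R M" and N: "dual_basis R N J y c g" "gr_module R N"
  shows "dual_basis R (direct_sum M N) (I <+> J) (case_sum (\<lambda>i. (x i, \<one>\<^bsub>N\<^esub>)) (\<lambda>j. (\<one>\<^bsub>M\<^esub>, y j))) (case_sum d c)
    (case_sum (\<lambda>i p. f i (fst p)) (\<lambda>j p. g j (snd p)))"
proof -
  interpret M: gr_module R M by fact
  interpret N: gr_module R N by fact
  show ?thesis
    by (rule dual_basis_biproduct[OF assms gr_module_direct_sum[OF M(2) N(2)] gmh_inl[OF N(2)] gmh_inr[OF M(2)]
          gmh_fst gmh_snd]) auto
qed

lemma fgproj_direct_sum:
  assumes "fgproj R M" "fgproj R N"
  shows "fgproj R (direct_sum M N)"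
proof -
  obtain n x d f where "dual_basis R M {..<n::nat} x d f" and M: "gr_module R M"
    using assms(1) by (auto simp: fgproj_def)
  moreover obtain k y c g where "dual_basis R N {..<k::nat} y c g" and N: "gr_module R N"
    using assms(2) by (auto simp: fgproj_def)
  ultimately show ?thesis
    using fgprojI[OF gr_module_direct_sum[OF M N] dual_basis_direct_sum] by blast
qed

lemma fgproj_zero:
  assumes "gr_ring R"
  shows "fgproj R zero_module"
  by (rule fgproj_retract[OF fgproj_regular[OF assms] gr_module_zero[OF assms]
        gmh_const_one[OF gr_module_regular[OF assms]] gmh_const_one[OF gr_module_zero[OF assms]]])
    (simp add: zero_module_def)

lemma fgproj_dsum:
  assumes "gr_ring R" "finite I" "\<And>i. i \<in> I \<Longrightarrow> fgproj R (M i)"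
  shows "fgproj R (dsum I M)"
  using assms(2,3)
proof (induction I)
  case empty
  have m: "gr_module R (dsum {} M)"
    by (rule gr_module_dsum[OF assms(1)]) auto
  show ?case
    by (rule fgproj_iso[OF fgproj_zero[OF assms(1)] m gr_isomorphic_sym[OF dsum_empty m gr_module_zero[OF assms(1)]]])
next
  case (insert i I)
  have m: "gr_module R (dsum (insert i I) M)"
    by (rule gr_module_dsum[OF assms(1)]) (use insert in \<open>auto intro: fgproj_module\<close>)
  have f: "fgproj R (direct_sum (M i) (dsum I M))"
    using insert by (intro fgproj_direct_sum) auto
  show ?case
    by (rule fgproj_iso[OF f m gr_isomorphic_sym[OF dsum_insert[OF insert.hyps(2)] m fgproj_module[OF f]]])
qed

text \<open>The coordinates f i m determine m by the dual basis identity, so m is encoded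
  injectively as an n-tuple over R and the structure is transported to the tuples.\<close>

lemma fgproj_tuple:
  fixes M :: "('g::ab_group_add, 'r, 'm) gmodule"
  assumes "fgproj R M"
  shows "\<exists>P :: ('g, 'r) tuple_module. fgproj R P \<and> gr_isomorphic R M P"
proof -
  obtain n x d f where B: "dual_basis R M {..<n::nat} x d f" and M: "gr_module R M"
    using assms by (auto simp: fgproj_def)
  define h where "h m = (\<lambda>i. if i < n then f i m else undefined)" for m
  interpret M: gr_module R M by fact
  have inj: "inj_on h (carrier M)"
  proof
    fix m m' assume m: "m \<in> carrier M" "m' \<in> carrier M" and e: "h m = h m'"
    have "f i m = f i m'" if "i < n" for i
      using fun_cong[OF e, of i] that by (simp add: h_def)
    then have "finprod M (\<lambda>i. x i \<star>\<^bsub>M\<^esub> f i m) {..<n} = finprod M (\<lambda>i. x i \<star>\<^bsub>M\<^esub> f i m') {..<n}"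
      using m by (intro M.M.finprod_cong') (auto simp: dual_basis_facts[OF B M] M.ract_closed)
    then show "m = m'"
      using m by (simp add: dual_basisD(4)[OF B])
  qed
  show ?thesis
    using gr_module_transport[OF M inj] transport_iso[OF M inj] fgproj_iso[OF assms] by blast
qed

text \<open>The given generators need not be homogeneous, but their finitely many nonzero components
  generate as well. They define a surjection p from a sum of shifts of R, which is a tuple module,
  so \<open>gr_projective\<close> may be applied to p; the coordinates of a lift of the identity are
  the functionals of a dual basis.\<close>

lemma gr_fgp_imp_fgproj:
  fixes P :: "('g::ab_group_add, 'r) tuple_module"
  assumes "P \<in> gr_fgp R"
  shows "fgproj R P"
proof -
  have P: "gr_module R P" and fg: "fin_generated R P" and proj: "gr_projective R P"
    using assms by (auto simp: gr_fgp_def)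
  interpret P: gr_module R P by fact
  obtain X where X: "finite X" "X \<subseteq> carrier P"
    and gen: "generate P {x \<star>\<^bsub>P\<^esub> r | x r. x \<in> X \<and> r \<in> carrier R} = carrier P"
    using fg by (auto simp: fin_generated_def)
  let ?c = "gcomp P (mgrade P)"
  \<comment> \<open>Pairs of a generator and a degree in which its component is nonzero. They are
    enumerated by e, where repetitions would do no harm to a generating family.\<close>
  define S where "S = (SIGMA x:X. {\<gamma>. ?c \<gamma> x \<noteq> \<one>\<^bsub>P\<^esub>})"
  have "finite S"
    using X P.MG.gcomp_finite by (auto simp: S_def)
  then obtain n :: nat and e where e: "S = e ` {i. i < n}"
    using finite_imp_nat_seg_image_inj_on by metis
  define y d where "y i = ?c (snd (e i)) (fst (e i))" and "d i = snd (e i)" for i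
  have eX: "fst (e i) \<in> X" if "i < n" for i
  proof -
    have "e i \<in> S" using that e by simp
    then show ?thesis by (auto simp: S_def)
  qed
  have y: "y i \<in> mgrade P (d i)" if "i < n" for i
    using eX[OF that] X P.MG.gcomp_in by (auto simp: y_def d_def)
  define Fr where "Fr i = shift (- d i) (regular_module R)" for i
  have Fr: "gr_module R (Fr i)" for i
    unfolding Fr_def by (intro gr_module_shift gr_module_regular P.R.gr_ring_axioms)
  let ?F = "dsum {..<n} Fr"
  have F: "gr_module R ?F"
    by (rule gr_module_dsum[OF P.R.gr_ring_axioms]) (auto simp: Fr)
  interpret F: gr_module R ?F by fact
  define p where "p r = finprod P (\<lambda>i. y i \<star>\<^bsub>P\<^esub> r i) {..<n}" for r
  have p: "p \<in> gr_module_hom R ?F P"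
    unfolding p_def
  proof (rule gmh_sum[OF F P])
    fix i assume "i \<in> {..<n}"
    then show "(\<lambda>r. y i \<star>\<^bsub>P\<^esub> r i) \<in> gr_module_hom R ?F P"
      using gmh_comp[OF gmh_dproj[of i "{..<n}" R Fr] gmh_ract_right[OF P y, of i, folded Fr_def]] by simp
  qed
  interpret ph: group_hom ?F P p
    by unfold_locales (rule gmh_hom[OF p])
  have img: "subgroup (p ` carrier ?F) P"
    by (rule ph.img_is_subgroup)
  have yp: "y i \<star>\<^bsub>P\<^esub> r \<in> p ` carrier ?F" if i: "i < n" and r: "r \<in> carrier R" for i r
  proof
    let ?r = "\<lambda>j\<in>{..<n}. if j = i then r else \<one>\<^bsub>Fr j\<^esub>"
    show rF: "?r \<in> carrier ?F"
      using gmh_closed[OF gmh_dinj[where R=R and I="{..<n}" and i=i and M=Fr], of r] i r Fr by (simp add: Fr_def)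
    have yc: "y j \<in> carrier P" if "j < n" for j
      using y[OF that] by (rule P.MG.D_carrier)
    have "p ?r = finprod P (\<lambda>j. if i = j then y j \<star>\<^bsub>P\<^esub> r else \<one>\<^bsub>P\<^esub>) {..<n}"
      unfolding p_def using yc r by (intro P.M.finprod_cong') (auto simp: Fr_def P.ract_zero P.ract_closed)
    also have "\<dots> = y i \<star>\<^bsub>P\<^esub> r"
      using i yc r by (intro P.M.finprod_singleton) (auto simp: P.ract_closed)
    finally show "y i \<star>\<^bsub>P\<^esub> r = p ?r" ..
  qed
  have gp: "x \<star>\<^bsub>P\<^esub> r \<in> p ` carrier ?F" if x: "x \<in> X" and r: "r \<in> carrier R" for x r
  proof -
    let ?G = "{\<gamma>. ?c \<gamma> x \<noteq> \<one>\<^bsub>P\<^esub>}"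
    have xc: "x \<in> carrier P" using x X by auto
    have "x \<star>\<^bsub>P\<^esub> r = finprod P (\<lambda>\<gamma>. ?c \<gamma> x) ?G \<star>\<^bsub>P\<^esub> r"
      by (subst P.MG.gcomp_sum) (auto simp: xc P.MG.gcomp_finite)
    also have "\<dots> = finprod P (\<lambda>\<gamma>. ?c \<gamma> x \<star>\<^bsub>P\<^esub> r) ?G"
      using r xc by (intro P.finprod_ract) (auto simp: P.MG.gcomp_carrier)
    also have "\<dots> \<in> p ` carrier ?F"
    proof (rule P.M.subgroup_finprod[OF P.M.comm_group_axioms img])
      fix \<gamma> assume "\<gamma> \<in> ?G"
      then have "(x, \<gamma>) \<in> S" using x by (simp add: S_def)
      then obtain i where "i < n" "e i = (x, \<gamma>)" unfolding e by auto
      then show "?c \<gamma> x \<star>\<^bsub>P\<^esub> r \<in> p ` carrier ?F"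
        using yp[of i r] r by (simp add: y_def)
    qed
    finally show ?thesis .
  qed
  have "carrier P \<subseteq> p ` carrier ?F"
    unfolding gen[symmetric]
    by (rule P.M.generate_subgroup_incl[OF _ img]) (use gp in auto)
  then have surj: "p ` carrier ?F = carrier P"
    using gmh_closed[OF p] by blast
  obtain h where h: "h \<in> gr_module_hom R P ?F" and ph: "\<And>m. m \<in> carrier P \<Longrightarrow> p (h m) = m"
    using proj[unfolded gr_projective_def, rule_format, of p ?F P "\<lambda>m. m"] p gmh_id F P surj by blast
  have "dual_basis R P {..<n} y d (\<lambda>i m. h m i)"
    unfolding dual_basis_def
  proof (intro conjI ballI)
    show "m = finprod P (\<lambda>i. y i \<star>\<^bsub>P\<^esub> h m i) {..<n}" if "m \<in> carrier P" for m
      using ph[OF that] by (simp add: p_def)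
    show "(\<lambda>m. h m i) \<in> gr_module_hom R P (shift (- d i) (regular_module R))" if "i \<in> {..<n}" for i
      using gmh_comp[OF h gmh_dproj[OF that]] by (simp add: Fr_def)
  qed (use y in auto)
  then show ?thesis
    using P by (auto simp: fgproj_def)
qed

text \<open>To lift k along a surjection g, preimages of the elements k (x i) are wanted in degree d
  i: since g commutes with taking components, the component of degree d i of any preimage serves.
  With such z i, the lift sends m to the sum of the z i times f i m.\<close>

lemma fgproj_imp_gr_fgp:
  fixes P :: "('g::ab_group_add, 'r) tuple_module"
  assumes "fgproj R P"
  shows "P \<in> gr_fgp R"
proof -
  obtain n x d f where B: "dual_basis R P {..<n::nat} x d f" and P: "gr_module R P"
    using assms by (auto simp: fgproj_def)
  interpret P: gr_module R P by fact
  note F = dual_basis_facts[OF B P]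
  have "fin_generated R P"
    unfolding fin_generated_def
  proof (intro exI conjI)
    let ?G = "{y \<star>\<^bsub>P\<^esub> r | y r. y \<in> x ` {..<n} \<and> r \<in> carrier R}"
    have G: "?G \<subseteq> carrier P" using F by (auto simp: P.ract_closed)
    show "generate P ?G = carrier P"
    proof
      show "generate P ?G \<subseteq> carrier P"
        by (rule P.M.generate_incl[OF G])
      show "carrier P \<subseteq> generate P ?G"
      proof
        fix m assume m: "m \<in> carrier P"
        have "finprod P (\<lambda>i. x i \<star>\<^bsub>P\<^esub> f i m) {..<n} \<in> generate P ?G"
          by (rule P.M.subgroup_finprod[OF P.M.comm_group_axioms P.M.generate_is_subgroup[OF G]])
            (use F(1,2) m in \<open>blast intro: generate.incl\<close>)
        then show "m \<in> generate P ?G"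
          by (simp add: dual_basisD(4)[OF B m])
      qed
    qed
  qed (use F in auto)
  moreover have "gr_projective R P"
    unfolding gr_projective_def
  proof (intro allI ballI impI, elim conjE)
    fix M N :: "('g, 'r) tuple_module" and g k
    assume g: "g \<in> gr_module_hom R M N" and k: "k \<in> gr_module_hom R P N"
      and M: "gr_module R M" and N: "gr_module R N" and surj: "g ` carrier M = carrier N"
    interpret M: gr_module R M by fact
    interpret N: gr_module R N by fact
    have "\<exists>z. z \<in> mgrade M (d i) \<and> g z = k (x i)" if i: "i < n" for i
    proof -
      have kx: "k (x i) \<in> mgrade N (d i)"
        using gmh_grade[OF k dual_basisD(2)[OF B]] i by simp
      then obtain m where m: "m \<in> carrier M" "g m = k (x i)"
        using surj N.MG.D_carrier[OF kx] by (metis imageE)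
      have "g (gcomp M (mgrade M) (d i) m) = k (x i)"
        using gmh_gcomp[OF M N g m(1), of "d i"] m(2) N.MG.gcomp_homogeneous[OF kx, of "d i"] by simp
      then show ?thesis
        using M.MG.gcomp_in[OF m(1)] by blast
    qed
    then obtain z where z: "\<And>i. i < n \<Longrightarrow> z i \<in> mgrade M (d i)" "\<And>i. i < n \<Longrightarrow> g (z i) = k (x i)"
      by metis
    have zc: "z i \<in> carrier M" if "i < n" for i
      using z(1)[OF that] by (rule M.MG.D_carrier)
    define h where "h m = finprod M (\<lambda>i. z i \<star>\<^bsub>M\<^esub> f i m) {..<n}" for m
    have "h \<in> gr_module_hom R P M"
      unfolding h_def
      by (rule gmh_sum[OF P M], rule gmh_comp[OF dual_basisD(3)[OF B]]) (use gmh_ract_right[OF M z(1)] in auto)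
    moreover have "g (h m) = k m" if m: "m \<in> carrier P" for m
    proof -
      have "g (h m) = finprod N (\<lambda>i. g (z i \<star>\<^bsub>M\<^esub> f i m)) {..<n}"
        unfolding h_def by (rule gmh_finprod[OF g M N]) (use F m zc in \<open>auto simp: M.ract_closed\<close>)
      also have "\<dots> = finprod N (\<lambda>i. k (x i \<star>\<^bsub>P\<^esub> f i m)) {..<n}"
        using m by (intro N.M.finprod_cong')
          (auto simp: gmh_ract[OF g] gmh_ract[OF k] gmh_closed[OF k] zc F z(2) N.ract_closed)
      also have "\<dots> = k (finprod P (\<lambda>i. x i \<star>\<^bsub>P\<^esub> f i m) {..<n})"
        by (rule gmh_finprod[OF k P N, symmetric]) (use F m in \<open>auto simp: P.ract_closed\<close>)
      finally show ?thesis by (simp add: dual_basisD(4)[OF B m])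
    qed
    ultimately show "\<exists>h\<in>gr_module_hom R P M. \<forall>p\<in>carrier P. g (h p) = k p" by blast
  qed
  ultimately show ?thesis
    using P by (simp add: gr_fgp_def)
qed

lemma gr_fgp_iff: "P \<in> gr_fgp R \<longleftrightarrow> fgproj R P"
  using gr_fgp_imp_fgproj fgproj_imp_gr_fgp by blast

section \<open>The monoid of isomorphism classes\<close>

lemma iso_class_iff: "P \<in> iso_class R M \<longleftrightarrow> fgproj R P \<and> gr_isomorphic R M P"
  by (simp add: iso_class_def gr_fgp_iff)

lemma iso_class_cong:
  assumes "gr_isomorphic R M N" "gr_module R M" "gr_module R N"
  shows "iso_class R M = iso_class R N"
  using gr_isomorphic_trans[OF assms(1)] gr_isomorphic_trans[OF gr_isomorphic_sym[OF assms]]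
  by (auto simp: iso_class_iff)

lemma iso_class_nonempty: "fgproj R M \<Longrightarrow> \<exists>P. P \<in> iso_class R M"
  using fgproj_tuple by (auto simp: iso_class_iff)

lemma iso_classD:
  assumes "P \<in> iso_class R M" "gr_module R M"
  shows "fgproj R P" "gr_module R P" "gr_isomorphic R M P" "iso_class R P = iso_class R M"
  using assms iso_class_cong[of R M P] by (auto simp: iso_class_iff fgproj_module)

text \<open>Classes consist of tuple modules, so a module over another type does not belong to its
  own class. From equal classes an isomorphism is obtained through a common representative, which
  exists by \<open>fgproj_tuple\<close>.\<close>

lemma iso_class_eq_iff:
  assumes "fgproj R M" "fgproj R N"
  shows "iso_class R M = iso_class R N \<longleftrightarrow> gr_isomorphic R M N"
proof
  assume e: "iso_class R M = iso_class R N"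
  obtain P where P: "P \<in> iso_class R M" using iso_class_nonempty[OF assms(1)] by blast
  then have P': "P \<in> iso_class R N" using e by simp
  show "gr_isomorphic R M N"
    using iso_classD[OF P fgproj_module[OF assms(1)]] iso_classD[OF P' fgproj_module[OF assms(2)]]
      gr_isomorphic_trans gr_isomorphic_sym fgproj_module assms by metis
qed (rule iso_class_cong[OF _ fgproj_module[OF assms(1)] fgproj_module[OF assms(2)]])

lemma V_carrier:
  assumes "fgproj R M"
  shows "iso_class R M \<in> carrier (V_gr R)"
proof -
  obtain P where P: "P \<in> iso_class R M"
    using iso_class_nonempty[OF assms] by blast
  note P = iso_classD[OF P fgproj_module[OF assms]]
  have "iso_class R P \<in> carrier (V_gr R)"
    using P(1) by (simp add: V_gr_def gr_fgp_iff)
  then show ?thesis by (simp add: P(4))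
qed

lemma V_carrierE:
  assumes "X \<in> carrier (V_gr R)"
  obtains P where "fgproj R P" "X = iso_class R P" "P \<in> gr_fgp R"
  using assms by (auto simp: V_gr_def gr_fgp_iff)

lemma V_one: "\<one>\<^bsub>V_gr R\<^esub> = iso_class R zero_module"
  by (simp add: V_gr_def)

text \<open>The union over representatives collapses: all its members are equal, and it is not empty
  because each class has a tuple module as representative. The same reason recurs for
  \<open>V_shift\<close> and \<open>V_map\<close>.\<close>

lemma V_mult:
  assumes M: "fgproj R M" and N: "fgproj R N"
  shows "iso_class R M \<otimes>\<^bsub>V_gr R\<^esub> iso_class R N = iso_class R (direct_sum M N)"
proof -
  have e: "iso_class R (direct_sum P Q) = iso_class R (direct_sum M N)"
    if "P \<in> iso_class R M" "Q \<in> iso_class R N" for P Q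
  proof -
    note P = iso_classD[OF that(1) fgproj_module[OF M]] and Q = iso_classD[OF that(2) fgproj_module[OF N]]
    show ?thesis
      by (rule iso_class_cong[symmetric, OF gr_isomorphic_direct_sum[OF P(3) Q(3)]])
        (intro gr_module_direct_sum fgproj_module M N P Q)+
  qed
  obtain P Q where "P \<in> iso_class R M" "Q \<in> iso_class R N"
    using iso_class_nonempty[OF M] iso_class_nonempty[OF N] by blast
  then show ?thesis
    using e by (auto simp: V_gr_def)
qed

lemma comm_monoid_V:
  assumes "gr_ring R"
  shows "comm_monoid (V_gr R)"
proof (rule comm_monoidI)
  note z = fgproj_zero[OF assms]
  show "\<one>\<^bsub>V_gr R\<^esub> \<in> carrier (V_gr R)"
    by (simp add: V_one V_carrier z)
  fix X Y assume "X \<in> carrier (V_gr R)" "Y \<in> carrier (V_gr R)"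
  then obtain P Q where P: "fgproj R P" "X = iso_class R P" "P \<in> gr_fgp R"
    and Q: "fgproj R Q" "Y = iso_class R Q" "Q \<in> gr_fgp R"
    by (elim V_carrierE)
  show "X \<otimes>\<^bsub>V_gr R\<^esub> Y \<in> carrier (V_gr R)"
    by (simp add: P Q V_mult V_carrier fgproj_direct_sum)
  show "X \<otimes>\<^bsub>V_gr R\<^esub> Y = Y \<otimes>\<^bsub>V_gr R\<^esub> X"
    using iso_class_cong[OF direct_sum_comm[of R P Q]] P Q
    by (simp add: V_mult fgproj_module gr_module_direct_sum)
  have "iso_class R P \<otimes>\<^bsub>V_gr R\<^esub> iso_class R zero_module = iso_class R P"
    using iso_class_cong[OF direct_sum_zero[of R P]] P z
    by (simp add: V_mult fgproj_module gr_module_direct_sum)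
  moreover have "iso_class R P \<otimes>\<^bsub>V_gr R\<^esub> iso_class R zero_module = iso_class R zero_module \<otimes>\<^bsub>V_gr R\<^esub> iso_class R P"
    using iso_class_cong[OF direct_sum_comm[of R P zero_module]] P z
    by (simp add: V_mult fgproj_module gr_module_direct_sum)
  ultimately show "\<one>\<^bsub>V_gr R\<^esub> \<otimes>\<^bsub>V_gr R\<^esub> X = X"
    by (simp add: V_one P)
  fix Z assume "Z \<in> carrier (V_gr R)"
  then obtain W where W: "fgproj R W" "Z = iso_class R W" "W \<in> gr_fgp R"
    by (elim V_carrierE)
  show "X \<otimes>\<^bsub>V_gr R\<^esub> Y \<otimes>\<^bsub>V_gr R\<^esub> Z = X \<otimes>\<^bsub>V_gr R\<^esub> (Y \<otimes>\<^bsub>V_gr R\<^esub> Z)"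
    using iso_class_cong[OF direct_sum_assoc[of R P Q W]] P Q W
    by (simp add: V_mult fgproj_module gr_module_direct_sum fgproj_direct_sum)
qed

lemma V_dsum:
  assumes "gr_ring R" "finite I" "\<And>i. i \<in> I \<Longrightarrow> fgproj R (M i)"
  shows "iso_class R (dsum I M) = finprod (V_gr R) (\<lambda>i. iso_class R (M i)) I"
proof -
  interpret V: comm_monoid "V_gr R" by (rule comm_monoid_V) fact
  show ?thesis
    using assms(2,3)
  proof (induction I)
    case empty
    have "gr_module R (dsum {} M)"
      by (rule gr_module_dsum[OF assms(1)]) auto
    then show ?case
      using iso_class_cong[OF dsum_empty _ gr_module_zero[OF assms(1)], of M]
      by (simp add: V_one)
  next
    case (insert i I)
    have f: "fgproj R (dsum I M)" "fgproj R (dsum (insert i I) M)" "fgproj R (M i)"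
      using insert assms(1) by (auto intro!: fgproj_dsum)
    have "iso_class R (dsum (insert i I) M) = iso_class R (M i) \<otimes>\<^bsub>V_gr R\<^esub> iso_class R (dsum I M)"
      using iso_class_cong[OF dsum_insert[OF insert.hyps(2), of R M]] f
      by (simp add: V_mult fgproj_module gr_module_direct_sum)
    also have "\<dots> = finprod (V_gr R) (\<lambda>i. iso_class R (M i)) (insert i I)"
      using insert by (subst V.finprod_insert) (auto intro: V_carrier)
    finally show ?case .
  qed
qed

lemma V_shift_class:
  assumes "fgproj R M"
  shows "V_shift R \<alpha> (iso_class R M) = iso_class R (shift \<alpha> M)"
proof -
  have "iso_class R (shift \<alpha> P) = iso_class R (shift \<alpha> M)" if "P \<in> iso_class R M" for P
    using iso_classD[OF that fgproj_module[OF assms]] assms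
    by (intro iso_class_cong[symmetric] gr_isomorphic_shift gr_module_shift fgproj_module)
  then show ?thesis
    using iso_class_nonempty[OF assms] by (auto simp: V_shift_def)
qed

section \<open>Change of rings for projective modules\<close>

section \<open>Extension of scalars\<close>

text \<open>Scalars from the graded field are left out on purpose: K0 and its functoriality concern
  rings only. Linearity returns where homomorphisms are compared or recovered through matrix
  units.\<close>

locale gr_hom = R: gr_ring R + S: gr_ring S
  for R :: "('g::ab_group_add, 'r, 'x) gring_scheme" and S :: "('g, 's, 'y) gring_scheme" and \<phi> :: "'r \<Rightarrow> 's" +
  assumes ring_hom: "\<phi> \<in> ring_hom R S" and hom_grade: "r \<in> grade R \<gamma> \<Longrightarrow> \<phi> r \<in> grade S \<gamma>"
begin

lemma \<phi>_closed: "r \<in> carrier R \<Longrightarrow> \<phi> r \<in> carrier S"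
  and \<phi>_add: "\<lbrakk>r \<in> carrier R; s \<in> carrier R\<rbrakk> \<Longrightarrow> \<phi> (r \<oplus>\<^bsub>R\<^esub> s) = \<phi> r \<oplus>\<^bsub>S\<^esub> \<phi> s"
  and \<phi>_mult: "\<lbrakk>r \<in> carrier R; s \<in> carrier R\<rbrakk> \<Longrightarrow> \<phi> (r \<otimes>\<^bsub>R\<^esub> s) = \<phi> r \<otimes>\<^bsub>S\<^esub> \<phi> s"
  and \<phi>_one: "\<phi> \<one>\<^bsub>R\<^esub> = \<one>\<^bsub>S\<^esub>"
  using ring_hom by (auto simp: ring_hom_def)

lemma \<phi>_hom: "\<phi> \<in> hom (add_monoid R) (add_monoid S)"
  by (auto simp: hom_def \<phi>_closed \<phi>_add)

lemma \<phi>_finsum: "f \<in> I \<rightarrow> carrier R \<Longrightarrow> \<phi> (finsum R f I) = finsum S (\<lambda>i. \<phi> (f i)) I"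
  using hom_finprod[OF R.a_comm_group S.a_comm_group \<phi>_hom, of f I] by (simp add: finsum_def)

end

lemma gr_hom_comp:
  assumes "gr_hom R S \<phi>" "gr_hom S T \<psi>"
  shows "gr_hom R T (\<lambda>r. \<psi> (\<phi> r))"
proof -
  interpret a: gr_hom R S \<phi> by fact
  interpret b: gr_hom S T \<psi> by fact
  have "(\<lambda>r. \<psi> (\<phi> r)) \<in> ring_hom R T"
    using ring_hom_trans[OF a.ring_hom b.ring_hom] by (simp add: comp_def)
  then show ?thesis
    by unfold_locales (auto simp: a.hom_grade b.hom_grade)
qed

lemma gr_hom_id: "gr_ring R \<Longrightarrow> gr_hom R R (\<lambda>r. r)"
  by (auto simp: gr_hom_def gr_hom_axioms_def ring_hom_def)

text \<open>Degree-preserving maps over a change of rings. For the identity of R these are the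
  graded homomorphisms, by \<open>semilinear_id\<close>, so one composition lemma serves
  both.\<close>

definition semilinear ::
  "('g, 'r, 'x) gring_scheme \<Rightarrow> ('r \<Rightarrow> 's) \<Rightarrow> ('g, 'r, 'm) gmodule \<Rightarrow> ('g, 's, 'n) gmodule \<Rightarrow> ('m \<Rightarrow> 'n) set" where
  "semilinear R \<phi> P Q = {u \<in> hom P Q.
     (\<forall>p\<in>carrier P. \<forall>r\<in>carrier R. u (p \<star>\<^bsub>P\<^esub> r) = u p \<star>\<^bsub>Q\<^esub> \<phi> r) \<and> (\<forall>\<gamma>. \<forall>p\<in>mgrade P \<gamma>. u p \<in> mgrade Q \<gamma>)}"

lemma semilinearI:
  assumes "\<And>p. p \<in> carrier P \<Longrightarrow> u p \<in> carrier Q"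
    and "\<And>p q. \<lbrakk>p \<in> carrier P; q \<in> carrier P\<rbrakk> \<Longrightarrow> u (p \<otimes>\<^bsub>P\<^esub> q) = u p \<otimes>\<^bsub>Q\<^esub> u q"
    and "\<And>p r. \<lbrakk>p \<in> carrier P; r \<in> carrier R\<rbrakk> \<Longrightarrow> u (p \<star>\<^bsub>P\<^esub> r) = u p \<star>\<^bsub>Q\<^esub> \<phi> r"
    and "\<And>p \<gamma>. p \<in> mgrade P \<gamma> \<Longrightarrow> u p \<in> mgrade Q \<gamma>"
  shows "u \<in> semilinear R \<phi> P Q"
  using assms by (auto simp: semilinear_def hom_def)

lemma
  assumes "u \<in> semilinear R \<phi> P Q"
  shows semilinear_hom: "u \<in> hom P Q"
    and semilinear_closed: "p \<in> carrier P \<Longrightarrow> u p \<in> carrier Q"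
    and semilinear_mult: "\<lbrakk>p \<in> carrier P; q \<in> carrier P\<rbrakk> \<Longrightarrow> u (p \<otimes>\<^bsub>P\<^esub> q) = u p \<otimes>\<^bsub>Q\<^esub> u q"
    and semilinear_ract: "\<lbrakk>p \<in> carrier P; r \<in> carrier R\<rbrakk> \<Longrightarrow> u (p \<star>\<^bsub>P\<^esub> r) = u p \<star>\<^bsub>Q\<^esub> \<phi> r"
    and semilinear_grade: "p \<in> mgrade P \<gamma> \<Longrightarrow> u p \<in> mgrade Q \<gamma>"
  using assms by (auto simp: semilinear_def hom_def)

lemma semilinear_id: "semilinear R (\<lambda>r. r) P Q = gr_module_hom R P Q"
  by (auto simp: semilinear_def gr_module_hom_def image_subset_iff)

lemma semilinear_comp:
  "\<lbrakk>u \<in> semilinear R \<phi> P Q; v \<in> semilinear S \<psi> Q W; \<And>r. r \<in> carrier R \<Longrightarrow> \<phi> r \<in> carrier S\<rbrakk>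
    \<Longrightarrow> (\<lambda>p. v (u p)) \<in> semilinear R (\<lambda>r. \<psi> (\<phi> r)) P W"
  by (rule semilinearI) (simp_all add: semilinear_closed semilinear_mult semilinear_ract semilinear_grade)

lemma semilinear_comp_hom:
  assumes "u \<in> semilinear R \<phi> P Q" "v \<in> gr_module_hom S Q W" "\<And>r. r \<in> carrier R \<Longrightarrow> \<phi> r \<in> carrier S"
  shows "(\<lambda>p. v (u p)) \<in> semilinear R \<phi> P W"
  using semilinear_comp[OF assms(1) assms(2)[folded semilinear_id] assms(3)] by simp

text \<open>
  A semilinear map exhibits its codomain as the extension of scalars of its domain if some dual basis
  of the domain is carried over to a dual basis of the codomain. This replaces the universal property,
  which would quantify over modules of all types.
\<close>

definition ext_scalars ::
  "('g::ab_group_add, 'r, 'x) gring_scheme \<Rightarrow> ('g, 's, 'y) gring_scheme \<Rightarrow> ('r \<Rightarrow> 's)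
    \<Rightarrow> ('g, 'r, 'm) gmodule \<Rightarrow> ('g, 's, 'n) gmodule \<Rightarrow> ('m \<Rightarrow> 'n) \<Rightarrow> bool" where
  "ext_scalars R S \<phi> P Q u \<longleftrightarrow> gr_module R P \<and> gr_module S Q \<and> u \<in> semilinear R \<phi> P Q \<and>
    (\<exists>(n::nat) x d f g. dual_basis R P {..<n} x d f \<and> dual_basis S Q {..<n} (\<lambda>i. u (x i)) d g \<and>
      (\<forall>i<n. \<forall>p\<in>carrier P. g i (u p) = \<phi> (f i p)))"

lemma ext_scalarsD:
  assumes "ext_scalars R S \<phi> P Q u"
  shows "gr_module R P" "gr_module S Q" "u \<in> semilinear R \<phi> P Q" "fgproj R P" "fgproj S Q"
  using assms by (auto simp: ext_scalars_def fgproj_def)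

lemma dual_basis_cong:
  assumes "dual_basis R M I x d f" "gr_module R M" "\<And>i. i \<in> I \<Longrightarrow> x' i = x i"
  shows "dual_basis R M I x' d f"
  unfolding dual_basis_def
proof (intro conjI ballI)
  interpret gr_module R M by fact
  show "m = finprod M (\<lambda>i. x' i \<star>\<^bsub>M\<^esub> f i m) I" if "m \<in> carrier M" for m
  proof -
    have "finprod M (\<lambda>i. x' i \<star>\<^bsub>M\<^esub> f i m) I = finprod M (\<lambda>i. x i \<star>\<^bsub>M\<^esub> f i m) I"
      using assms(3) dual_basis_facts[OF assms(1,2)] that by (intro M.finprod_cong') (auto simp: ract_closed)
    then show ?thesis using dual_basisD(4)[OF assms(1) that] by simp
  qed
qed (use assms(3) dual_basisD[OF assms(1)] in auto)

lemma gmh_mult_left: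
  assumes "gr_ring S" "a \<in> grade S (d - c)"
  shows "(\<lambda>s. a \<otimes>\<^bsub>S\<^esub> s) \<in> gr_module_hom S (shift (- d) (regular_module S)) (shift (- c) (regular_module S))"
proof -
  interpret gr_ring S by fact
  have a: "a \<in> carrier S" using assms(2) by (rule grade_carrier)
  show ?thesis
  proof (rule gr_module_homI)
    fix s \<gamma> assume "s \<in> mgrade (shift (- d) (regular_module S)) \<gamma>"
    then show "a \<otimes>\<^bsub>S\<^esub> s \<in> mgrade (shift (- c) (regular_module S)) \<gamma>"
      using grade_mult[OF assms(2), of s "- d + \<gamma>"] by (simp add: algebra_simps)
  qed (auto simp: a r_distr m_assoc)
qed

context gr_hom
begin

text \<open>The elements u (x i) generate Q over S, so a homomorphism out of Q is determined by its
  values on the image of u.\<close>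

lemma ext_scalars_hom_eq:
  assumes E: "ext_scalars R S \<phi> P Q u" and N: "gr_module S N"
    and f: "f \<in> gr_module_hom S Q N" and g: "g \<in> gr_module_hom S Q N"
    and eq: "\<And>p. p \<in> carrier P \<Longrightarrow> f (u p) = g (u p)" and q: "q \<in> carrier Q"
  shows "f q = g q"
proof -
  obtain n x d h k where B: "dual_basis R P {..<n::nat} x d h" and C: "dual_basis S Q {..<n} (\<lambda>i. u (x i)) d k"
    using E by (auto simp: ext_scalars_def)
  note E' = ext_scalarsD[OF E]
  interpret Q: gr_module S Q by (rule E')
  interpret N: gr_module S N by fact
  note F = dual_basis_facts[OF B E'(1)] dual_basis_facts[OF C E'(2)]
  have "f' q = finprod N (\<lambda>i. f' (u (x i)) \<star>\<^bsub>N\<^esub> k i q) {..<n}" if f': "f' \<in> gr_module_hom S Q N" for f'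
  proof -
    have "f' (finprod Q (\<lambda>i. u (x i) \<star>\<^bsub>Q\<^esub> k i q) {..<n}) = finprod N (\<lambda>i. f' (u (x i) \<star>\<^bsub>Q\<^esub> k i q)) {..<n}"
      by (rule gmh_finprod[OF f' E'(2) N]) (use F q in \<open>auto simp: Q.ract_closed\<close>)
    also have "\<dots> = finprod N (\<lambda>i. f' (u (x i)) \<star>\<^bsub>N\<^esub> k i q) {..<n}"
      by (rule N.M.finprod_cong') (use F q in \<open>auto simp: gmh_ract[OF f'] N.ract_closed gmh_closed[OF f']\<close>)
    finally show ?thesis by (simp add: dual_basisD(4)[OF C q])
  qed
  note this[OF f] this[OF g]
  moreover have "finprod N (\<lambda>i. f (u (x i)) \<star>\<^bsub>N\<^esub> k i q) {..<n} = finprod N (\<lambda>i. g (u (x i)) \<star>\<^bsub>N\<^esub> k i q) {..<n}"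
    by (rule N.M.finprod_cong') (use F q in \<open>auto simp: eq N.ract_closed gmh_closed[OF g]\<close>)
  ultimately show ?thesis by simp
qed

text \<open>Explicitly, w q is the sum of the v (x i) times g i q. On u p the coefficient g i (u p)
  is \<phi> (f i p), and semilinearity turns the sum into v applied to the expansion of p. The
  target may have any type, since this is a theorem and not part of a definition.\<close>

lemma ext_scalars_universal:
  assumes E: "ext_scalars R S \<phi> P Q u" and N: "gr_module S N" and v: "v \<in> semilinear R \<phi> P N"
  obtains w where "w \<in> gr_module_hom S Q N" "\<And>p. p \<in> carrier P \<Longrightarrow> w (u p) = v p"
proof -
  obtain n x d f g where B: "dual_basis R P {..<n::nat} x d f" and C: "dual_basis S Q {..<n} (\<lambda>i. u (x i)) d g"
    and gu: "\<forall>i<n. \<forall>p\<in>carrier P. g i (u p) = \<phi> (f i p)"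
    using E by (auto simp: ext_scalars_def)
  note E' = ext_scalarsD[OF E]
  interpret P: gr_module R P by (rule E')
  interpret Q: gr_module S Q by (rule E')
  interpret N: gr_module S N by fact
  note F = dual_basis_facts[OF B E'(1)] dual_basis_facts[OF C E'(2)]
  let ?w = "\<lambda>q. finprod N (\<lambda>i. v (x i) \<star>\<^bsub>N\<^esub> g i q) {..<n}"
  have "?w \<in> gr_module_hom S Q N"
    by (rule gmh_sum[OF E'(2) N], rule gmh_comp[OF dual_basisD(3)[OF C]])
      (use gmh_ract_right[OF N semilinear_grade[OF v dual_basisD(2)[OF B]]] in auto)
  moreover have "?w (u p) = v p" if p: "p \<in> carrier P" for p
  proof -
    have "?w (u p) = finprod N (\<lambda>i. v (x i \<star>\<^bsub>P\<^esub> f i p)) {..<n}"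
      by (rule N.M.finprod_cong')
        (use F p gu in \<open>auto simp: semilinear_ract[OF v] N.ract_closed semilinear_closed[OF v] \<phi>_closed\<close>)
    also have "\<dots> = v (finprod P (\<lambda>i. x i \<star>\<^bsub>P\<^esub> f i p) {..<n})"
      by (rule hom_finprod[OF P.M.comm_group_axioms N.M.comm_group_axioms semilinear_hom[OF v], symmetric])
        (use F p in \<open>auto simp: P.ract_closed\<close>)
    finally show ?thesis by (simp add: dual_basisD(4)[OF B p])
  qed
  ultimately show ?thesis using that by blast
qed

lemma ext_scalars_unique:
  assumes E: "ext_scalars R S \<phi> P Q u" and E2: "ext_scalars R S \<phi> P Q' u'"
  shows "gr_isomorphic S Q Q'"
proof -
  note D = ext_scalarsD[OF E] and D2 = ext_scalarsD[OF E2]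
  obtain w where w: "w \<in> gr_module_hom S Q Q'" "\<And>p. p \<in> carrier P \<Longrightarrow> w (u p) = u' p"
    using ext_scalars_universal[OF E D2(2,3)] by blast
  obtain w' where w': "w' \<in> gr_module_hom S Q' Q" "\<And>p. p \<in> carrier P \<Longrightarrow> w' (u' p) = u p"
    using ext_scalars_universal[OF E2 D(2,3)] by blast
  show ?thesis
  proof (rule gr_isomorphicI2[OF w(1) w'(1)])
    show "w' (w q) = q" if "q \<in> carrier Q" for q
      by (rule ext_scalars_hom_eq[OF E D(2) gmh_comp[OF w(1) w'(1)] gmh_id _ that]) (simp add: w w')
    show "w (w' q) = q" if "q \<in> carrier Q'" for q
      by (rule ext_scalars_hom_eq[OF E2 D2(2) gmh_comp[OF w'(1) w(1)] gmh_id _ that]) (simp add: w w')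
  qed
qed

text \<open>The definition of \<open>ext_scalars\<close> provides one particular dual basis of P
  that is carried over; this extends it to all of them. The functionals come from the universal
  property applied to \<phi> after h j, and the dual basis identity on Q is an equality of
  homomorphisms, hence needs checking on the image of u only.\<close>

lemma ext_scalars_dual_basis:
  assumes E: "ext_scalars R S \<phi> P Q u" and Y: "dual_basis R P J y c h"
  obtains k where "dual_basis S Q J (\<lambda>j. u (y j)) c k" "\<And>j p. \<lbrakk>j \<in> J; p \<in> carrier P\<rbrakk> \<Longrightarrow> k j (u p) = \<phi> (h j p)"
proof -
  note E' = ext_scalarsD[OF E]
  interpret P: gr_module R P by (rule E')
  interpret Q: gr_module S Q by (rule E')
  note F = dual_basis_facts[OF Y E'(1)]
  have "\<exists>w. w \<in> gr_module_hom S Q (shift (- c j) (regular_module S)) \<and> (\<forall>p\<in>carrier P. w (u p) = \<phi> (h j p))"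
    if j: "j \<in> J" for j
  proof -
    have v: "(\<lambda>p. \<phi> (h j p)) \<in> semilinear R \<phi> P (shift (- c j) (regular_module S))"
    proof (rule semilinearI)
      show "\<phi> (h j p) \<in> mgrade (shift (- c j) (regular_module S)) \<gamma>" if "p \<in> mgrade P \<gamma>" for p \<gamma>
        using hom_grade[OF F(5)[OF j that]] by simp
    qed (auto simp: F(2-4)[OF j] \<phi>_closed \<phi>_add \<phi>_mult)
    show ?thesis
    proof (rule ext_scalars_universal[OF E gr_module_shift[OF gr_module_regular[OF S.gr_ring_axioms]] v])
      fix w assume "w \<in> gr_module_hom S Q (shift (- c j) (regular_module S))"
        "\<And>p. p \<in> carrier P \<Longrightarrow> w (u p) = \<phi> (h j p)"
      then show ?thesis by auto
    qed
  qed
  then obtain k where k: "\<And>j. j \<in> J \<Longrightarrow> k j \<in> gr_module_hom S Q (shift (- c j) (regular_module S))"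
    and ku: "\<And>j p. \<lbrakk>j \<in> J; p \<in> carrier P\<rbrakk> \<Longrightarrow> k j (u p) = \<phi> (h j p)"
    by metis
  let ?T = "\<lambda>q. finprod Q (\<lambda>j. u (y j) \<star>\<^bsub>Q\<^esub> k j q) J"
  have uy: "u (y j) \<in> mgrade Q (c j)" if "j \<in> J" for j
    using semilinear_grade[OF E'(3) dual_basisD(2)[OF Y that]] .
  have T: "?T \<in> gr_module_hom S Q Q"
    by (rule gmh_sum[OF E'(2) E'(2)], rule gmh_comp[OF k]) (use gmh_ract_right[OF E'(2) uy] in auto)
  have "dual_basis S Q J (\<lambda>j. u (y j)) c k"
    unfolding dual_basis_def
  proof (intro conjI ballI)
    show "q = ?T q" if q: "q \<in> carrier Q" for q
    proof (rule ext_scalars_hom_eq[OF E E'(2) gmh_id T _ q])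
      fix p assume p: "p \<in> carrier P"
      have "?T (u p) = finprod Q (\<lambda>j. u (y j \<star>\<^bsub>P\<^esub> h j p)) J"
        by (rule Q.M.finprod_cong')
          (use F p ku in \<open>auto simp: semilinear_ract[OF E'(3)] Q.ract_closed semilinear_closed[OF E'(3)] \<phi>_closed\<close>)
      also have "\<dots> = u (finprod P (\<lambda>j. y j \<star>\<^bsub>P\<^esub> h j p) J)"
        by (rule hom_finprod[OF P.M.comm_group_axioms Q.M.comm_group_axioms semilinear_hom[OF E'(3)], symmetric])
          (use F p in \<open>auto simp: P.ract_closed\<close>)
      finally show "u p = ?T (u p)" by (simp add: dual_basisD(4)[OF Y p])
    qed
  qed (use dual_basisD(1)[OF Y] k uy in auto)
  then show ?thesis using that ku by blast
qed

lemma ext_scalarsI: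
  fixes I :: "'i set"
  assumes "gr_module R P" "gr_module S Q" "u \<in> semilinear R \<phi> P Q"
    and B: "dual_basis R P I x d f" and C: "dual_basis S Q I (\<lambda>i. u (x i)) d g"
    and gu: "\<And>i p. \<lbrakk>i \<in> I; p \<in> carrier P\<rbrakk> \<Longrightarrow> g i (u p) = \<phi> (f i p)"
  shows "ext_scalars R S \<phi> P Q u"
proof -
  interpret P: gr_module R P by fact
  interpret Q: gr_module S Q by fact
  have "finite I" using B by (rule dual_basisD)
  then obtain n :: nat and e where "I = e ` {i. i < n}" "inj_on e {i. i < n}"
    using finite_imp_nat_seg_image_inj_on by metis
  then have e: "I = e ` {..<n}" "inj_on e {..<n}"
    by (simp_all add: lessThan_def)
  have "dual_basis R P {..<n} (\<lambda>i. x (e i)) (\<lambda>i. d (e i)) (\<lambda>i. f (e i))"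
    by (rule dual_basis_reindex[OF B[unfolded e(1)] assms(1) _ e(2)]) simp
  moreover have "dual_basis S Q {..<n} (\<lambda>i. u (x (e i))) (\<lambda>i. d (e i)) (\<lambda>i. g (e i))"
    by (rule dual_basis_reindex[OF C[unfolded e(1)] assms(2) _ e(2)]) simp
  moreover have "\<forall>i<n. \<forall>p\<in>carrier P. g (e i) (u p) = \<phi> (f (e i) p)"
    using e gu by auto
  ultimately show ?thesis
    using assms(1-3) unfolding ext_scalars_def by blast
qed

lemma ext_scalars_iso_left:
  assumes E: "ext_scalars R S \<phi> P Q u" and P': "gr_module R P'" and i: "gr_isomorphic R P' P"
  shows "\<exists>u'. ext_scalars R S \<phi> P' Q u'"
proof -
  note E' = ext_scalarsD[OF E]
  interpret P: gr_module R P by (rule E')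
  interpret P': gr_module R P' by fact
  obtain a b where a: "a \<in> gr_module_hom R P' P" and b: "b \<in> gr_module_hom R P P'"
    and ba: "\<And>m. m \<in> carrier P' \<Longrightarrow> b (a m) = m" and ab: "\<And>n. n \<in> carrier P \<Longrightarrow> a (b n) = n"
    using gr_isomorphicE[OF i P' E'(1)] by metis
  obtain n x d f g where B: "dual_basis R P {..<n::nat} x d f" and C: "dual_basis S Q {..<n} (\<lambda>i. u (x i)) d g"
    and gu: "\<forall>i<n. \<forall>p\<in>carrier P. g i (u p) = \<phi> (f i p)"
    using E by (auto simp: ext_scalars_def)
  note F = dual_basis_facts[OF B E'(1)]
  have B': "dual_basis R P' {..<n} (\<lambda>i. b (x i)) d (\<lambda>i p. f i (a p))"
    by (rule dual_basis_retract[OF B E'(1) P' a b]) (rule ba)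
  have C': "dual_basis S Q {..<n} (\<lambda>i. u (a (b (x i)))) d g"
    by (rule dual_basis_cong[OF C E'(2)]) (use F(1) ab in auto)
  have "ext_scalars R S \<phi> P' Q (\<lambda>p. u (a p))"
  proof (rule ext_scalarsI[OF P' E'(2) _ B'])
    show "(\<lambda>p. u (a p)) \<in> semilinear R \<phi> P' Q"
      using semilinear_comp[OF a[folded semilinear_id] E'(3)] by simp
    show "g i (u (a p)) = \<phi> (f i (a p))" if "i \<in> {..<n}" "p \<in> carrier P'" for i p
      using that gu gmh_closed[OF a] by simp
  qed (rule C')
  then show ?thesis by blast
qed

lemma ext_scalars_iso_right:
  assumes E: "ext_scalars R S \<phi> P Q u" and Q': "gr_module S Q'" and i: "gr_isomorphic S Q Q'"
  shows "\<exists>u'. ext_scalars R S \<phi> P Q' u'"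
proof -
  note E' = ext_scalarsD[OF E]
  interpret Q: gr_module S Q by (rule E')
  interpret Q': gr_module S Q' by fact
  obtain a b where a: "a \<in> gr_module_hom S Q Q'" and b: "b \<in> gr_module_hom S Q' Q"
    and ba: "\<And>m. m \<in> carrier Q \<Longrightarrow> b (a m) = m" and ab: "\<And>n. n \<in> carrier Q' \<Longrightarrow> a (b n) = n"
    using gr_isomorphicE[OF i E'(2) Q'] by metis
  obtain n x d f g where B: "dual_basis R P {..<n::nat} x d f" and C: "dual_basis S Q {..<n} (\<lambda>i. u (x i)) d g"
    and gu: "\<forall>i<n. \<forall>p\<in>carrier P. g i (u p) = \<phi> (f i p)"
    using E by (auto simp: ext_scalars_def)
  note F = dual_basis_facts[OF C E'(2)]
  have C': "dual_basis S Q' {..<n} (\<lambda>i. a (u (x i))) d (\<lambda>i p. g i (b p))"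
    by (rule dual_basis_retract[OF C E'(2) Q' b a]) (rule ab)
  have "ext_scalars R S \<phi> P Q' (\<lambda>p. a (u p))"
  proof (rule ext_scalarsI[OF E'(1) Q' _ B C'])
    show "(\<lambda>p. a (u p)) \<in> semilinear R \<phi> P Q'"
      using semilinear_comp_hom[OF E'(3) a \<phi>_closed] .
    show "g i (b (a (u p))) = \<phi> (f i p)" if "i \<in> {..<n}" "p \<in> carrier P" for i p
      using that gu ba semilinear_closed[OF E'(3)] by simp
  qed
  then show ?thesis by blast
qed

lemma ext_scalars_direct_sum:
  assumes E: "ext_scalars R S \<phi> P Q u" and E2: "ext_scalars R S \<phi> P' Q' u'"
  shows "ext_scalars R S \<phi> (direct_sum P P') (direct_sum Q Q') (map_prod u u')"
proof -
  note D = ext_scalarsD[OF E] and D2 = ext_scalarsD[OF E2]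
  interpret P: gr_module R P by (rule D)
  interpret Q: gr_module S Q by (rule D)
  interpret P': gr_module R P' by (rule D2)
  interpret Q': gr_module S Q' by (rule D2)
  obtain n x d f g where B: "dual_basis R P {..<n::nat} x d f" and C: "dual_basis S Q {..<n} (\<lambda>i. u (x i)) d g"
    and gu: "\<forall>i<n. \<forall>p\<in>carrier P. g i (u p) = \<phi> (f i p)"
    using E by (auto simp: ext_scalars_def)
  obtain n' x' d' f' g' where B': "dual_basis R P' {..<n'::nat} x' d' f'"
    and C': "dual_basis S Q' {..<n'} (\<lambda>i. u' (x' i)) d' g'"
    and gu': "\<forall>i<n'. \<forall>p\<in>carrier P'. g' i (u' p) = \<phi> (f' i p)"
    using E2 by (auto simp: ext_scalars_def)
  have u1: "u \<one>\<^bsub>P\<^esub> = \<one>\<^bsub>Q\<^esub>" by (rule hom_one[OF semilinear_hom[OF D(3)]]) unfold_locales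
  have u1': "u' \<one>\<^bsub>P'\<^esub> = \<one>\<^bsub>Q'\<^esub>" by (rule hom_one[OF semilinear_hom[OF D2(3)]]) unfold_locales
  have x: "(\<lambda>k. map_prod u u' (case_sum (\<lambda>i. (x i, \<one>\<^bsub>P'\<^esub>)) (\<lambda>j. (\<one>\<^bsub>P\<^esub>, x' j)) k))
    = case_sum (\<lambda>i. (u (x i), \<one>\<^bsub>Q'\<^esub>)) (\<lambda>j. (\<one>\<^bsub>Q\<^esub>, u' (x' j)))"
    by (auto simp: fun_eq_iff u1 u1' split: sum.splits)
  show ?thesis
  proof (rule ext_scalarsI[OF gr_module_direct_sum[OF D(1) D2(1)] gr_module_direct_sum[OF D(2) D2(2)] _
        dual_basis_direct_sum[OF B D(1) B' D2(1)] dual_basis_direct_sum[OF C D(2) C' D2(2), folded x]])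
    show "map_prod u u' \<in> semilinear R \<phi> (direct_sum P P') (direct_sum Q Q')"
      using D(3) D2(3)
      by (intro semilinearI) (auto simp: semilinear_closed semilinear_mult semilinear_ract semilinear_grade)
  qed (use gu gu' in auto)
qed

lemma ext_scalars_shift:
  assumes E: "ext_scalars R S \<phi> P Q u"
  shows "ext_scalars R S \<phi> (shift \<alpha> P) (shift \<alpha> Q) u"
proof -
  note D = ext_scalarsD[OF E]
  obtain n x d f g where B: "dual_basis R P {..<n::nat} x d f" and C: "dual_basis S Q {..<n} (\<lambda>i. u (x i)) d g"
    and gu: "\<forall>i<n. \<forall>p\<in>carrier P. g i (u p) = \<phi> (f i p)"
    using E by (auto simp: ext_scalars_def)
  have "dual_basis R (shift \<alpha> P) {..<n} x (\<lambda>i. d i - \<alpha>) f"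
    using dual_basisD[OF B] gmh_shift[of _ R P _ \<alpha>] by (fastforce simp: dual_basis_def shift_shift)
  moreover have "dual_basis S (shift \<alpha> Q) {..<n} (\<lambda>i. u (x i)) (\<lambda>i. d i - \<alpha>) g"
    using dual_basisD[OF C] gmh_shift[of _ S Q _ \<alpha>] by (fastforce simp: dual_basis_def shift_shift)
  moreover have "u \<in> semilinear R \<phi> (shift \<alpha> P) (shift \<alpha> Q)"
    using D(3) by (auto simp: semilinear_def hom_def)
  ultimately show ?thesis
    using gr_module_shift[OF D(1)] gr_module_shift[OF D(2)] gu
    by (intro ext_scalarsI[where I="{..<n}" and x=x and f=f and g=g]) auto
qed

lemma ext_scalars_regular: "ext_scalars R S \<phi> (regular_module R) (regular_module S) \<phi>"
proof (rule ext_scalarsI[where I="{()}" and d="\<lambda>_. 0"])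
  show "dual_basis R (regular_module R) {()} (\<lambda>_. \<one>\<^bsub>R\<^esub>) (\<lambda>_. 0) (\<lambda>_ r. r)"
    using R.one_grade by (auto simp: dual_basis_def finprod_regular shift_zero gmh_id)
  show "dual_basis S (regular_module S) {()} (\<lambda>_. \<phi> \<one>\<^bsub>R\<^esub>) (\<lambda>_. 0) (\<lambda>_ r. r)"
    using S.one_grade by (auto simp: dual_basis_def finprod_regular shift_zero gmh_id \<phi>_one)
  show "\<phi> \<in> semilinear R \<phi> (regular_module R) (regular_module S)"
    by (rule semilinearI) (auto simp: \<phi>_closed \<phi>_add \<phi>_mult hom_grade)
qed (auto simp: gr_module_regular R.gr_ring_axioms S.gr_ring_axioms)

lemma ext_scalars_zero: "ext_scalars R S \<phi> zero_module zero_module (\<lambda>x. x)"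
proof (rule ext_scalarsI[where I="{}::nat set"])
  show "dual_basis R zero_module {} (\<lambda>_. ()) (\<lambda>_. 0) (\<lambda>_ r. undefined)"
    by (auto simp: dual_basis_def zero_module_def)
  show "dual_basis S zero_module {} (\<lambda>_. ()) (\<lambda>_. 0) (\<lambda>_ r. undefined)"
    by (auto simp: dual_basis_def zero_module_def)
  show "(\<lambda>x. x) \<in> semilinear R \<phi> zero_module zero_module"
    by (rule semilinearI) (auto simp: zero_module_def)
qed (auto simp: gr_module_zero R.gr_ring_axioms S.gr_ring_axioms)

end

lemma ext_scalars_id:
  assumes "fgproj R P"
  shows "ext_scalars R R (\<lambda>r. r) P P (\<lambda>p. p)"
proof -
  obtain n x d f where "dual_basis R P {..<n::nat} x d f" "gr_module R P"
    using assms by (auto simp: fgproj_def)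
  then show ?thesis
    unfolding ext_scalars_def semilinear_id using gmh_id by blast
qed

text \<open>The two hypotheses may come with unrelated dual bases of the middle module Q. The one
  inherited from P is pushed on to W by \<open>ext_scalars_dual_basis\<close>.\<close>

lemma ext_scalars_comp:
  assumes \<phi>: "gr_hom R S \<phi>" and \<psi>: "gr_hom S T \<psi>"
    and E: "ext_scalars R S \<phi> P Q u" and E2: "ext_scalars S T \<psi> Q W w"
  shows "ext_scalars R T (\<lambda>r. \<psi> (\<phi> r)) P W (\<lambda>p. w (u p))"
proof -
  interpret a: gr_hom R S \<phi> by fact
  interpret b: gr_hom S T \<psi> by fact
  interpret c: gr_hom R T "\<lambda>r. \<psi> (\<phi> r)" by (rule gr_hom_comp[OF \<phi> \<psi>])
  note D = ext_scalarsD[OF E] and D2 = ext_scalarsD[OF E2]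
  obtain n x d f g where B: "dual_basis R P {..<n::nat} x d f" and C: "dual_basis S Q {..<n} (\<lambda>i. u (x i)) d g"
    and gu: "\<forall>i<n. \<forall>p\<in>carrier P. g i (u p) = \<phi> (f i p)"
    using E by (auto simp: ext_scalars_def)
  obtain k where K: "dual_basis T W {..<n} (\<lambda>j. w (u (x j))) d k"
    and ku: "\<And>j q. \<lbrakk>j \<in> {..<n}; q \<in> carrier Q\<rbrakk> \<Longrightarrow> k j (w q) = \<psi> (g j q)"
    using b.ext_scalars_dual_basis[OF E2 C] by blast
  show ?thesis
  proof (rule c.ext_scalarsI[OF D(1) D2(2) _ B K])
    show "(\<lambda>p. w (u p)) \<in> semilinear R (\<lambda>r. \<psi> (\<phi> r)) P W"
      by (rule semilinear_comp[OF D(3) D2(3) a.\<phi>_closed])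
    show "k i (w (u p)) = \<psi> (\<phi> (f i p))" if "i \<in> {..<n}" "p \<in> carrier P" for i p
      using that gu ku semilinear_closed[OF D(3)] by simp
  qed
qed

section \<open>Tensor products\<close>

lemma hom_finprod_fun:
  assumes "comm_group H" "\<And>i. i \<in> I \<Longrightarrow> f i \<in> hom G H"
  shows "(\<lambda>x. finprod H (\<lambda>i. f i x) I) \<in> hom G H"
proof -
  interpret H: comm_group H by fact
  have c: "f i x \<in> carrier H" if "i \<in> I" "x \<in> carrier G" for i x
    using assms(2)[OF that(1)] that(2) by (auto simp: hom_def)
  show ?thesis
  proof (rule homI)
    fix x y assume "x \<in> carrier G" "y \<in> carrier G"
    then have "finprod H (\<lambda>i. f i (x \<otimes>\<^bsub>G\<^esub> y)) I = finprod H (\<lambda>i. f i x \<otimes>\<^bsub>H\<^esub> f i y) I"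
      using c hom_mult[OF assms(2)] by (intro H.finprod_cong') auto
    also have "\<dots> = finprod H (\<lambda>i. f i x) I \<otimes>\<^bsub>H\<^esub> finprod H (\<lambda>i. f i y) I"
      using c \<open>x \<in> carrier G\<close> \<open>y \<in> carrier G\<close> by (intro H.finprod_multf) auto
    finally show "finprod H (\<lambda>i. f i (x \<otimes>\<^bsub>G\<^esub> y)) I = \<dots>" .
  qed (use c in \<open>auto intro: H.finprod_closed\<close>)
qed

lemma hom_generate_subset:
  assumes "group G" "group H" "h \<in> hom G H" "X \<subseteq> carrier G" "subgroup K H" "h ` X \<subseteq> K"
  shows "h ` generate G X \<subseteq> K"
proof -
  interpret group_hom G H h
    using assms by (simp add: group_hom_def group_hom_axioms_def)
  show ?thesis
    using generate_img[OF assms(4)] H.generate_subgroup_incl[OF assms(6,5)] by simp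
qed

text \<open>For an arbitrary module P only the additive group and the action of S are studied here;
  the grading of the tensor product is established in \<open>tensor_ext_scalars\<close>, for
  projective P.\<close>

locale gr_tensor = gr_hom R S \<phi> + P: gr_module R P
  for R :: "('g::ab_group_add, 'r, 'x) gring_scheme" and S :: "('g, 's, 'y) gring_scheme" and \<phi> :: "'r \<Rightarrow> 's"
    and P :: "('g, 'r, 'm) gmodule"
begin

abbreviation "F \<equiv> tensor_free S P"
abbreviation "rels \<equiv> tensor_relations R S \<phi> P"
abbreviation "N \<equiv> generate F rels"
abbreviation "T \<equiv> F Mod N"
abbreviation "Tm \<equiv> tensor R S \<phi> P"

definition tens :: "'m \<Rightarrow> 's \<Rightarrow> ('m \<times> 's \<Rightarrow>\<^sub>0 int) set" where "tens p s = N #>\<^bsub>F\<^esub> frag_of (p, s)"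

lemma F_simps: "c \<in> carrier F \<longleftrightarrow> Poly_Mapping.keys c \<subseteq> carrier P \<times> carrier S" "c \<otimes>\<^bsub>F\<^esub> d = c + d" "\<one>\<^bsub>F\<^esub> = 0"
  by (simp_all add: tensor_free_def)

lemma F_inv: "c \<in> carrier F \<Longrightarrow> inv\<^bsub>F\<^esub> c = - c"
  by (simp add: tensor_free_def)

sublocale F: comm_group F
  by (simp add: tensor_free_def abelian_free_Abelian_group)

lemma F_diff: "\<lbrakk>c \<in> carrier F; d \<in> carrier F\<rbrakk> \<Longrightarrow> c - d \<in> carrier F"
  using keys_diff[of c d] by (auto simp: F_simps)

lemma F_of: "frag_of (p, s) \<in> carrier F \<longleftrightarrow> p \<in> carrier P \<and> s \<in> carrier S"
  by (simp add: F_simps)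

lemma rels_carrier: "rels \<subseteq> carrier F"
  unfolding tensor_relations_def
  by (auto intro!: F_diff simp: F_of P.ract_closed \<phi>_closed simp del: F_simps)

lemma N_subgroup: "subgroup N F"
  by (rule F.generate_is_subgroup[OF rels_carrier])

lemma N_normal: "N \<lhd> F"
  by (rule F.subgroup_imp_normal[OF N_subgroup])

sublocale T: comm_group T
  by (rule F.abelian_FactGroup[OF N_subgroup])

lemma T_carrier: "carrier T = (\<lambda>c. N #>\<^bsub>F\<^esub> c) ` carrier F"
  by (rule carrier_FactGroup)

lemma q_hom: "(\<lambda>c. N #>\<^bsub>F\<^esub> c) \<in> hom F T"
  by (rule normal.r_coset_hom_Mod[OF N_normal])

lemma hom_diff:
  assumes "h \<in> hom F G" "group G" "c \<in> carrier F" "d \<in> carrier F"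
  shows "h (c - d) = h c \<otimes>\<^bsub>G\<^esub> inv\<^bsub>G\<^esub> (h d)"
proof -
  interpret h: group_hom F G h
    using assms F.is_group by (simp add: group_hom_def group_hom_axioms_def)
  have "c - d = c \<otimes>\<^bsub>F\<^esub> inv\<^bsub>F\<^esub> d"
    using assms by (simp add: F_inv F_simps(2))
  then show ?thesis
    using assms by simp
qed

lemma kernel_iff_rels:
  assumes h: "h \<in> hom F G" and G: "group G" and r: "\<And>c. c \<in> rels \<Longrightarrow> h c = \<one>\<^bsub>G\<^esub>"
  shows "N \<subseteq> kernel F G h"
proof -
  interpret h: group_hom F G h
    using h G F.is_group by (simp add: group_hom_def group_hom_axioms_def)
  show ?thesis
    by (rule F.generate_subgroup_incl[OF _ h.subgroup_kernel]) (use r rels_carrier in \<open>auto simp: kernel_def\<close>)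
qed

lemma T_lift:
  assumes h: "h \<in> hom F G" and G: "group G" and r: "\<And>c. c \<in> rels \<Longrightarrow> h c = \<one>\<^bsub>G\<^esub>"
  obtains k where "k \<in> hom T G" "\<And>c. c \<in> carrier F \<Longrightarrow> k (N #>\<^bsub>F\<^esub> c) = h c"
proof -
  interpret h: group_hom F G h
    using h G F.is_group by (simp add: group_hom_def group_hom_axioms_def)
  show ?thesis
    using h.FactGroup_universal_kernel[OF N_normal kernel_iff_rels[OF assms]] that by blast
qed

lemma tens_closed: "\<lbrakk>p \<in> carrier P; s \<in> carrier S\<rbrakk> \<Longrightarrow> tens p s \<in> carrier T"
  by (auto simp: tens_def T_carrier F_of)

text \<open>The tensors are the classes of the generators \<open>frag_of (p, s)\<close>, from which
  the free abelian group is reached by taking differences.\<close>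

lemma T_hom_eq:
  assumes "h \<in> hom T G" "h' \<in> hom T G" "group G"
    and eq: "\<And>p s. \<lbrakk>p \<in> carrier P; s \<in> carrier S\<rbrakk> \<Longrightarrow> h (tens p s) = h' (tens p s)" and C: "C \<in> carrier T"
  shows "h C = h' C"
proof -
  obtain c where c: "c \<in> carrier F" "C = N #>\<^bsub>F\<^esub> c" using C by (auto simp: T_carrier)
  let ?k = "\<lambda>c. h (N #>\<^bsub>F\<^esub> c)" and ?k' = "\<lambda>c. h' (N #>\<^bsub>F\<^esub> c)"
  have k: "?k \<in> hom F G" "?k' \<in> hom F G"
    using hom_compose[OF q_hom assms(1)] hom_compose[OF q_hom assms(2)] by (simp_all add: comp_def)
  interpret G: group G by fact
  have "Poly_Mapping.keys c \<subseteq> carrier P \<times> carrier S" using c by (simp add: F_simps)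
  then have "?k c = ?k' c"
  proof (induction c rule: free_Abelian_group_induct[consumes 1, case_names zero diff single])
    case zero
    show ?case
      using hom_one[OF k(1) F.is_group G.is_group] hom_one[OF k(2) F.is_group G.is_group] by (simp add: F_simps)
  next
    case (diff x y)
    then show ?case
      using hom_diff[OF k(1) assms(3), of x y] hom_diff[OF k(2) assms(3), of x y] by (simp add: F_simps)
  next
    case (single a)
    then show ?case using eq by (cases a) (auto simp: tens_def)
  qed
  then show ?thesis by (simp add: c)
qed

text \<open>All three families of relations have this shape: the balancing relation, which has only
  two terms, is read with c the zero element of \<open>F\<close>.\<close>

lemma tens_relation:
  assumes "a \<in> carrier F" "b \<in> carrier F" "c \<in> carrier F" "a - b - c \<in> rels"
  shows "N #>\<^bsub>F\<^esub> a = (N #>\<^bsub>F\<^esub> b) \<otimes>\<^bsub>T\<^esub> (N #>\<^bsub>F\<^esub> c)"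
proof -
  have bc: "b \<otimes>\<^bsub>F\<^esub> c \<in> carrier F" using assms by (intro F.m_closed)
  have "a - b - c \<in> N" using assms(4) by (rule generate.incl)
  moreover have "a - b - c = a - (b \<otimes>\<^bsub>F\<^esub> c)" by (simp add: F_simps)
  ultimately have n: "a - (b \<otimes>\<^bsub>F\<^esub> c) \<in> N" by simp
  have "(N #>\<^bsub>F\<^esub> a) \<otimes>\<^bsub>T\<^esub> inv\<^bsub>T\<^esub> (N #>\<^bsub>F\<^esub> (b \<otimes>\<^bsub>F\<^esub> c)) = N #>\<^bsub>F\<^esub> (a - (b \<otimes>\<^bsub>F\<^esub> c))"
    by (rule hom_diff[OF q_hom T.is_group assms(1) bc, symmetric])
  also have "\<dots> = \<one>\<^bsub>T\<^esub>"
    using F.coset_join2[OF F_diff[OF assms(1) bc] N_subgroup n] by simp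
  finally have "(N #>\<^bsub>F\<^esub> a) \<otimes>\<^bsub>T\<^esub> inv\<^bsub>T\<^esub> (N #>\<^bsub>F\<^esub> (b \<otimes>\<^bsub>F\<^esub> c)) = \<one>\<^bsub>T\<^esub>" .
  then have "N #>\<^bsub>F\<^esub> a = N #>\<^bsub>F\<^esub> (b \<otimes>\<^bsub>F\<^esub> c)"
    using assms bc by (metis T.inv_closed T.inv_equality T.inv_inv T_carrier imageI)
  then show ?thesis
    using hom_mult[OF q_hom assms(2,3)] by simp
qed

lemma tens_add_left:
  assumes "p \<in> carrier P" "q \<in> carrier P" "s \<in> carrier S"
  shows "tens (p \<otimes>\<^bsub>P\<^esub> q) s = tens p s \<otimes>\<^bsub>T\<^esub> tens q s"
  unfolding tens_def
  by (rule tens_relation) (use assms in \<open>auto simp: F_of tensor_relations_def simp del: F_simps\<close>)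

lemma tens_add_right:
  assumes "p \<in> carrier P" "s \<in> carrier S" "t \<in> carrier S"
  shows "tens p (s \<oplus>\<^bsub>S\<^esub> t) = tens p s \<otimes>\<^bsub>T\<^esub> tens p t"
  unfolding tens_def
  by (rule tens_relation) (use assms in \<open>auto simp: F_of tensor_relations_def simp del: F_simps\<close>)

lemma tens_ract:
  assumes "p \<in> carrier P" "r \<in> carrier R" "s \<in> carrier S"
  shows "tens (p \<star>\<^bsub>P\<^esub> r) s = tens p (\<phi> r \<otimes>\<^bsub>S\<^esub> s)"
proof -
  have "tens (p \<star>\<^bsub>P\<^esub> r) s = tens p (\<phi> r \<otimes>\<^bsub>S\<^esub> s) \<otimes>\<^bsub>T\<^esub> (N #>\<^bsub>F\<^esub> \<one>\<^bsub>F\<^esub>)"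
    unfolding tens_def
  proof (rule tens_relation)
    have "frag_of (p \<star>\<^bsub>P\<^esub> r, s) - frag_of (p, \<phi> r \<otimes>\<^bsub>S\<^esub> s) \<in> rels"
      using assms by (auto simp: tensor_relations_def)
    then show "frag_of (p \<star>\<^bsub>P\<^esub> r, s) - frag_of (p, \<phi> r \<otimes>\<^bsub>S\<^esub> s) - \<one>\<^bsub>F\<^esub> \<in> rels"
      by (simp add: F_simps)
  qed (use assms in \<open>auto simp: F_of P.ract_closed \<phi>_closed simp del: F_simps\<close>)
  also have "N #>\<^bsub>F\<^esub> \<one>\<^bsub>F\<^esub> = \<one>\<^bsub>T\<^esub>"
    using F.coset_join2[OF F.one_closed N_subgroup generate.one] by simp
  finally show ?thesis
    using assms by (simp add: tens_closed \<phi>_closed del: mult_FactGroup one_FactGroup)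
qed

lemma tens_hom_left: "s \<in> carrier S \<Longrightarrow> (\<lambda>p. tens p s) \<in> hom P T"
  by (rule homI) (auto simp: tens_closed tens_add_left)

lemma tens_hom_right: "p \<in> carrier P \<Longrightarrow> (\<lambda>s. tens p s) \<in> hom (add_monoid S) T"
  by (rule homI) (auto simp: tens_closed tens_add_right)

lemma T_universal:
  assumes G: "comm_group G" and b: "\<And>p s. \<lbrakk>p \<in> carrier P; s \<in> carrier S\<rbrakk> \<Longrightarrow> b p s \<in> carrier G"
    and bl: "\<And>p q s. \<lbrakk>p \<in> carrier P; q \<in> carrier P; s \<in> carrier S\<rbrakk> \<Longrightarrow> b (p \<otimes>\<^bsub>P\<^esub> q) s = b p s \<otimes>\<^bsub>G\<^esub> b q s"
    and br: "\<And>p s t. \<lbrakk>p \<in> carrier P; s \<in> carrier S; t \<in> carrier S\<rbrakk> \<Longrightarrow> b p (s \<oplus>\<^bsub>S\<^esub> t) = b p s \<otimes>\<^bsub>G\<^esub> b p t"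
    and bb: "\<And>p r s. \<lbrakk>p \<in> carrier P; r \<in> carrier R; s \<in> carrier S\<rbrakk> \<Longrightarrow> b (p \<star>\<^bsub>P\<^esub> r) s = b p (\<phi> r \<otimes>\<^bsub>S\<^esub> s)"
  obtains k where "k \<in> hom T G" "\<And>p s. \<lbrakk>p \<in> carrier P; s \<in> carrier S\<rbrakk> \<Longrightarrow> k (tens p s) = b p s"
proof -
  interpret G: comm_group G by fact
  have "(\<lambda>(p, s). b p s) ` (carrier P \<times> carrier S) \<subseteq> carrier G" using b by auto
  then have "\<exists>h. h \<in> hom (free_Abelian_group (carrier P \<times> carrier S)) G \<and>
    (\<forall>x\<in>carrier P \<times> carrier S. h (frag_of x) = (\<lambda>(p, s). b p s) x)"
    by (rule G.free_Abelian_group_universal) blast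
  then obtain h where h: "h \<in> hom F G" and hb: "\<And>p s. \<lbrakk>p \<in> carrier P; s \<in> carrier S\<rbrakk> \<Longrightarrow> h (frag_of (p, s)) = b p s"
    by (auto simp: tensor_free_def)
  have cancel: "x \<otimes>\<^bsub>G\<^esub> y \<otimes>\<^bsub>G\<^esub> inv\<^bsub>G\<^esub> x \<otimes>\<^bsub>G\<^esub> inv\<^bsub>G\<^esub> y = \<one>\<^bsub>G\<^esub>" if "x \<in> carrier G" "y \<in> carrier G" for x y
    using that by (metis G.inv_closed G.inv_mult G.m_assoc G.m_closed G.r_inv)
  note hd = hom_diff[OF h G.is_group]
  have rel: "h c = \<one>\<^bsub>G\<^esub>" if c: "c \<in> rels" for c
    using c unfolding tensor_relations_def
  proof (elim UnE)
    assume "c \<in> {frag_of (p \<otimes>\<^bsub>P\<^esub> q, s) - frag_of (p, s) - frag_of (q, s) | p q s.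
        p \<in> carrier P \<and> q \<in> carrier P \<and> s \<in> carrier S}"
    then obtain p q s where pq: "p \<in> carrier P" "q \<in> carrier P" "s \<in> carrier S"
      and c: "c = frag_of (p \<otimes>\<^bsub>P\<^esub> q, s) - frag_of (p, s) - frag_of (q, s)" by blast
    then have "h c = b (p \<otimes>\<^bsub>P\<^esub> q) s \<otimes>\<^bsub>G\<^esub> inv\<^bsub>G\<^esub> b p s \<otimes>\<^bsub>G\<^esub> inv\<^bsub>G\<^esub> b q s"
      by (simp add: hd F_of F_diff hb del: F_simps)
    then show ?thesis using pq by (simp add: bl b cancel)
  next
    assume "c \<in> {frag_of (p, s \<oplus>\<^bsub>S\<^esub> t) - frag_of (p, s) - frag_of (p, t) | p s t.
        p \<in> carrier P \<and> s \<in> carrier S \<and> t \<in> carrier S}"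
    then obtain p s t where pq: "p \<in> carrier P" "s \<in> carrier S" "t \<in> carrier S"
      and c: "c = frag_of (p, s \<oplus>\<^bsub>S\<^esub> t) - frag_of (p, s) - frag_of (p, t)" by blast
    then have "h c = b p (s \<oplus>\<^bsub>S\<^esub> t) \<otimes>\<^bsub>G\<^esub> inv\<^bsub>G\<^esub> b p s \<otimes>\<^bsub>G\<^esub> inv\<^bsub>G\<^esub> b p t"
      by (simp add: hd F_of F_diff hb del: F_simps)
    then show ?thesis using pq by (simp add: br b cancel)
  next
    assume "c \<in> {frag_of (p \<star>\<^bsub>P\<^esub> r, s) - frag_of (p, \<phi> r \<otimes>\<^bsub>S\<^esub> s) | p r s.
        p \<in> carrier P \<and> r \<in> carrier R \<and> s \<in> carrier S}"
    then obtain p r s where pq: "p \<in> carrier P" "r \<in> carrier R" "s \<in> carrier S"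
      and c: "c = frag_of (p \<star>\<^bsub>P\<^esub> r, s) - frag_of (p, \<phi> r \<otimes>\<^bsub>S\<^esub> s)" by blast
    then have "h c = b (p \<star>\<^bsub>P\<^esub> r) s \<otimes>\<^bsub>G\<^esub> inv\<^bsub>G\<^esub> b p (\<phi> r \<otimes>\<^bsub>S\<^esub> s)"
      by (simp add: hd F_of F_diff hb P.ract_closed \<phi>_closed del: F_simps)
    then show ?thesis using pq by (simp add: bb b \<phi>_closed)
  qed
  show ?thesis
  proof (rule T_lift[OF h G.is_group rel])
    fix k assume "k \<in> hom T G" "\<And>c. c \<in> carrier F \<Longrightarrow> k (N #>\<^bsub>F\<^esub> c) = h c"
    then show ?thesis
      using that[of k] hb by (simp add: tens_def F_of del: F_simps)
  qed
qed

lemma Tm_simps: "carrier Tm = carrier T" "monoid.mult Tm = monoid.mult T" "one Tm = one T"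
  "mgrade Tm \<gamma> = generate T {tens p s | p s \<alpha> \<beta>. p \<in> mgrade P \<alpha> \<and> s \<in> grade S \<beta> \<and> \<alpha> + \<beta> = \<gamma>}"
  by (simp_all add: tensor_def Let_def tens_def)

text \<open>The definition of the action takes a union over all chains in a coset. The universal
  property supplies an endomorphism k with the right values on tensors, and every chain in the coset
  \<open>C\<close> contributes the same coset \<open>k C\<close>; so the action is well defined and
  additive.\<close>

lemma ract_exists:
  assumes t: "t \<in> carrier S"
  obtains k where "k \<in> hom T T" "\<And>p s. \<lbrakk>p \<in> carrier P; s \<in> carrier S\<rbrakk> \<Longrightarrow> k (tens p s) = tens p (s \<otimes>\<^bsub>S\<^esub> t)"
    "\<And>C. C \<in> carrier T \<Longrightarrow> C \<star>\<^bsub>Tm\<^esub> t = k C"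
proof -
  obtain k where k: "k \<in> hom T T" and kt: "\<And>p s. \<lbrakk>p \<in> carrier P; s \<in> carrier S\<rbrakk> \<Longrightarrow> k (tens p s) = tens p (s \<otimes>\<^bsub>S\<^esub> t)"
  proof (rule T_universal[OF T.comm_group_axioms, where b="\<lambda>p s. tens p (s \<otimes>\<^bsub>S\<^esub> t)"])
    fix p r s assume "p \<in> carrier P" "r \<in> carrier R" "s \<in> carrier S"
    then show "tens (p \<star>\<^bsub>P\<^esub> r) (s \<otimes>\<^bsub>S\<^esub> t) = tens p (\<phi> r \<otimes>\<^bsub>S\<^esub> s \<otimes>\<^bsub>S\<^esub> t)"
      using t by (simp add: tens_ract S.m_assoc \<phi>_closed)
  qed (use t in \<open>auto simp: tens_closed tens_add_left tens_add_right S.l_distr\<close>)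
  let ?E = "frag_extend (\<lambda>(p, s). frag_of (p, s \<otimes>\<^bsub>S\<^esub> t))"
  have Ek: "N #>\<^bsub>F\<^esub> ?E c = k (N #>\<^bsub>F\<^esub> c)" and Ec: "?E c \<in> carrier F" if "c \<in> carrier F" for c
  proof -
    have "Poly_Mapping.keys c \<subseteq> carrier P \<times> carrier S" using that by (simp add: F_simps)
    then have "?E c \<in> carrier F \<and> N #>\<^bsub>F\<^esub> ?E c = k (N #>\<^bsub>F\<^esub> c)"
    proof (induction c rule: free_Abelian_group_induct[consumes 1, case_names zero diff single])
      case zero
      show ?case
        using hom_one[OF q_hom F.is_group T.is_group] hom_one[OF k T.is_group T.is_group] by (simp add: F_simps)
    next
      case (diff x y)
      have kq: "(\<lambda>c. k (N #>\<^bsub>F\<^esub> c)) \<in> hom F T"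
        using hom_compose[OF q_hom k] by (simp add: comp_def)
      have "x \<in> carrier F" "y \<in> carrier F" using diff by (auto simp: F_simps)
      then show ?case
        using diff hom_diff[OF q_hom T.is_group, of "?E x" "?E y"] hom_diff[OF kq T.is_group, of x y] F_diff[of "?E x" "?E y"]
        by (simp add: frag_extend_diff)
    next
      case (single a)
      then show ?case using kt t by (cases a) (auto simp: tens_def F_of simp del: F_simps)
    qed
    then show "N #>\<^bsub>F\<^esub> ?E c = k (N #>\<^bsub>F\<^esub> c)" "?E c \<in> carrier F" by auto
  qed
  have "C \<star>\<^bsub>Tm\<^esub> t = k C" if "C \<in> carrier T" for C
  proof -
    from that have "C \<in> (\<lambda>c. N #>\<^bsub>F\<^esub> c) ` carrier F" by (simp only: T_carrier)
    then obtain c where c: "c \<in> carrier F" "C = N #>\<^bsub>F\<^esub> c" by blast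
    have "N #>\<^bsub>F\<^esub> ?E c' = k C" if "c' \<in> C" for c'
    proof -
      have "c' \<in> carrier F" using that c subgroup.subset[OF N_subgroup] F.r_coset_subset_G by blast
      moreover have "N #>\<^bsub>F\<^esub> c' = C"
        using F.repr_independence[of c' N c] that c N_subgroup by simp
      ultimately show ?thesis using Ek by simp
    qed
    moreover have "c \<in> C" using F.rcos_self[OF c(1) N_subgroup] c by simp
    moreover have "C \<star>\<^bsub>Tm\<^esub> t = (\<Union>c\<in>C. N #>\<^bsub>F\<^esub> ?E c)"
      by (simp add: tensor_def Let_def)
    ultimately show ?thesis by auto
  qed
  with k kt that show ?thesis by blast
qed

lemma ract_hom: "t \<in> carrier S \<Longrightarrow> (\<lambda>C. C \<star>\<^bsub>Tm\<^esub> t) \<in> hom T T"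
proof (erule ract_exists)
  fix k assume k: "k \<in> hom T T" and "\<And>C. C \<in> carrier T \<Longrightarrow> C \<star>\<^bsub>Tm\<^esub> t = k C"
  then show ?thesis
    by (auto simp: hom_def Pi_iff simp del: mult_FactGroup intro!: T.m_closed)
qed

lemma ract_tens: "\<lbrakk>p \<in> carrier P; s \<in> carrier S; t \<in> carrier S\<rbrakk> \<Longrightarrow> tens p s \<star>\<^bsub>Tm\<^esub> t = tens p (s \<otimes>\<^bsub>S\<^esub> t)"
  by (rule ract_exists[of t]) (auto simp: tens_closed)

text \<open>That the spans of the homogeneous tensors form a direct sum is not visible from
  generators and relations. A dual basis of P embeds the tensor product as a retract of a sum of
  shifts of S, with coordinates g i determined by g i (p \<otimes> s) = \<phi> (f i p) s, and the
  grading is inherited by \<open>grading_retract\<close>. The same g i are the functionals of the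
  dual basis of the tensor product.\<close>

lemma tensor_ext_scalars:
  assumes fg: "fgproj R P"
  shows "ext_scalars R S \<phi> P Tm (\<lambda>p. tens p \<one>\<^bsub>S\<^esub>)"
proof -
  obtain n x d f where B: "dual_basis R P {..<n::nat} x d f" and Pm: "gr_module R P"
    using fg by (auto simp: fgproj_def)
  note Fb = dual_basis_facts[OF B Pm]
  have Tm_group: "comm_group Tm"
    using T.comm_group_axioms comm_group_struct_cong[of Tm T] by (simp add: Tm_simps)
  interpret Tm: comm_group Tm by fact
  have homT: "hom T G = hom Tm G" "hom G' T = hom G' Tm" for G G'
    by (auto simp: hom_def Tm_simps)
  \<comment> \<open>\<open>T\<close> and the module \<open>Tm\<close> share their operations but are
    different records, so generated subgroups are compared by induction over their
    construction.\<close>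
  have genT: "generate T X = generate Tm X" if "X \<subseteq> carrier T" for X
  proof -
    have i: "m_inv T = m_inv Tm" by (rule m_inv_struct_cong) (simp_all add: Tm_simps)
    have "y \<in> generate T X \<longleftrightarrow> y \<in> generate Tm X" for y
    proof
      show "y \<in> generate T X \<Longrightarrow> y \<in> generate Tm X"
        by (induction rule: generate.induct)
          (use generate.one[of Tm X] generate.incl[of _ X Tm] generate.inv[of _ X Tm] generate.eng[of _ Tm X] i
            in \<open>auto simp: Tm_simps simp del: one_FactGroup mult_FactGroup\<close>)
      show "y \<in> generate Tm X \<Longrightarrow> y \<in> generate T X"
        by (induction rule: generate.induct)
          (use generate.one[of T X] generate.incl[of _ X T] generate.inv[of _ X T] generate.eng[of _ T X] i
            in \<open>auto simp: Tm_simps simp del: one_FactGroup mult_FactGroup\<close>)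
    qed
    then show ?thesis by auto
  qed
  let ?gens = "\<lambda>\<gamma>. {tens p s | p s \<alpha> \<beta>. p \<in> mgrade P \<alpha> \<and> s \<in> grade S \<beta> \<and> \<alpha> + \<beta> = \<gamma>}"
  have gens: "?gens \<gamma> \<subseteq> carrier Tm" for \<gamma>
    by (auto simp: Tm_simps(1) intro!: tens_closed P.MG.D_carrier S.grade_carrier)
  have grade: "mgrade Tm \<gamma> = generate Tm (?gens \<gamma>)" for \<gamma>
    using genT[of "?gens \<gamma>"] gens[of \<gamma>] by (simp add: Tm_simps)
  have sub: "subgroup (mgrade Tm \<gamma>) Tm" for \<gamma>
    unfolding grade by (rule Tm.generate_is_subgroup[OF gens])
  have tens_grade: "tens p s \<in> mgrade Tm \<gamma>" if "p \<in> mgrade P \<alpha>" "s \<in> grade S \<beta>" "\<alpha> + \<beta> = \<gamma>" for p s \<alpha> \<beta> \<gamma>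
    unfolding grade by (rule generate.incl) (use that in blast)
  \<comment> \<open>Each component is generated by tensors of homogeneous elements, so an inclusion
    between components need only be checked on these.\<close>
  have gen_le: "h ` mgrade Tm \<gamma> \<subseteq> K"
    if "h \<in> hom Tm G" "group G" "subgroup K G" and hK: "\<And>p s \<alpha> \<beta>. \<lbrakk>p \<in> mgrade P \<alpha>; s \<in> grade S \<beta>; \<alpha> + \<beta> = \<gamma>\<rbrakk> \<Longrightarrow> h (tens p s) \<in> K"
    for h \<gamma> K and G :: "('z, 'w) monoid_scheme"
    unfolding grade by (rule hom_generate_subset[OF Tm.is_group that(2,1) gens that(3)]) (use hK in blast)
  define Fr where "Fr i = shift (- d i) (regular_module S)" for i
  have Fr: "gr_module S (Fr i)" for i
    unfolding Fr_def by (intro gr_module_shift gr_module_regular S.gr_ring_axioms)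
  let ?D = "dsum {..<n} Fr"
  have D: "gr_module S ?D"
    by (rule gr_module_dsum[OF S.gr_ring_axioms]) (auto simp: Fr)
  interpret D: gr_module S ?D by fact
  have "\<exists>g. g \<in> hom T (add_monoid S) \<and> (\<forall>p\<in>carrier P. \<forall>s\<in>carrier S. g (tens p s) = \<phi> (f i p) \<otimes>\<^bsub>S\<^esub> s)" if i: "i < n" for i
  proof -
    obtain g where "g \<in> hom T (add_monoid S)" "\<And>p s. \<lbrakk>p \<in> carrier P; s \<in> carrier S\<rbrakk> \<Longrightarrow> g (tens p s) = \<phi> (f i p) \<otimes>\<^bsub>S\<^esub> s"
      by (rule T_universal[OF S.a_comm_group, where b="\<lambda>p s. \<phi> (f i p) \<otimes>\<^bsub>S\<^esub> s"])
        (use i in \<open>auto simp: Fb \<phi>_closed \<phi>_add \<phi>_mult S.l_distr S.r_distr S.m_assoc\<close>)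
    then show ?thesis by blast
  qed
  then obtain g where g: "\<And>i. i < n \<Longrightarrow> g i \<in> hom T (add_monoid S)"
    and gt: "\<And>i p s. \<lbrakk>i < n; p \<in> carrier P; s \<in> carrier S\<rbrakk> \<Longrightarrow> g i (tens p s) = \<phi> (f i p) \<otimes>\<^bsub>S\<^esub> s"
    by metis
  have gc: "g i C \<in> carrier S" if "i < n" "C \<in> carrier T" for i C
    using g[OF that(1)] that(2) by (auto simp: hom_def)
  have ga: "g i (C \<otimes>\<^bsub>T\<^esub> E) = g i C \<oplus>\<^bsub>S\<^esub> g i E" if "i < n" "C \<in> carrier T" "E \<in> carrier T" for i C E
    using hom_mult[OF g[OF that(1)] that(2,3)] by simp
  have gr: "g i (C \<star>\<^bsub>Tm\<^esub> t) = g i C \<otimes>\<^bsub>S\<^esub> t" if i: "i < n" and C: "C \<in> carrier T" and t: "t \<in> carrier S" for i C t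
  proof (rule T_hom_eq[OF _ _ S.add.is_group _ C])
    show "(\<lambda>C. g i (C \<star>\<^bsub>Tm\<^esub> t)) \<in> hom T (add_monoid S)"
      using hom_compose[OF ract_hom[OF t] g[OF i]] by (simp add: comp_def)
    show "(\<lambda>C. g i C \<otimes>\<^bsub>S\<^esub> t) \<in> hom T (add_monoid S)"
      by (rule homI) (use i t in \<open>auto simp: gc ga S.l_distr simp del: mult_FactGroup\<close>)
  qed (use i t in \<open>auto simp: ract_tens gt Fb \<phi>_closed S.m_assoc\<close>)
  \<comment> \<open>\<open>inj\<close> reads off coordinates, and \<open>pr\<close> rebuilds an
    element from them as the sum of the tensors x i \<otimes> s i; the dual basis identity on P
    shows that \<open>pr\<close> undoes \<open>inj\<close>.\<close>
  define inj where "inj C = (\<lambda>i\<in>{..<n}. g i C)" for C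
  define pr where "pr s = finprod Tm (\<lambda>i. tens (x i) (s i)) {..<n}" for s
  have xc: "x i \<in> carrier P" if "i < n" for i using Fb(1) that by simp
  have inj: "inj \<in> hom Tm ?D"
    by (rule homI)
      (auto simp: inj_def Tm_simps(1,2) Fr_def gc ga simp del: mult_FactGroup intro!: restrict_ext)
  have pr: "pr \<in> hom ?D Tm"
    unfolding pr_def
  proof (rule hom_finprod_fun[OF Tm_group])
    fix i assume i: "i \<in> {..<n}"
    have 1: "(\<lambda>s. s i) \<in> hom ?D (add_monoid S)"
      using gmh_hom[OF gmh_dproj[OF i, of S Fr]] by (auto simp: hom_def Fr_def)
    show "(\<lambda>s. tens (x i) (s i)) \<in> hom ?D Tm"
      using hom_compose[OF 1 tens_hom_right[OF xc]] i by (simp add: comp_def homT)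
  qed
  have pr_inj: "pr (inj C) = C" if C: "C \<in> carrier T" for C
  proof (rule T_hom_eq[OF _ _ Tm.is_group _ C])
    show "(\<lambda>C. pr (inj C)) \<in> hom T Tm"
      using hom_compose[OF inj pr] by (simp add: comp_def homT)
    show "(\<lambda>C. C) \<in> hom T Tm"
      by (auto simp: hom_def Tm_simps)
    fix p s assume p: "p \<in> carrier P" and s: "s \<in> carrier S"
    have "pr (inj (tens p s)) = finprod Tm (\<lambda>i. tens (x i \<star>\<^bsub>P\<^esub> f i p) s) {..<n}"
      unfolding pr_def inj_def
      by (rule Tm.finprod_cong') (use p s in \<open>auto simp: gt tens_ract xc Fb Tm_simps(1) intro!: tens_closed \<phi>_closed P.ract_closed\<close>)
    also have "\<dots> = tens (finprod P (\<lambda>i. x i \<star>\<^bsub>P\<^esub> f i p) {..<n}) s"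
      by (rule hom_finprod[OF P.M.comm_group_axioms Tm_group tens_hom_left[OF s, unfolded homT], symmetric])
        (use p in \<open>auto simp: Fb P.ract_closed\<close>)
    finally show "pr (inj (tens p s)) = tens p s" by (simp add: dual_basisD(4)[OF B p])
  qed
  have grade_g: "g i ` mgrade Tm \<gamma> \<subseteq> grade S (\<gamma> - d i)" if i: "i < n" for i \<gamma>
  proof (rule gen_le[OF g[OF i, unfolded homT] S.add.is_group S.RG.D_subgroup])
    fix p s \<alpha> \<beta> assume ps: "p \<in> mgrade P \<alpha>" "s \<in> grade S \<beta>" "\<alpha> + \<beta> = \<gamma>"
    have "\<phi> (f i p) \<otimes>\<^bsub>S\<^esub> s \<in> grade S (\<alpha> - d i + \<beta>)"
      using S.grade_mult[OF hom_grade[OF Fb(5)[OF _ ps(1)]] ps(2)] i by simp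
    then show "g i (tens p s) \<in> grade S (\<gamma> - d i)"
      using ps i P.MG.D_carrier S.grade_carrier by (simp add: gt algebra_simps)
  qed
  have grad: "grading Tm (mgrade Tm)"
  proof (rule grading_retract[OF Tm_group D.MG.graded_group_axioms sub inj _ pr])
    show "inj ` mgrade Tm \<gamma> \<subseteq> mgrade ?D \<gamma>" for \<gamma>
      using grade_g[of _ \<gamma>] by (auto simp: inj_def Fr_def PiE_iff image_subset_iff)
    show "pr ` mgrade ?D \<gamma> \<subseteq> mgrade Tm \<gamma>" for \<gamma>
    proof safe
      fix s assume s: "s \<in> mgrade ?D \<gamma>"
      show "pr s \<in> mgrade Tm \<gamma>"
        unfolding pr_def
      proof (rule Tm.subgroup_finprod[OF Tm_group sub])
        fix i assume "i \<in> {..<n}"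
        then show "tens (x i) (s i) \<in> mgrade Tm \<gamma>"
          using s dual_basisD(2)[OF B, of i]
          by (intro tens_grade[of _ "d i" _ "- d i + \<gamma>"]) (auto simp: Fr_def PiE_iff)
      qed
    qed
  qed (simp add: pr_inj Tm_simps)
  have Tm: "gr_module S Tm"
  proof (intro gr_module.intro gr_module_axioms.intro S.gr_ring_axioms Tm_group grad)
    fix C t assume "C \<in> carrier Tm" "t \<in> carrier S"
    then show "C \<star>\<^bsub>Tm\<^esub> t \<in> carrier Tm"
      using ract_hom by (auto simp: Tm_simps hom_def)
  next
    fix C E t assume "C \<in> carrier Tm" "E \<in> carrier Tm" "t \<in> carrier S"
    then show "(C \<otimes>\<^bsub>Tm\<^esub> E) \<star>\<^bsub>Tm\<^esub> t = C \<star>\<^bsub>Tm\<^esub> t \<otimes>\<^bsub>Tm\<^esub> E \<star>\<^bsub>Tm\<^esub> t"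
      using hom_mult[OF ract_hom[of t]] by (simp add: Tm_simps del: mult_FactGroup)
  next
    fix C s t assume C: "C \<in> carrier Tm" and s: "s \<in> carrier S" and t: "t \<in> carrier S"
    have "(\<lambda>C. C \<star>\<^bsub>Tm\<^esub> s \<otimes>\<^bsub>T\<^esub> C \<star>\<^bsub>Tm\<^esub> t) \<in> hom T T"
      using ract_hom[OF s] ract_hom[OF t]
      by (intro homI) (auto simp: hom_def T.m_ac Pi_iff simp del: mult_FactGroup)
    then show "C \<star>\<^bsub>Tm\<^esub> (s \<oplus>\<^bsub>S\<^esub> t) = C \<star>\<^bsub>Tm\<^esub> s \<otimes>\<^bsub>Tm\<^esub> C \<star>\<^bsub>Tm\<^esub> t"
      unfolding Tm_simps
      by (rule T_hom_eq[OF ract_hom[OF S.add.m_closed[OF s t]] _ T.is_group])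
        (use s t C in \<open>auto simp: ract_tens S.r_distr tens_add_right Tm_simps simp del: mult_FactGroup\<close>)
    have "(\<lambda>C. C \<star>\<^bsub>Tm\<^esub> s \<star>\<^bsub>Tm\<^esub> t) \<in> hom T T"
      using hom_compose[OF ract_hom[OF s] ract_hom[OF t]] by (simp add: comp_def)
    then show "C \<star>\<^bsub>Tm\<^esub> (s \<otimes>\<^bsub>S\<^esub> t) = C \<star>\<^bsub>Tm\<^esub> s \<star>\<^bsub>Tm\<^esub> t"
      by (rule T_hom_eq[OF ract_hom[OF S.m_closed[OF s t]] _ T.is_group])
        (use s t C in \<open>auto simp: ract_tens S.m_assoc Tm_simps\<close>)
  next
    fix C assume C: "C \<in> carrier Tm"
    show "C \<star>\<^bsub>Tm\<^esub> \<one>\<^bsub>S\<^esub> = C"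
      by (rule T_hom_eq[OF ract_hom _ T.is_group, where h'="\<lambda>C. C"])
        (use C in \<open>auto simp: ract_tens Tm_simps hom_def\<close>)
  next
    fix C t \<gamma> \<beta> assume C: "C \<in> mgrade Tm \<gamma>" and t: "t \<in> grade S \<beta>"
    have tc: "t \<in> carrier S" using t by (rule S.grade_carrier)
    have "(\<lambda>C. C \<star>\<^bsub>Tm\<^esub> t) ` mgrade Tm \<gamma> \<subseteq> mgrade Tm (\<gamma> + \<beta>)"
    proof (rule gen_le[OF ract_hom[OF tc, unfolded homT] Tm.is_group sub])
      fix p s \<alpha> \<beta>' assume ps: "p \<in> mgrade P \<alpha>" "s \<in> grade S \<beta>'" "\<alpha> + \<beta>' = \<gamma>"
      then show "tens p s \<star>\<^bsub>Tm\<^esub> t \<in> mgrade Tm (\<gamma> + \<beta>)"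
        using tens_grade[OF ps(1) S.grade_mult[OF ps(2) t], of "\<gamma> + \<beta>"] tc P.MG.D_carrier S.grade_carrier
        by (simp add: ract_tens algebra_simps)
    qed
    then show "C \<star>\<^bsub>Tm\<^esub> t \<in> mgrade Tm (\<gamma> + \<beta>)" using C by blast
  qed
  interpret Tmm: gr_module S Tm by fact
  show ?thesis
  proof (rule ext_scalarsI[OF Pm Tm _ B])
    show "(\<lambda>p. tens p \<one>\<^bsub>S\<^esub>) \<in> semilinear R \<phi> P Tm"
    proof (rule semilinearI)
      show "tens p \<one>\<^bsub>S\<^esub> \<in> mgrade Tm \<gamma>" if "p \<in> mgrade P \<gamma>" for p \<gamma>
        using tens_grade[OF that S.one_grade] by simp
    qed (auto simp: Tm_simps tens_closed tens_add_left tens_ract ract_tens \<phi>_closed simp del: mult_FactGroup)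
    show "dual_basis S Tm {..<n} (\<lambda>i. tens (x i) \<one>\<^bsub>S\<^esub>) d g"
      unfolding dual_basis_def
    proof (intro conjI ballI)
      fix C assume C: "C \<in> carrier Tm"
      have "finprod Tm (\<lambda>i. tens (x i) \<one>\<^bsub>S\<^esub> \<star>\<^bsub>Tm\<^esub> g i C) {..<n} = pr (inj C)"
        unfolding pr_def inj_def
        by (rule Tm.finprod_cong') (use C in \<open>auto simp: ract_tens xc gc Tm_simps(1) intro!: tens_closed\<close>)
      then show "C = finprod Tm (\<lambda>i. tens (x i) \<one>\<^bsub>S\<^esub> \<star>\<^bsub>Tm\<^esub> g i C) {..<n}"
        using C pr_inj by (simp add: Tm_simps)
    next
      fix i assume i: "i \<in> {..<n}"
      show "tens (x i) \<one>\<^bsub>S\<^esub> \<in> mgrade Tm (d i)"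
        using tens_grade[OF dual_basisD(2)[OF B i] S.one_grade] by simp
      show "g i \<in> gr_module_hom S Tm (shift (- d i) (regular_module S))"
      proof (rule gr_module_homI)
        show "g i C \<in> mgrade (shift (- d i) (regular_module S)) \<gamma>" if "C \<in> mgrade Tm \<gamma>" for C \<gamma>
          using grade_g[of i \<gamma>] i that by auto
      qed (use i in \<open>auto simp: gc ga gr Tm_simps simp del: mult_FactGroup\<close>)
    qed simp
    show "g i (tens p \<one>\<^bsub>S\<^esub>) = \<phi> (f i p)" if "i \<in> {..<n}" "p \<in> carrier P" for i p
      using that by (simp add: gt Fb \<phi>_closed)
  qed
qed

end

context gr_hom
begin

lemma tensor_ext: "fgproj R P \<Longrightarrow> \<exists>u. ext_scalars R S \<phi> P (tensor R S \<phi> P) u"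
proof -
  assume fg: "fgproj R P"
  interpret gr_module R P using fg by (rule fgproj_module)
  interpret gr_tensor R S \<phi> P by unfold_locales
  show ?thesis using tensor_ext_scalars[OF fg] by blast
qed

text \<open>Any extension of scalars may stand for the tensor product: it can be moved from P to
  another representative P' of its class, and extensions of the same module are isomorphic.\<close>

lemma V_map_class:
  assumes E: "ext_scalars R S \<phi> P Q u"
  shows "V_map R S \<phi> (iso_class R P) = iso_class S Q"
proof -
  note D = ext_scalarsD[OF E]
  have "iso_class S (tensor R S \<phi> P') = iso_class S Q" if P': "P' \<in> iso_class R P" for P'
  proof -
    note P = iso_classD[OF P' D(1)]
    obtain u' where u': "ext_scalars R S \<phi> P' (tensor R S \<phi> P') u'"
      using tensor_ext[OF P(1)] by blast
    obtain u'' where u'': "ext_scalars R S \<phi> P' Q u''"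
      using ext_scalars_iso_left[OF E P(2) gr_isomorphic_sym[OF P(3) D(1) P(2)]] by blast
    show ?thesis
      by (rule iso_class_cong[OF ext_scalars_unique[OF u' u''] ext_scalarsD(2)[OF u'] D(2)])
  qed
  then show ?thesis
    using iso_class_nonempty[OF D(4)] by (auto simp: V_map_def)
qed

lemma ext_scalars_exists:
  assumes "fgproj R P"
  obtains Q :: "('g, 's) tuple_module" and u where "ext_scalars R S \<phi> P Q u"
proof -
  obtain u where u: "ext_scalars R S \<phi> P (tensor R S \<phi> P) u"
    using tensor_ext[OF assms] by blast
  obtain Q :: "('g, 's) tuple_module" where "fgproj S Q" "gr_isomorphic S (tensor R S \<phi> P) Q"
    using fgproj_tuple[OF ext_scalarsD(5)[OF u]] by blast
  then show ?thesis
    using ext_scalars_iso_right[OF u] fgproj_module that by blast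
qed

end

section \<open>The functor K0 on graded rings\<close>

section \<open>Group completions\<close>

text \<open>The formal difference a - b, of which \<open>gc_inj\<close> is the case where b is the
  neutral element.\<close>

definition gc_diff :: "('v, 'x) monoid_scheme \<Rightarrow> 'v \<Rightarrow> 'v \<Rightarrow> ('v \<times> 'v) set" where
  "gc_diff M a b = gc_rel M `` {(a, b)}"

context comm_monoid
begin

lemma gc_rel_iff: "((a, b), (c, d)) \<in> gc_rel G \<longleftrightarrow> a \<in> carrier G \<and> b \<in> carrier G \<and> c \<in> carrier G \<and> d \<in> carrier G \<and>
    (\<exists>e\<in>carrier G. a \<otimes> d \<otimes> e = c \<otimes> b \<otimes> e)"
  by (simp add: gc_rel_def)

lemma gc_equiv: "equiv (carrier G \<times> carrier G) (gc_rel G)"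
proof (rule equivI)
  show "gc_rel G \<subseteq> (carrier G \<times> carrier G) \<times> (carrier G \<times> carrier G)"
    by (auto simp: gc_rel_def)
  show "refl_on (carrier G \<times> carrier G) (gc_rel G)"
    by (auto simp: refl_on_def gc_rel_iff)
  show "sym (gc_rel G)"
    by (auto simp: sym_def gc_rel_iff) metis
  show "trans (gc_rel G)"
  proof (rule transI, clarify)
    fix a b c d p q assume "((a, b), (c, d)) \<in> gc_rel G" "((c, d), (p, q)) \<in> gc_rel G"
    then obtain e f where c: "a \<in> carrier G" "b \<in> carrier G" "c \<in> carrier G" "d \<in> carrier G" "p \<in> carrier G" "q \<in> carrier G"
      "e \<in> carrier G" "f \<in> carrier G" and e: "a \<otimes> d \<otimes> e = c \<otimes> b \<otimes> e" and f: "c \<otimes> q \<otimes> f = p \<otimes> d \<otimes> f"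
      by (auto simp: gc_rel_iff)
    have "a \<otimes> q \<otimes> (d \<otimes> e \<otimes> f) = (a \<otimes> d \<otimes> e) \<otimes> (q \<otimes> f)"
      using c by (simp add: m_ac)
    also have "\<dots> = (c \<otimes> q \<otimes> f) \<otimes> (b \<otimes> e)"
      unfolding e using c by (simp add: m_ac)
    also have "\<dots> = p \<otimes> b \<otimes> (d \<otimes> e \<otimes> f)"
      unfolding f using c by (simp add: m_ac)
    finally have "\<exists>e\<in>carrier G. a \<otimes> q \<otimes> e = p \<otimes> b \<otimes> e"
      using c by (intro bexI[of _ "d \<otimes> e \<otimes> f"]) auto
    then show "((a, b), (p, q)) \<in> gc_rel G"
      using c by (simp add: gc_rel_iff)
  qed
qed

lemma gc_diff_eq_iff:
  assumes "a \<in> carrier G" "b \<in> carrier G" "c \<in> carrier G" "d \<in> carrier G"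
  shows "gc_diff G a b = gc_diff G c d \<longleftrightarrow> (\<exists>e\<in>carrier G. a \<otimes> d \<otimes> e = c \<otimes> b \<otimes> e)"
  unfolding gc_diff_def using assms
  by (subst eq_equiv_class_iff[OF gc_equiv]) (auto simp: gc_rel_iff)

lemma gc_diff_mem:
  assumes "a \<in> carrier G" "b \<in> carrier G" "(c, d) \<in> gc_diff G a b"
  shows "c \<in> carrier G" "d \<in> carrier G" "gc_diff G c d = gc_diff G a b"
proof -
  have r: "((a, b), (c, d)) \<in> gc_rel G" using assms(3) by (simp add: gc_diff_def)
  then show "c \<in> carrier G" "d \<in> carrier G" by (auto simp: gc_rel_iff)
  show "gc_diff G c d = gc_diff G a b"
    unfolding gc_diff_def using equiv_class_eq[OF gc_equiv r] by simp
qed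

lemma gc_diff_self: "\<lbrakk>a \<in> carrier G; b \<in> carrier G\<rbrakk> \<Longrightarrow> (a, b) \<in> gc_diff G a b"
  unfolding gc_diff_def by (rule equiv_class_self[OF gc_equiv]) simp

lemma gc_carrier: "carrier (group_completion G) = {gc_diff G a b | a b. a \<in> carrier G \<and> b \<in> carrier G}"
  by (auto simp: group_completion_def quotient_def gc_diff_def)

lemma gc_one: "\<one>\<^bsub>group_completion G\<^esub> = gc_diff G \<one> \<one>"
  by (simp add: group_completion_def gc_diff_def)

lemma gc_mult:
  assumes "a \<in> carrier G" "b \<in> carrier G" "c \<in> carrier G" "d \<in> carrier G"
  shows "gc_diff G a b \<otimes>\<^bsub>group_completion G\<^esub> gc_diff G c d = gc_diff G (a \<otimes> c) (b \<otimes> d)"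
proof -
  have e: "gc_diff G (a' \<otimes> c') (b' \<otimes> d') = gc_diff G (a \<otimes> c) (b \<otimes> d)"
    if "(a', b') \<in> gc_diff G a b" "(c', d') \<in> gc_diff G c d" for a' b' c' d'
  proof -
    note A = gc_diff_mem[OF assms(1,2) that(1)] and C = gc_diff_mem[OF assms(3,4) that(2)]
    obtain e where e: "e \<in> carrier G" "a' \<otimes> b \<otimes> e = a \<otimes> b' \<otimes> e"
      using A assms gc_diff_eq_iff[of a' b' a b] by auto
    obtain f where f: "f \<in> carrier G" "c' \<otimes> d \<otimes> f = c \<otimes> d' \<otimes> f"
      using C assms gc_diff_eq_iff[of c' d' c d] by auto
    have "(a' \<otimes> c') \<otimes> (b \<otimes> d) \<otimes> (e \<otimes> f) = (a' \<otimes> b \<otimes> e) \<otimes> (c' \<otimes> d \<otimes> f)"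
      using A(1,2) C(1,2) assms e(1) f(1) by (simp add: m_ac)
    also have "\<dots> = (a \<otimes> c) \<otimes> (b' \<otimes> d') \<otimes> (e \<otimes> f)"
      unfolding e(2) f(2) using A(1,2) C(1,2) assms e(1) f(1) by (simp add: m_ac)
    finally show ?thesis
      using A C assms e(1) f(1) by (subst gc_diff_eq_iff) (auto intro!: bexI[of _ "e \<otimes> f"])
  qed
  have "gc_diff G a b \<otimes>\<^bsub>group_completion G\<^esub> gc_diff G c d =
      (\<Union>(a', b')\<in>gc_diff G a b. \<Union>(c', d')\<in>gc_diff G c d. gc_diff G (a' \<otimes> c') (b' \<otimes> d'))"
    by (simp add: group_completion_def gc_diff_def)
  also have "\<dots> = (\<Union>(a', b')\<in>gc_diff G a b. \<Union>(c', d')\<in>gc_diff G c d. gc_diff G (a \<otimes> c) (b \<otimes> d))"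
    using e by (intro SUP_cong refl) (auto split: prod.splits)
  also have "\<dots> = gc_diff G (a \<otimes> c) (b \<otimes> d)"
    using gc_diff_self[OF assms(1,2)] gc_diff_self[OF assms(3,4)] by auto
  finally show ?thesis .
qed

lemma comm_group_gc: "comm_group (group_completion G)"
proof (rule comm_groupI)
  fix x y z assume x: "x \<in> carrier (group_completion G)" and y: "y \<in> carrier (group_completion G)"
    and z: "z \<in> carrier (group_completion G)"
  obtain a b c d p q where ab: "x = gc_diff G a b" "a \<in> carrier G" "b \<in> carrier G"
    and cd: "y = gc_diff G c d" "c \<in> carrier G" "d \<in> carrier G"
    and pq: "z = gc_diff G p q" "p \<in> carrier G" "q \<in> carrier G"
    using x y z unfolding gc_carrier by blast
  show "x \<otimes>\<^bsub>group_completion G\<^esub> y \<otimes>\<^bsub>group_completion G\<^esub> z = x \<otimes>\<^bsub>group_completion G\<^esub> (y \<otimes>\<^bsub>group_completion G\<^esub> z)"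
    using ab cd pq by (simp add: gc_mult m_ac)
next
  fix x y assume x: "x \<in> carrier (group_completion G)" and y: "y \<in> carrier (group_completion G)"
  obtain a b c d where ab: "x = gc_diff G a b" "a \<in> carrier G" "b \<in> carrier G"
    and cd: "y = gc_diff G c d" "c \<in> carrier G" "d \<in> carrier G"
    using x y unfolding gc_carrier by blast
  show "x \<otimes>\<^bsub>group_completion G\<^esub> y \<in> carrier (group_completion G)"
    unfolding gc_carrier using ab cd by (auto simp: gc_mult)
  show "x \<otimes>\<^bsub>group_completion G\<^esub> y = y \<otimes>\<^bsub>group_completion G\<^esub> x"
    using ab cd by (simp add: gc_mult m_ac)
next
  fix x assume x: "x \<in> carrier (group_completion G)"
  obtain a b where ab: "x = gc_diff G a b" "a \<in> carrier G" "b \<in> carrier G"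
    using x unfolding gc_carrier by blast
  show "\<one>\<^bsub>group_completion G\<^esub> \<otimes>\<^bsub>group_completion G\<^esub> x = x"
    using ab by (simp add: gc_one gc_mult)
  have "gc_diff G (b \<otimes> a) (a \<otimes> b) = gc_diff G \<one> \<one>"
    using ab by (subst gc_diff_eq_iff) (auto intro!: bexI[of _ \<one>] simp: m_ac)
  then show "\<exists>y\<in>carrier (group_completion G). y \<otimes>\<^bsub>group_completion G\<^esub> x = \<one>\<^bsub>group_completion G\<^esub>"
    using ab by (intro bexI[of _ "gc_diff G b a"]) (auto simp: gc_one gc_mult gc_carrier)
qed (auto simp: gc_carrier gc_one)

lemma gc_inv:
  assumes "a \<in> carrier G" "b \<in> carrier G"
  shows "inv\<^bsub>group_completion G\<^esub> (gc_diff G a b) = gc_diff G b a"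
proof -
  interpret K: comm_group "group_completion G" by (rule comm_group_gc)
  have "gc_diff G (b \<otimes> a) (a \<otimes> b) = gc_diff G \<one> \<one>"
    using assms by (subst gc_diff_eq_iff) (auto intro!: bexI[of _ \<one>] simp: m_ac)
  then show ?thesis
    using assms by (intro K.inv_equality) (auto simp: gc_mult gc_one gc_carrier)
qed

lemma gc_inj_diff: "gc_inj G a = gc_diff G a \<one>"
  by (simp add: gc_inj_def gc_diff_def)

lemma gc_inj_closed: "a \<in> carrier G \<Longrightarrow> gc_inj G a \<in> carrier (group_completion G)"
  by (auto simp: gc_inj_diff gc_carrier)

lemma gc_inj_mult:
  "\<lbrakk>a \<in> carrier G; b \<in> carrier G\<rbrakk> \<Longrightarrow> gc_inj G (a \<otimes> b) = gc_inj G a \<otimes>\<^bsub>group_completion G\<^esub> gc_inj G b"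
  by (simp add: gc_inj_diff gc_mult)

lemma gc_inj_one: "gc_inj G \<one> = \<one>\<^bsub>group_completion G\<^esub>"
  by (simp add: gc_inj_diff gc_one)

lemma gc_inj_eq_iff:
  "\<lbrakk>a \<in> carrier G; b \<in> carrier G\<rbrakk> \<Longrightarrow> gc_inj G a = gc_inj G b \<longleftrightarrow> (\<exists>e\<in>carrier G. a \<otimes> e = b \<otimes> e)"
  by (simp add: gc_inj_diff gc_diff_eq_iff)

lemma gc_diff_inj:
  "\<lbrakk>a \<in> carrier G; b \<in> carrier G\<rbrakk> \<Longrightarrow> gc_diff G a b = gc_inj G a \<otimes>\<^bsub>group_completion G\<^esub> inv\<^bsub>group_completion G\<^esub> gc_inj G b"
  by (simp add: gc_inj_diff gc_inv gc_mult)

lemma gc_inj_finprod: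
  assumes "f \<in> I \<rightarrow> carrier G"
  shows "gc_inj G (finprod G f I) = finprod (group_completion G) (\<lambda>i. gc_inj G (f i)) I"
proof -
  interpret K: comm_group "group_completion G" by (rule comm_group_gc)
  show ?thesis
    using assms
  proof (induction I rule: infinite_finite_induct)
    case (insert i I)
    then have f: "f i \<in> carrier G" "f \<in> I \<rightarrow> carrier G" by auto
    have "gc_inj G (finprod G f (insert i I)) = gc_inj G (f i \<otimes> finprod G f I)"
      using insert.hyps f by simp
    also have "\<dots> = gc_inj G (f i) \<otimes>\<^bsub>group_completion G\<^esub> finprod (group_completion G) (\<lambda>i. gc_inj G (f i)) I"
      using f insert.IH by (simp add: gc_inj_mult)
    also have "\<dots> = finprod (group_completion G) (\<lambda>i. gc_inj G (f i)) (insert i I)"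
      using f insert.hyps by (intro K.finprod_insert[symmetric]) (auto simp: Pi_iff gc_inj_closed)
    finally show ?case .
  qed (simp_all add: gc_inj_one)
qed

end

lemma gc_map_diff:
  assumes M: "comm_monoid M" and N: "comm_monoid N" and h: "h \<in> hom M N" and ab: "a \<in> carrier M" "b \<in> carrier M"
  shows "gc_map N h (gc_diff M a b) = gc_diff N (h a) (h b)"
proof -
  interpret M: comm_monoid M by fact
  interpret N: comm_monoid N by fact
  have hc: "h x \<in> carrier N" if "x \<in> carrier M" for x using h that by (auto simp: hom_def)
  have hm: "h (x \<otimes>\<^bsub>M\<^esub> y) = h x \<otimes>\<^bsub>N\<^esub> h y" if "x \<in> carrier M" "y \<in> carrier M" for x y
    using h that by (auto simp: hom_def)
  have e: "gc_diff N (h a') (h b') = gc_diff N (h a) (h b)" if "(a', b') \<in> gc_diff M a b" for a' b'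
  proof -
    note A = M.gc_diff_mem[OF ab that]
    obtain e where e: "e \<in> carrier M" "a' \<otimes>\<^bsub>M\<^esub> b \<otimes>\<^bsub>M\<^esub> e = a \<otimes>\<^bsub>M\<^esub> b' \<otimes>\<^bsub>M\<^esub> e"
      using A ab M.gc_diff_eq_iff[of a' b' a b] by auto
    have "h (a' \<otimes>\<^bsub>M\<^esub> b \<otimes>\<^bsub>M\<^esub> e) = h (a \<otimes>\<^bsub>M\<^esub> b' \<otimes>\<^bsub>M\<^esub> e)"
      using e(2) by simp
    then have "h a' \<otimes>\<^bsub>N\<^esub> h b \<otimes>\<^bsub>N\<^esub> h e = h a \<otimes>\<^bsub>N\<^esub> h b' \<otimes>\<^bsub>N\<^esub> h e"
      using A ab e(1) by (simp add: hm)
    then show ?thesis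
      using A ab e(1) hc by (subst N.gc_diff_eq_iff) auto
  qed
  have "gc_map N h (gc_diff M a b) = (\<Union>(a', b')\<in>gc_diff M a b. gc_diff N (h a') (h b'))"
    by (simp add: gc_map_def gc_diff_def)
  also have "\<dots> = (\<Union>(a', b')\<in>gc_diff M a b. gc_diff N (h a) (h b))"
    using e by (intro SUP_cong refl) (auto split: prod.splits)
  also have "\<dots> = gc_diff N (h a) (h b)"
    using M.gc_diff_self[OF ab] by auto
  finally show ?thesis .
qed

lemma gc_map_hom:
  assumes M: "comm_monoid M" and N: "comm_monoid N" and h: "h \<in> hom M N"
  shows "gc_map N h \<in> hom (group_completion M) (group_completion N)"
proof -
  interpret M: comm_monoid M by fact
  interpret N: comm_monoid N by fact
  have hc: "h x \<in> carrier N" if "x \<in> carrier M" for x using h that by (auto simp: hom_def)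
  show ?thesis
  proof (rule homI)
    fix x assume "x \<in> carrier (group_completion M)"
    then obtain a b where "x = gc_diff M a b" "a \<in> carrier M" "b \<in> carrier M"
      unfolding M.gc_carrier by blast
    then show "gc_map N h x \<in> carrier (group_completion N)"
      using hc[of a] hc[of b] unfolding N.gc_carrier by (auto simp: gc_map_diff[OF M N h])
  next
    fix x y assume x: "x \<in> carrier (group_completion M)" and y: "y \<in> carrier (group_completion M)"
    obtain a b c d where ab: "x = gc_diff M a b" "a \<in> carrier M" "b \<in> carrier M"
      and cd: "y = gc_diff M c d" "c \<in> carrier M" "d \<in> carrier M"
      using x y unfolding M.gc_carrier by blast
    then show "gc_map N h (x \<otimes>\<^bsub>group_completion M\<^esub> y) = gc_map N h x \<otimes>\<^bsub>group_completion N\<^esub> gc_map N h y"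
      using h by (simp add: M.gc_mult N.gc_mult gc_map_diff[OF M N h] hc hom_mult)
  qed
qed

section \<open>The graded Grothendieck group of a graded ring\<close>

text \<open>The map x \<mapsto> x - i (p x) retracts D onto the kernel of p; together with p it
  splits D. The kernel is an \<open>equalizer\<close>, so it stays over the element type of
  D.\<close>

lemma split_kernel:
  assumes D: "gr_module R D" and P: "gr_module R P" and i: "i \<in> gr_module_hom R P D" and p: "p \<in> gr_module_hom R D P"
    and pi: "\<And>x. x \<in> carrier P \<Longrightarrow> p (i x) = x"
  shows "gr_isomorphic R D (direct_sum P (equalizer D p (\<lambda>_. \<one>\<^bsub>P\<^esub>)))"
    and "gr_module R (equalizer D p (\<lambda>_. \<one>\<^bsub>P\<^esub>))"
    and "fgproj R D \<Longrightarrow> fgproj R (equalizer D p (\<lambda>_. \<one>\<^bsub>P\<^esub>))"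
proof -
  interpret D: gr_module R D by fact
  interpret P: gr_module R P by fact
  let ?K = "equalizer D p (\<lambda>_. \<one>\<^bsub>P\<^esub>)"
  show K: "gr_module R ?K"
    by (rule gr_module_equalizer[OF D P p gmh_const_one[OF P]])
  let ?r = "\<lambda>x. x \<otimes>\<^bsub>D\<^esub> inv\<^bsub>D\<^esub> i (p x)"
  have ic: "i x \<in> carrier D" if "x \<in> carrier P" for x using gmh_closed[OF i that] .
  have pc: "p x \<in> carrier P" if "x \<in> carrier D" for x using gmh_closed[OF p that] .
  have pr: "p (?r x) = \<one>\<^bsub>P\<^esub>" if "x \<in> carrier D" for x
    using that by (simp add: gmh_mult[OF p] gmh_inv[OF p D P] ic pc pi)
  have rhom: "?r \<in> gr_module_hom R D D"
    by (rule gmh_prod[OF D gmh_id gmh_uminus[OF D gmh_comp[OF p i]]])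
  have r: "?r \<in> gr_module_hom R D ?K"
    by (rule gmh_into_equalizer[OF D rhom]) (rule pr)
  show "gr_isomorphic R D (direct_sum P ?K)"
  proof (rule gr_isomorphicI2)
    show "(\<lambda>x. (p x, ?r x)) \<in> gr_module_hom R D (direct_sum P ?K)"
      using p r by (auto simp: gr_module_hom_def hom_def Pi_iff image_subset_iff)
    show "(\<lambda>z. i (fst z) \<otimes>\<^bsub>D\<^esub> snd z) \<in> gr_module_hom R (direct_sum P ?K) D"
      by (rule gmh_prod[OF D gmh_comp[OF gmh_fst i] gmh_comp[OF gmh_snd gmh_equalizer_incl]])
    show "i (fst (p x, ?r x)) \<otimes>\<^bsub>D\<^esub> snd (p x, ?r x) = x" if "x \<in> carrier D" for x
      using that ic[OF pc[OF that]] by (simp add: D.M.m_lcomm[of "i (p x)" x])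
    show "(p (i (fst z) \<otimes>\<^bsub>D\<^esub> snd z), ?r (i (fst z) \<otimes>\<^bsub>D\<^esub> snd z)) = z" if "z \<in> carrier (direct_sum P ?K)" for z
    proof -
      obtain a b where ab: "z = (a, b)" by (cases z)
      have z: "a \<in> carrier P" "b \<in> carrier D" "p b = \<one>\<^bsub>P\<^esub>"
        using that unfolding ab by auto
      have "i a \<otimes>\<^bsub>D\<^esub> b \<otimes>\<^bsub>D\<^esub> inv\<^bsub>D\<^esub> i a = b"
        using z ic by (simp add: D.M.m_comm[of "i a" b] D.M.m_assoc)
      then show ?thesis
        using z by (simp add: ab gmh_mult[OF p] ic pi)
    qed
  qed
  show "fgproj R ?K" if f: "fgproj R D"
  proof (rule fgproj_retract[OF f K gmh_equalizer_incl r])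
    show "?r x = x" if "x \<in> carrier ?K" for x
      using that gmh_one[OF i P D] by simp
  qed
qed

text \<open>The complement is the kernel of the surjection that a dual basis of P defines on a sum
  of shifts of R. Its elements are functions on \<open>nat\<close>, so it is a tuple module whatever
  the type of P.\<close>

lemma fgproj_complement:
  fixes R :: "('g::ab_group_add, 'r, 'x) gring_scheme"
  assumes "fgproj R P"
  obtains n :: nat and d and P' :: "('g, 'r) tuple_module" where "fgproj R P'"
    "gr_isomorphic R (dsum {..<n} (\<lambda>i. shift (d i) (regular_module R))) (direct_sum P P')"
proof -
  obtain n x d f where B: "dual_basis R P {..<n::nat} x d f" and P: "gr_module R P"
    using assms by (auto simp: fgproj_def)
  interpret P: gr_module R P by fact
  let ?M = "\<lambda>i. shift (- d i) (regular_module R)"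
  let ?D = "dsum {..<n} ?M"
  have f: "fgproj R ?D"
    by (intro fgproj_dsum fgproj_shift fgproj_regular P.R.gr_ring_axioms) simp
  note D = fgproj_module[OF f]
  define io where "io p = (\<lambda>i\<in>{..<n}. f i p)" for p
  define pr where "pr s = finprod P (\<lambda>i. x i \<star>\<^bsub>P\<^esub> s i) {..<n}" for s
  have i: "io \<in> gr_module_hom R P ?D"
    unfolding io_def by (rule gmh_dsum) (rule dual_basisD(3)[OF B])
  have p: "pr \<in> gr_module_hom R ?D P"
    unfolding pr_def
  proof (rule gmh_sum[OF D P])
    fix i assume i: "i \<in> {..<n}"
    show "(\<lambda>s. x i \<star>\<^bsub>P\<^esub> s i) \<in> gr_module_hom R ?D P"
      by (rule gmh_comp[OF gmh_dproj[OF i, where M="?M"] gmh_ract_right[OF P dual_basisD(2)[OF B i]]])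
  qed
  have pi: "pr (io m) = m" if "m \<in> carrier P" for m
  proof -
    have "pr (io m) = finprod P (\<lambda>i. x i \<star>\<^bsub>P\<^esub> f i m) {..<n}"
      unfolding pr_def io_def
      by (rule P.M.finprod_cong') (use that dual_basis_facts[OF B P] in \<open>auto simp: P.ract_closed\<close>)
    then show ?thesis by (simp add: dual_basisD(4)[OF B that])
  qed
  have S: "gr_isomorphic R ?D (direct_sum P (equalizer ?D pr (\<lambda>_. \<one>\<^bsub>P\<^esub>)))"
    "fgproj R (equalizer ?D pr (\<lambda>_. \<one>\<^bsub>P\<^esub>))"
    using split_kernel[where i=io, OF D P i p] pi f by blast+
  show ?thesis
    using that[OF S(2) S(1)] .
qed

lemma K0_simps: "carrier (K0_group R) = carrier (group_completion (V_gr R))"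
  "monoid.mult (K0_group R) = monoid.mult (group_completion (V_gr R))"
  "one (K0_group R) = one (group_completion (V_gr R))"
  "act (K0_group R) \<alpha> = gc_map (V_gr R) (V_shift R \<alpha>)"
  "le (K0_group R) x y \<longleftrightarrow> y \<otimes>\<^bsub>group_completion (V_gr R)\<^esub> inv\<^bsub>group_completion (V_gr R)\<^esub> x \<in> K0_class R ` gr_fgp R"
  by (simp_all add: K0_group_def Let_def)

lemma K0_class_cong: "\<lbrakk>gr_isomorphic R M N; gr_module R M; gr_module R N\<rbrakk> \<Longrightarrow> K0_class R M = K0_class R N"
  unfolding K0_class_def using iso_class_cong by metis

lemma K0_class_in_image:
  fixes M :: "('g::ab_group_add, 'r, 'm) gmodule"
  assumes "fgproj R M"
  shows "K0_class R M \<in> K0_class R ` gr_fgp R"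
proof -
  obtain P :: "('g, 'r) tuple_module" where "fgproj R P" "gr_isomorphic R M P"
    using fgproj_tuple[OF assms] by blast
  then show ?thesis
    using K0_class_cong[of R M P] fgproj_module[OF assms] fgproj_module[of R P] by (auto simp: gr_fgp_iff)
qed

lemma V_shift_hom: "V_shift R \<alpha> \<in> hom (V_gr R) (V_gr R)"
proof (rule homI)
  fix X assume "X \<in> carrier (V_gr R)"
  then obtain P where "fgproj R P" "X = iso_class R P" "P \<in> gr_fgp R" by (elim V_carrierE)
  then show "V_shift R \<alpha> X \<in> carrier (V_gr R)"
    by (simp add: V_shift_class V_carrier fgproj_shift)
next
  fix X Y assume "X \<in> carrier (V_gr R)" "Y \<in> carrier (V_gr R)"
  then obtain P Q where "fgproj R P" "X = iso_class R P" "P \<in> gr_fgp R" "fgproj R Q" "Y = iso_class R Q" "Q \<in> gr_fgp R"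
    by (elim V_carrierE)
  then show "V_shift R \<alpha> (X \<otimes>\<^bsub>V_gr R\<^esub> Y) = V_shift R \<alpha> X \<otimes>\<^bsub>V_gr R\<^esub> V_shift R \<alpha> Y"
    by (simp add: V_shift_class V_mult fgproj_shift fgproj_direct_sum shift_direct_sum)
qed

context gr_ring
begin

sublocale V: comm_monoid "V_gr R"
  by (rule comm_monoid_V) (rule gr_ring_axioms)

sublocale GC: comm_group "group_completion (V_gr R)"
  by (rule V.comm_group_gc)

sublocale K0: comm_group "K0_group R"
  using GC.comm_group_axioms comm_group_struct_cong[of "K0_group R" "group_completion (V_gr R)"]
  by (simp add: K0_simps)

lemma K0_inv: "inv\<^bsub>K0_group R\<^esub> x = inv\<^bsub>group_completion (V_gr R)\<^esub> x"
  by (rule fun_cong[OF m_inv_struct_cong]) (simp_all add: K0_simps)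

lemma K0_class_closed: "fgproj R M \<Longrightarrow> K0_class R M \<in> carrier (K0_group R)"
  by (simp add: K0_class_def K0_simps V.gc_inj_closed V_carrier)

lemma K0_class_direct_sum:
  "\<lbrakk>fgproj R M; fgproj R N\<rbrakk> \<Longrightarrow> K0_class R (direct_sum M N) = K0_class R M \<otimes>\<^bsub>K0_group R\<^esub> K0_class R N"
  by (simp add: K0_class_def K0_simps V_mult[symmetric] V.gc_inj_mult V_carrier)

lemma K0_class_zero: "K0_class R zero_module = \<one>\<^bsub>K0_group R\<^esub>"
  by (simp add: K0_class_def K0_simps V_one[symmetric] V.gc_inj_one)

lemma K0_class_dsum:
  assumes "finite I" "\<And>i. i \<in> I \<Longrightarrow> fgproj R (M i)"
  shows "K0_class R (dsum I M) = finprod (K0_group R) (\<lambda>i. K0_class R (M i)) I"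
proof -
  have "iso_class R (dsum I M) = finprod (V_gr R) (\<lambda>i. iso_class R (M i)) I"
    by (rule V_dsum[OF gr_ring_axioms assms])
  then have "K0_class R (dsum I M) = finprod (group_completion (V_gr R)) (\<lambda>i. K0_class R (M i)) I"
    unfolding K0_class_def
    using V.gc_inj_finprod[of "\<lambda>i. iso_class R (M i)" I] V_carrier[OF assms(2)] by simp
  also have "\<dots> = finprod (K0_group R) (\<lambda>i. K0_class R (M i)) I"
    by (rule finprod_struct_cong) (simp_all add: K0_simps)
  finally show ?thesis .
qed

lemma K0_elem:
  assumes "x \<in> carrier (K0_group R)"
  obtains P Q where "P \<in> gr_fgp R" "Q \<in> gr_fgp R" "x = K0_class R P \<otimes>\<^bsub>K0_group R\<^esub> inv\<^bsub>K0_group R\<^esub> K0_class R Q"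
proof -
  obtain a b where "a \<in> carrier (V_gr R)" "b \<in> carrier (V_gr R)" and x: "x = gc_diff (V_gr R) a b"
    using assms by (auto simp: K0_simps V.gc_carrier)
  then obtain P Q where P: "P \<in> gr_fgp R" "a = iso_class R P" and Q: "Q \<in> gr_fgp R" "b = iso_class R Q"
    by (elim V_carrierE)
  then have "x = K0_class R P \<otimes>\<^bsub>K0_group R\<^esub> inv\<^bsub>K0_group R\<^esub> K0_class R Q"
    unfolding x by (simp add: V.gc_diff_inj V_carrier gr_fgp_iff K0_class_def K0_simps K0_inv)
  then show ?thesis using that P Q by blast
qed

lemma K0_class_eq_iff:
  assumes "fgproj R M" "fgproj R N"
  shows "K0_class R M = K0_class R N \<longleftrightarrow>
    (\<exists>Y\<in>carrier (V_gr R). iso_class R M \<otimes>\<^bsub>V_gr R\<^esub> Y = iso_class R N \<otimes>\<^bsub>V_gr R\<^esub> Y)"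
  by (simp add: K0_class_def V.gc_inj_eq_iff V_carrier assms)

lemma act_hom: "act (K0_group R) \<alpha> \<in> hom (K0_group R) (K0_group R)"
  using gc_map_hom[OF V.comm_monoid_axioms V.comm_monoid_axioms V_shift_hom[of R \<alpha>]]
  by (simp add: hom_def K0_simps)

lemma act_class: "fgproj R M \<Longrightarrow> act (K0_group R) \<alpha> (K0_class R M) = K0_class R (shift \<alpha> M)"
proof -
  assume M: "fgproj R M"
  have z: "shift \<alpha> zero_module = (zero_module :: (_, _, unit) gmodule)"
    by (simp add: zero_module_def shift_def)
  have "V_shift R \<alpha> \<one>\<^bsub>V_gr R\<^esub> = \<one>\<^bsub>V_gr R\<^esub>"
    by (simp add: V_one V_shift_class fgproj_zero gr_ring_axioms z)
  then show ?thesis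
    using gc_map_diff[OF V.comm_monoid_axioms V.comm_monoid_axioms V_shift_hom[of R \<alpha>] V_carrier[OF M] V.one_closed] M
    by (simp add: K0_simps K0_class_def V.gc_inj_diff V_shift_class)
qed

lemma K0_hom_eq:
  assumes "f \<in> hom (K0_group R) H" "g \<in> hom (K0_group R) H" "group H"
    and "\<And>P. P \<in> gr_fgp R \<Longrightarrow> f (K0_class R P) = g (K0_class R P)" and x: "x \<in> carrier (K0_group R)"
  shows "f x = g x"
proof -
  interpret f: group_hom "K0_group R" H f
    using assms by (simp add: group_hom_def group_hom_axioms_def K0.is_group)
  interpret g: group_hom "K0_group R" H g
    using assms by (simp add: group_hom_def group_hom_axioms_def K0.is_group)
  show ?thesis
    using K0_elem[OF x] assms(4) by (metis K0.inv_closed K0_class_closed f.hom_inv f.hom_mult g.hom_inv g.hom_mult gr_fgp_iff)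
qed

lemma pos_cone_K0: "pos_cone (K0_group R) = K0_class R ` gr_fgp R"
  by (auto simp: pos_cone_def K0_simps K0_class_closed[unfolded K0_simps] gr_fgp_iff
      GC.r_one GC.inv_one)

lemma K0_le_iff: "x \<preceq>\<^bsub>K0_group R\<^esub> y \<longleftrightarrow> y \<otimes>\<^bsub>K0_group R\<^esub> inv\<^bsub>K0_group R\<^esub> x \<in> K0_class R ` gr_fgp R"
  by (simp add: K0_simps K0_inv)

text \<open>The laws of the action are equations between additive maps, so they are checked on
  classes of modules. Transitivity and compatibility with the order reduce to the positive elements
  being closed under sums and shifts.\<close>

lemma preordered_K0: "preordered_group (K0_group R)"
proof (intro preordered_group.intro preordered_group_axioms.intro K0.comm_group_axioms)
  note le = K0_le_iff
  have cl: "K0_class R P \<otimes>\<^bsub>K0_group R\<^esub> K0_class R Q \<in> K0_class R ` gr_fgp R" if "P \<in> gr_fgp R" "Q \<in> gr_fgp R" for P Q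
    using that K0_class_in_image[of R "direct_sum P Q"] K0_class_direct_sum[of P Q] fgproj_direct_sum[of R P Q]
    by (simp add: gr_fgp_iff)
  fix x y \<alpha>
  assume x: "x \<in> carrier (K0_group R)"
  show "act (K0_group R) \<alpha> x \<in> carrier (K0_group R)"
    using act_hom x by (auto simp: hom_def)
  show "act (K0_group R) 0 x = x"
    by (rule K0_hom_eq[OF act_hom _ K0.is_group _ x]) (auto simp: hom_def act_class gr_fgp_iff shift_zero)
  show "act (K0_group R) (\<alpha> + \<beta>) x = act (K0_group R) \<alpha> (act (K0_group R) \<beta> x)" for \<beta>
  proof (rule K0_hom_eq[OF act_hom _ K0.is_group _ x])
    show "(\<lambda>x. act (K0_group R) \<alpha> (act (K0_group R) \<beta> x)) \<in> hom (K0_group R) (K0_group R)"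
      using hom_compose[OF act_hom act_hom] by (simp add: comp_def)
  qed (auto simp: act_class gr_fgp_iff shift_shift fgproj_shift)
  have "K0_class R zero_module \<in> K0_class R ` gr_fgp R"
    by (rule K0_class_in_image[OF fgproj_zero[OF gr_ring_axioms]])
  then show "x \<preceq>\<^bsub>K0_group R\<^esub> x"
    using x by (simp add: le K0_class_zero)
  assume y: "y \<in> carrier (K0_group R)"
  show "act (K0_group R) \<alpha> (x \<otimes>\<^bsub>K0_group R\<^esub> y) = act (K0_group R) \<alpha> x \<otimes>\<^bsub>K0_group R\<^esub> act (K0_group R) \<alpha> y"
    by (rule hom_mult[OF act_hom x y])
  show "x \<otimes>\<^bsub>K0_group R\<^esub> z \<preceq>\<^bsub>K0_group R\<^esub> y \<otimes>\<^bsub>K0_group R\<^esub> z" if z: "z \<in> carrier (K0_group R)" and xy: "x \<preceq>\<^bsub>K0_group R\<^esub> y" for z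
  proof -
    have "y \<otimes>\<^bsub>K0_group R\<^esub> z \<otimes>\<^bsub>K0_group R\<^esub> inv\<^bsub>K0_group R\<^esub> (x \<otimes>\<^bsub>K0_group R\<^esub> z) = y \<otimes>\<^bsub>K0_group R\<^esub> inv\<^bsub>K0_group R\<^esub> x"
      using x y z by (simp add: K0.inv_mult K0.m_ac)
    then show ?thesis using xy by (simp add: le)
  qed
  show "x \<preceq>\<^bsub>K0_group R\<^esub> z" if z: "z \<in> carrier (K0_group R)" and xy: "x \<preceq>\<^bsub>K0_group R\<^esub> y" and yz: "y \<preceq>\<^bsub>K0_group R\<^esub> z" for z
  proof -
    obtain P Q where "P \<in> gr_fgp R" "Q \<in> gr_fgp R" "y \<otimes>\<^bsub>K0_group R\<^esub> inv\<^bsub>K0_group R\<^esub> x = K0_class R P"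
      "z \<otimes>\<^bsub>K0_group R\<^esub> inv\<^bsub>K0_group R\<^esub> y = K0_class R Q"
      using xy yz by (auto simp: le)
    moreover have "z \<otimes>\<^bsub>K0_group R\<^esub> inv\<^bsub>K0_group R\<^esub> x =
        (z \<otimes>\<^bsub>K0_group R\<^esub> inv\<^bsub>K0_group R\<^esub> y) \<otimes>\<^bsub>K0_group R\<^esub> (y \<otimes>\<^bsub>K0_group R\<^esub> inv\<^bsub>K0_group R\<^esub> x)"
      using x y z by (simp add: K0.m_assoc[symmetric]) (simp add: K0.m_assoc)
    ultimately show ?thesis
      using cl by (simp add: le)
  qed
  show "act (K0_group R) \<alpha> x \<preceq>\<^bsub>K0_group R\<^esub> act (K0_group R) \<alpha> y" if xy: "x \<preceq>\<^bsub>K0_group R\<^esub> y"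
  proof -
    interpret a: group_hom "K0_group R" "K0_group R" "act (K0_group R) \<alpha>"
      by unfold_locales (rule act_hom)
    obtain P where P: "P \<in> gr_fgp R" "y \<otimes>\<^bsub>K0_group R\<^esub> inv\<^bsub>K0_group R\<^esub> x = K0_class R P"
      using xy by (auto simp: le)
    have "act (K0_group R) \<alpha> y \<otimes>\<^bsub>K0_group R\<^esub> inv\<^bsub>K0_group R\<^esub> act (K0_group R) \<alpha> x
        = act (K0_group R) \<alpha> (y \<otimes>\<^bsub>K0_group R\<^esub> inv\<^bsub>K0_group R\<^esub> x)"
      using x y by simp
    also have "\<dots> = K0_class R (shift \<alpha> P)"
      using P by (simp add: act_class gr_fgp_iff)
    also have "\<dots> \<in> K0_class R ` gr_fgp R"
      using P by (intro K0_class_in_image fgproj_shift) (simp add: gr_fgp_iff)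
    finally show ?thesis by (simp add: le)
  qed
qed

text \<open>If P has a complement P' in a sum of modules R(d i), then the sum of the d i [R] minus
  ([P] - [Q]) is the class of P' \<oplus> Q, hence positive.\<close>

lemma order_unit_K0: "order_unit (K0_group R) (K0_class R (regular_module R))"
  unfolding order_unit_def
proof (intro conjI ballI)
  note fr = fgproj_regular[OF gr_ring_axioms]
  show "K0_class R (regular_module R) \<in> pos_cone (K0_group R)"
    unfolding pos_cone_K0 by (rule K0_class_in_image[OF fr])
  fix x assume "x \<in> carrier (K0_group R)"
  then obtain P Q where P: "P \<in> gr_fgp R" and Q: "Q \<in> gr_fgp R"
    and x: "x = K0_class R P \<otimes>\<^bsub>K0_group R\<^esub> inv\<^bsub>K0_group R\<^esub> K0_class R Q"
    by (rule K0_elem)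
  have fP: "fgproj R P" "fgproj R Q" using P Q by (simp_all add: gr_fgp_iff)
  show "\<exists>\<alpha>s. x \<preceq>\<^bsub>K0_group R\<^esub> finprod (K0_group R) (\<lambda>i. act (K0_group R) (\<alpha>s ! i) (K0_class R (regular_module R))) {..<length \<alpha>s}"
  proof (rule fgproj_complement[OF fP(1)])
    fix n :: nat and d and P' :: "('g, 'r) tuple_module"
    assume P': "fgproj R P'" and iso: "gr_isomorphic R (dsum {..<n} (\<lambda>i. shift (d i) (regular_module R))) (direct_sum P P')"
    let ?\<alpha>s = "map d [0..<n]"
    have "finprod (K0_group R) (\<lambda>i. act (K0_group R) (?\<alpha>s ! i) (K0_class R (regular_module R))) {..<length ?\<alpha>s} =
      finprod (K0_group R) (\<lambda>i. K0_class R (shift (d i) (regular_module R))) {..<n}"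
      by (rule K0.finprod_cong') (auto simp: act_class fr fgproj_shift K0_class_closed)
    also have "\<dots> = K0_class R (dsum {..<n} (\<lambda>i. shift (d i) (regular_module R)))"
      by (rule K0_class_dsum[symmetric]) (auto simp: fgproj_shift fr)
    also have "\<dots> = K0_class R (direct_sum P P')"
      by (rule K0_class_cong[OF iso fgproj_module fgproj_module])
        (auto simp: fgproj_shift fr P' fP intro!: fgproj_dsum[OF gr_ring_axioms] fgproj_direct_sum)
    also have "\<dots> = K0_class R P \<otimes>\<^bsub>K0_group R\<^esub> K0_class R P'"
      by (rule K0_class_direct_sum[OF fP(1) P'])
    finally have s: "finprod (K0_group R) (\<lambda>i. act (K0_group R) (?\<alpha>s ! i) (K0_class R (regular_module R))) {..<length ?\<alpha>s} =
      K0_class R P \<otimes>\<^bsub>K0_group R\<^esub> K0_class R P'" .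
    have c: "K0_class R P \<in> carrier (K0_group R)" "K0_class R P' \<in> carrier (K0_group R)" "K0_class R Q \<in> carrier (K0_group R)"
      using fP P' by (simp_all add: K0_class_closed)
    have "K0_class R P \<otimes>\<^bsub>K0_group R\<^esub> K0_class R P' \<otimes>\<^bsub>K0_group R\<^esub> inv\<^bsub>K0_group R\<^esub> x = K0_class R P' \<otimes>\<^bsub>K0_group R\<^esub> K0_class R Q"
      unfolding x using c by (simp add: K0.inv_mult K0.m_ac)
    also have "\<dots> = K0_class R (direct_sum P' Q)"
      by (rule K0_class_direct_sum[OF P' fP(2), symmetric])
    also have "\<dots> \<in> K0_class R ` gr_fgp R"
      by (rule K0_class_in_image[OF fgproj_direct_sum[OF P' fP(2)]])
    finally show ?thesis
      using s by (intro exI[of _ ?\<alpha>s]) (simp add: K0_le_iff)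
  qed
qed

end

section \<open>Functoriality\<close>

context gr_hom
begin

lemma V_map_hom: "V_map R S \<phi> \<in> hom (V_gr R) (V_gr S)"
proof (rule homI)
  fix X assume "X \<in> carrier (V_gr R)"
  then obtain P where P: "fgproj R P" "X = iso_class R P" "P \<in> gr_fgp R" by (elim V_carrierE)
  obtain Q :: "('g, 's) tuple_module" and u where E: "ext_scalars R S \<phi> P Q u" by (rule ext_scalars_exists[OF P(1)])
  then show "V_map R S \<phi> X \<in> carrier (V_gr S)"
    using ext_scalarsD(5)[OF E] P by (simp add: V_map_class[OF E] V_carrier)
next
  fix X Y assume "X \<in> carrier (V_gr R)" "Y \<in> carrier (V_gr R)"
  then obtain P P' where P: "fgproj R P" "X = iso_class R P" "P \<in> gr_fgp R" and P': "fgproj R P'" "Y = iso_class R P'" "P' \<in> gr_fgp R"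
    by (elim V_carrierE)
  obtain Q :: "('g, 's) tuple_module" and u where E: "ext_scalars R S \<phi> P Q u" by (rule ext_scalars_exists[OF P(1)])
  obtain Q' :: "('g, 's) tuple_module" and u' where E': "ext_scalars R S \<phi> P' Q' u'" by (rule ext_scalars_exists[OF P'(1)])
  show "V_map R S \<phi> (X \<otimes>\<^bsub>V_gr R\<^esub> Y) = V_map R S \<phi> X \<otimes>\<^bsub>V_gr S\<^esub> V_map R S \<phi> Y"
    using P P' V_map_class[OF E] V_map_class[OF E'] V_map_class[OF ext_scalars_direct_sum[OF E E']]
      ext_scalarsD(5)[OF E] ext_scalarsD(5)[OF E']
    by (simp add: V_mult)
qed

lemma K0_map_hom: "K0_map R S \<phi> \<in> hom (K0_group R) (K0_group S)"
proof -
  have "gc_map (V_gr S) (V_map R S \<phi>) \<in> hom (K0_group R) (K0_group S)"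
    using gc_map_hom[OF R.V.comm_monoid_axioms S.V.comm_monoid_axioms V_map_hom]
    by (simp add: hom_def K0_simps)
  then show ?thesis
    by (intro homI) (auto simp: K0_map_def hom_def)
qed

text \<open>This reduces every computation with \<open>K0_map\<close> to exhibiting some extension
  of scalars. As \<open>gc_inj\<close> pairs a class with the neutral element, the class of the zero
  module has to be followed as well.\<close>

lemma K0_map_class:
  assumes E: "ext_scalars R S \<phi> P Q u"
  shows "K0_map R S \<phi> (K0_class R P) = K0_class S Q"
proof -
  note D = ext_scalarsD[OF E]
  have "V_map R S \<phi> \<one>\<^bsub>V_gr R\<^esub> = \<one>\<^bsub>V_gr S\<^esub>"
    unfolding V_one by (rule V_map_class[OF ext_scalars_zero])
  then have "gc_map (V_gr S) (V_map R S \<phi>) (K0_class R P) = K0_class S Q"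
    using gc_map_diff[OF R.V.comm_monoid_axioms S.V.comm_monoid_axioms V_map_hom V_carrier[OF D(4)] R.V.one_closed]
    by (simp add: K0_class_def R.V.gc_inj_diff S.V.gc_inj_diff V_map_class[OF E])
  then show ?thesis
    using R.K0_class_closed[OF D(4)] by (simp add: K0_map_def)
qed

lemma K0_map_pogroup_hom: "K0_map R S \<phi> \<in> pogroup_hom (K0_obj R) (K0_obj S)"
proof -
  have "K0_map R S \<phi> (act (K0_group R) \<alpha> x) = act (K0_group S) \<alpha> (K0_map R S \<phi> x)" if x: "x \<in> carrier (K0_group R)" for \<alpha> x
  proof (rule R.K0_hom_eq[OF _ _ S.K0.is_group _ x])
    show "(\<lambda>x. K0_map R S \<phi> (act (K0_group R) \<alpha> x)) \<in> hom (K0_group R) (K0_group S)"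
      using hom_compose[OF R.act_hom K0_map_hom] by (simp add: comp_def)
    show "(\<lambda>x. act (K0_group S) \<alpha> (K0_map R S \<phi> x)) \<in> hom (K0_group R) (K0_group S)"
      using hom_compose[OF K0_map_hom S.act_hom] by (simp add: comp_def)
    fix P assume "P \<in> gr_fgp R"
    then have P: "fgproj R P" by (simp add: gr_fgp_iff)
    obtain Q :: "('g, 's) tuple_module" and u where E: "ext_scalars R S \<phi> P Q u" by (rule ext_scalars_exists[OF P])
    show "K0_map R S \<phi> (act (K0_group R) \<alpha> (K0_class R P)) = act (K0_group S) \<alpha> (K0_map R S \<phi> (K0_class R P))"
      using K0_map_class[OF E] K0_map_class[OF ext_scalars_shift[OF E, of \<alpha>]] P ext_scalarsD(5)[OF E]
      by (simp add: R.act_class S.act_class)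
  qed
  moreover have "K0_map R S \<phi> ` pos_cone (K0_group R) \<subseteq> pos_cone (K0_group S)"
    unfolding R.pos_cone_K0 S.pos_cone_K0
  proof safe
    fix P assume "P \<in> gr_fgp R"
    then have P: "fgproj R P" by (simp add: gr_fgp_iff)
    obtain Q :: "('g, 's) tuple_module" and u where E: "ext_scalars R S \<phi> P Q u" by (rule ext_scalars_exists[OF P])
    show "K0_map R S \<phi> (K0_class R P) \<in> K0_class S ` gr_fgp S"
      using K0_map_class[OF E] K0_class_in_image[OF ext_scalarsD(5)[OF E]] by simp
  qed
  moreover have "K0_map R S \<phi> \<in> extensional (carrier (K0_group R))"
    by (simp add: K0_map_def)
  ultimately show ?thesis
    using K0_map_hom K0_map_class[OF ext_scalars_regular] by (simp add: pogroup_hom_def K0_obj_def)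
qed

lemma K0_map_eqI:
  assumes "g \<in> hom (K0_group R) (K0_group S)" "g \<in> extensional (carrier (K0_group R))"
    and "\<And>P. P \<in> gr_fgp R \<Longrightarrow> K0_map R S \<phi> (K0_class R P) = g (K0_class R P)"
  shows "K0_map R S \<phi> = g"
proof (rule extensionalityI[OF _ assms(2)])
  show "K0_map R S \<phi> \<in> extensional (carrier (K0_group R))"
    by (simp add: K0_map_def)
qed (rule R.K0_hom_eq[OF K0_map_hom assms(1) S.K0.is_group assms(3)])

end

text \<open>Morphisms of the categories are extensional functions, whereas plain composites and the
  identity are not; the two agree on the carrier, and that is enough here.\<close>

lemma ext_scalars_cong:
  assumes E: "ext_scalars R S \<phi> P Q u" and eq: "\<And>r. r \<in> carrier R \<Longrightarrow> \<psi> r = \<phi> r"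
  shows "ext_scalars R S \<psi> P Q u"
proof -
  obtain n x d f g where B: "dual_basis R P {..<n::nat} x d f" and C: "dual_basis S Q {..<n} (\<lambda>i. u (x i)) d g"
    and gu: "\<forall>i<n. \<forall>p\<in>carrier P. g i (u p) = \<phi> (f i p)"
    using E by (auto simp: ext_scalars_def)
  note D = ext_scalarsD[OF E]
  have "\<forall>i<n. \<forall>p\<in>carrier P. g i (u p) = \<psi> (f i p)"
    using gu dual_basis_facts(2)[OF B D(1)] by (simp add: eq)
  moreover have "u \<in> semilinear R \<psi> P Q"
    using D(3) by (auto simp: semilinear_def eq)
  ultimately show ?thesis
    using B C D unfolding ext_scalars_def by blast
qed

lemma gr_hom_cong:
  assumes "gr_hom R S \<phi>" "\<And>r. r \<in> carrier R \<Longrightarrow> \<psi> r = \<phi> r"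
  shows "gr_hom R S \<psi>"
proof -
  interpret gr_hom R S \<phi> by fact
  have "\<psi> \<in> ring_hom R S"
    using ring_hom assms(2) by (auto simp: ring_hom_def Pi_iff)
  then show ?thesis
    using assms(2) hom_grade R.grade_carrier by unfold_locales auto
qed

lemma K0_map_ident:
  assumes "gr_ring R"
  shows "K0_map R R (\<lambda>r\<in>carrier R. r) = (\<lambda>x\<in>carrier (K0_group R). x)"
proof -
  interpret gr_hom R R "\<lambda>r\<in>carrier R. r"
    by (rule gr_hom_cong[OF gr_hom_id[OF assms]]) simp
  show ?thesis
  proof (rule K0_map_eqI)
    show "(\<lambda>x\<in>carrier (K0_group R). x) \<in> hom (K0_group R) (K0_group R)"
      by (auto simp: hom_def)
    fix P assume "P \<in> gr_fgp R"
    then have P: "fgproj R P" by (simp add: gr_fgp_iff)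
    have "ext_scalars R R (\<lambda>r\<in>carrier R. r) P P (\<lambda>p. p)"
      by (rule ext_scalars_cong[OF ext_scalars_id[OF P]]) simp
    then show "K0_map R R (\<lambda>r\<in>carrier R. r) (K0_class R P) = (\<lambda>x\<in>carrier (K0_group R). x) (K0_class R P)"
      using K0_map_class R.K0_class_closed[OF P] by simp
  qed simp
qed

lemma K0_map_compose:
  fixes R :: "('g::ab_group_add, 'r, 'x) gring_scheme" and S :: "('g, 's, 'y) gring_scheme"
    and T :: "('g, 't, 'z) gring_scheme"
  assumes \<phi>: "gr_hom R S \<phi>" and \<psi>: "gr_hom S T \<psi>"
  shows "K0_map R T (compose (carrier R) \<psi> \<phi>) = compose (carrier (K0_group R)) (K0_map S T \<psi>) (K0_map R S \<phi>)"
proof -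
  interpret a: gr_hom R S \<phi> by fact
  interpret b: gr_hom S T \<psi> by fact
  interpret c: gr_hom R T "compose (carrier R) \<psi> \<phi>"
    by (rule gr_hom_cong[OF gr_hom_comp[OF assms]]) (simp add: compose_def)
  show ?thesis
  proof (rule c.K0_map_eqI)
    have "K0_map S T \<psi> \<circ> K0_map R S \<phi> \<in> hom (K0_group R) (K0_group T)"
      by (rule hom_compose[OF a.K0_map_hom b.K0_map_hom])
    then show "compose (carrier (K0_group R)) (K0_map S T \<psi>) (K0_map R S \<phi>) \<in> hom (K0_group R) (K0_group T)"
      by (auto simp: hom_def compose_def)
    fix P assume "P \<in> gr_fgp R"
    then have P: "fgproj R P" by (simp add: gr_fgp_iff)
    obtain Q :: "('g, 's) tuple_module" and u where E: "ext_scalars R S \<phi> P Q u" by (rule a.ext_scalars_exists[OF P])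
    obtain W :: "('g, 't) tuple_module" and w where E2: "ext_scalars S T \<psi> Q W w" by (rule b.ext_scalars_exists[OF ext_scalarsD(5)[OF E]])
    have "ext_scalars R T (compose (carrier R) \<psi> \<phi>) P W (\<lambda>p. w (u p))"
      by (rule ext_scalars_cong[OF ext_scalars_comp[OF \<phi> \<psi> E E2]]) (simp add: compose_def)
    then show "K0_map R T (compose (carrier R) \<psi> \<phi>) (K0_class R P) =
        compose (carrier (K0_group R)) (K0_map S T \<psi>) (K0_map R S \<phi>) (K0_class R P)"
      using c.K0_map_class a.K0_map_class[OF E] b.K0_map_class[OF E2] a.R.K0_class_closed[OF P]
      by (simp add: compose_def)
  qed (simp add: compose_def)
qed

section \<open>Krull-Schmidt theory: cancellation, primality and rings built from such
  modules\<close>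

section \<open>Cancellation and exchange for modules with division endomorphism rings\<close>

text \<open>For nonzero X this says that the ring of degree-preserving endomorphisms is a division
  ring. Endomorphisms of other degrees are not considered, and a shift does not change which maps
  preserve degree. The zero module satisfies the condition too, and the lemmas below cover that
  case.\<close>

definition brick :: "('g::ab_group_add, 'r, 'x) gring_scheme \<Rightarrow> ('g, 'r, 'm) gmodule \<Rightarrow> bool" where
  "brick R X \<longleftrightarrow> gr_module R X \<and>
    (\<forall>h\<in>gr_module_hom R X X. (\<exists>x\<in>carrier X. h x \<noteq> \<one>\<^bsub>X\<^esub>) \<longrightarrow> bij_betw h (carrier X) (carrier X))"

lemma brick_shift:
  assumes "brick R X"
  shows "brick R (shift \<alpha> X)"
proof -
  have "h \<in> gr_module_hom R X X" if "h \<in> gr_module_hom R (shift \<alpha> X) (shift \<alpha> X)" for h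
    using gmh_shift[OF that, of "- \<alpha>"] by (simp add: shift_shift shift_zero)
  then show ?thesis
    using assms by (auto simp: brick_def gr_module_shift)
qed

text \<open>Gaussian elimination: F is a 2 by 2 matrix of maps whose corner a : X \<rightarrow> X is
  invertible; let b be the corner P \<rightarrow> X. The isomorphism is the corner Q \<rightarrow> P
  of the inverse matrix G. For F (x, p) in Q the equation a x + b p = 0 determines x from p, which
  gives injectivity, and it can be solved for x, which gives surjectivity.\<close>

lemma cancel_pivot:
  assumes X: "gr_module R X" and P: "gr_module R P" and Q: "gr_module R Q"
    and F: "F \<in> gr_module_hom R (direct_sum X P) (direct_sum X Q)"
    and G: "G \<in> gr_module_hom R (direct_sum X Q) (direct_sum X P)"
    and GF: "\<And>z. z \<in> carrier X \<times> carrier P \<Longrightarrow> G (F z) = z" and FG: "\<And>z. z \<in> carrier X \<times> carrier Q \<Longrightarrow> F (G z) = z"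
    and a: "bij_betw (\<lambda>x. fst (F (x, \<one>\<^bsub>P\<^esub>))) (carrier X) (carrier X)"
  shows "gr_isomorphic R P Q"
proof -
  interpret X: gr_module R X by fact
  interpret P: gr_module R P by fact
  interpret Q: gr_module R Q by fact
  let ?a = "\<lambda>x. fst (F (x, \<one>\<^bsub>P\<^esub>))" and ?b = "\<lambda>p. fst (F (\<one>\<^bsub>X\<^esub>, p))"
  have Fc: "F z \<in> carrier X \<times> carrier Q" if "z \<in> carrier X \<times> carrier P" for z
    using gmh_closed[OF F, of z] that by simp
  have Gc: "G z \<in> carrier X \<times> carrier P" if "z \<in> carrier X \<times> carrier Q" for z
    using gmh_closed[OF G, of z] that by simp
  have ac: "?a x \<in> carrier X" if "x \<in> carrier X" for x using Fc[of "(x, \<one>\<^bsub>P\<^esub>)"] that by (auto simp: mem_Times_iff)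
  have bc: "?b p \<in> carrier X" if "p \<in> carrier P" for p using Fc[of "(\<one>\<^bsub>X\<^esub>, p)"] that by (auto simp: mem_Times_iff)
  have ab: "fst (F (x, p)) = ?a x \<otimes>\<^bsub>X\<^esub> ?b p" if "x \<in> carrier X" "p \<in> carrier P" for x p
  proof -
    have "F (x, p) = F (x, \<one>\<^bsub>P\<^esub>) \<otimes>\<^bsub>direct_sum X Q\<^esub> F (\<one>\<^bsub>X\<^esub>, p)"
      using gmh_mult[OF F, of "(x, \<one>\<^bsub>P\<^esub>)" "(\<one>\<^bsub>X\<^esub>, p)"] that by simp
    then show ?thesis by (cases "F (x, \<one>\<^bsub>P\<^esub>)"; cases "F (\<one>\<^bsub>X\<^esub>, p)") simp
  qed
  let ?w = "\<lambda>q. snd (G (\<one>\<^bsub>X\<^esub>, q))"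
  have w: "?w \<in> gr_module_hom R Q P"
    by (rule gmh_comp[OF gmh_comp[OF gmh_inr[OF X] G] gmh_snd])
  have "bij_betw ?w (carrier Q) (carrier P)"
    unfolding bij_betw_def
  proof
    show "inj_on ?w (carrier Q)"
    proof
      fix q q' assume q: "q \<in> carrier Q" "q' \<in> carrier Q" and e: "?w q = ?w q'"
      obtain x p where xp: "G (\<one>\<^bsub>X\<^esub>, q) = (x, p)" by (cases "G (\<one>\<^bsub>X\<^esub>, q)")
      obtain x' p' where xp': "G (\<one>\<^bsub>X\<^esub>, q') = (x', p')" by (cases "G (\<one>\<^bsub>X\<^esub>, q')")
      have c: "x \<in> carrier X" "p \<in> carrier P" "x' \<in> carrier X" "p' \<in> carrier P"
        using Gc[of "(\<one>\<^bsub>X\<^esub>, q)"] Gc[of "(\<one>\<^bsub>X\<^esub>, q')"] q xp xp' by auto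
      have pp: "p' = p" using e xp xp' by simp
      have F1: "F (x, p) = (\<one>\<^bsub>X\<^esub>, q)" "F (x', p) = (\<one>\<^bsub>X\<^esub>, q')"
        using FG[of "(\<one>\<^bsub>X\<^esub>, q)"] FG[of "(\<one>\<^bsub>X\<^esub>, q')"] q xp xp' pp by auto
      have "?a x \<otimes>\<^bsub>X\<^esub> ?b p = ?a x' \<otimes>\<^bsub>X\<^esub> ?b p"
        using ab[of x p] ab[of x' p] c F1 by simp
      then have "?a x = ?a x'"
        using c ac bc by simp
      then have "x = x'"
        using a c by (auto simp: bij_betw_def inj_on_def)
      then show "q = q'" using F1 by simp
    qed
    show "?w ` carrier Q = carrier P"
    proof
      show "?w ` carrier Q \<subseteq> carrier P" using gmh_closed[OF w] by blast
      show "carrier P \<subseteq> ?w ` carrier Q"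
      proof
        fix p assume p: "p \<in> carrier P"
        have "inv\<^bsub>X\<^esub> ?b p \<in> ?a ` carrier X"
          using a bc[OF p] by (auto simp: bij_betw_def)
        then obtain x where x: "x \<in> carrier X" "?a x = inv\<^bsub>X\<^esub> ?b p" by auto
        have f: "fst (F (x, p)) = \<one>\<^bsub>X\<^esub>"
          using ab[OF x(1) p] x(2) bc[OF p] by simp
        obtain q where q: "F (x, p) = (\<one>\<^bsub>X\<^esub>, q)" using f by (cases "F (x, p)") auto
        have "q \<in> carrier Q" using Fc[of "(x, p)"] q x p by auto
        moreover have "G (\<one>\<^bsub>X\<^esub>, q) = (x, p)" using GF[of "(x, p)"] q x p by auto
        ultimately show "p \<in> ?w ` carrier Q" by (intro image_eqI[of _ _ q]) auto
      qed
    qed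
  qed
  then have "gr_isomorphic R Q P" using w by (rule gr_isomorphicI[rotated])
  then show ?thesis by (rule gr_isomorphic_sym[OF _ Q P])
qed

text \<open>If the corner X \<rightarrow> X of F is nonzero, it is bijective and serves as pivot. If
  it vanishes, F is first composed with an elementary automorphism of X \<oplus> P that turns this
  corner into the identity.\<close>

lemma brick_cancel:
  assumes X: "brick R X" and P: "gr_module R P" and Q: "gr_module R Q"
    and iso: "gr_isomorphic R (direct_sum X P) (direct_sum X Q)"
  shows "gr_isomorphic R P Q"
proof -
  have Xm: "gr_module R X" using X by (simp add: brick_def)
  interpret X: gr_module R X by fact
  interpret P: gr_module R P by fact
  interpret Q: gr_module R Q by fact
  obtain F G where F: "F \<in> gr_module_hom R (direct_sum X P) (direct_sum X Q)"
    and G: "G \<in> gr_module_hom R (direct_sum X Q) (direct_sum X P)"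
    and GF: "\<And>z. z \<in> carrier (direct_sum X P) \<Longrightarrow> G (F z) = z" and FG: "\<And>z. z \<in> carrier (direct_sum X Q) \<Longrightarrow> F (G z) = z"
    using gr_isomorphicE[OF iso gr_module_direct_sum[OF Xm P] gr_module_direct_sum[OF Xm Q]] by metis
  let ?a = "\<lambda>x. fst (F (x, \<one>\<^bsub>P\<^esub>))"
  have a: "?a \<in> gr_module_hom R X X"
    by (rule gmh_comp[OF gmh_comp[OF gmh_inl[OF P] F] gmh_fst])
  show ?thesis
  proof (cases "\<exists>x\<in>carrier X. ?a x \<noteq> \<one>\<^bsub>X\<^esub>")
    case True
    then have "bij_betw ?a (carrier X) (carrier X)"
      using X a by (simp add: brick_def)
    then show ?thesis
      using cancel_pivot[OF Xm P Q F G] GF FG by simp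
  next
    case False
    then have a1: "?a x = \<one>\<^bsub>X\<^esub>" if "x \<in> carrier X" for x using that by auto
    \<comment> \<open>The corner X \<rightarrow> P of G. The entry of F G = 1 at X reads a a' + b c
      = 1; with a = 0 it becomes b c = 1, and b c is the corner of F once c x has been added to the
      P-component.\<close>
    let ?c = "\<lambda>x. snd (G (x, \<one>\<^bsub>Q\<^esub>))"
    have c: "?c \<in> gr_module_hom R X P"
      by (rule gmh_comp[OF gmh_comp[OF gmh_inl[OF Q] G] gmh_snd])
    have cc: "?c x \<in> carrier P" if "x \<in> carrier X" for x using gmh_closed[OF c that] .
    let ?E = "\<lambda>z. (fst z, snd z \<otimes>\<^bsub>P\<^esub> ?c (fst z))" and ?E' = "\<lambda>z. (fst z, snd z \<otimes>\<^bsub>P\<^esub> inv\<^bsub>P\<^esub> ?c (fst z))"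
    have pair: "(\<lambda>z. (f z, g z)) \<in> gr_module_hom R (direct_sum X P) (direct_sum X P)"
      if "f \<in> gr_module_hom R (direct_sum X P) X" "g \<in> gr_module_hom R (direct_sum X P) P" for f g
      using that by (auto simp: gr_module_hom_def hom_def Pi_iff image_subset_iff)
    have E: "?E \<in> gr_module_hom R (direct_sum X P) (direct_sum X P)"
      by (rule pair[OF gmh_fst gmh_prod[OF P gmh_snd gmh_comp[OF gmh_fst c]]])
    have E': "?E' \<in> gr_module_hom R (direct_sum X P) (direct_sum X P)"
      by (rule pair[OF gmh_fst gmh_prod[OF P gmh_snd gmh_comp[OF gmh_fst gmh_uminus[OF P c]]]])
    have Gc: "G z \<in> carrier (direct_sum X P)" if "z \<in> carrier X \<times> carrier Q" for z
      using gmh_closed[OF G, of z] that by simp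
    have Fc: "F z \<in> carrier (direct_sum X Q)" if "z \<in> carrier X \<times> carrier P" for z
      using gmh_closed[OF F, of z] that by simp
    show ?thesis
    proof (rule cancel_pivot[OF Xm P Q gmh_comp[OF E F] gmh_comp[OF G E']])
      fix z assume z: "z \<in> carrier X \<times> carrier P"
      then have "?E z \<in> carrier (direct_sum X P)" by (auto simp: cc)
      then show "?E' (G (F (?E z))) = z"
        using z cc by (auto simp: GF P.M.m_assoc simp del: direct_sum_simps)
    next
      fix z assume z: "z \<in> carrier X \<times> carrier Q"
      then have Gz: "G z \<in> carrier (direct_sum X P)" by (rule Gc)
      have "?E (?E' (G z)) = G z"
        using Gz cc by (cases "G z") (auto simp: P.M.m_assoc)
      then show "F (?E (?E' (G z))) = z"
        using FG[of z] z by simp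
    next
      have "fst (F (?E (x, \<one>\<^bsub>P\<^esub>))) = x" if x: "x \<in> carrier X" for x
      proof -
        obtain a' where G1: "G (x, \<one>\<^bsub>Q\<^esub>) = (a', ?c x)" "a' \<in> carrier X"
          using Gc[of "(x, \<one>\<^bsub>Q\<^esub>)"] x by (cases "G (x, \<one>\<^bsub>Q\<^esub>)") auto
        have split: "fst (F (y, p)) = ?a y \<otimes>\<^bsub>X\<^esub> fst (F (\<one>\<^bsub>X\<^esub>, p))" if "y \<in> carrier X" "p \<in> carrier P" for y p
        proof -
          have "F (y, p) = F (y, \<one>\<^bsub>P\<^esub>) \<otimes>\<^bsub>direct_sum X Q\<^esub> F (\<one>\<^bsub>X\<^esub>, p)"
            using gmh_mult[OF F, of "(y, \<one>\<^bsub>P\<^esub>)" "(\<one>\<^bsub>X\<^esub>, p)"] that by simp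
          then show ?thesis by (cases "F (y, \<one>\<^bsub>P\<^esub>)"; cases "F (\<one>\<^bsub>X\<^esub>, p)") simp
        qed
        have "fst (F (x, ?c x)) = fst (F (a', ?c x))"
          using split[OF x cc[OF x]] split[OF G1(2) cc[OF x]] a1[OF x] a1[OF G1(2)] by simp
        also have "\<dots> = x" using FG[of "(x, \<one>\<^bsub>Q\<^esub>)"] G1(1) x by simp
        finally show ?thesis using cc[OF x] by simp
      qed
      then show "bij_betw (\<lambda>x. fst (F (?E (x, \<one>\<^bsub>P\<^esub>)))) (carrier X) (carrier X)"
        by (intro bij_betwI[of _ _ _ "\<lambda>x. x"]) auto
    qed
  qed
qed

text \<open>Correcting j by the inverse of the bijection k j gives a section of k, so X splits off
  from P with the kernel of k as complement.\<close>

lemma brick_split: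
  assumes X: "gr_module R X" and P: "gr_module R P" and j: "j \<in> gr_module_hom R X P" and k: "k \<in> gr_module_hom R P X"
    and b: "bij_betw (\<lambda>x. k (j x)) (carrier X) (carrier X)"
  shows "\<exists>P1 :: ('g::ab_group_add, 'r, 'm) gmodule. gr_module R P1 \<and>
    gr_isomorphic R (P :: ('g, 'r, 'm) gmodule) (direct_sum X P1) \<and> (fgproj R P \<longrightarrow> fgproj R P1)"
proof -
  obtain m where m: "m \<in> gr_module_hom R X X" and km: "\<And>x. x \<in> carrier X \<Longrightarrow> k (j (m x)) = x"
    using gmh_inverse[OF X X gmh_comp[OF j k] b] by metis
  have jm: "(\<lambda>x. j (m x)) \<in> gr_module_hom R X P"
    by (rule gmh_comp[OF m j])
  show ?thesis
    using split_kernel[OF P X jm k km] by blast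
qed

text \<open>The identity of X is a sum of two endomorphisms, one through P and one through P'. They
  cannot both vanish unless X is zero, and a nonvanishing one is bijective. This is the locality of
  a division ring, and it makes the class of X prime for direct sums.\<close>

lemma brick_exchange:
  assumes X: "brick R X" and P: "gr_module R P" and P': "gr_module R P'" and Y: "gr_module R Y"
    and iso: "gr_isomorphic R (direct_sum P P') (direct_sum X Y)"
  shows "(\<exists>j k. j \<in> gr_module_hom R X P \<and> k \<in> gr_module_hom R P X \<and> bij_betw (\<lambda>x. k (j x)) (carrier X) (carrier X)) \<or>
    (\<exists>j k. j \<in> gr_module_hom R X P' \<and> k \<in> gr_module_hom R P' X \<and> bij_betw (\<lambda>x. k (j x)) (carrier X) (carrier X))"
proof -
  have Xm: "gr_module R X" using X by (simp add: brick_def)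
  interpret X: gr_module R X by fact
  interpret P: gr_module R P by fact
  interpret P': gr_module R P' by fact
  interpret Y: gr_module R Y by fact
  obtain F G where F: "F \<in> gr_module_hom R (direct_sum P P') (direct_sum X Y)"
    and G: "G \<in> gr_module_hom R (direct_sum X Y) (direct_sum P P')"
    and FG: "\<And>z. z \<in> carrier (direct_sum X Y) \<Longrightarrow> F (G z) = z"
    using gr_isomorphicE[OF iso gr_module_direct_sum[OF P P'] gr_module_direct_sum[OF Xm Y]] by metis
  let ?j = "\<lambda>x. fst (G (x, \<one>\<^bsub>Y\<^esub>))" and ?j' = "\<lambda>x. snd (G (x, \<one>\<^bsub>Y\<^esub>))"
  let ?k = "\<lambda>p. fst (F (p, \<one>\<^bsub>P'\<^esub>))" and ?k' = "\<lambda>p. fst (F (\<one>\<^bsub>P\<^esub>, p))"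
  have j: "?j \<in> gr_module_hom R X P" by (rule gmh_comp[OF gmh_comp[OF gmh_inl[OF Y] G] gmh_fst])
  have j': "?j' \<in> gr_module_hom R X P'" by (rule gmh_comp[OF gmh_comp[OF gmh_inl[OF Y] G] gmh_snd])
  have k: "?k \<in> gr_module_hom R P X" by (rule gmh_comp[OF gmh_comp[OF gmh_inl[OF P'] F] gmh_fst])
  have k': "?k' \<in> gr_module_hom R P' X" by (rule gmh_comp[OF gmh_comp[OF gmh_inr[OF P] F] gmh_fst])
  have s: "?k (?j x) \<otimes>\<^bsub>X\<^esub> ?k' (?j' x) = x" if x: "x \<in> carrier X" for x
  proof -
    obtain p p' where pp: "G (x, \<one>\<^bsub>Y\<^esub>) = (p, p')" by (cases "G (x, \<one>\<^bsub>Y\<^esub>)")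
    have c: "p \<in> carrier P" "p' \<in> carrier P'"
      using gmh_closed[OF G, of "(x, \<one>\<^bsub>Y\<^esub>)"] x pp by auto
    have "F (p, p') = F (p, \<one>\<^bsub>P'\<^esub>) \<otimes>\<^bsub>direct_sum X Y\<^esub> F (\<one>\<^bsub>P\<^esub>, p')"
      using gmh_mult[OF F, of "(p, \<one>\<^bsub>P'\<^esub>)" "(\<one>\<^bsub>P\<^esub>, p')"] c by simp
    then have "fst (F (p, p')) = ?k p \<otimes>\<^bsub>X\<^esub> ?k' p'"
      by (cases "F (p, \<one>\<^bsub>P'\<^esub>)"; cases "F (\<one>\<^bsub>P\<^esub>, p')") simp
    moreover have "F (p, p') = (x, \<one>\<^bsub>Y\<^esub>)" using FG[of "(x, \<one>\<^bsub>Y\<^esub>)"] pp x by simp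
    ultimately show ?thesis using pp by simp
  qed
  have e: "(\<lambda>x. ?k (?j x)) \<in> gr_module_hom R X X" by (rule gmh_comp[OF j k])
  have e': "(\<lambda>x. ?k' (?j' x)) \<in> gr_module_hom R X X" by (rule gmh_comp[OF j' k'])
  consider "\<exists>x\<in>carrier X. ?k (?j x) \<noteq> \<one>\<^bsub>X\<^esub>" | "\<exists>x\<in>carrier X. ?k' (?j' x) \<noteq> \<one>\<^bsub>X\<^esub>" |
    "\<forall>x\<in>carrier X. ?k (?j x) = \<one>\<^bsub>X\<^esub> \<and> ?k' (?j' x) = \<one>\<^bsub>X\<^esub>" by blast
  then show ?thesis
  proof cases
    case 1
    then have "bij_betw (\<lambda>x. ?k (?j x)) (carrier X) (carrier X)" using X e by (simp add: brick_def)
    then show ?thesis using j k by blast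
  next
    case 2
    then have "bij_betw (\<lambda>x. ?k' (?j' x)) (carrier X) (carrier X)" using X e' by (simp add: brick_def)
    then show ?thesis using j' k' by blast
  next
    case 3
    \<comment> \<open>If both summands vanish, so does the identity of X; then X is trivial and
      every endomorphism of it is bijective.\<close>
    have triv: "x = \<one>\<^bsub>X\<^esub>" if "x \<in> carrier X" for x
      using s[OF that] 3 that by simp
    have "bij_betw (\<lambda>x. ?k (?j x)) (carrier X) (carrier X)"
      by (rule bij_betwI[of _ _ _ "\<lambda>x. x"]) (use gmh_closed[OF e] triv in \<open>auto simp del: X.M.one_closed\<close>)
    then show ?thesis using j k by blast
  qed
qed

section \<open>Commutative monoids generated by cancellable primes\<close>

inductive_set prods :: "('a, 'b) monoid_scheme \<Rightarrow> 'a set \<Rightarrow> 'a set" for G (structure) and X where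
  prods_one: "\<one> \<in> prods G X"
| prods_mult: "\<lbrakk>x \<in> X; y \<in> prods G X\<rbrakk> \<Longrightarrow> x \<otimes> y \<in> prods G X"

text \<open>An abstract form of the part of the Krull-Schmidt theorem that is needed: the monoid
  turns out to be generated by \<open>X\<close> and cancellative. Uniqueness of factorisations is
  not asked for, so it can stay open which members of a family of indecomposables coincide.\<close>

locale prime_monoid = comm_monoid G for G (structure) +
  fixes X
  assumes X_carrier: "X \<subseteq> carrier G"
    and X_cancel: "\<lbrakk>x \<in> X; a \<in> carrier G; b \<in> carrier G; x \<otimes> a = x \<otimes> b\<rbrakk> \<Longrightarrow> a = b"
    and X_prime: "\<lbrakk>x \<in> X; y \<in> carrier G; a \<in> carrier G; b \<in> carrier G; a \<otimes> b = x \<otimes> y\<rbrakk>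
      \<Longrightarrow> \<exists>c\<in>carrier G. a = x \<otimes> c \<or> b = x \<otimes> c"
    and conical: "\<lbrakk>a \<in> carrier G; b \<in> carrier G; a \<otimes> b = \<one>\<rbrakk> \<Longrightarrow> a = \<one>"
    and divides: "a \<in> carrier G \<Longrightarrow> \<exists>b\<in>carrier G. a \<otimes> b \<in> prods G X"
begin

lemma prods_carrier: "y \<in> prods G X \<Longrightarrow> y \<in> carrier G"
  by (induction rule: prods.induct) (use X_carrier in auto)

text \<open>Induction along the product: the prime x divides a or b, and after cancelling x what
  remains multiplies to the shorter product. So a summand of a sum of atoms is again a sum of
  atoms.\<close>

lemma prods_factor: "y \<in> prods G X \<Longrightarrow> a \<in> carrier G \<Longrightarrow> b \<in> carrier G \<Longrightarrow> a \<otimes> b = y \<Longrightarrow> a \<in> prods G X"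
proof (induction arbitrary: a b rule: prods.induct)
  case prods_one
  then show ?case using conical prods.prods_one by metis
next
  case (prods_mult x y)
  have x: "x \<in> carrier G" using prods_mult.hyps X_carrier by auto
  have y: "y \<in> carrier G" using prods_mult.hyps prods_carrier by auto
  obtain c where c: "c \<in> carrier G" "a = x \<otimes> c \<or> b = x \<otimes> c"
    using X_prime[OF prods_mult.hyps(1) y prods_mult.prems(1,2)] prods_mult.prems(3) by auto
  show ?case
  proof (cases "a = x \<otimes> c")
    case True
    then have "x \<otimes> (c \<otimes> b) = x \<otimes> y"
      using prods_mult.prems x c by (simp add: m_assoc)
    then have "c \<otimes> b = y"
      using X_cancel[OF prods_mult.hyps(1)] c y prods_mult.prems by auto
    then have "c \<in> prods G X"
      using prods_mult.IH[OF c(1) prods_mult.prems(2)] by simp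
    then show ?thesis using True prods.prods_mult[OF prods_mult.hyps(1)] by simp
  next
    case False
    then have "b = x \<otimes> c" using c by simp
    then have "x \<otimes> (a \<otimes> c) = x \<otimes> y"
      using prods_mult.prems x c by (simp add: m_lcomm)
    then have "a \<otimes> c = y"
      using X_cancel[OF prods_mult.hyps(1)] c y prods_mult.prems by auto
    then show ?thesis
      using prods_mult.IH[OF prods_mult.prems(1) c(1)] by simp
  qed
qed

lemma carrier_prods: "a \<in> carrier G \<Longrightarrow> a \<in> prods G X"
  using divides prods_factor by blast

text \<open>By \<open>carrier_prods\<close> the element c is a product from \<open>X\<close>, and
  its factors are cancelled one at a time.\<close>

lemma cancel: "c \<in> carrier G \<Longrightarrow> a \<in> carrier G \<Longrightarrow> b \<in> carrier G \<Longrightarrow> c \<otimes> a = c \<otimes> b \<Longrightarrow> a = b"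
proof -
  have "c \<in> prods G X \<Longrightarrow> a \<in> carrier G \<Longrightarrow> b \<in> carrier G \<Longrightarrow> c \<otimes> a = c \<otimes> b \<Longrightarrow> a = b"
  proof (induction rule: prods.induct)
    case (prods_mult x y)
    have "x \<in> carrier G" "y \<in> carrier G"
      using prods_mult.hyps X_carrier prods_carrier by auto
    then have "x \<otimes> (y \<otimes> a) = x \<otimes> (y \<otimes> b)"
      using prods_mult.prems by (simp add: m_assoc)
    then have "y \<otimes> a = y \<otimes> b"
      using X_cancel[OF prods_mult.hyps(1)] prods_mult.prems \<open>y \<in> carrier G\<close> by auto
    then show ?case using prods_mult by auto
  qed simp
  then show "c \<in> carrier G \<Longrightarrow> a \<in> carrier G \<Longrightarrow> b \<in> carrier G \<Longrightarrow> c \<otimes> a = c \<otimes> b \<Longrightarrow> a = b"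
    using carrier_prods by blast
qed

end

lemma (in comm_monoid) prods_closed_mult:
  assumes "X \<subseteq> carrier G" "y \<in> prods G X" "z \<in> prods G X"
  shows "y \<otimes> z \<in> prods G X \<and> y \<in> carrier G \<and> z \<in> carrier G"
proof -
  have c: "w \<in> carrier G" if "w \<in> prods G X" for w
    using that by (induction rule: prods.induct) (use assms(1) in auto)
  have "y \<otimes> z \<in> prods G X"
    using assms(2)
  proof (induction rule: prods.induct)
    case (prods_mult x y)
    have "x \<in> carrier G" using prods_mult assms(1) by auto
    then have "x \<otimes> y \<otimes> z = x \<otimes> (y \<otimes> z)"
      using prods_mult c assms(3) by (simp add: m_assoc)
    then show ?case using prods_mult prods.prods_mult by metis
  qed (use c assms(3) in simp)
  then show ?thesis using c assms by auto
qed

lemma (in comm_monoid) prods_finprod: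
  assumes "X \<subseteq> carrier G" "\<And>i. i \<in> I \<Longrightarrow> f i \<in> prods G X"
  shows "finprod G f I \<in> prods G X"
  using assms(2)
proof (induction I rule: infinite_finite_induct)
  case (insert i I)
  have "f j \<in> carrier G" if "j \<in> insert i I" for j
    using prods_closed_mult[OF assms(1), of "f j" \<one>] insert that by (auto intro: prods.prods_one)
  then have "finprod G f (insert i I) = f i \<otimes> finprod G f I"
    using insert by (intro finprod_insert) auto
  then show ?case using prods_closed_mult[OF assms(1)] insert by auto
qed (auto intro: prods.prods_one)

section \<open>Modules generated by idempotents\<close>

text \<open>For idempotent e this is eR, described by fixed points rather than as an image, so that
  its module structure and grading come from \<open>equalizer\<close>.\<close>

definition idem_module :: "('g::ab_group_add, 'r, 'x) gring_scheme \<Rightarrow> 'r \<Rightarrow> ('g, 'r, 'r) gmodule" where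
  "idem_module R e = equalizer (regular_module R) (\<lambda>r. e \<otimes>\<^bsub>R\<^esub> r) (\<lambda>r. r)"

lemma idem_module_simps [simp]:
  "carrier (idem_module R e) = {r \<in> carrier R. e \<otimes>\<^bsub>R\<^esub> r = r}" "monoid.mult (idem_module R e) = add R"
  "one (idem_module R e) = ring.zero R" "ract (idem_module R e) = monoid.mult R"
  "mgrade (idem_module R e) \<gamma> = grade R \<gamma> \<inter> {r \<in> carrier R. e \<otimes>\<^bsub>R\<^esub> r = r}"
  by (simp_all add: idem_module_def)

context gr_ring
begin

lemma gmh_mult_left0: "a \<in> grade R 0 \<Longrightarrow> (\<lambda>r. a \<otimes> r) \<in> gr_module_hom R (regular_module R) (regular_module R)"
  using gmh_mult_left[of R a 0 0] by (simp add: shift_zero gr_ring_axioms)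

lemma gr_module_idem: "e \<in> grade R 0 \<Longrightarrow> gr_module R (idem_module R e)"
  unfolding idem_module_def
  by (intro gr_module_equalizer[OF _ _ gmh_mult_left0 gmh_id] gr_module_regular gr_ring_axioms)

lemma dual_basis_idem:
  assumes "e \<in> grade R 0" "e \<otimes> e = e"
  shows "dual_basis R (idem_module R e) {()} (\<lambda>_. e) (\<lambda>_. 0) (\<lambda>_ r. r)"
proof -
  interpret M: gr_module R "idem_module R e" by (rule gr_module_idem) fact
  have e: "e \<in> carrier R" using assms(1) by (rule grade_carrier)
  have "(\<lambda>r. r) \<in> gr_module_hom R (idem_module R e) (regular_module R)"
    by (rule gr_module_homI) auto
  moreover have "finprod (idem_module R e) (\<lambda>i. e \<star>\<^bsub>idem_module R e\<^esub> m) {()} = m" if "m \<in> carrier (idem_module R e)" for m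
    using that e assms(2) by (subst M.M.finprod_insert) auto
  ultimately show ?thesis
    using assms e by (auto simp: dual_basis_def shift_zero)
qed

lemma fgproj_idem: "\<lbrakk>e \<in> grade R 0; e \<otimes> e = e\<rbrakk> \<Longrightarrow> fgproj R (idem_module R e)"
  using fgprojI[OF gr_module_idem dual_basis_idem] .

text \<open>The Peirce decomposition: r has the components e i r, which add up to r by completeness,
  and orthogonality recovers each of them from the sum.\<close>

lemma idem_module_decomp:
  assumes "finite I" and e: "\<And>i. i \<in> I \<Longrightarrow> e i \<in> grade R 0"
    and orth: "\<And>i j. \<lbrakk>i \<in> I; j \<in> I\<rbrakk> \<Longrightarrow> e i \<otimes> e j = (if i = j then e i else \<zero>)"
    and sum: "(\<Oplus>i\<in>I. e i) = \<one>"
  shows "gr_isomorphic R (regular_module R) (dsum I (\<lambda>i. idem_module R (e i)))"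
proof -
  interpret M: gr_module R "regular_module R" by (rule gr_module_regular) (rule gr_ring_axioms)
  let ?D = "dsum I (\<lambda>i. idem_module R (e i))"
  have D: "gr_module R ?D"
    by (rule gr_module_dsum[OF gr_ring_axioms assms(1)]) (rule gr_module_idem[OF e])
  have ec: "e i \<in> carrier R" if "i \<in> I" for i using e[OF that] by (rule grade_carrier)
  show ?thesis
  proof (rule gr_isomorphicI2)
    show "(\<lambda>r. \<lambda>i\<in>I. e i \<otimes> r) \<in> gr_module_hom R (regular_module R) ?D"
    proof (rule gmh_dsum)
      fix i assume i: "i \<in> I"
      show "(\<lambda>r. e i \<otimes> r) \<in> gr_module_hom R (regular_module R) (idem_module R (e i))"
        unfolding idem_module_def
        by (rule gmh_into_equalizer[OF M.gr_module_axioms gmh_mult_left0[OF e[OF i]]])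
          (use orth[OF i i] ec[OF i] in \<open>simp add: m_assoc[symmetric]\<close>)
    qed
    show "(\<lambda>s. finprod (regular_module R) s I) \<in> gr_module_hom R ?D (regular_module R)"
    proof (rule gmh_sum[OF D M.gr_module_axioms])
      fix i assume i: "i \<in> I"
      have "(\<lambda>r. r) \<in> gr_module_hom R (idem_module R (e i)) (regular_module R)"
        by (rule gr_module_homI) auto
      from gmh_comp[OF gmh_dproj[OF i, where M="\<lambda>i. idem_module R (e i)"] this]
      show "(\<lambda>s. s i) \<in> gr_module_hom R ?D (regular_module R)" by simp
    qed
    show "finprod (regular_module R) (\<lambda>i\<in>I. e i \<otimes> r) I = r" if "r \<in> carrier (regular_module R)" for r
    proof -
      have "finprod (regular_module R) (\<lambda>i\<in>I. e i \<otimes> r) I = (\<Oplus>i\<in>I. e i \<otimes> r)"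
        unfolding finprod_regular using that ec by (intro finsum_cong') auto
      also have "\<dots> = (\<Oplus>i\<in>I. e i) \<otimes> r"
        using assms(1) that ec by (intro finsum_ldistr[symmetric]) auto
      finally show ?thesis using that by (simp add: sum)
    qed
    show "(\<lambda>i\<in>I. e i \<otimes> finprod (regular_module R) s I) = s" if s: "s \<in> carrier ?D" for s
    proof (rule extensionalityI[of _ I])
      show "s \<in> extensional I" using s by (auto simp: PiE_iff)
      have sc: "s j \<in> carrier R" "e j \<otimes> s j = s j" if "j \<in> I" for j
        using s that by (auto simp: PiE_iff)
      fix i assume i: "i \<in> I"
      have "e i \<otimes> finsum R s I = (\<Oplus>j\<in>I. e i \<otimes> s j)"
        using assms(1) sc ec[OF i] by (intro finsum_rdistr) auto
      also have "\<dots> = (\<Oplus>j\<in>I. if i = j then s j else \<zero>)"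
      proof (rule finsum_cong')
        fix j assume j: "j \<in> I"
        have "e i \<otimes> s j = e i \<otimes> (e j \<otimes> s j)" by (simp add: sc(2)[OF j])
        also have "\<dots> = (e i \<otimes> e j) \<otimes> s j"
          by (rule m_assoc[symmetric]) (use i j ec sc in auto)
        finally show "e i \<otimes> s j = (if i = j then s j else \<zero>)"
          using i j by (simp add: orth sc)
      qed (use sc in auto)
      also have "\<dots> = s i"
        using assms(1) i sc by (intro finsum_singleton) auto
      finally show "(\<lambda>i\<in>I. e i \<otimes> finprod (regular_module R) s I) i = s i"
        using i by (simp add: finprod_regular)
    qed simp
  qed
qed

text \<open>Left multiplications by v and by u are inverse to each other between the modules of uv
  and vu. As v has degree -d, the target is shifted by -d.\<close>

lemma idem_module_iso_shift:
  assumes e: "e \<in> grade R 0" and e': "e' \<in> grade R 0" and u: "u \<in> grade R d" and v: "v \<in> grade R (- d)"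
    and uv: "u \<otimes> v = e" and vu: "v \<otimes> u = e'"
  shows "gr_isomorphic R (idem_module R e) (shift (- d) (idem_module R e'))"
proof -
  have c: "u \<in> carrier R" "v \<in> carrier R" "e \<in> carrier R" "e' \<in> carrier R"
    using assms grade_carrier by blast+
  have ev: "e' \<otimes> (v \<otimes> r) = v \<otimes> r" if r: "r \<in> carrier R" "e \<otimes> r = r" for r
  proof -
    have "e' \<otimes> (v \<otimes> r) = v \<otimes> ((u \<otimes> v) \<otimes> r)"
      unfolding vu[symmetric] using c r(1) by (simp add: m_assoc)
    then show ?thesis by (simp add: uv r)
  qed
  have eu: "e \<otimes> (u \<otimes> r) = u \<otimes> r" if r: "r \<in> carrier R" "e' \<otimes> r = r" for r
  proof -
    have "e \<otimes> (u \<otimes> r) = u \<otimes> ((v \<otimes> u) \<otimes> r)"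
      unfolding uv[symmetric] using c r(1) by (simp add: m_assoc)
    then show ?thesis by (simp add: vu r)
  qed
  show ?thesis
  proof (rule gr_isomorphicI2)
    show "(\<lambda>r. v \<otimes> r) \<in> gr_module_hom R (idem_module R e) (shift (- d) (idem_module R e'))"
    proof (rule gr_module_homI)
      fix r assume r: "r \<in> carrier (idem_module R e)"
      then have "e' \<otimes> (v \<otimes> r) = v \<otimes> r" by (intro ev) auto
      then show "v \<otimes> r \<in> carrier (shift (- d) (idem_module R e'))"
        using c r by simp
    next
      fix r \<gamma> assume r: "r \<in> mgrade (idem_module R e) \<gamma>"
      then have "e' \<otimes> (v \<otimes> r) = v \<otimes> r" by (intro ev) auto
      then show "v \<otimes> r \<in> mgrade (shift (- d) (idem_module R e')) \<gamma>"
        using c r grade_mult[OF v, of r \<gamma>] by simp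
    qed (use c in \<open>auto simp: r_distr m_assoc\<close>)
    show "(\<lambda>r. u \<otimes> r) \<in> gr_module_hom R (shift (- d) (idem_module R e')) (idem_module R e)"
    proof (rule gr_module_homI)
      fix r assume r: "r \<in> carrier (shift (- d) (idem_module R e'))"
      then have "e \<otimes> (u \<otimes> r) = u \<otimes> r" by (intro eu) auto
      then show "u \<otimes> r \<in> carrier (idem_module R e)"
        using c r by simp
    next
      fix r \<gamma> assume r: "r \<in> mgrade (shift (- d) (idem_module R e')) \<gamma>"
      then have "e \<otimes> (u \<otimes> r) = u \<otimes> r" by (intro eu) auto
      then show "u \<otimes> r \<in> mgrade (idem_module R e) \<gamma>"
        using c r grade_mult[OF u, of r "- d + \<gamma>"] by simp
    qed (use c in \<open>auto simp: r_distr m_assoc\<close>)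
    show "u \<otimes> (v \<otimes> r) = r" if "r \<in> carrier (idem_module R e)" for r
      using that c uv by (simp add: m_assoc[symmetric])
    show "v \<otimes> (u \<otimes> r) = r" if "r \<in> carrier (shift (- d) (idem_module R e'))" for r
      using that c vu by (simp add: m_assoc[symmetric])
  qed
qed

end

text \<open>The single element e with the inclusion as functional is a dual basis of eR, and \<phi>
  carries it to the one of \<phi>(e)S. So the classes of right ideals of idempotents can be followed
  without touching tensor products.\<close>

lemma (in gr_hom) ext_scalars_idem:
  assumes e: "e \<in> grade R 0" "e \<otimes>\<^bsub>R\<^esub> e = e"
  shows "ext_scalars R S \<phi> (idem_module R e) (idem_module S (\<phi> e)) \<phi>"
proof -
  have ec: "e \<in> carrier R" using e(1) by (rule R.grade_carrier)
  have f: "\<phi> e \<in> grade S 0" "\<phi> e \<otimes>\<^bsub>S\<^esub> \<phi> e = \<phi> e"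
    using e hom_grade \<phi>_mult[OF ec ec] by auto
  show ?thesis
  proof (rule ext_scalarsI[where u=\<phi> and I="{()}" and x="\<lambda>_. e" and d="\<lambda>_. 0" and f="\<lambda>_ r. r" and g="\<lambda>_ r. r",
        OF R.gr_module_idem[OF e(1)] S.gr_module_idem[OF f(1)] _ R.dual_basis_idem[OF e] S.dual_basis_idem[OF f]])
    show "\<phi> \<in> semilinear R \<phi> (idem_module R e) (idem_module S (\<phi> e))"
    proof (rule semilinearI)
      show "\<phi> p \<in> carrier (idem_module S (\<phi> e))" if "p \<in> carrier (idem_module R e)" for p
        using that \<phi>_mult[OF ec, of p] by (auto simp: \<phi>_closed)
      show "\<phi> p \<in> mgrade (idem_module S (\<phi> e)) \<gamma>" if "p \<in> mgrade (idem_module R e) \<gamma>" for p \<gamma>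
        using that \<phi>_mult[OF ec, of p] by (auto simp: \<phi>_closed hom_grade)
    qed (auto simp: \<phi>_add \<phi>_mult)
  qed simp
qed

section \<open>Rings that are finite sums of bricks\<close>

text \<open>A direct sum isomorphic to the zero module has one element only, hence so has each of
  its summands.\<close>

lemma V_conical:
  fixes R :: "('g::ab_group_add, 'r, 'x) gring_scheme"
  assumes "fgproj R P" "fgproj R Q" "iso_class R P \<otimes>\<^bsub>V_gr R\<^esub> iso_class R Q = \<one>\<^bsub>V_gr R\<^esub>"
  shows "iso_class R P = \<one>\<^bsub>V_gr R\<^esub>"
proof -
  have P: "gr_module R P" and Q: "gr_module R Q" using assms fgproj_module by auto
  interpret P: gr_module R P by fact
  interpret Q: gr_module R Q by fact
  have z: "fgproj R zero_module" by (rule fgproj_zero[OF P.R.gr_ring_axioms])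
  have "gr_isomorphic R (direct_sum P Q) zero_module"
    using assms iso_class_eq_iff[OF fgproj_direct_sum[OF assms(1,2)] z] by (simp add: V_mult V_one)
  then obtain f where "bij_betw f (carrier (direct_sum P Q)) (carrier (zero_module :: ('g, 'r, unit) gmodule))"
    unfolding gr_isomorphic_def by blast
  then have "inj_on f (carrier (direct_sum P Q))"
    by (rule bij_betw_imp_inj_on)
  then have f: "inj_on f (carrier P \<times> carrier Q)"
    unfolding direct_sum_simps(1) .
  have triv: "p = \<one>\<^bsub>P\<^esub>" if "p \<in> carrier P" for p
  proof -
    have "f (p, \<one>\<^bsub>Q\<^esub>) = f (\<one>\<^bsub>P\<^esub>, \<one>\<^bsub>Q\<^esub>)" by simp
    from inj_onD[OF f this] that show ?thesis by simp
  qed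
  have "gr_isomorphic R P zero_module"
    by (rule gr_isomorphicI2[OF gmh_const_one[OF fgproj_module[OF z]] gmh_const_one[OF P]])
      (use triv in \<open>auto simp: zero_module_def\<close>)
  then show ?thesis
    using iso_class_cong[OF _ P fgproj_module[OF z]] by (simp add: V_one)
qed

text \<open>The form in which the structure of the ring enters the cancellation theory. For a
  matricial algebra the summands are the row modules.\<close>

locale brick_ring = gr_ring R for R :: "('g::ab_group_add, 'r, 'x) gring_scheme" (structure) +
  fixes I :: "'i set" and B :: "'i \<Rightarrow> ('g, 'r, 'r) gmodule"
  assumes finite_I: "finite I"
    and B_brick: "i \<in> I \<Longrightarrow> brick R (B i)" and B_fgproj: "i \<in> I \<Longrightarrow> fgproj R (B i)"
    and regular_decomp: "gr_isomorphic R (regular_module R) (dsum I B)"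
begin

text \<open>All shifts are included because a projective module is complemented in a sum of shifted
  copies of R. Shifts of different summands may be isomorphic and then give the same atom.\<close>

definition atoms :: "('g, 'r) tuple_module set set" where
  "atoms = {iso_class R (shift \<alpha> (B i)) | \<alpha> i. i \<in> I}"

lemma atoms_carrier: "atoms \<subseteq> carrier (V_gr R)"
  by (auto simp: atoms_def V_carrier fgproj_shift B_fgproj)

lemma iso_class_shift_regular: "iso_class R (shift \<alpha> (regular_module R)) \<in> prods (V_gr R) atoms"
proof -
  have D: "gr_module R (dsum I B)"
    by (rule gr_module_dsum[OF gr_ring_axioms finite_I]) (use B_fgproj fgproj_module in blast)
  have f: "fgproj R (dsum I B)"
    by (rule fgproj_dsum[OF gr_ring_axioms finite_I B_fgproj])
  have "iso_class R (shift \<alpha> (regular_module R)) = iso_class R (shift \<alpha> (dsum I B))"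
    by (rule iso_class_cong[OF gr_isomorphic_shift[OF regular_decomp]])
      (auto intro!: gr_module_shift D gr_module_regular gr_ring_axioms)
  also have "\<dots> = iso_class R (dsum I (\<lambda>i. shift \<alpha> (B i)))"
    by (simp add: shift_def dsum_def)
  also have "\<dots> = finprod (V_gr R) (\<lambda>i. iso_class R (shift \<alpha> (B i))) I"
    by (rule V_dsum[OF gr_ring_axioms finite_I]) (rule fgproj_shift[OF B_fgproj])
  also have "\<dots> \<in> prods (V_gr R) atoms"
  proof (rule V.prods_finprod[OF atoms_carrier])
    fix i assume "i \<in> I"
    then have a: "iso_class R (shift \<alpha> (B i)) \<in> atoms" by (auto simp: atoms_def)
    then have "iso_class R (shift \<alpha> (B i)) \<otimes>\<^bsub>V_gr R\<^esub> \<one>\<^bsub>V_gr R\<^esub> \<in> prods (V_gr R) atoms"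
      by (intro prods.intros)
    then show "iso_class R (shift \<alpha> (B i)) \<in> prods (V_gr R) atoms"
      using a atoms_carrier by auto
  qed
  finally show ?thesis .
qed

text \<open>Cancellation of an atom is \<open>brick_cancel\<close>. Primality combines
  \<open>brick_exchange\<close>, which finds the summand through which an automorphism of X factors,
  with \<open>brick_split\<close>, which splits X off from it. Each class divides a sum of shifts of
  R by \<open>fgproj_complement\<close>.\<close>

sublocale VP: prime_monoid "V_gr R" atoms
proof
  show "atoms \<subseteq> carrier (V_gr R)" by (rule atoms_carrier)
next
  fix x a b assume x: "x \<in> atoms" and "a \<in> carrier (V_gr R)" "b \<in> carrier (V_gr R)"
    and e: "x \<otimes>\<^bsub>V_gr R\<^esub> a = x \<otimes>\<^bsub>V_gr R\<^esub> b"
  then obtain P Q where P: "fgproj R P" "a = iso_class R P" "P \<in> gr_fgp R" and Q: "fgproj R Q" "b = iso_class R Q" "Q \<in> gr_fgp R"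
    by (elim V_carrierE)
  obtain \<alpha> i where X: "i \<in> I" "x = iso_class R (shift \<alpha> (B i))" using x by (auto simp: atoms_def)
  have fX: "fgproj R (shift \<alpha> (B i))" using X by (intro fgproj_shift B_fgproj)
  have "gr_isomorphic R (direct_sum (shift \<alpha> (B i)) P) (direct_sum (shift \<alpha> (B i)) Q)"
    using e P Q X fX iso_class_eq_iff[OF fgproj_direct_sum[OF fX P(1)] fgproj_direct_sum[OF fX Q(1)]]
    by (simp add: V_mult)
  then have "gr_isomorphic R P Q"
    using brick_cancel[OF brick_shift[OF B_brick[OF X(1)]]] P Q fgproj_module by blast
  then show "a = b" using P Q iso_class_eq_iff by blast
next
  fix x y a b assume x: "x \<in> atoms" and "y \<in> carrier (V_gr R)" "a \<in> carrier (V_gr R)" "b \<in> carrier (V_gr R)"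
    and e: "a \<otimes>\<^bsub>V_gr R\<^esub> b = x \<otimes>\<^bsub>V_gr R\<^esub> y"
  then obtain P Q Y where P: "fgproj R P" "a = iso_class R P" "P \<in> gr_fgp R" and Q: "fgproj R Q" "b = iso_class R Q" "Q \<in> gr_fgp R"
    and Y: "fgproj R Y" "y = iso_class R Y" "Y \<in> gr_fgp R"
    by (elim V_carrierE)
  obtain \<alpha> i where X: "i \<in> I" "x = iso_class R (shift \<alpha> (B i))" using x by (auto simp: atoms_def)
  let ?X = "shift \<alpha> (B i)"
  have fX: "fgproj R ?X" using X by (intro fgproj_shift B_fgproj)
  note br = brick_shift[OF B_brick[OF X(1)], of \<alpha>]
  have iso: "gr_isomorphic R (direct_sum P Q) (direct_sum ?X Y)"
    using e P Q X Y fX iso_class_eq_iff[OF fgproj_direct_sum[OF P(1) Q(1)] fgproj_direct_sum[OF fX Y(1)]]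
    by (simp add: V_mult)
  have step: "\<exists>c\<in>carrier (V_gr R). iso_class R W = x \<otimes>\<^bsub>V_gr R\<^esub> c"
    if W: "fgproj R W" and jk: "j \<in> gr_module_hom R ?X W" "k \<in> gr_module_hom R W ?X"
      "bij_betw (\<lambda>x. k (j x)) (carrier ?X) (carrier ?X)" for W :: "('g, 'r) tuple_module" and j k
  proof -
    obtain W1 :: "('g, 'r) tuple_module" where W1: "fgproj R W1" "gr_isomorphic R W (direct_sum ?X W1)"
      using brick_split[where j=j and k=k, OF fgproj_module[OF fX] fgproj_module[OF W] jk] W by blast
    then have "iso_class R W = x \<otimes>\<^bsub>V_gr R\<^esub> iso_class R W1"
      using iso_class_eq_iff[OF W fgproj_direct_sum[OF fX W1(1)]] fX X by (simp add: V_mult)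
    then show ?thesis using V_carrier[OF W1(1)] by blast
  qed
  show "\<exists>c\<in>carrier (V_gr R). a = x \<otimes>\<^bsub>V_gr R\<^esub> c \<or> b = x \<otimes>\<^bsub>V_gr R\<^esub> c"
    using brick_exchange[OF br fgproj_module[OF P(1)] fgproj_module[OF Q(1)] fgproj_module[OF Y(1)] iso]
      step[OF P(1)] step[OF Q(1)] P(2) Q(2) by blast
next
  fix a b assume "a \<in> carrier (V_gr R)" "b \<in> carrier (V_gr R)" and e: "a \<otimes>\<^bsub>V_gr R\<^esub> b = \<one>\<^bsub>V_gr R\<^esub>"
  then obtain P Q where P: "fgproj R P" "a = iso_class R P" "P \<in> gr_fgp R" and Q: "fgproj R Q" "b = iso_class R Q" "Q \<in> gr_fgp R"
    by (elim V_carrierE)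
  then show "a = \<one>\<^bsub>V_gr R\<^esub>" using V_conical[OF P(1) Q(1)] e by simp
next
  fix a assume "a \<in> carrier (V_gr R)"
  then obtain P where P: "fgproj R P" "a = iso_class R P" "P \<in> gr_fgp R" by (elim V_carrierE)
  show "\<exists>b\<in>carrier (V_gr R). a \<otimes>\<^bsub>V_gr R\<^esub> b \<in> prods (V_gr R) atoms"
  proof (rule fgproj_complement[OF P(1)])
    fix n :: nat and d and P' :: "('g, 'r) tuple_module"
    assume P': "fgproj R P'" and iso: "gr_isomorphic R (dsum {..<n} (\<lambda>i. shift (d i) (regular_module R))) (direct_sum P P')"
    have fr: "fgproj R (shift (d i) (regular_module R))" for i
      by (intro fgproj_shift fgproj_regular gr_ring_axioms)
    have "fgproj R (dsum {..<n} (\<lambda>i. shift (d i) (regular_module R)))"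
      by (rule fgproj_dsum[OF gr_ring_axioms]) (simp_all add: fr)
    then have "a \<otimes>\<^bsub>V_gr R\<^esub> iso_class R P' = iso_class R (dsum {..<n} (\<lambda>i. shift (d i) (regular_module R)))"
      using iso_class_cong[OF iso] P P'
      by (simp add: V_mult fgproj_module fgproj_direct_sum gr_module_direct_sum)
    also have "\<dots> = finprod (V_gr R) (\<lambda>i. iso_class R (shift (d i) (regular_module R))) {..<n}"
      by (rule V_dsum[OF gr_ring_axioms]) (simp_all add: fr)
    also have "\<dots> \<in> prods (V_gr R) atoms"
      by (rule V.prods_finprod[OF atoms_carrier iso_class_shift_regular])
    finally show ?thesis using V_carrier[OF P'] by blast
  qed
qed

text \<open>Equality in the group completion only says that the modules become isomorphic after
  adding a common summand; the monoid is cancellative, so that summand can be removed.\<close>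

lemma K0_class_eq_imp_iso:
  assumes "fgproj R M" "fgproj R N" "K0_class R M = K0_class R N"
  shows "gr_isomorphic R M N"
proof -
  obtain Y where "Y \<in> carrier (V_gr R)" "iso_class R M \<otimes>\<^bsub>V_gr R\<^esub> Y = iso_class R N \<otimes>\<^bsub>V_gr R\<^esub> Y"
    using assms K0_class_eq_iff by blast
  then have "iso_class R M = iso_class R N"
    using VP.cancel[of Y "iso_class R M" "iso_class R N"] V_carrier[OF assms(1)] V_carrier[OF assms(2)]
    by (simp add: V.m_comm)
  then show ?thesis using iso_class_eq_iff assms by blast
qed

text \<open>By \<open>VP.carrier_prods\<close> every class is a sum of atoms, so additive maps need
  comparing on atoms alone.\<close>

lemma K0_hom_eq_atoms:
  assumes f: "f \<in> hom (K0_group R) H" and g: "g \<in> hom (K0_group R) H" and H: "group H"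
    and eq: "\<And>\<alpha> i. i \<in> I \<Longrightarrow> f (K0_class R (shift \<alpha> (B i))) = g (K0_class R (shift \<alpha> (B i)))"
    and x: "x \<in> carrier (K0_group R)"
  shows "f x = g x"
proof (rule K0_hom_eq[OF f g H _ x])
  fix P assume "P \<in> gr_fgp R"
  then have "iso_class R P \<in> carrier (V_gr R)" by (simp add: gr_fgp_iff V_carrier)
  then have "iso_class R P \<in> prods (V_gr R) atoms" by (rule VP.carrier_prods)
  then have "f (gc_inj (V_gr R) (iso_class R P)) = g (gc_inj (V_gr R) (iso_class R P))"
  proof (induction rule: prods.induct)
    case prods_one
    show ?case
      using hom_one[OF f K0.is_group H] hom_one[OF g K0.is_group H] by (simp add: V.gc_inj_one K0_simps)
  next
    case (prods_mult x y)
    have c: "x \<in> carrier (V_gr R)" "y \<in> carrier (V_gr R)"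
      using prods_mult atoms_carrier VP.prods_carrier by auto
    then have c': "gc_inj (V_gr R) x \<in> carrier (K0_group R)" "gc_inj (V_gr R) y \<in> carrier (K0_group R)"
      by (simp_all add: K0_simps V.gc_inj_closed)
    have "gc_inj (V_gr R) (x \<otimes>\<^bsub>V_gr R\<^esub> y) = gc_inj (V_gr R) x \<otimes>\<^bsub>K0_group R\<^esub> gc_inj (V_gr R) y"
      using c by (simp add: V.gc_inj_mult K0_simps)
    moreover have "f (gc_inj (V_gr R) x) = g (gc_inj (V_gr R) x)"
      using prods_mult.hyps(1) eq by (auto simp: atoms_def K0_class_def)
    ultimately show ?case
      using prods_mult.IH hom_mult[OF f c'] hom_mult[OF g c'] by simp
  qed
  then show "f (K0_class R P) = g (K0_class R P)" by (simp add: K0_class_def)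
qed

end

section \<open>Matricial algebras, their matrix units and row modules\<close>

section \<open>Matricial algebras\<close>

lemma (in comm_monoid) finprod_swap:
  assumes "finite I" "\<And>i j. \<lbrakk>i \<in> I; j \<in> J\<rbrakk> \<Longrightarrow> f i j \<in> carrier G"
  shows "finprod G (\<lambda>i. finprod G (f i) J) I = finprod G (\<lambda>j. finprod G (\<lambda>i. f i j) I) J"
  using assms
proof (induction I)
  case (insert i I)
  have "finprod G (\<lambda>i. finprod G (f i) J) (insert i I) = finprod G (f i) J \<otimes> finprod G (\<lambda>i. finprod G (f i) J) I"
    using insert by (intro finprod_insert) (auto intro!: finprod_closed)
  also have "\<dots> = finprod G (f i) J \<otimes> finprod G (\<lambda>j. finprod G (\<lambda>i. f i j) I) J"
    using insert by simp
  also have "\<dots> = finprod G (\<lambda>j. f i j \<otimes> finprod G (\<lambda>i. f i j) I) J"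
    using insert.prems by (intro finprod_multf[symmetric]) (auto intro!: finprod_closed)
  also have "\<dots> = finprod G (\<lambda>j. finprod G (\<lambda>i. f i j) (insert i I)) J"
    using insert by (intro finprod_cong') (auto intro!: finprod_insert[symmetric] finprod_closed m_closed)
  finally show ?case .
qed simp

lemmas (in abelian_monoid) finsum_swap = add.finprod_swap[folded finsum_def, simplified]

text \<open>Collects the laws of scalars used of the target algebra in the faithfulness and fullness
  arguments. Those are carried out for any such algebra with cancellation for its modules; matrices
  appear explicitly in the source alone.\<close>

locale gr_algebra = A: gr_field A + gr_ring R
  for A :: "('g::ab_group_add, 'a) gring" and R :: "('g, 'a, 'r) galg" (structure) +
  assumes scale_closed: "\<lbrakk>a \<in> carrier A; r \<in> carrier R\<rbrakk> \<Longrightarrow> scale R a r \<in> carrier R"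
    and scale_add_left: "\<lbrakk>a \<in> carrier A; b \<in> carrier A; r \<in> carrier R\<rbrakk> \<Longrightarrow> scale R (a \<oplus>\<^bsub>A\<^esub> b) r = scale R a r \<oplus> scale R b r"
    and scale_add_right: "\<lbrakk>a \<in> carrier A; r \<in> carrier R; s \<in> carrier R\<rbrakk> \<Longrightarrow> scale R a (r \<oplus> s) = scale R a r \<oplus> scale R a s"
    and scale_scale: "\<lbrakk>a \<in> carrier A; b \<in> carrier A; r \<in> carrier R\<rbrakk> \<Longrightarrow> scale R (a \<otimes>\<^bsub>A\<^esub> b) r = scale R a (scale R b r)"
    and scale_one: "r \<in> carrier R \<Longrightarrow> scale R \<one>\<^bsub>A\<^esub> r = r"
    and scale_mult_left: "\<lbrakk>a \<in> carrier A; r \<in> carrier R; s \<in> carrier R\<rbrakk> \<Longrightarrow> scale R a r \<otimes> s = scale R a (r \<otimes> s)"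
    and scale_mult_right: "\<lbrakk>a \<in> carrier A; r \<in> carrier R; s \<in> carrier R\<rbrakk> \<Longrightarrow> r \<otimes> scale R a s = scale R a (r \<otimes> s)"
    and scale_grade: "\<lbrakk>a \<in> grade A \<alpha>; r \<in> grade R \<beta>\<rbrakk> \<Longrightarrow> scale R a r \<in> grade R (\<alpha> + \<beta>)"

locale matricial = gr_field A for A :: "('g::ab_group_add, 'a) gring" (structure) +
  fixes \<Delta> :: "'g list list"
begin

abbreviation R where "R \<equiv> gr_prod (map (gr_mat A) \<Delta>)"
abbreviation dim where "dim k \<equiv> length (\<Delta> ! k)"

text \<open>Elements of R are extensional functions with extensional functions as values. Building
  them from an unrestricted family of entries lets equations in R be proved entry by entry via
  \<open>blocks_cong\<close>, without bookkeeping of undefined values.\<close>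

definition blocks :: "(nat \<Rightarrow> nat \<Rightarrow> nat \<Rightarrow> 'a) \<Rightarrow> 'a blocks" where
  "blocks h = (\<lambda>k\<in>{..<length \<Delta>}. \<lambda>(i, j)\<in>{..<dim k} \<times> {..<dim k}. h k i j)"

definition entries :: "'a set \<Rightarrow> (nat \<Rightarrow> nat \<Rightarrow> nat \<Rightarrow> 'a) set" where
  "entries C = {h. \<forall>k<length \<Delta>. \<forall>i<dim k. \<forall>j<dim k. h k i j \<in> C}"

lemma entriesD: "\<lbrakk>h \<in> entries C; k < length \<Delta>; i < dim k; j < dim k\<rbrakk> \<Longrightarrow> h k i j \<in> C"
  by (simp add: entries_def)

lemma blocks_app [simp]: "\<lbrakk>k < length \<Delta>; i < dim k; j < dim k\<rbrakk> \<Longrightarrow> blocks h k (i, j) = h k i j"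
  by (simp add: blocks_def)

lemma blocks_eq_iff: "blocks g = blocks h \<longleftrightarrow> (\<forall>k<length \<Delta>. \<forall>i<dim k. \<forall>j<dim k. g k i j = h k i j)"
proof
  assume e: "blocks g = blocks h"
  show "\<forall>k<length \<Delta>. \<forall>i<dim k. \<forall>j<dim k. g k i j = h k i j"
    using e blocks_app by metis
next
  assume "\<forall>k<length \<Delta>. \<forall>i<dim k. \<forall>j<dim k. g k i j = h k i j"
  then show "blocks g = blocks h"
    by (auto simp: blocks_def intro!: restrict_ext)
qed

lemma blocks_cong:
  "(\<And>k i j. \<lbrakk>k < length \<Delta>; i < dim k; j < dim k\<rbrakk> \<Longrightarrow> g k i j = h k i j) \<Longrightarrow> blocks g = blocks h"
  by (simp add: blocks_eq_iff)

lemma R_carrierD: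
  assumes "r \<in> carrier R"
  shows "r = blocks (\<lambda>k i j. r k (i, j))" and "(\<lambda>k i j. r k (i, j)) \<in> entries (carrier A)"
proof -
  have r: "r \<in> (\<Pi>\<^sub>E k\<in>{..<length \<Delta>}. ({..<dim k} \<times> {..<dim k}) \<rightarrow>\<^sub>E carrier A)"
    using assms by (auto simp: gr_prod_def gr_mat_def Let_def PiE_iff)
  then show "(\<lambda>k i j. r k (i, j)) \<in> entries (carrier A)"
    by (auto simp: entries_def PiE_iff)
  show "r = blocks (\<lambda>k i j. r k (i, j))"
  proof (rule extensionalityI[of _ "{..<length \<Delta>}"])
    fix k assume k: "k \<in> {..<length \<Delta>}"
    show "r k = blocks (\<lambda>k i j. r k (i, j)) k"
    proof (rule extensionalityI[of _ "{..<dim k} \<times> {..<dim k}"])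
      show "r k \<in> extensional ({..<dim k} \<times> {..<dim k})"
        using r k by (auto simp: PiE_iff)
    qed (use k in \<open>auto simp: blocks_def\<close>)
  qed (use r in \<open>auto simp: PiE_iff blocks_def\<close>)
qed

lemma blocks_carrier [simp]: "blocks h \<in> carrier R \<longleftrightarrow> h \<in> entries (carrier A)"
  by (auto simp: gr_prod_def gr_mat_def Let_def PiE_iff blocks_def entries_def)

lemma R_carrierE:
  assumes "r \<in> carrier R"
  obtains h where "r = blocks h" "h \<in> entries (carrier A)"
  using R_carrierD[OF assms] that by blast

lemma R_add [simp]: "blocks g \<oplus>\<^bsub>R\<^esub> blocks h = blocks (\<lambda>k i j. g k i j \<oplus> h k i j)"
  by (auto simp: gr_prod_def gr_mat_def Let_def blocks_def intro!: restrict_ext)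

lemma R_zero: "\<zero>\<^bsub>R\<^esub> = blocks (\<lambda>k i j. \<zero>)"
  by (auto simp: gr_prod_def gr_mat_def Let_def blocks_def intro!: restrict_ext)

lemma R_one: "\<one>\<^bsub>R\<^esub> = blocks (\<lambda>k i j. if i = j then \<one> else \<zero>)"
  by (auto simp: gr_prod_def gr_mat_def Let_def blocks_def intro!: restrict_ext)

lemma R_scale [simp]: "scale R a (blocks h) = blocks (\<lambda>k i j. a \<otimes> h k i j)"
  by (auto simp: gr_prod_def gr_mat_def Let_def blocks_def intro!: restrict_ext)

lemma R_mult [simp]:
  assumes "g \<in> entries (carrier A)" "h \<in> entries (carrier A)"
  shows "blocks g \<otimes>\<^bsub>R\<^esub> blocks h = blocks (\<lambda>k i j. \<Oplus>m\<in>{..<dim k}. g k i m \<otimes> h k m j)"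
proof -
  have "blocks g \<otimes>\<^bsub>R\<^esub> blocks h = blocks (\<lambda>k i j. \<Oplus>m\<in>{..<dim k}. blocks g k (i, m) \<otimes> blocks h k (m, j))"
    by (auto simp: gr_prod_def gr_mat_def Let_def blocks_def intro!: restrict_ext)
  also have "\<dots> = blocks (\<lambda>k i j. \<Oplus>m\<in>{..<dim k}. g k i m \<otimes> h k m j)"
    by (rule blocks_cong, rule finsum_cong') (use assms in \<open>auto dest: entriesD\<close>)
  finally show ?thesis .
qed

lemma R_grade: "blocks h \<in> grade R \<gamma> \<longleftrightarrow>
  (\<forall>k<length \<Delta>. \<forall>i<dim k. \<forall>j<dim k. h k i j \<in> grade A (\<gamma> + \<Delta> ! k ! j - \<Delta> ! k ! i))"
  by (auto simp: gr_prod_def gr_mat_def Let_def PiE_iff blocks_def)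

lemma R_grade_carrier: "r \<in> grade R \<gamma> \<Longrightarrow> r \<in> carrier R"
  using grade_carrier
  by (force simp: gr_prod_def gr_mat_def Let_def PiE_iff)

lemma R_ring: "ring R"
proof (rule ringI)
  show "abelian_group R"
  proof (rule abelian_groupI)
    fix x y z assume "x \<in> carrier R" "y \<in> carrier R" "z \<in> carrier R"
    then show "x \<oplus>\<^bsub>R\<^esub> y \<oplus>\<^bsub>R\<^esub> z = x \<oplus>\<^bsub>R\<^esub> (y \<oplus>\<^bsub>R\<^esub> z)"
      by (elim R_carrierE) (auto simp: a_assoc entries_def intro!: blocks_cong)
  next
    fix x y assume "x \<in> carrier R" "y \<in> carrier R"
    then show "x \<oplus>\<^bsub>R\<^esub> y = y \<oplus>\<^bsub>R\<^esub> x" "x \<oplus>\<^bsub>R\<^esub> y \<in> carrier R"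
      by (elim R_carrierE; auto simp: a_comm entries_def intro!: blocks_cong)+
  next
    fix x assume "x \<in> carrier R"
    then obtain h where h: "x = blocks h" "h \<in> entries (carrier A)" by (rule R_carrierE)
    then show "\<zero>\<^bsub>R\<^esub> \<oplus>\<^bsub>R\<^esub> x = x"
      by (auto simp: R_zero entries_def intro!: blocks_cong)
    show "\<exists>y\<in>carrier R. y \<oplus>\<^bsub>R\<^esub> x = \<zero>\<^bsub>R\<^esub>"
      using h by (intro bexI[of _ "blocks (\<lambda>k i j. \<ominus> h k i j)"]) (auto simp: R_zero entries_def l_neg intro!: blocks_cong)
  qed (auto simp: R_zero entries_def)
  show "Group.monoid R"
  proof (rule monoidI)
    fix x y assume "x \<in> carrier R" "y \<in> carrier R"
    then show "x \<otimes>\<^bsub>R\<^esub> y \<in> carrier R"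
      by (elim R_carrierE) (auto simp: entries_def intro!: finsum_closed)
  next
    fix x y z assume "x \<in> carrier R" "y \<in> carrier R" "z \<in> carrier R"
    then obtain f g h where x: "x = blocks f" "f \<in> entries (carrier A)" and y: "y = blocks g" "g \<in> entries (carrier A)"
      and z: "z = blocks h" "h \<in> entries (carrier A)"
      by (elim R_carrierE)
    have fg: "(\<lambda>k i j. \<Oplus>m\<in>{..<dim k}. f k i m \<otimes> g k m j) \<in> entries (carrier A)"
      and gh: "(\<lambda>k i j. \<Oplus>m\<in>{..<dim k}. g k i m \<otimes> h k m j) \<in> entries (carrier A)"
      using x(2) y(2) z(2) by (auto simp: entries_def intro!: finsum_closed)
    have "(\<Oplus>m\<in>{..<dim k}. (\<Oplus>p\<in>{..<dim k}. f k i p \<otimes> g k p m) \<otimes> h k m j) =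
        (\<Oplus>p\<in>{..<dim k}. f k i p \<otimes> (\<Oplus>m\<in>{..<dim k}. g k p m \<otimes> h k m j))"
      if r: "k < length \<Delta>" "i < dim k" "j < dim k" for k i j
    proof -
      note c = entriesD[OF x(2) r(1)] entriesD[OF y(2) r(1)] entriesD[OF z(2) r(1)]
      have "(\<Oplus>m\<in>{..<dim k}. (\<Oplus>p\<in>{..<dim k}. f k i p \<otimes> g k p m) \<otimes> h k m j) =
        (\<Oplus>m\<in>{..<dim k}. \<Oplus>p\<in>{..<dim k}. f k i p \<otimes> g k p m \<otimes> h k m j)"
        by (rule finsum_cong') (use c r in \<open>auto intro!: finsum_ldistr finsum_closed\<close>)
      also have "\<dots> = (\<Oplus>p\<in>{..<dim k}. \<Oplus>m\<in>{..<dim k}. f k i p \<otimes> g k p m \<otimes> h k m j)"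
        by (rule finsum_swap) (use c r in auto)
      also have "\<dots> = (\<Oplus>p\<in>{..<dim k}. f k i p \<otimes> (\<Oplus>m\<in>{..<dim k}. g k p m \<otimes> h k m j))"
      proof (rule finsum_cong')
        fix p assume p: "p \<in> {..<dim k}"
        have "(\<Oplus>m\<in>{..<dim k}. f k i p \<otimes> g k p m \<otimes> h k m j) = (\<Oplus>m\<in>{..<dim k}. f k i p \<otimes> (g k p m \<otimes> h k m j))"
          by (rule finsum_cong') (use c r p in \<open>auto simp: m_assoc\<close>)
        also have "\<dots> = f k i p \<otimes> (\<Oplus>m\<in>{..<dim k}. g k p m \<otimes> h k m j)"
          by (rule finsum_rdistr[symmetric]) (use c r p in auto)
        finally show "(\<Oplus>m\<in>{..<dim k}. f k i p \<otimes> g k p m \<otimes> h k m j) = \<dots>" .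
      qed (use c r in \<open>auto intro!: finsum_closed\<close>)
      finally show ?thesis .
    qed
    then show "x \<otimes>\<^bsub>R\<^esub> y \<otimes>\<^bsub>R\<^esub> z = x \<otimes>\<^bsub>R\<^esub> (y \<otimes>\<^bsub>R\<^esub> z)"
      unfolding x(1) y(1) z(1) R_mult[OF x(2) y(2)] R_mult[OF y(2) z(2)] R_mult[OF fg z(2)] R_mult[OF x(2) gh]
      by (rule blocks_cong)
  next
    fix x assume "x \<in> carrier R"
    then obtain h where h: "x = blocks h" "h \<in> entries (carrier A)" by (rule R_carrierE)
    have o: "(\<lambda>k i j. if i = j then \<one> else \<zero>) \<in> entries (carrier A)"
      by (auto simp: entries_def)
    have "(\<Oplus>m\<in>{..<dim k}. (if i = m then \<one> else \<zero>) \<otimes> h k m j) = h k i j"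
      "(\<Oplus>m\<in>{..<dim k}. h k i m \<otimes> (if m = j then \<one> else \<zero>)) = h k i j" if r: "k < length \<Delta>" "i < dim k" "j < dim k" for k i j
    proof -
      note c = entriesD[OF h(2) r(1)]
      have "(\<Oplus>m\<in>{..<dim k}. (if i = m then \<one> else \<zero>) \<otimes> h k m j) = (\<Oplus>m\<in>{..<dim k}. if i = m then h k m j else \<zero>)"
        by (rule finsum_cong') (use c r in auto)
      then show "(\<Oplus>m\<in>{..<dim k}. (if i = m then \<one> else \<zero>) \<otimes> h k m j) = h k i j"
        using c r by (simp add: finsum_singleton)
      have "(\<Oplus>m\<in>{..<dim k}. h k i m \<otimes> (if m = j then \<one> else \<zero>)) = (\<Oplus>m\<in>{..<dim k}. if j = m then h k i m else \<zero>)"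
        by (rule finsum_cong') (use c r in auto)
      then show "(\<Oplus>m\<in>{..<dim k}. h k i m \<otimes> (if m = j then \<one> else \<zero>)) = h k i j"
        using c r by (simp add: finsum_singleton)
    qed
    then show "\<one>\<^bsub>R\<^esub> \<otimes>\<^bsub>R\<^esub> x = x" "x \<otimes>\<^bsub>R\<^esub> \<one>\<^bsub>R\<^esub> = x"
      unfolding R_one h(1) R_mult[OF o h(2)] R_mult[OF h(2) o] by (auto intro!: blocks_cong)
  qed (auto simp: R_one entries_def)
next
  fix x y z assume "x \<in> carrier R" "y \<in> carrier R" "z \<in> carrier R"
  then obtain f g h where x: "x = blocks f" "f \<in> entries (carrier A)" and y: "y = blocks g" "g \<in> entries (carrier A)"
    and z: "z = blocks h" "h \<in> entries (carrier A)"
    by (elim R_carrierE)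
  have fg: "(\<lambda>k i j. f k i j \<oplus> g k i j) \<in> entries (carrier A)"
    using x(2) y(2) by (auto simp: entries_def)
  have "(\<Oplus>m\<in>{..<dim k}. (f k i m \<oplus> g k i m) \<otimes> h k m j) =
      (\<Oplus>m\<in>{..<dim k}. f k i m \<otimes> h k m j) \<oplus> (\<Oplus>m\<in>{..<dim k}. g k i m \<otimes> h k m j)"
    "(\<Oplus>m\<in>{..<dim k}. h k i m \<otimes> (f k m j \<oplus> g k m j)) =
      (\<Oplus>m\<in>{..<dim k}. h k i m \<otimes> f k m j) \<oplus> (\<Oplus>m\<in>{..<dim k}. h k i m \<otimes> g k m j)"
    if r: "k < length \<Delta>" "i < dim k" "j < dim k" for k i j
  proof -
    note c = entriesD[OF x(2) r(1)] entriesD[OF y(2) r(1)] entriesD[OF z(2) r(1)]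
    show "(\<Oplus>m\<in>{..<dim k}. (f k i m \<oplus> g k i m) \<otimes> h k m j) =
      (\<Oplus>m\<in>{..<dim k}. f k i m \<otimes> h k m j) \<oplus> (\<Oplus>m\<in>{..<dim k}. g k i m \<otimes> h k m j)"
      by (rule trans[OF finsum_cong' finsum_addf]) (use c r in \<open>auto simp: l_distr\<close>)
    show "(\<Oplus>m\<in>{..<dim k}. h k i m \<otimes> (f k m j \<oplus> g k m j)) =
      (\<Oplus>m\<in>{..<dim k}. h k i m \<otimes> f k m j) \<oplus> (\<Oplus>m\<in>{..<dim k}. h k i m \<otimes> g k m j)"
      by (rule trans[OF finsum_cong' finsum_addf]) (use c r in \<open>auto simp: r_distr\<close>)
  qed
  then show "(x \<oplus>\<^bsub>R\<^esub> y) \<otimes>\<^bsub>R\<^esub> z = x \<otimes>\<^bsub>R\<^esub> z \<oplus>\<^bsub>R\<^esub> y \<otimes>\<^bsub>R\<^esub> z" "z \<otimes>\<^bsub>R\<^esub> (x \<oplus>\<^bsub>R\<^esub> y) = z \<otimes>\<^bsub>R\<^esub> x \<oplus>\<^bsub>R\<^esub> z \<otimes>\<^bsub>R\<^esub> y"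
    unfolding x(1) y(1) z(1) R_add R_mult[OF x(2) z(2)] R_mult[OF y(2) z(2)] R_mult[OF fg z(2)]
      R_mult[OF z(2) x(2)] R_mult[OF z(2) y(2)] R_mult[OF z(2) fg]
    by (auto intro!: blocks_cong)
qed

text \<open>The component of degree \<gamma> is taken entrywise, at position (i, j) in degree
  \<gamma> + \<delta>_j - \<delta>_i of \<open>A\<close>. There are finitely many positions, and
  each contributes a translate of a finite support.\<close>

lemma R_grading: "grading (add_monoid R) (grade R)"
proof -
  interpret R: ring R by (rule R_ring)
  let ?d = "\<lambda>\<gamma> k i j. \<gamma> + \<Delta> ! k ! j - \<Delta> ! k ! i"
  let ?c = "\<lambda>\<gamma> r. blocks (\<lambda>k i j. gcomp (add_monoid A) (grade A) (?d \<gamma> k i j) (r k (i, j)))"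
  note G = RG.gcomp_in[simplified] RG.gcomp_carrier[simplified]
  have in_R: "h \<in> entries (carrier A) \<Longrightarrow> ?c \<gamma> (blocks h) = blocks (\<lambda>k i j. gcomp (add_monoid A) (grade A) (?d \<gamma> k i j) (h k i j))" for h \<gamma>
    by (rule blocks_cong) simp
  have neg: "\<ominus>\<^bsub>R\<^esub> blocks h = blocks (\<lambda>k i j. \<ominus> h k i j)" if "h \<in> entries (carrier A)" for h
    by (rule R.minus_equality) (use that in \<open>auto simp: R_zero entries_def l_neg intro!: blocks_cong\<close>)
  show ?thesis
  proof (rule gradingI[where c = ?c])
    show "comm_group (add_monoid R)" by (rule R.a_comm_group)
    show "subgroup (grade R \<gamma>) (add_monoid R)" for \<gamma>
    proof (rule group.subgroupI[OF R.add.is_group])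
      show "grade R \<gamma> \<subseteq> carrier (add_monoid R)" using R_grade_carrier by auto
      have "blocks (\<lambda>k i j. \<zero>) \<in> grade R \<gamma>" by (simp add: R_grade grade_zero)
      then show "grade R \<gamma> \<noteq> {}" by blast
      fix a assume a: "a \<in> grade R \<gamma>"
      then obtain h where h: "a = blocks h" "h \<in> entries (carrier A)" using R_grade_carrier by (metis R_carrierE)
      then show "inv\<^bsub>add_monoid R\<^esub> a \<in> grade R \<gamma>"
        using a unfolding a_inv_def[symmetric] by (simp add: neg R_grade grade_minus)
      fix b assume b: "b \<in> grade R \<gamma>"
      then obtain g where g: "b = blocks g" "g \<in> entries (carrier A)" using R_grade_carrier by (metis R_carrierE)
      then show "a \<otimes>\<^bsub>add_monoid R\<^esub> b \<in> grade R \<gamma>"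
        using a b h by (simp add: R_grade grade_add)
    qed
    fix x assume "x \<in> carrier (add_monoid R)"
    then obtain h where h: "x = blocks h" "h \<in> entries (carrier A)" by (auto elim: R_carrierE)
    note hc = entriesD[OF h(2)]
    show "?c \<gamma> x \<in> grade R \<gamma>" for \<gamma>
      by (simp add: R_grade h(1) G hc)
    show "finite {\<gamma>. ?c \<gamma> x \<noteq> \<one>\<^bsub>add_monoid R\<^esub>}"
    proof (rule finite_subset)
      show "{\<gamma>. ?c \<gamma> x \<noteq> \<one>\<^bsub>add_monoid R\<^esub>} \<subseteq> (\<Union>k\<in>{..<length \<Delta>}. \<Union>i\<in>{..<dim k}. \<Union>j\<in>{..<dim k}.
        (\<lambda>\<gamma>. ?d \<gamma> k i j) -` {\<gamma>. gcomp (add_monoid A) (grade A) \<gamma> (h k i j) \<noteq> \<zero>})"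
        by (auto simp: R_zero h(1) blocks_eq_iff)
      have "finite ((\<lambda>\<gamma>. ?d \<gamma> k i j) -` {\<gamma>. gcomp (add_monoid A) (grade A) \<gamma> (h k i j) \<noteq> \<zero>})"
        if "k < length \<Delta>" "i < dim k" "j < dim k" for k i j
        using RG.gcomp_finite[of "h k i j"] hc[OF that] by (intro finite_vimageI) (auto simp: inj_def)
      then show "finite (\<Union>k\<in>{..<length \<Delta>}. \<Union>i\<in>{..<dim k}. \<Union>j\<in>{..<dim k}.
        (\<lambda>\<gamma>. ?d \<gamma> k i j) -` {\<gamma>. gcomp (add_monoid A) (grade A) \<gamma> (h k i j) \<noteq> \<zero>})"
        by blast
    qed
    show "x = \<one>\<^bsub>add_monoid R\<^esub>" if c: "\<And>\<gamma>. ?c \<gamma> x = \<one>\<^bsub>add_monoid R\<^esub>"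
    proof -
      have "h k i j = \<zero>" if r: "k < length \<Delta>" "i < dim k" "j < dim k" for k i j
      proof (rule RG.gcomp_eqI)
        fix \<gamma>
        show "gcomp (add_monoid A) (grade A) \<gamma> (h k i j) = gcomp (add_monoid A) (grade A) \<gamma> \<zero>"
        proof -
          \<comment> \<open>The degree in which the component of a matrix sees, at position (i, j),
            the component of degree \<gamma> of the entry.\<close>
          let ?\<gamma> = "\<gamma> + \<Delta> ! k ! i - \<Delta> ! k ! j"
          have "\<forall>k<length \<Delta>. \<forall>i<dim k. \<forall>j<dim k. gcomp (add_monoid A) (grade A) (?d ?\<gamma> k i j) (h k i j) = \<zero>"
            using c[of ?\<gamma>] by (simp add: R_zero h(1) blocks_eq_iff)
          then have "gcomp (add_monoid A) (grade A) (?d ?\<gamma> k i j) (h k i j) = \<zero>"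
            using r by blast
          then show ?thesis using RG.gcomp_one by simp
        qed
      qed (use hc r in auto)
      then show ?thesis by (simp add: h(1) R_zero blocks_eq_iff)
    qed
    fix y \<gamma> assume "y \<in> carrier (add_monoid R)"
    then obtain g where g: "y = blocks g" "g \<in> entries (carrier A)" by (auto elim: R_carrierE)
    show "?c \<gamma> (x \<otimes>\<^bsub>add_monoid R\<^esub> y) = ?c \<gamma> x \<otimes>\<^bsub>add_monoid R\<^esub> ?c \<gamma> y"
      using RG.gcomp_mult entriesD[OF g(2)] hc by (simp add: h(1) g(1) blocks_eq_iff)
  next
    fix \<gamma> \<gamma>' x assume x: "x \<in> grade R \<gamma>"
    then obtain h where h: "x = blocks h" "h \<in> entries (carrier A)" using R_grade_carrier by (metis R_carrierE)
    have "gcomp (add_monoid A) (grade A) (?d \<gamma>' k i j) (h k i j) = (if \<gamma>' = \<gamma> then h k i j else \<zero>)"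
      if r: "k < length \<Delta>" "i < dim k" "j < dim k" for k i j
      using RG.gcomp_homogeneous[of "h k i j" "?d \<gamma> k i j" "?d \<gamma>' k i j"] x r by (simp add: h(1) R_grade)
    then show "?c \<gamma>' x = (if \<gamma>' = \<gamma> then x else \<one>\<^bsub>add_monoid R\<^esub>)"
      by (cases "\<gamma>' = \<gamma>") (auto simp: h(1) R_zero blocks_eq_iff)
  qed
qed

sublocale R: gr_algebra A R
proof -
  interpret R: ring R by (rule R_ring)
  have E: "\<And>g h. \<lbrakk>g \<in> entries (carrier A); h \<in> entries (carrier A)\<rbrakk> \<Longrightarrow>
      (\<lambda>k i j. \<Oplus>m\<in>{..<dim k}. g k i m \<otimes> h k m j) \<in> entries (carrier A)"
    by (auto simp: entries_def intro!: finsum_closed)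
  have sc: "(\<lambda>k i j. a \<otimes> h k i j) \<in> entries (carrier A)" if "a \<in> carrier A" "h \<in> entries (carrier A)" for a h
    using that by (auto simp: entries_def)
  show "gr_algebra A R"
  proof (intro gr_algebra.intro gr_field_axioms gr_ring.intro R_ring gr_ring_axioms.intro R_grading gr_algebra_axioms.intro)
    fix x y \<alpha> \<beta> assume x: "x \<in> grade R \<alpha>" and y: "y \<in> grade R \<beta>"
    obtain g where g: "x = blocks g" "g \<in> entries (carrier A)" using x R_grade_carrier by (metis R_carrierE)
    obtain h where h: "y = blocks h" "h \<in> entries (carrier A)" using y R_grade_carrier by (metis R_carrierE)
    have "(\<Oplus>m\<in>{..<dim k}. g k i m \<otimes> h k m j) \<in> grade A (\<alpha> + \<beta> + \<Delta> ! k ! j - \<Delta> ! k ! i)"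
      if r: "k < length \<Delta>" "i < dim k" "j < dim k" for k i j
      unfolding finsum_def
    proof (rule RG.D_finprod)
      fix m assume "m \<in> {..<dim k}"
      then have "g k i m \<in> grade A (\<alpha> + \<Delta> ! k ! m - \<Delta> ! k ! i)" "h k m j \<in> grade A (\<beta> + \<Delta> ! k ! j - \<Delta> ! k ! m)"
        using x y r by (auto simp: g(1) h(1) R_grade)
      from grade_mult[OF this] show "g k i m \<otimes> h k m j \<in> grade A (\<alpha> + \<beta> + \<Delta> ! k ! j - \<Delta> ! k ! i)"
        by (simp add: algebra_simps)
    qed
    then show "x \<otimes>\<^bsub>R\<^esub> y \<in> grade R (\<alpha> + \<beta>)"
      unfolding g(1) h(1) R_mult[OF g(2) h(2)] R_grade by blast
  next
    fix a r assume "a \<in> carrier A" "r \<in> carrier R"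
    then show "scale R a r \<in> carrier R"
      by (elim R_carrierE) (simp add: sc)
  next
    fix a b r assume "a \<in> carrier A" "b \<in> carrier A" "r \<in> carrier R"
    then show "scale R (a \<oplus> b) r = scale R a r \<oplus>\<^bsub>R\<^esub> scale R b r" "scale R (a \<otimes> b) r = scale R a (scale R b r)"
      by (elim R_carrierE; auto simp: l_distr m_assoc entries_def intro!: blocks_cong)+
  next
    fix a r s assume "a \<in> carrier A" "r \<in> carrier R" "s \<in> carrier R"
    then show "scale R a (r \<oplus>\<^bsub>R\<^esub> s) = scale R a r \<oplus>\<^bsub>R\<^esub> scale R a s"
      by (elim R_carrierE) (auto simp: r_distr entries_def intro!: blocks_cong)
  next
    fix r assume "r \<in> carrier R"
    then show "scale R \<one> r = r"
      by (elim R_carrierE) (auto simp: entries_def intro!: blocks_cong)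
  next
    fix a x y assume a: "a \<in> carrier A" and "x \<in> carrier R" "y \<in> carrier R"
    then obtain f g where x: "x = blocks f" "f \<in> entries (carrier A)" and y: "y = blocks g" "g \<in> entries (carrier A)"
      by (elim R_carrierE)
    have s: "a \<otimes> (\<Oplus>m\<in>{..<dim k}. f k i m \<otimes> g k m j) = (\<Oplus>m\<in>{..<dim k}. a \<otimes> (f k i m \<otimes> g k m j))"
      if r: "k < length \<Delta>" "i < dim k" "j < dim k" for k i j
      by (rule finsum_rdistr) (use a entriesD[OF x(2) r(1)] entriesD[OF y(2) r(1)] r in auto)
    show "scale R a x \<otimes>\<^bsub>R\<^esub> y = scale R a (x \<otimes>\<^bsub>R\<^esub> y)"
      unfolding x(1) y(1) R_scale R_mult[OF x(2) y(2)] R_mult[OF sc[OF a x(2)] y(2)]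
      by (rule blocks_cong, subst s)
        (use a entriesD[OF x(2)] entriesD[OF y(2)] in \<open>auto simp: m_assoc intro!: finsum_cong'\<close>)
    show "x \<otimes>\<^bsub>R\<^esub> scale R a y = scale R a (x \<otimes>\<^bsub>R\<^esub> y)"
      unfolding x(1) y(1) R_scale R_mult[OF x(2) y(2)] R_mult[OF x(2) sc[OF a y(2)]]
      by (rule blocks_cong, subst s)
        (use a entriesD[OF x(2)] entriesD[OF y(2)] in \<open>auto simp: m_lcomm intro!: finsum_cong'\<close>)
  next
    fix a r \<alpha> \<beta> assume a: "a \<in> grade A \<alpha>" and r: "r \<in> grade R \<beta>"
    obtain g where g: "r = blocks g" "g \<in> entries (carrier A)" using r R_grade_carrier by (metis R_carrierE)
    have "a \<otimes> g k i j \<in> grade A (\<alpha> + \<beta> + \<Delta> ! k ! j - \<Delta> ! k ! i)" if "k < length \<Delta>" "i < dim k" "j < dim k" for k i j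
      using grade_mult[OF a, of "g k i j" "\<beta> + \<Delta> ! k ! j - \<Delta> ! k ! i"] r that by (simp add: g(1) R_grade algebra_simps)
    then show "scale R a r \<in> grade R (\<alpha> + \<beta>)"
      by (simp add: g(1) R_grade)
  qed
qed

definition unit_mat :: "'a \<Rightarrow> nat \<Rightarrow> nat \<Rightarrow> nat \<Rightarrow> 'a blocks" where
  "unit_mat a k i j = blocks (\<lambda>k' i' j'. if k' = k \<and> i' = i \<and> j' = j then a else \<zero>)"

lemma unit_mat_entries: "a \<in> carrier A \<Longrightarrow> (\<lambda>k' i' j'. if k' = k \<and> i' = i \<and> j' = j then a else \<zero>) \<in> entries (carrier A)"
  by (simp add: entries_def)

lemma unit_mat_carrier: "a \<in> carrier A \<Longrightarrow> unit_mat a k i j \<in> carrier R"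
  by (simp add: unit_mat_def unit_mat_entries)

lemma unit_mat_grade: "a \<in> grade A \<gamma> \<Longrightarrow> unit_mat a k i j \<in> grade R (\<gamma> + \<Delta> ! k ! i - \<Delta> ! k ! j)"
  by (auto simp: unit_mat_def R_grade grade_zero)

lemma unit_mat_scale: "\<lbrakk>a \<in> carrier A; b \<in> carrier A\<rbrakk> \<Longrightarrow> scale R a (unit_mat b k i j) = unit_mat (a \<otimes> b) k i j"
  by (simp add: unit_mat_def blocks_eq_iff)

lemma unit_mat_zero: "unit_mat \<zero> k i j = \<zero>\<^bsub>R\<^esub>"
  by (simp add: unit_mat_def R_zero blocks_eq_iff)

lemma unit_mat_mult_left:
  assumes a: "a \<in> carrier A" and h: "h \<in> entries (carrier A)" and j: "j < dim k"
  shows "unit_mat a k i j \<otimes>\<^bsub>R\<^esub> blocks h = blocks (\<lambda>k' i' j'. if k' = k \<and> i' = i then a \<otimes> h k j j' else \<zero>)"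
  unfolding unit_mat_def R_mult[OF unit_mat_entries[OF a] h]
proof (rule blocks_cong)
  fix k' i' j' assume r: "k' < length \<Delta>" "i' < dim k'" "j' < dim k'"
  note c = entriesD[OF h r(1)]
  have "(\<Oplus>m\<in>{..<dim k'}. (if k' = k \<and> i' = i \<and> m = j then a else \<zero>) \<otimes> h k' m j') =
      (\<Oplus>m\<in>{..<dim k'}. if j = m then (if k' = k \<and> i' = i then a \<otimes> h k' m j' else \<zero>) else \<zero>)"
    by (rule finsum_cong') (use a c r in auto)
  also have "\<dots> = (if k' = k \<and> i' = i then a \<otimes> h k j j' else \<zero>)"
  proof (cases "k' = k")
    case True
    then show ?thesis using a c r j by (subst finsum_singleton) auto
  next
    case False
    then show ?thesis by (auto intro!: add.finprod_one_eqI[folded finsum_def, simplified])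
  qed
  finally show "(\<Oplus>m\<in>{..<dim k'}. (if k' = k \<and> i' = i \<and> m = j then a else \<zero>) \<otimes> h k' m j') = \<dots>" .
qed

lemma unit_mat_mult_right:
  assumes a: "a \<in> carrier A" and h: "h \<in> entries (carrier A)" and i: "i < dim k"
  shows "blocks h \<otimes>\<^bsub>R\<^esub> unit_mat a k i j = blocks (\<lambda>k' i' j'. if k' = k \<and> j' = j then h k i' i \<otimes> a else \<zero>)"
  unfolding unit_mat_def R_mult[OF h unit_mat_entries[OF a]]
proof (rule blocks_cong)
  fix k' i' j' assume r: "k' < length \<Delta>" "i' < dim k'" "j' < dim k'"
  note c = entriesD[OF h r(1)]
  have "(\<Oplus>m\<in>{..<dim k'}. h k' i' m \<otimes> (if k' = k \<and> m = i \<and> j' = j then a else \<zero>)) =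
      (\<Oplus>m\<in>{..<dim k'}. if i = m then (if k' = k \<and> j' = j then h k' i' m \<otimes> a else \<zero>) else \<zero>)"
    by (rule finsum_cong') (use a c r in auto)
  also have "\<dots> = (if k' = k \<and> j' = j then h k i' i \<otimes> a else \<zero>)"
  proof (cases "k' = k")
    case True
    then show ?thesis using a c r i by (subst finsum_singleton) auto
  next
    case False
    then show ?thesis by (auto intro!: add.finprod_one_eqI[folded finsum_def, simplified])
  qed
  finally show "(\<Oplus>m\<in>{..<dim k'}. h k' i' m \<otimes> (if k' = k \<and> m = i \<and> j' = j then a else \<zero>)) = \<dots>" .
qed

lemma unit_mat_mult:
  assumes "a \<in> carrier A" "b \<in> carrier A" "j < dim k"
  shows "unit_mat a k i j \<otimes>\<^bsub>R\<^esub> unit_mat b k' i' j' = (if k' = k \<and> i' = j then unit_mat (a \<otimes> b) k i j' else \<zero>\<^bsub>R\<^esub>)"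
  unfolding unit_mat_def[of b] unit_mat_mult_left[OF assms(1) unit_mat_entries[OF assms(2)] assms(3)]
  using assms by (auto simp: unit_mat_def R_zero blocks_eq_iff)

definition idx3 :: "(nat \<times> nat \<times> nat) set" where
  "idx3 = {(k, i, j). k < length \<Delta> \<and> i < dim k \<and> j < dim k}"

text \<open>One index for each diagonal idempotent, hence for each row module.\<close>

definition idx2 :: "(nat \<times> nat) set" where
  "idx2 = {(k, i). k < length \<Delta> \<and> i < dim k}"

lemma finite_idx2: "finite idx2"
proof -
  have "idx2 = (SIGMA k:{..<length \<Delta>}. {..<dim k})" by (auto simp: idx2_def)
  then show ?thesis by simp
qed

lemma finite_idx3: "finite idx3"
proof -
  have "idx3 = (SIGMA k:{..<length \<Delta>}. {..<dim k} \<times> {..<dim k})" by (auto simp: idx3_def)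
  then show ?thesis by simp
qed

lemma entry_finsum:
  assumes "f \<in> I \<rightarrow> carrier R" "k < length \<Delta>" "i < dim k" "j < dim k"
  shows "finsum R f I k (i, j) = (\<Oplus>x\<in>I. f x k (i, j))"
proof -
  have "(\<lambda>r. r k (i, j)) \<in> hom (add_monoid R) (add_monoid A)"
  proof (rule homI)
    fix r s assume "r \<in> carrier (add_monoid R)" "s \<in> carrier (add_monoid R)"
    then have "r \<in> carrier R" "s \<in> carrier R" by auto
    then show "(r \<otimes>\<^bsub>add_monoid R\<^esub> s) k (i, j) = r k (i, j) \<otimes>\<^bsub>add_monoid A\<^esub> s k (i, j)"
      using assms(2-) by (elim R_carrierE) simp
  qed (use assms(2-) in \<open>auto elim!: R_carrierE simp: entriesD\<close>)
  from hom_finprod[OF R.a_comm_group a_comm_group this, of f I] assms(1) show ?thesis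
    by (simp add: finsum_def)
qed

lemma R_eqI:
  assumes "r \<in> carrier R" "s \<in> carrier R"
    and "\<And>k i j. \<lbrakk>k < length \<Delta>; i < dim k; j < dim k\<rbrakk> \<Longrightarrow> r k (i, j) = s k (i, j)"
  shows "r = s"
  using assms(3) by (subst R_carrierD(1)[OF assms(1)], subst R_carrierD(1)[OF assms(2)]) (rule blocks_cong)

lemma R_decomp:
  assumes "r \<in> carrier R"
  shows "r = finsum R (\<lambda>(k, i, j). unit_mat (r k (i, j)) k i j) idx3"
proof (rule R_eqI[OF assms])
  note c = entriesD[OF R_carrierD(2)[OF assms]]
  let ?f = "\<lambda>(k, i, j). unit_mat (r k (i, j)) k i j"
  have f: "?f \<in> idx3 \<rightarrow> carrier R"
    using c by (auto simp: idx3_def unit_mat_carrier)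
  then show "finsum R ?f idx3 \<in> carrier R" by (rule R.finsum_closed)
  fix k i j assume r: "k < length \<Delta>" "i < dim k" "j < dim k"
  have "finsum R ?f idx3 k (i, j) = (\<Oplus>x\<in>idx3. ?f x k (i, j))"
    by (rule entry_finsum[OF f r])
  also have "\<dots> = (\<Oplus>x\<in>idx3. if (k, i, j) = x then r k (i, j) else \<zero>)"
    by (rule finsum_cong') (use c r in \<open>auto simp: unit_mat_def split: if_splits\<close>)
  also have "\<dots> = r k (i, j)"
    using c r finite_idx3 by (intro finsum_singleton) (auto simp: idx3_def)
  finally show "r k (i, j) = finsum R ?f idx3 k (i, j)" by simp
qed

lemma R_one_decomp: "finsum R (\<lambda>(k, i). unit_mat \<one> k i i) idx2 = \<one>\<^bsub>R\<^esub>"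
proof (rule R_eqI)
  let ?f = "\<lambda>(k, i). unit_mat \<one> k i i"
  have f: "?f \<in> idx2 \<rightarrow> carrier R"
    by (auto simp: idx2_def unit_mat_carrier)
  then show "finsum R ?f idx2 \<in> carrier R" by (rule R.finsum_closed)
  fix k i j assume r: "k < length \<Delta>" "i < dim k" "j < dim k"
  have "finsum R ?f idx2 k (i, j) = (\<Oplus>x\<in>idx2. ?f x k (i, j))"
    by (rule entry_finsum[OF f r])
  also have "\<dots> = (\<Oplus>x\<in>idx2. if (k, i) = x then (if i = j then \<one> else \<zero>) else \<zero>)"
    by (rule finsum_cong') (use r in \<open>auto simp: unit_mat_def split: if_splits\<close>)
  also have "\<dots> = (if i = j then \<one> else \<zero>)"
    using r finite_idx2 by (intro finsum_singleton) (auto simp: idx2_def)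
  finally show "finsum R ?f idx2 k (i, j) = \<one>\<^bsub>R\<^esub> k (i, j)" using r by (simp add: R_one)
qed simp

text \<open>By \<open>R_decomp\<close> the multiples of matrix units generate R additively.
  Identities that are additive in one argument, such as multiplicativity, are proved this
  way.\<close>

lemma R_induct:
  assumes r: "r \<in> carrier R" and zero: "P \<zero>\<^bsub>R\<^esub>"
    and add: "\<And>x y. \<lbrakk>x \<in> carrier R; y \<in> carrier R; P x; P y\<rbrakk> \<Longrightarrow> P (x \<oplus>\<^bsub>R\<^esub> y)"
    and unit: "\<And>a k i j. \<lbrakk>a \<in> carrier A; k < length \<Delta>; i < dim k; j < dim k\<rbrakk> \<Longrightarrow> P (unit_mat a k i j)"
  shows "P r"
proof -
  let ?f = "\<lambda>(k, i, j). unit_mat (r k (i, j)) k i j"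
  note c = entriesD[OF R_carrierD(2)[OF r]]
  have "J \<subseteq> idx3 \<Longrightarrow> P (finsum R ?f J) \<and> finsum R ?f J \<in> carrier R" for J
  proof (induction J rule: infinite_finite_induct)
    case (insert t J)
    have t: "P (?f t)" "?f t \<in> carrier R"
      using insert.prems c by (auto simp: idx3_def unit unit_mat_carrier split: prod.splits)
    have "?f \<in> J \<rightarrow> carrier R"
      using insert.prems c by (auto simp: idx3_def unit_mat_carrier)
    then have "finsum R ?f (insert t J) = ?f t \<oplus>\<^bsub>R\<^esub> finsum R ?f J"
      using insert.hyps t by (intro R.finsum_insert) auto
    then show ?case using insert add t by auto
  qed (simp_all add: zero)
  from this[of idx3] R_decomp[OF r] show ?thesis by simp
qed

abbreviation row where "row k i \<equiv> idem_module R (unit_mat \<one> k i i)"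

lemma one_grade_unit: "unit_mat \<one> k i j \<in> grade R (\<Delta> ! k ! i - \<Delta> ! k ! j)"
  using unit_mat_grade[OF one_grade, of k i j] by simp

lemma unit_idem: "i < dim k \<Longrightarrow> unit_mat \<one> k i i \<otimes>\<^bsub>R\<^esub> unit_mat \<one> k i i = unit_mat \<one> k i i"
  by (simp add: unit_mat_mult)

lemma row_fgproj: "i < dim k \<Longrightarrow> fgproj R (row k i)"
  using R.fgproj_idem[OF one_grade_unit[of k i i, simplified] unit_idem] .

text \<open>An endomorphism h is left multiplication by h e, where e is
  \<open>unit_mat \<one> k i i\<close>, and h e = e (h e) e is a multiple of e by some a. The shifts
  at a diagonal position cancel, so a lies in degree zero of \<open>A\<close>; if h is nonzero then
  so is a, and as a homogeneous element it is invertible. Here the hypothesis that \<open>A\<close>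
  is a graded field enters.\<close>

lemma row_brick:
  assumes k: "k < length \<Delta>" and i: "i < dim k"
  shows "brick R (row k i)"
  unfolding brick_def
proof (intro conjI ballI impI)
  let ?e = "unit_mat \<one> k i i"
  have e0: "?e \<in> grade R 0" using one_grade_unit[of k i i] by simp
  have ec: "?e \<in> carrier R" by (simp add: unit_mat_carrier)
  show M: "gr_module R (row k i)" by (rule R.gr_module_idem[OF e0])
  fix h assume h: "h \<in> gr_module_hom R (row k i) (row k i)" and "\<exists>x\<in>carrier (row k i). h x \<noteq> \<one>\<^bsub>row k i\<^esub>"
  then obtain x where x: "x \<in> carrier R" "?e \<otimes>\<^bsub>R\<^esub> x = x" "h x \<noteq> \<zero>\<^bsub>R\<^esub>" by auto
  have he: "h ?e \<in> mgrade (row k i) 0"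
    by (rule gmh_grade[OF h]) (use e0 ec unit_idem[OF i] in simp)
  then have c: "h ?e \<in> carrier R" "?e \<otimes>\<^bsub>R\<^esub> h ?e = h ?e" "h ?e \<in> grade R 0" by auto
  have ce: "h ?e \<otimes>\<^bsub>R\<^esub> ?e = h ?e"
    using gmh_ract[OF h, of ?e ?e] ec unit_idem[OF i] by simp
  obtain g where g: "h ?e = blocks g" "g \<in> entries (carrier A)" using c(1) by (rule R_carrierE)
  define a where "a = g k i i"
  have ac: "a \<in> carrier A" using entriesD[OF g(2) k i i] by (simp add: a_def)
  have "g k i i \<in> grade A (0 + \<Delta> ! k ! i - \<Delta> ! k ! i)" using c(3) k i unfolding g(1) R_grade by blast
  then have a0: "a \<in> grade A 0" by (simp add: a_def)
  have eg: "(\<lambda>k' i' j'. if k' = k \<and> i' = i then \<one> \<otimes> g k i j' else \<zero>) \<in> entries (carrier A)"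
    using entriesD[OF g(2)] by (auto simp: entries_def)
  have "h ?e = (?e \<otimes>\<^bsub>R\<^esub> h ?e) \<otimes>\<^bsub>R\<^esub> ?e" by (simp add: c ce)
  also have "\<dots> = unit_mat a k i i"
    unfolding g(1) unit_mat_mult_left[OF one_closed g(2) i] unit_mat_mult_right[OF one_closed eg i]
    using entriesD[OF g(2) k i i] by (auto simp: unit_mat_def a_def blocks_eq_iff)
  finally have hea: "h ?e = unit_mat a k i i" .
  have hr: "h r = unit_mat a k i i \<otimes>\<^bsub>R\<^esub> r" if "r \<in> carrier (row k i)" for r
    using gmh_ract[OF h, of ?e r] that ec unit_idem[OF i] by (simp add: hea)
  have "a \<noteq> \<zero>"
  proof
    assume "a = \<zero>"
    then have "h x = \<zero>\<^bsub>R\<^esub>" using hr[of x] x by (simp add: unit_mat_zero)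
    then show False using x by simp
  qed
  then have aU: "a \<in> Units A" using homogeneous_Units[OF a0] by blast
  let ?b = "unit_mat (inv a) k i i"
  have bc: "?b \<in> carrier R" "unit_mat a k i i \<in> carrier R" using aU by (auto simp: unit_mat_carrier)
  have ab: "unit_mat a k i i \<otimes>\<^bsub>R\<^esub> ?b = ?e" "?b \<otimes>\<^bsub>R\<^esub> unit_mat a k i i = ?e" "?e \<otimes>\<^bsub>R\<^esub> ?b = ?b"
    using aU ac i Units_inv_closed[OF aU] by (simp_all add: unit_mat_mult)
  show "bij_betw h (carrier (row k i)) (carrier (row k i))"
  proof (rule bij_betwI[where g = "\<lambda>r. ?b \<otimes>\<^bsub>R\<^esub> r"])
    show "h \<in> carrier (row k i) \<rightarrow> carrier (row k i)" using gmh_closed[OF h] by blast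
    show b: "(\<lambda>r. ?b \<otimes>\<^bsub>R\<^esub> r) \<in> carrier (row k i) \<rightarrow> carrier (row k i)"
      using bc ec ab(3) by (auto simp: R.m_assoc[symmetric])
    show "?b \<otimes>\<^bsub>R\<^esub> h r = r" if "r \<in> carrier (row k i)" for r
      using hr[OF that] that bc ab by (simp add: R.m_assoc[symmetric])
    show "h (?b \<otimes>\<^bsub>R\<^esub> r) = r" if "r \<in> carrier (row k i)" for r
    proof -
      have "?b \<otimes>\<^bsub>R\<^esub> r \<in> carrier (row k i)" using b that by blast
      then have "h (?b \<otimes>\<^bsub>R\<^esub> r) = unit_mat a k i i \<otimes>\<^bsub>R\<^esub> (?b \<otimes>\<^bsub>R\<^esub> r)" by (rule hr)
      then show ?thesis using that bc ab by (simp add: R.m_assoc[symmetric])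
    qed
  qed
qed

lemma regular_rows: "gr_isomorphic R (regular_module R) (dsum idx2 (\<lambda>(k, i). row k i))"
proof -
  let ?e = "\<lambda>(k, i). unit_mat \<one> k i i"
  have "gr_isomorphic R (regular_module R) (dsum idx2 (\<lambda>t. idem_module R (?e t)))"
  proof (rule R.idem_module_decomp[OF finite_idx2])
    show "?e t \<in> grade R 0" for t using one_grade_unit[of "fst t" "snd t" "snd t"] by (cases t) simp
    show "?e t \<otimes>\<^bsub>R\<^esub> ?e t' = (if t = t' then ?e t else \<zero>\<^bsub>R\<^esub>)" if "t \<in> idx2" "t' \<in> idx2" for t t'
      using that by (auto simp: idx2_def unit_mat_mult)
  qed (rule R_one_decomp)
  moreover have "(\<lambda>t. idem_module R (?e t)) = (\<lambda>(k, i). row k i)" by auto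
  ultimately show ?thesis by simp
qed

sublocale BR: brick_ring R idx2 "\<lambda>(k, i). row k i"
  by unfold_locales (use finite_idx2 regular_rows in \<open>auto simp: idx2_def row_brick row_fgproj\<close>)

text \<open>The matrix units e_ij and e_ji link the two diagonal idempotents, and e_ij has degree
  \<delta>_i - \<delta>_j. So a block contributes one class up to the action of \<Gamma>, that of
  its first row.\<close>

lemma row_shift_iso:
  assumes "i < dim k" "j < dim k"
  shows "gr_isomorphic R (row k i) (shift (\<Delta> ! k ! j - \<Delta> ! k ! i) (row k j))"
  using R.idem_module_iso_shift[of "unit_mat \<one> k i i" "unit_mat \<one> k j j" "unit_mat \<one> k i j" "\<Delta> ! k ! i - \<Delta> ! k ! j" "unit_mat \<one> k j i"]
    one_grade_unit[of k i i] one_grade_unit[of k j j] one_grade_unit[of k i j] one_grade_unit[of k j i] assms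
  by (simp add: unit_mat_mult)

end

section \<open>Homomorphisms between matricial algebras and their effect on K0\<close>

section \<open>Inner automorphisms act trivially\<close>

text \<open>Let b be the component of degree zero of the inverse. Left multiplication by x preserves
  degrees and 1 has degree zero, so x b = 1, and b is the inverse itself.\<close>

lemma (in gr_ring) inv_grade_zero:
  assumes "x \<in> Units R" "x \<in> grade R 0"
  shows "inv x \<in> grade R 0"
proof -
  interpret M: gr_module R "regular_module R" by (rule gr_module_regular) (rule gr_ring_axioms)
  have x: "x \<in> carrier R" "inv x \<in> carrier R" using assms by auto
  let ?b = "gcomp (regular_module R) (mgrade (regular_module R)) 0 (inv x)"
  have b: "?b \<in> grade R 0" using M.MG.gcomp_in[of "inv x" 0] x by simp
  then have bc: "?b \<in> carrier R" by (rule grade_carrier)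
  have "x \<otimes> ?b = gcomp (regular_module R) (mgrade (regular_module R)) 0 (x \<otimes> inv x)"
    using gmh_gcomp[OF M.gr_module_axioms M.gr_module_axioms gmh_mult_left0[OF assms(2)], of "inv x" 0] x by simp
  also have "\<dots> = \<one>"
    using M.MG.gcomp_homogeneous[of \<one> 0 0] one_grade assms(1) by simp
  finally have "inv x \<otimes> (x \<otimes> ?b) = inv x" using x by simp
  then have "?b = inv x" using x bc assms(1) by (simp add: m_assoc[symmetric])
  then show ?thesis using b by simp
qed

text \<open>The same module Q extends scalars along both maps: if u does so along \<psi>, then u
  followed by right multiplication with the inverse of x does so along \<phi>, and coordinates are
  multiplied by x from the left. Degrees are kept because x and its inverse have degree
  zero.\<close>

lemma K0_map_inner:
  fixes R :: "('g::ab_group_add, 'r, 'x) gring_scheme" and S :: "('g, 's, 'y) gring_scheme"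
  assumes \<phi>: "gr_hom R S \<phi>" and \<psi>: "gr_hom R S \<psi>" and x: "x \<in> Units S" "x \<in> grade S 0"
    and eq: "\<And>r. r \<in> carrier R \<Longrightarrow> \<phi> r = x \<otimes>\<^bsub>S\<^esub> \<psi> r \<otimes>\<^bsub>S\<^esub> inv\<^bsub>S\<^esub> x"
  shows "K0_map R S \<phi> = K0_map R S \<psi>"
proof -
  interpret a: gr_hom R S \<phi> by fact
  interpret b: gr_hom R S \<psi> by fact
  let ?y = "inv\<^bsub>S\<^esub> x"
  have y0: "?y \<in> grade S 0" by (rule a.S.inv_grade_zero[OF x])
  have c: "x \<in> carrier S" "?y \<in> carrier S" using x by auto
  have xy: "x \<otimes>\<^bsub>S\<^esub> ?y = \<one>\<^bsub>S\<^esub>" "?y \<otimes>\<^bsub>S\<^esub> x = \<one>\<^bsub>S\<^esub>" using x by auto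
  show ?thesis
  proof (rule a.K0_map_eqI[OF b.K0_map_hom])
    show "K0_map R S \<psi> \<in> extensional (carrier (K0_group R))" by (simp add: K0_map_def)
    fix P assume "P \<in> gr_fgp R"
    then have P: "fgproj R P" by (simp add: gr_fgp_iff)
    obtain Q :: "('g, 's) tuple_module" and u where E: "ext_scalars R S \<psi> P Q u" by (rule b.ext_scalars_exists[OF P])
    note D = ext_scalarsD[OF E]
    interpret Q: gr_module S Q by (rule D)
    obtain n z d f g where B: "dual_basis R P {..<n::nat} z d f" and C: "dual_basis S Q {..<n} (\<lambda>i. u (z i)) d g"
      and gu: "\<forall>i<n. \<forall>p\<in>carrier P. g i (u p) = \<psi> (f i p)"
      using E by (auto simp: ext_scalars_def)
    note F = dual_basis_facts[OF B D(1)] and G = dual_basis_facts[OF C D(2)]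
    note uc = semilinear_closed[OF D(3)]
    have "ext_scalars R S \<phi> P Q (\<lambda>p. u p \<star>\<^bsub>Q\<^esub> ?y)"
    proof (rule a.ext_scalarsI[OF D(1,2) _ B, where g = "\<lambda>i q. x \<otimes>\<^bsub>S\<^esub> g i q"])
      show "(\<lambda>p. u p \<star>\<^bsub>Q\<^esub> ?y) \<in> semilinear R \<phi> P Q"
      proof (rule semilinearI)
        fix p r assume p: "p \<in> carrier P" and r: "r \<in> carrier R"
        have "?y \<otimes>\<^bsub>S\<^esub> \<phi> r = ?y \<otimes>\<^bsub>S\<^esub> x \<otimes>\<^bsub>S\<^esub> \<psi> r \<otimes>\<^bsub>S\<^esub> ?y"
          using c b.\<phi>_closed[OF r] by (simp add: eq[OF r] a.S.m_assoc)
        then have "?y \<otimes>\<^bsub>S\<^esub> \<phi> r = \<psi> r \<otimes>\<^bsub>S\<^esub> ?y"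
          using xy(2) b.\<phi>_closed[OF r] by simp
        then show "u (p \<star>\<^bsub>P\<^esub> r) \<star>\<^bsub>Q\<^esub> ?y = u p \<star>\<^bsub>Q\<^esub> ?y \<star>\<^bsub>Q\<^esub> \<phi> r"
          using p r c uc[OF p] a.\<phi>_closed[OF r] b.\<phi>_closed[OF r]
          by (simp add: semilinear_ract[OF D(3)] Q.ract_mult[symmetric])
      next
        fix p \<gamma> assume "p \<in> mgrade P \<gamma>"
        then show "u p \<star>\<^bsub>Q\<^esub> ?y \<in> mgrade Q \<gamma>"
          using Q.grade_ract[OF semilinear_grade[OF D(3)] y0] by fastforce
      qed (auto simp: uc c Q.ract_closed semilinear_mult[OF D(3)] Q.ract_add_left)
      show "dual_basis S Q {..<n} (\<lambda>i. u (z i) \<star>\<^bsub>Q\<^esub> ?y) d (\<lambda>i q. x \<otimes>\<^bsub>S\<^esub> g i q)"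
        unfolding dual_basis_def
      proof (intro conjI ballI)
        fix q assume q: "q \<in> carrier Q"
        have "finprod Q (\<lambda>i. u (z i) \<star>\<^bsub>Q\<^esub> ?y \<star>\<^bsub>Q\<^esub> (x \<otimes>\<^bsub>S\<^esub> g i q)) {..<n} = finprod Q (\<lambda>i. u (z i) \<star>\<^bsub>Q\<^esub> g i q) {..<n}"
        proof (rule Q.M.finprod_cong')
          fix i assume i: "i \<in> {..<n}"
          have "?y \<otimes>\<^bsub>S\<^esub> (x \<otimes>\<^bsub>S\<^esub> g i q) = g i q"
            using c xy(2) G(2)[OF i q] by (simp add: a.S.m_assoc[symmetric])
          then show "u (z i) \<star>\<^bsub>Q\<^esub> ?y \<star>\<^bsub>Q\<^esub> (x \<otimes>\<^bsub>S\<^esub> g i q) = u (z i) \<star>\<^bsub>Q\<^esub> g i q"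
            using c G(1)[OF i] G(2)[OF i q] by (simp add: Q.ract_mult[symmetric])
        qed (use G q in \<open>auto simp: Q.ract_closed\<close>)
        then show "q = finprod Q (\<lambda>i. u (z i) \<star>\<^bsub>Q\<^esub> ?y \<star>\<^bsub>Q\<^esub> (x \<otimes>\<^bsub>S\<^esub> g i q)) {..<n}"
          by (simp add: dual_basisD(4)[OF C q])
      next
        fix i assume i: "i \<in> {..<n}"
        show "u (z i) \<star>\<^bsub>Q\<^esub> ?y \<in> mgrade Q (d i)"
          using Q.grade_ract[OF dual_basisD(2)[OF C i] y0] by simp
        show "(\<lambda>q. x \<otimes>\<^bsub>S\<^esub> g i q) \<in> gr_module_hom S Q (shift (- d i) (regular_module S))"
          by (rule gmh_comp[OF dual_basisD(3)[OF C i] gmh_mult_left[OF a.S.gr_ring_axioms]]) (simp add: x)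
      qed simp
      show "x \<otimes>\<^bsub>S\<^esub> g i (u p \<star>\<^bsub>Q\<^esub> ?y) = \<phi> (f i p)" if i: "i \<in> {..<n}" and p: "p \<in> carrier P" for i p
        using G(4)[OF i uc[OF p] c(2)] gu i p c F(2)[OF i p] b.\<phi>_closed[of "f i p"] by (simp add: eq a.S.m_assoc)
    qed
    then show "K0_map R S \<phi> (K0_class R P) = K0_map R S \<psi> (K0_class R P)"
      by (simp add: a.K0_map_class b.K0_map_class[OF E])
  qed
qed

section \<open>Systems of matrix units\<close>

lemma gr_alg_hom_gr_hom: "\<lbrakk>\<phi> \<in> gr_alg_hom A R S; gr_ring R; gr_ring S\<rbrakk> \<Longrightarrow> gr_hom R S \<phi>"
  by (auto simp: gr_alg_hom_def gr_hom_def gr_hom_axioms_def image_subset_iff)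

lemma (in gr_algebra) scale_zero_right: "a \<in> carrier A \<Longrightarrow> scale R a \<zero> = \<zero>"
  using scale_add_right[of a \<zero> \<zero>] scale_closed[of a \<zero>] by simp

lemma (in gr_algebra) scale_zero_left: "r \<in> carrier R \<Longrightarrow> scale R \<zero>\<^bsub>A\<^esub> r = \<zero>"
  using scale_add_left[of "\<zero>\<^bsub>A\<^esub>" "\<zero>\<^bsub>A\<^esub>" r] scale_closed[of "\<zero>\<^bsub>A\<^esub>" r] by simp

context matricial
begin

text \<open>The last condition makes the homomorphism built from such a system unital. Members of
  the system may vanish, as happens when a block is mapped to zero.\<close>

definition matrix_units :: "('s, 'z) ring_scheme \<Rightarrow> (nat \<Rightarrow> nat \<Rightarrow> nat \<Rightarrow> 's) \<Rightarrow> bool" where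
  "matrix_units S e \<longleftrightarrow>
    (\<forall>k i j. k < length \<Delta> \<longrightarrow> i < dim k \<longrightarrow> j < dim k \<longrightarrow> e k i j \<in> carrier S) \<and>
    (\<forall>k i j k' i' j'. k < length \<Delta> \<longrightarrow> i < dim k \<longrightarrow> j < dim k \<longrightarrow> k' < length \<Delta> \<longrightarrow> i' < dim k' \<longrightarrow> j' < dim k' \<longrightarrow>
      e k i j \<otimes>\<^bsub>S\<^esub> e k' i' j' = (if k' = k \<and> i' = j then e k i j' else \<zero>\<^bsub>S\<^esub>)) \<and>
    finsum S (\<lambda>(k, i). e k i i) idx2 = \<one>\<^bsub>S\<^esub>"

lemma
  assumes "matrix_units S e" "k < length \<Delta>" "i < dim k" "j < dim k"
  shows mu_closed: "e k i j \<in> carrier S"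
    and mu_mult: "\<lbrakk>k' < length \<Delta>; i' < dim k'; j' < dim k'\<rbrakk>
      \<Longrightarrow> e k i j \<otimes>\<^bsub>S\<^esub> e k' i' j' = (if k' = k \<and> i' = j then e k i j' else \<zero>\<^bsub>S\<^esub>)"
  using assms unfolding matrix_units_def by blast+

lemma mu_sum: "matrix_units S e \<Longrightarrow> finsum S (\<lambda>(k, i). e k i i) idx2 = \<one>\<^bsub>S\<^esub>"
  by (simp add: matrix_units_def)

lemma matrix_units_hom:
  assumes "gr_hom R S \<phi>"
  shows "matrix_units S (\<lambda>k i j. \<phi> (unit_mat \<one> k i j))"
proof -
  interpret h: gr_hom R S \<phi> by fact
  have z: "\<phi> \<zero>\<^bsub>R\<^esub> = \<zero>\<^bsub>S\<^esub>"
    using hom_one[OF h.\<phi>_hom R.add.is_group h.S.add.is_group] by simp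
  have c: "unit_mat \<one> k i j \<in> carrier R" for k i j by (simp add: unit_mat_carrier)
  have m: "\<phi> (unit_mat \<one> k i j) \<otimes>\<^bsub>S\<^esub> \<phi> (unit_mat \<one> k' i' j') =
      (if k' = k \<and> i' = j then \<phi> (unit_mat \<one> k i j') else \<zero>\<^bsub>S\<^esub>)"
    if "j < dim k" for k i j k' i' j'
    using h.\<phi>_mult[OF c c, of k i j k' i' j'] that by (auto simp: unit_mat_mult z)
  have "finsum S (\<lambda>(k, i). \<phi> (unit_mat \<one> k i i)) idx2 = \<phi> (finsum R (\<lambda>(k, i). unit_mat \<one> k i i) idx2)"
    by (subst h.\<phi>_finsum) (auto simp: c case_prod_unfold)
  then show ?thesis
    unfolding matrix_units_def using m by (auto simp: c h.\<phi>_closed R_one_decomp h.\<phi>_one)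
qed

text \<open>The intertwiner T of two systems. \<open>twist_mult_right\<close> and
  \<open>twist_mult_left\<close> bring T f_kjl and e_kjl T to one and the same expression, so, when
  T is invertible, conjugation by T carries the system f to the system e.\<close>

definition twist :: "('s, 'z) ring_scheme \<Rightarrow> (nat \<Rightarrow> nat \<Rightarrow> nat \<Rightarrow> 's) \<Rightarrow> (nat \<Rightarrow> nat \<Rightarrow> nat \<Rightarrow> 's) \<Rightarrow> (nat \<Rightarrow> 's) \<Rightarrow> 's" where
  "twist S e f x = finsum S (\<lambda>(k, i). e k i 0 \<otimes>\<^bsub>S\<^esub> x k \<otimes>\<^bsub>S\<^esub> f k 0 i) idx2"

context
  fixes S :: "('s, 'z) ring_scheme" and e f :: "nat \<Rightarrow> nat \<Rightarrow> nat \<Rightarrow> 's" and x :: "nat \<Rightarrow> 's"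
  assumes S: "ring S" and e: "matrix_units S e" and f: "matrix_units S f"
    and x: "\<And>k. k < length \<Delta> \<Longrightarrow> x k \<in> carrier S"
begin

lemma twist_term: "(\<lambda>(k, i). e k i 0 \<otimes>\<^bsub>S\<^esub> x k \<otimes>\<^bsub>S\<^esub> f k 0 i) \<in> idx2 \<rightarrow> carrier S"
proof -
  interpret S: ring S by (rule S)
  show ?thesis
  proof (rule funcsetI)
    fix t assume "t \<in> idx2"
    then obtain k i where t: "t = (k, i)" "k < length \<Delta>" "i < dim k" by (auto simp: idx2_def)
    have d: "0 < dim k" using t by linarith
    show "(\<lambda>(k, i). e k i 0 \<otimes>\<^bsub>S\<^esub> x k \<otimes>\<^bsub>S\<^esub> f k 0 i) t \<in> carrier S"
      using mu_closed[OF e t(2,3) d] mu_closed[OF f t(2) d t(3)] x[OF t(2)] by (simp add: t(1))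
  qed
qed

lemma twist_closed: "twist S e f x \<in> carrier S"
proof -
  interpret S: ring S by (rule S)
  show ?thesis unfolding twist_def by (rule S.finsum_closed[OF twist_term])
qed

lemma twist_mult_right:
  assumes k: "k < length \<Delta>" and j: "j < dim k" and l: "l < dim k"
  shows "twist S e f x \<otimes>\<^bsub>S\<^esub> f k j l = e k j 0 \<otimes>\<^bsub>S\<^esub> x k \<otimes>\<^bsub>S\<^esub> f k 0 l"
proof -
  interpret S: ring S by (rule S)
  let ?t = "\<lambda>(k, i). e k i 0 \<otimes>\<^bsub>S\<^esub> x k \<otimes>\<^bsub>S\<^esub> f k 0 i"
  have kj: "(k, j) \<in> idx2" using k j by (simp add: idx2_def)
  have d0: "0 < dim k" using j by linarith
  note w = mu_closed[OF e k j d0] x[OF k] mu_closed[OF f k d0 l]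
  have fc: "f k j l \<in> carrier S" by (rule mu_closed[OF f k j l])
  have "twist S e f x \<otimes>\<^bsub>S\<^esub> f k j l = finsum S (\<lambda>t. ?t t \<otimes>\<^bsub>S\<^esub> f k j l) idx2"
    unfolding twist_def by (rule S.finsum_ldistr[OF finite_idx2 fc twist_term])
  also have "\<dots> = finsum S (\<lambda>t. if (k, j) = t then e k j 0 \<otimes>\<^bsub>S\<^esub> x k \<otimes>\<^bsub>S\<^esub> f k 0 l else \<zero>\<^bsub>S\<^esub>) idx2"
  proof (rule S.finsum_cong')
    fix t assume "t \<in> idx2"
    then obtain k' i where t: "t = (k', i)" "k' < length \<Delta>" "i < dim k'" by (auto simp: idx2_def)
    have d: "0 < dim k'" using t by linarith
    have c: "e k' i 0 \<in> carrier S" "f k' 0 i \<in> carrier S" "x k' \<in> carrier S"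
      using t d mu_closed[OF e] mu_closed[OF f] x by auto
    show "?t t \<otimes>\<^bsub>S\<^esub> f k j l = (if (k, j) = t then e k j 0 \<otimes>\<^bsub>S\<^esub> x k \<otimes>\<^bsub>S\<^esub> f k 0 l else \<zero>\<^bsub>S\<^esub>)"
      using mu_mult[OF f t(2) d t(3) k j l] c fc t w by (auto simp: S.m_assoc)
  qed (use w in auto)
  also have "\<dots> = e k j 0 \<otimes>\<^bsub>S\<^esub> x k \<otimes>\<^bsub>S\<^esub> f k 0 l"
    by (rule S.finsum_singleton[OF kj finite_idx2]) (use w in auto)
  finally show ?thesis .
qed

lemma twist_mult_left:
  assumes k: "k < length \<Delta>" and j: "j < dim k" and l: "l < dim k"
  shows "e k j l \<otimes>\<^bsub>S\<^esub> twist S e f x = e k j 0 \<otimes>\<^bsub>S\<^esub> x k \<otimes>\<^bsub>S\<^esub> f k 0 l"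
proof -
  interpret S: ring S by (rule S)
  let ?t = "\<lambda>(k, i). e k i 0 \<otimes>\<^bsub>S\<^esub> x k \<otimes>\<^bsub>S\<^esub> f k 0 i"
  have kl: "(k, l) \<in> idx2" using k l by (simp add: idx2_def)
  have d0: "0 < dim k" using j by linarith
  note w = mu_closed[OF e k j d0] x[OF k] mu_closed[OF f k d0 l]
  have ec: "e k j l \<in> carrier S" by (rule mu_closed[OF e k j l])
  have "e k j l \<otimes>\<^bsub>S\<^esub> twist S e f x = finsum S (\<lambda>t. e k j l \<otimes>\<^bsub>S\<^esub> ?t t) idx2"
    unfolding twist_def by (rule S.finsum_rdistr[OF finite_idx2 ec twist_term])
  also have "\<dots> = finsum S (\<lambda>t. if (k, l) = t then e k j 0 \<otimes>\<^bsub>S\<^esub> x k \<otimes>\<^bsub>S\<^esub> f k 0 l else \<zero>\<^bsub>S\<^esub>) idx2"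
  proof (rule S.finsum_cong')
    fix t assume "t \<in> idx2"
    then obtain k' i where t: "t = (k', i)" "k' < length \<Delta>" "i < dim k'" by (auto simp: idx2_def)
    have d: "0 < dim k'" using t by linarith
    have c: "e k' i 0 \<in> carrier S" "f k' 0 i \<in> carrier S" "x k' \<in> carrier S"
      using t d mu_closed[OF e] mu_closed[OF f] x by auto
    have "e k j l \<otimes>\<^bsub>S\<^esub> ?t t = (e k j l \<otimes>\<^bsub>S\<^esub> e k' i 0) \<otimes>\<^bsub>S\<^esub> x k' \<otimes>\<^bsub>S\<^esub> f k' 0 i"
      using c ec t by (simp add: S.m_assoc)
    then show "e k j l \<otimes>\<^bsub>S\<^esub> ?t t = (if (k, l) = t then e k j 0 \<otimes>\<^bsub>S\<^esub> x k \<otimes>\<^bsub>S\<^esub> f k 0 l else \<zero>\<^bsub>S\<^esub>)"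
      using mu_mult[OF e k j l t(2,3) d] c t by auto
  qed (use w in auto)
  also have "\<dots> = e k j 0 \<otimes>\<^bsub>S\<^esub> x k \<otimes>\<^bsub>S\<^esub> f k 0 l"
    by (rule S.finsum_singleton[OF kl finite_idx2]) (use w in auto)
  finally show ?thesis .
qed

end

text \<open>Only matching indices survive in the product: f_k0i f_ki0 collapses to f_k00 between x k
  and y k, the hypothesis turns the middle into e_k00, and what remains is the sum of the diagonal
  e_kii, which is 1.\<close>

lemma twist_inverse:
  fixes S :: "('s, 'z) ring_scheme"
  assumes S: "ring S" and e: "matrix_units S e" and f: "matrix_units S f"
    and x: "\<And>k. k < length \<Delta> \<Longrightarrow> x k \<in> carrier S" and y: "\<And>k. k < length \<Delta> \<Longrightarrow> y k \<in> carrier S"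
    and xy: "\<And>k. \<lbrakk>k < length \<Delta>; 0 < dim k\<rbrakk> \<Longrightarrow> x k \<otimes>\<^bsub>S\<^esub> f k 0 0 \<otimes>\<^bsub>S\<^esub> y k = e k 0 0"
  shows "twist S e f x \<otimes>\<^bsub>S\<^esub> twist S f e y = \<one>\<^bsub>S\<^esub>"
proof -
  interpret S: ring S by (rule S)
  note tc = twist_closed[OF S e f x]
  have "twist S e f x \<otimes>\<^bsub>S\<^esub> twist S f e y =
      finsum S (\<lambda>t. twist S e f x \<otimes>\<^bsub>S\<^esub> (\<lambda>(k, i). f k i 0 \<otimes>\<^bsub>S\<^esub> y k \<otimes>\<^bsub>S\<^esub> e k 0 i) t) idx2"
    unfolding twist_def[of S f e y] by (rule S.finsum_rdistr[OF finite_idx2 tc twist_term[OF S f e y]])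
  also have "\<dots> = finsum S (\<lambda>(k, i). e k i i) idx2"
  proof (rule S.finsum_cong')
    show "(\<lambda>(k, i). e k i i) \<in> idx2 \<rightarrow> carrier S"
      using mu_closed[OF e] by (auto simp: idx2_def)
    fix t assume "t \<in> idx2"
    then obtain k i where t: "t = (k, i)" "k < length \<Delta>" "i < dim k" by (auto simp: idx2_def)
    have d: "0 < dim k" using t by linarith
    have c: "e k i 0 \<in> carrier S" "e k 0 i \<in> carrier S" "f k i 0 \<in> carrier S" "f k 0 0 \<in> carrier S"
      "x k \<in> carrier S" "y k \<in> carrier S"
      using t d mu_closed[OF e] mu_closed[OF f] x y by auto
    have "twist S e f x \<otimes>\<^bsub>S\<^esub> (f k i 0 \<otimes>\<^bsub>S\<^esub> y k \<otimes>\<^bsub>S\<^esub> e k 0 i) = twist S e f x \<otimes>\<^bsub>S\<^esub> f k i 0 \<otimes>\<^bsub>S\<^esub> (y k \<otimes>\<^bsub>S\<^esub> e k 0 i)"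
      using c tc by (simp add: S.m_assoc)
    also have "\<dots> = e k i 0 \<otimes>\<^bsub>S\<^esub> (x k \<otimes>\<^bsub>S\<^esub> f k 0 0 \<otimes>\<^bsub>S\<^esub> y k) \<otimes>\<^bsub>S\<^esub> e k 0 i"
      using c by (simp add: twist_mult_right[OF S e f x t(2,3) d] S.m_assoc)
    also have "\<dots> = e k i i"
      using mu_mult[OF e t(2,3) d t(2) d d] mu_mult[OF e t(2,3) d t(2) d t(3)] by (simp add: xy[OF t(2) d])
    finally show "twist S e f x \<otimes>\<^bsub>S\<^esub> (\<lambda>(k, i). f k i 0 \<otimes>\<^bsub>S\<^esub> y k \<otimes>\<^bsub>S\<^esub> e k 0 i) t = (\<lambda>(k, i). e k i i) t"
      by (simp add: t)
  qed simp
  finally show ?thesis by (simp add: mu_sum[OF e])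
qed

section \<open>Faithfulness\<close>

lemma hom_unit_mat:
  assumes "\<phi> \<in> gr_alg_hom A R S" "a \<in> carrier A"
  shows "\<phi> (unit_mat a k i j) = scale S a (\<phi> (unit_mat \<one> k i j))"
proof -
  have "\<phi> (scale R a (unit_mat \<one> k i j)) = scale S a (\<phi> (unit_mat \<one> k i j))"
    using assms by (simp add: gr_alg_hom_def unit_mat_carrier)
  then show ?thesis using assms(2) by (simp add: unit_mat_scale)
qed

text \<open>A premise cannot be polymorphic, so \<open>cancel\<close> is stated at modules whose
  elements have the type of S; it is applied to right ideals of idempotents of S.\<close>

lemma faithful:
  fixes S :: "('g, 'a, 's) galg"
  assumes S: "gr_algebra A S" and cancel: "\<And>(M :: ('g, 's, 's) gmodule) (N :: ('g, 's, 's) gmodule). \<lbrakk>fgproj S M; fgproj S N; K0_class S M = K0_class S N\<rbrakk>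
      \<Longrightarrow> gr_isomorphic S M N"
    and \<phi>: "\<phi> \<in> gr_alg_hom A R S" and \<psi>: "\<psi> \<in> gr_alg_hom A R S" and eq: "K0_map R S \<phi> = K0_map R S \<psi>"
  shows "\<exists>x\<in>Units S. x \<in> grade S 0 \<and> (\<forall>r\<in>carrier R. \<phi> r = x \<otimes>\<^bsub>S\<^esub> \<psi> r \<otimes>\<^bsub>S\<^esub> inv\<^bsub>S\<^esub> x)"
proof -
  interpret S: gr_algebra A S by fact
  interpret a: gr_hom R S \<phi> by (rule gr_alg_hom_gr_hom[OF \<phi> R.gr_ring_axioms S.gr_ring_axioms])
  interpret b: gr_hom R S \<psi> by (rule gr_alg_hom_gr_hom[OF \<psi> R.gr_ring_axioms S.gr_ring_axioms])
  define e where "e k i j = \<phi> (unit_mat \<one> k i j)" for k i j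
  define f where "f k i j = \<psi> (unit_mat \<one> k i j)" for k i j
  have e: "matrix_units S e" and f: "matrix_units S f"
    unfolding e_def f_def by (rule matrix_units_hom, unfold_locales)+
  have eg: "e k i j \<in> grade S (\<Delta> ! k ! i - \<Delta> ! k ! j)" and fg: "f k i j \<in> grade S (\<Delta> ! k ! i - \<Delta> ! k ! j)" for k i j
    unfolding e_def f_def by (intro a.hom_grade b.hom_grade one_grade_unit)+
  have "\<exists>x y. x \<in> grade S 0 \<and> y \<in> grade S 0 \<and> x \<otimes>\<^bsub>S\<^esub> f k 0 0 \<otimes>\<^bsub>S\<^esub> y = e k 0 0 \<and> y \<otimes>\<^bsub>S\<^esub> e k 0 0 \<otimes>\<^bsub>S\<^esub> x = f k 0 0"
    if k: "k < length \<Delta>" "0 < dim k" for k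
  proof -
    let ?E = "e k 0 0" and ?F = "f k 0 0"
    have c: "?E \<in> carrier S" "?F \<in> carrier S" and g: "?E \<in> grade S 0" "?F \<in> grade S 0"
      using mu_closed[OF e k(1,2,2)] mu_closed[OF f k(1,2,2)] eg[of k 0 0] fg[of k 0 0] by auto
    have i: "?E \<otimes>\<^bsub>S\<^esub> ?E = ?E" "?F \<otimes>\<^bsub>S\<^esub> ?F = ?F"
      using mu_mult[OF e k(1,2,2) k(1,2,2)] mu_mult[OF f k(1,2,2) k(1,2,2)] by auto
    note u0 = one_grade_unit[of k 0 0, simplified] and ui = unit_idem[OF k(2)]
    \<comment> \<open>The first row of block k is the right ideal of
      \<open>unit_mat \<one> k 0 0\<close>. Its extensions along the two maps are the right ideals
      of \<open>?E\<close> and \<open>?F\<close>, whose classes agree because the maps on K0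
      do.\<close>
    have "K0_class S (idem_module S ?E) = K0_class S (idem_module S ?F)"
      using a.K0_map_class[OF a.ext_scalars_idem[OF u0 ui]] b.K0_map_class[OF b.ext_scalars_idem[OF u0 ui]] eq
      by (simp add: e_def f_def)
    then have iso: "gr_isomorphic S (idem_module S ?E) (idem_module S ?F)"
      by (rule cancel[OF S.fgproj_idem[OF g(1) i(1)] S.fgproj_idem[OF g(2) i(2)]])
    obtain h h' where h: "h \<in> gr_module_hom S (idem_module S ?E) (idem_module S ?F)"
      and h': "h' \<in> gr_module_hom S (idem_module S ?F) (idem_module S ?E)"
      and h'h: "\<And>m. m \<in> carrier (idem_module S ?E) \<Longrightarrow> h' (h m) = m"
      and hh': "\<And>m. m \<in> carrier (idem_module S ?F) \<Longrightarrow> h (h' m) = m"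
      using gr_isomorphicE[OF iso S.gr_module_idem[OF g(1)] S.gr_module_idem[OF g(2)]] by metis
    \<comment> \<open>A homomorphism out of the right ideal of \<open>?E\<close> is left
      multiplication by its value at \<open>?E\<close>, so h and h' become elements y = h ?E and x =
      h' ?F of S; that h and h' are inverse to each other means xy = ?E and yx = ?F.\<close>
    have y: "h ?E \<in> grade S 0" "h ?E \<in> carrier S" "?F \<otimes>\<^bsub>S\<^esub> h ?E = h ?E"
      using gmh_grade[OF h, of ?E 0] g c i by auto
    have x: "h' ?F \<in> grade S 0" "h' ?F \<in> carrier S" "?E \<otimes>\<^bsub>S\<^esub> h' ?F = h' ?F"
      using gmh_grade[OF h', of ?F 0] g c i by auto
    have 1: "h' ?F \<otimes>\<^bsub>S\<^esub> h ?E = ?E"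
      using gmh_ract[OF h', of ?F "h ?E"] y c i h'h[of ?E] by simp
    have 2: "h ?E \<otimes>\<^bsub>S\<^esub> h' ?F = ?F"
      using gmh_ract[OF h, of ?E "h' ?F"] x c i hh'[of ?F] by simp
    have 3: "h' ?F \<otimes>\<^bsub>S\<^esub> ?F = h' ?F" "h ?E \<otimes>\<^bsub>S\<^esub> ?E = h ?E"
      using gmh_ract[OF h', of ?F ?F] gmh_ract[OF h, of ?E ?E] c i by auto
    show ?thesis
      using x y 1 2 3 by (intro exI[of _ "h' ?F"] exI[of _ "h ?E"]) auto
  qed
  \<comment> \<open>An empty block imposes no condition; zero can be taken there, so that x and y
    are defined for every k.\<close>
  then have "\<exists>x y. x \<in> grade S 0 \<and> y \<in> grade S 0 \<and>
      (0 < dim k \<longrightarrow> x \<otimes>\<^bsub>S\<^esub> f k 0 0 \<otimes>\<^bsub>S\<^esub> y = e k 0 0 \<and> y \<otimes>\<^bsub>S\<^esub> e k 0 0 \<otimes>\<^bsub>S\<^esub> x = f k 0 0)" if "k < length \<Delta>" for k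
    using that S.grade_zero by (cases "0 < dim k") blast+
  then obtain x y where xy: "\<And>k. k < length \<Delta> \<Longrightarrow> x k \<in> grade S 0" "\<And>k. k < length \<Delta> \<Longrightarrow> y k \<in> grade S 0"
    "\<And>k. \<lbrakk>k < length \<Delta>; 0 < dim k\<rbrakk> \<Longrightarrow> x k \<otimes>\<^bsub>S\<^esub> f k 0 0 \<otimes>\<^bsub>S\<^esub> y k = e k 0 0"
    "\<And>k. \<lbrakk>k < length \<Delta>; 0 < dim k\<rbrakk> \<Longrightarrow> y k \<otimes>\<^bsub>S\<^esub> e k 0 0 \<otimes>\<^bsub>S\<^esub> x k = f k 0 0"
    by metis
  note xc = S.grade_carrier[OF xy(1)] and yc = S.grade_carrier[OF xy(2)]
  note Sr = S.ring_axioms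
  let ?x = "twist S e f x" and ?y = "twist S f e y"
  have X: "?x \<in> carrier S" "?y \<in> carrier S"
    by (rule twist_closed[OF Sr e f xc], assumption, rule twist_closed[OF Sr f e yc], assumption)
  have XY: "?x \<otimes>\<^bsub>S\<^esub> ?y = \<one>\<^bsub>S\<^esub>" "?y \<otimes>\<^bsub>S\<^esub> ?x = \<one>\<^bsub>S\<^esub>"
    using twist_inverse[OF Sr e f xc yc xy(3)] twist_inverse[OF Sr f e yc xc xy(4)] by auto
  have U: "?x \<in> Units S" using X XY by (auto simp: Units_def)
  \<comment> \<open>The degrees \<delta>_i - \<delta>_0, 0 and \<delta>_0 - \<delta>_i of the three
    factors of a summand add up to zero.\<close>
  have X0: "?x \<in> grade S 0"
    unfolding twist_def finsum_def
  proof (rule S.RG.D_finprod)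
    fix t assume "t \<in> idx2"
    then obtain k i where t: "t = (k, i)" "k < length \<Delta>" "i < dim k" by (auto simp: idx2_def)
    show "(\<lambda>(k, i). e k i 0 \<otimes>\<^bsub>S\<^esub> x k \<otimes>\<^bsub>S\<^esub> f k 0 i) t \<in> grade S 0"
      using S.grade_mult[OF S.grade_mult[OF eg[of k i 0] xy(1)[OF t(2)]] fg[of k 0 i]] t by simp
  qed
  \<comment> \<open>Conjugation is proved as an intertwining identity. This is additive in r, so it
    reduces to multiples of matrix units, and the coefficient passes through by linearity over
    \<open>A\<close>.\<close>
  have "\<phi> r \<otimes>\<^bsub>S\<^esub> ?x = ?x \<otimes>\<^bsub>S\<^esub> \<psi> r" if r: "r \<in> carrier R" for r
    using r
  proof (rule R_induct)
    have "\<phi> \<zero>\<^bsub>R\<^esub> = \<zero>\<^bsub>S\<^esub>" "\<psi> \<zero>\<^bsub>R\<^esub> = \<zero>\<^bsub>S\<^esub>"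
      using hom_one[OF a.\<phi>_hom R.add.is_group S.add.is_group] hom_one[OF b.\<phi>_hom R.add.is_group S.add.is_group] by auto
    then show "\<phi> \<zero>\<^bsub>R\<^esub> \<otimes>\<^bsub>S\<^esub> ?x = ?x \<otimes>\<^bsub>S\<^esub> \<psi> \<zero>\<^bsub>R\<^esub>" using X by simp
  next
    fix r s assume "r \<in> carrier R" "s \<in> carrier R" "\<phi> r \<otimes>\<^bsub>S\<^esub> ?x = ?x \<otimes>\<^bsub>S\<^esub> \<psi> r" "\<phi> s \<otimes>\<^bsub>S\<^esub> ?x = ?x \<otimes>\<^bsub>S\<^esub> \<psi> s"
    then show "\<phi> (r \<oplus>\<^bsub>R\<^esub> s) \<otimes>\<^bsub>S\<^esub> ?x = ?x \<otimes>\<^bsub>S\<^esub> \<psi> (r \<oplus>\<^bsub>R\<^esub> s)"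
      using X by (simp add: a.\<phi>_add b.\<phi>_add a.\<phi>_closed b.\<phi>_closed S.l_distr S.r_distr)
  next
    fix c k i j assume c: "c \<in> carrier A" and k: "k < length \<Delta>" "i < dim k" "j < dim k"
    have ec: "e k i j \<in> carrier S" "f k i j \<in> carrier S" using mu_closed[OF e k] mu_closed[OF f k] by auto
    have "e k i j \<otimes>\<^bsub>S\<^esub> ?x = ?x \<otimes>\<^bsub>S\<^esub> f k i j"
      using twist_mult_left[OF Sr e f xc k] twist_mult_right[OF Sr e f xc k] by simp
    then show "\<phi> (unit_mat c k i j) \<otimes>\<^bsub>S\<^esub> ?x = ?x \<otimes>\<^bsub>S\<^esub> \<psi> (unit_mat c k i j)"
      using hom_unit_mat[OF \<phi> c, of k i j] hom_unit_mat[OF \<psi> c, of k i j] ec X c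
      by (simp add: e_def[symmetric] f_def[symmetric] S.scale_mult_left S.scale_mult_right)
  qed
  then have "\<phi> r = ?x \<otimes>\<^bsub>S\<^esub> \<psi> r \<otimes>\<^bsub>S\<^esub> inv\<^bsub>S\<^esub> ?x" if "r \<in> carrier R" for r
    using that X U a.\<phi>_closed[OF that]
    by (metis S.Units_inv_closed S.Units_r_inv S.m_assoc S.r_one)
  then show ?thesis using U X0 by blast
qed

section \<open>Fullness\<close>

text \<open>R is free over \<open>A\<close> on its matrix units, and \<phi> is the linear extension
  of their assignment to E. The degree required of \<open>E k i j\<close> is that of
  \<open>unit_mat \<one> k i j\<close>, so \<phi> preserves degrees.\<close>

lemma matrix_units_alg_hom:
  fixes S :: "('g, 'a, 's) galg"
  assumes S: "gr_algebra A S" and E: "matrix_units S E"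
    and Eg: "\<And>k i j. \<lbrakk>k < length \<Delta>; i < dim k; j < dim k\<rbrakk> \<Longrightarrow> E k i j \<in> grade S (\<Delta> ! k ! i - \<Delta> ! k ! j)"
  shows "\<exists>\<phi>\<in>gr_alg_hom A R S. \<forall>k<length \<Delta>. \<forall>i<dim k. \<forall>j<dim k. \<phi> (unit_mat \<one> k i j) = E k i j"
proof -
  interpret S: gr_algebra A S by fact
  define F where "F r = (\<lambda>(k, i, j). scale S (r k (i, j)) (E k i j))" for r
  define \<phi> where "\<phi> = (\<lambda>r\<in>carrier R. finsum S (F r) idx3)"
  note Ec = mu_closed[OF E]
  have Fc: "F r \<in> idx3 \<rightarrow> carrier S" if "r \<in> carrier R" for r
    using entriesD[OF R_carrierD(2)[OF that]] Ec by (auto simp: F_def idx3_def S.scale_closed)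
  have \<phi>_closed: "\<phi> r \<in> carrier S" if "r \<in> carrier R" for r
    using Fc[OF that] that by (simp add: \<phi>_def S.finsum_closed)
  have \<phi>_add: "\<phi> (r \<oplus>\<^bsub>R\<^esub> s) = \<phi> r \<oplus>\<^bsub>S\<^esub> \<phi> s" if r: "r \<in> carrier R" and s: "s \<in> carrier R" for r s
  proof -
    have ent: "(r \<oplus>\<^bsub>R\<^esub> s) k (i, j) = r k (i, j) \<oplus> s k (i, j)" if "k < length \<Delta>" "i < dim k" "j < dim k" for k i j
      using r s that by (elim R_carrierE) simp
    have "finsum S (F (r \<oplus>\<^bsub>R\<^esub> s)) idx3 = finsum S (\<lambda>t. F r t \<oplus>\<^bsub>S\<^esub> F s t) idx3"
    proof (rule S.finsum_cong')
      fix t assume "t \<in> idx3"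
      then show "F (r \<oplus>\<^bsub>R\<^esub> s) t = F r t \<oplus>\<^bsub>S\<^esub> F s t"
        using entriesD[OF R_carrierD(2)[OF r]] entriesD[OF R_carrierD(2)[OF s]] Ec
        by (auto simp: F_def idx3_def ent S.scale_add_left)
    qed (use Fc[OF r] Fc[OF s] in auto)
    also have "\<dots> = finsum S (F r) idx3 \<oplus>\<^bsub>S\<^esub> finsum S (F s) idx3"
      by (rule S.finsum_addf[OF Fc[OF r] Fc[OF s]])
    finally show ?thesis using r s by (simp add: \<phi>_def)
  qed
  have \<phi>_hom: "\<phi> \<in> hom (add_monoid R) (add_monoid S)"
    by (auto simp: hom_def \<phi>_closed \<phi>_add)
  have \<phi>_zero: "\<phi> \<zero>\<^bsub>R\<^esub> = \<zero>\<^bsub>S\<^esub>"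
    using hom_one[OF \<phi>_hom R.add.is_group S.add.is_group] by simp
  have \<phi>_unit: "\<phi> (unit_mat a k i j) = scale S a (E k i j)"
    if a: "a \<in> carrier A" and k: "k < length \<Delta>" "i < dim k" "j < dim k" for a k i j
  proof -
    have "finsum S (F (unit_mat a k i j)) idx3 = finsum S (\<lambda>t. if (k, i, j) = t then scale S a (E k i j) else \<zero>\<^bsub>S\<^esub>) idx3"
    proof (rule S.finsum_cong')
      fix t assume "t \<in> idx3"
      then obtain k' i' j' where t: "t = (k', i', j')" "k' < length \<Delta>" "i' < dim k'" "j' < dim k'"
        by (auto simp: idx3_def)
      show "F (unit_mat a k i j) t = (if (k, i, j) = t then scale S a (E k i j) else \<zero>\<^bsub>S\<^esub>)"
        using t Ec[OF t(2-4)] by (auto simp: F_def unit_mat_def S.scale_zero_left)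
    qed (use a k Ec S.scale_closed in auto)
    also have "\<dots> = scale S a (E k i j)"
      using finite_idx3 a k Ec S.scale_closed by (intro S.finsum_singleton) (auto simp: idx3_def)
    finally show ?thesis using unit_mat_carrier[OF a] by (simp add: \<phi>_def)
  qed
  \<comment> \<open>Both sides are additive in r and in s, so they are compared on pairs of
    multiples of matrix units, where the product rule for E decides.\<close>
  have \<phi>_mult: "\<phi> (r \<otimes>\<^bsub>R\<^esub> s) = \<phi> r \<otimes>\<^bsub>S\<^esub> \<phi> s" if r: "r \<in> carrier R" and s: "s \<in> carrier R" for r s
    using r
  proof (rule R_induct)
    show "\<phi> (\<zero>\<^bsub>R\<^esub> \<otimes>\<^bsub>R\<^esub> s) = \<phi> \<zero>\<^bsub>R\<^esub> \<otimes>\<^bsub>S\<^esub> \<phi> s" using s by (simp add: \<phi>_zero \<phi>_closed)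
  next
    fix x y assume "x \<in> carrier R" "y \<in> carrier R" "\<phi> (x \<otimes>\<^bsub>R\<^esub> s) = \<phi> x \<otimes>\<^bsub>S\<^esub> \<phi> s" "\<phi> (y \<otimes>\<^bsub>R\<^esub> s) = \<phi> y \<otimes>\<^bsub>S\<^esub> \<phi> s"
    then show "\<phi> ((x \<oplus>\<^bsub>R\<^esub> y) \<otimes>\<^bsub>R\<^esub> s) = \<phi> (x \<oplus>\<^bsub>R\<^esub> y) \<otimes>\<^bsub>S\<^esub> \<phi> s"
      using s by (simp add: R.l_distr S.l_distr \<phi>_add \<phi>_closed)
  next
    fix a k i j assume a: "a \<in> carrier A" and k: "k < length \<Delta>" "i < dim k" "j < dim k"
    let ?u = "unit_mat a k i j"
    have uc: "?u \<in> carrier R" by (rule unit_mat_carrier[OF a])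
    show "\<phi> (?u \<otimes>\<^bsub>R\<^esub> s) = \<phi> ?u \<otimes>\<^bsub>S\<^esub> \<phi> s"
      using s
    proof (rule R_induct)
      show "\<phi> (?u \<otimes>\<^bsub>R\<^esub> \<zero>\<^bsub>R\<^esub>) = \<phi> ?u \<otimes>\<^bsub>S\<^esub> \<phi> \<zero>\<^bsub>R\<^esub>" using uc by (simp add: \<phi>_zero \<phi>_closed)
    next
      fix x y assume "x \<in> carrier R" "y \<in> carrier R" "\<phi> (?u \<otimes>\<^bsub>R\<^esub> x) = \<phi> ?u \<otimes>\<^bsub>S\<^esub> \<phi> x" "\<phi> (?u \<otimes>\<^bsub>R\<^esub> y) = \<phi> ?u \<otimes>\<^bsub>S\<^esub> \<phi> y"
      then show "\<phi> (?u \<otimes>\<^bsub>R\<^esub> (x \<oplus>\<^bsub>R\<^esub> y)) = \<phi> ?u \<otimes>\<^bsub>S\<^esub> \<phi> (x \<oplus>\<^bsub>R\<^esub> y)"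
        using uc by (simp add: R.r_distr S.r_distr \<phi>_add \<phi>_closed)
    next
      fix b k' i' j' assume b: "b \<in> carrier A" and k': "k' < length \<Delta>" "i' < dim k'" "j' < dim k'"
      have "\<phi> ?u \<otimes>\<^bsub>S\<^esub> \<phi> (unit_mat b k' i' j') = scale S a (E k i j \<otimes>\<^bsub>S\<^esub> scale S b (E k' i' j'))"
        unfolding \<phi>_unit[OF a k] \<phi>_unit[OF b k']
        by (rule S.scale_mult_left[OF a Ec[OF k] S.scale_closed[OF b Ec[OF k']]])
      also have "\<dots> = scale S a (scale S b (E k i j \<otimes>\<^bsub>S\<^esub> E k' i' j'))"
        by (simp only: S.scale_mult_right[OF b Ec[OF k] Ec[OF k']])
      also have "\<dots> = \<phi> (?u \<otimes>\<^bsub>R\<^esub> unit_mat b k' i' j')"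
        using a b k k' Ec by (auto simp: unit_mat_mult \<phi>_unit \<phi>_zero mu_mult[OF E k k'] S.scale_scale S.scale_zero_right)
      finally show "\<phi> (?u \<otimes>\<^bsub>R\<^esub> unit_mat b k' i' j') = \<phi> ?u \<otimes>\<^bsub>S\<^esub> \<phi> (unit_mat b k' i' j')" by simp
    qed
  qed
  have "\<phi> (finsum R (\<lambda>(k, i). unit_mat \<one> k i i) idx2) = finsum S (\<lambda>t. \<phi> ((\<lambda>(k, i). unit_mat \<one> k i i) t)) idx2"
    unfolding finsum_def
    by (rule hom_finprod[OF R.a_comm_group S.a_comm_group \<phi>_hom]) (auto simp: unit_mat_carrier)
  then have "\<phi> \<one>\<^bsub>R\<^esub> = finsum S (\<lambda>t. \<phi> ((\<lambda>(k, i). unit_mat \<one> k i i) t)) idx2"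
    unfolding R_one_decomp .
  also have "\<dots> = finsum S (\<lambda>(k, i). E k i i) idx2"
    by (rule S.finsum_cong') (use Ec S.scale_one in \<open>auto simp: idx2_def \<phi>_unit\<close>)
  finally have \<phi>_one: "\<phi> \<one>\<^bsub>R\<^esub> = \<one>\<^bsub>S\<^esub>" by (simp add: mu_sum[OF E])
  have \<phi>_grade: "\<phi> r \<in> grade S \<gamma>" if r: "r \<in> grade R \<gamma>" for r \<gamma>
  proof -
    have rc: "r \<in> carrier R" using r by (rule R_grade_carrier)
    have "finsum S (F r) idx3 \<in> grade S \<gamma>"
      unfolding finsum_def
    proof (rule S.RG.D_finprod)
      fix t assume "t \<in> idx3"
      then obtain k i j where t: "t = (k, i, j)" "k < length \<Delta>" "i < dim k" "j < dim k"
        by (auto simp: idx3_def)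
      have "r k (i, j) \<in> grade A (\<gamma> + \<Delta> ! k ! j - \<Delta> ! k ! i)"
        using r t R_grade[of "\<lambda>k i j. r k (i, j)" \<gamma>] R_carrierD(1)[OF rc] by simp
      from S.scale_grade[OF this Eg[OF t(2-4)]] show "F r t \<in> grade S \<gamma>"
        by (simp add: F_def t)
    qed
    then show ?thesis using rc by (simp add: \<phi>_def)
  qed
  have \<phi>_scale: "\<phi> (scale R a r) = scale S a (\<phi> r)" if a: "a \<in> carrier A" and r: "r \<in> carrier R" for a r
    using r
  proof (rule R_induct)
    show "\<phi> (scale R a \<zero>\<^bsub>R\<^esub>) = scale S a (\<phi> \<zero>\<^bsub>R\<^esub>)"
      using a by (simp add: R.scale_zero_right S.scale_zero_right \<phi>_zero)
  next
    fix x y assume "x \<in> carrier R" "y \<in> carrier R" "\<phi> (scale R a x) = scale S a (\<phi> x)" "\<phi> (scale R a y) = scale S a (\<phi> y)"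
    then show "\<phi> (scale R a (x \<oplus>\<^bsub>R\<^esub> y)) = scale S a (\<phi> (x \<oplus>\<^bsub>R\<^esub> y))"
      using a by (simp add: R.scale_add_right S.scale_add_right \<phi>_add \<phi>_closed R.scale_closed)
  next
    fix b k i j assume b: "b \<in> carrier A" and k: "k < length \<Delta>" "i < dim k" "j < dim k"
    then show "\<phi> (scale R a (unit_mat b k i j)) = scale S a (\<phi> (unit_mat b k i j))"
      using a Ec[OF k] by (simp add: unit_mat_scale \<phi>_unit S.scale_scale)
  qed
  have "\<phi> \<in> gr_alg_hom A R S"
    using \<phi>_closed \<phi>_add \<phi>_mult \<phi>_one \<phi>_grade \<phi>_scale
    by (auto simp: gr_alg_hom_def ring_hom_def \<phi>_def[THEN arg_cong[of _ _ "\<lambda>f. f \<in> extensional (carrier R)"]])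
  moreover have "\<phi> (unit_mat \<one> k i j) = E k i j" if "k < length \<Delta>" "i < dim k" "j < dim k" for k i j
    using \<phi>_unit[OF one_closed that] Ec[OF that] by (simp add: S.scale_one)
  ultimately show ?thesis by blast
qed

end

text \<open>The coordinates of the sum are computed by projecting. In \<open>full\<close> this
  expresses the identity of S as the sum of the projections to its summands.\<close>

lemma dsum_decomp:
  assumes R: "gr_ring R" and I: "finite I" and M: "\<And>i. i \<in> I \<Longrightarrow> gr_module R (M i)" and d: "d \<in> carrier (dsum I M)"
  shows "finprod (dsum I M) (\<lambda>t. \<lambda>j\<in>I. if j = t then d t else \<one>\<^bsub>M j\<^esub>) I = d"
proof -
  let ?D = "dsum I M" and ?F = "\<lambda>t. \<lambda>j\<in>I. if j = t then d t else \<one>\<^bsub>M j\<^esub>"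
  have D: "gr_module R ?D" by (rule gr_module_dsum[OF R I M])
  interpret D: gr_module R ?D by fact
  have F: "?F \<in> I \<rightarrow> carrier ?D"
  proof (rule funcsetI)
    fix t assume t: "t \<in> I"
    have h: "(\<lambda>m. \<lambda>j\<in>I. if j = t then m else \<one>\<^bsub>M j\<^esub>) \<in> gr_module_hom R (M t) ?D"
      by (rule gmh_dinj) (use M t in auto)
    show "?F t \<in> carrier ?D" by (rule gmh_closed[OF h]) (use d t in auto)
  qed
  have Fc: "finprod ?D ?F I \<in> carrier ?D" using F by (rule D.M.finprod_closed)
  show ?thesis
  proof (rule extensionalityI[of _ I])
    show "finprod ?D ?F I \<in> extensional I" "d \<in> extensional I" using Fc d by (auto simp: PiE_iff)
    fix j assume j: "j \<in> I"
    interpret Mj: gr_module R "M j" by (rule M[OF j])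
    have dj: "d j \<in> carrier (M j)" using d j by auto
    have "finprod ?D ?F I j = finprod (M j) (\<lambda>t. ?F t j) I"
      by (rule gmh_finprod[OF gmh_dproj[OF j] D M[OF j] F])
    also have "\<dots> = finprod (M j) (\<lambda>t. if j = t then d j else \<one>\<^bsub>M j\<^esub>) I"
      using j dj by (intro Mj.M.finprod_cong') auto
    also have "\<dots> = d j"
      using j dj I by (intro Mj.M.finprod_singleton) auto
    finally show "finprod ?D ?F I j = d j" .
  qed
qed

context matricial
begin

text \<open>Block k is represented by its first row, which exists by \<open>pos\<close>; since all
  rows are shifts of first rows, the values of f on these determine f. The homomorphism to be
  constructed therefore only has to send the class of the first row of block k to that of Q
  k.\<close>

lemma full:
  fixes S :: "('g, 'a, 's) galg"
  assumes S: "gr_algebra A S" and SB: "brick_ring S I B" and pos: "\<And>k. k < length \<Delta> \<Longrightarrow> 0 < dim k"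
    and f: "f \<in> pogroup_hom (K0_obj R) (K0_obj S)"
  shows "\<exists>\<phi>\<in>gr_alg_hom A R S. K0_map R S \<phi> = f"
proof -
  interpret S: gr_algebra A S by fact
  interpret SB: brick_ring S I B by fact
  have fh: "f \<in> hom (K0_group R) (K0_group S)" and fext: "f \<in> extensional (carrier (K0_group R))"
    and f_act: "\<And>\<alpha> x. x \<in> carrier (K0_group R) \<Longrightarrow> f (act (K0_group R) \<alpha> x) = act (K0_group S) \<alpha> (f x)"
    and fpos: "f ` pos_cone (K0_group R) \<subseteq> pos_cone (K0_group S)"
    and funit: "f (K0_class R (regular_module R)) = K0_class S (regular_module S)"
    using f by (auto simp: pogroup_hom_def K0_obj_def)
  have "\<exists>Q\<in>gr_fgp S. f (K0_class R (row k 0)) = K0_class S Q" if "k < length \<Delta>" for k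
  proof -
    have "K0_class R (row k 0) \<in> pos_cone (K0_group R)"
      unfolding R.pos_cone_K0 by (rule K0_class_in_image[OF row_fgproj[OF pos[OF that]]])
    then have "f (K0_class R (row k 0)) \<in> pos_cone (K0_group S)" using fpos by blast
    then show ?thesis unfolding S.pos_cone_K0 by blast
  qed
  then obtain Q where Q: "\<And>k. k < length \<Delta> \<Longrightarrow> Q k \<in> gr_fgp S"
    and fQ: "\<And>k. k < length \<Delta> \<Longrightarrow> f (K0_class R (row k 0)) = K0_class S (Q k)"
    by metis
  \<comment> \<open>The shift is the one by which row i of block k differs from row 0, so that M (k,
    i) has the class f [row k i]; at i = 0 it is trivial.\<close>
  define M where "M t = shift (\<Delta> ! fst t ! 0 - \<Delta> ! fst t ! snd t) (Q (fst t))" for t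
  have M0: "M (k, 0) = Q k" for k by (simp add: M_def shift_zero)
  have Qf: "fgproj S (Q k)" if "k < length \<Delta>" for k using Q[OF that] by (simp add: gr_fgp_iff)
  have Mf: "fgproj S (M t)" if "t \<in> idx2" for t
    unfolding M_def using that by (intro fgproj_shift Qf) (auto simp: idx2_def)
  note Mm = fgproj_module[OF Mf]
  note Sg = S.gr_ring_axioms
  let ?D = "dsum idx2 M"
  let ?B = "\<lambda>(k, i). row k i"
  have Bf: "fgproj R (?B t)" if "t \<in> idx2" for t using that by (auto simp: idx2_def row_fgproj)
  have rowK: "K0_class R (row k i) = act (K0_group R) (\<Delta> ! k ! 0 - \<Delta> ! k ! i) (K0_class R (row k 0))"
    if "k < length \<Delta>" "i < dim k" for k i
    using K0_class_cong[OF row_shift_iso[OF that(2) pos[OF that(1)]]] row_fgproj[OF that(2)] row_fgproj[OF pos[OF that(1)]]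
    by (simp add: R.act_class fgproj_module gr_module_shift)
  have rc: "K0_class R (row k 0) \<in> carrier (K0_group R)" if "k < length \<Delta>" for k
    by (rule R.K0_class_closed[OF row_fgproj[OF pos[OF that]]])
  have MB: "K0_class S (M t) = f (K0_class R (?B t))" if t2: "t \<in> idx2" for t
  proof -
    obtain k i where t: "t = (k, i)" "k < length \<Delta>" "i < dim k" using t2 by (auto simp: idx2_def)
    show ?thesis
      using f_act[OF rc[OF t(2)]] by (simp add: t M_def S.act_class[OF Qf[OF t(2)], symmetric] rowK fQ)
  qed
  have "K0_class S ?D = finprod (K0_group S) (\<lambda>t. K0_class S (M t)) idx2"
    by (rule S.K0_class_dsum[OF finite_idx2 Mf])
  also have "\<dots> = finprod (K0_group S) (\<lambda>t. f (K0_class R (?B t))) idx2"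
    by (rule S.K0.finprod_cong') (use MB S.K0_class_closed[OF Mf] in auto)
  also have "\<dots> = f (finprod (K0_group R) (\<lambda>t. K0_class R (?B t)) idx2)"
    by (rule hom_finprod[OF R.K0.comm_group_axioms S.K0.comm_group_axioms fh, symmetric])
      (use R.K0_class_closed[OF Bf] in blast)
  also have "finprod (K0_group R) (\<lambda>t. K0_class R (?B t)) idx2 = K0_class R (dsum idx2 ?B)"
    by (rule R.K0_class_dsum[OF finite_idx2 Bf, symmetric])
  also have "K0_class R (dsum idx2 ?B) = K0_class R (regular_module R)"
    by (rule K0_class_cong[symmetric, OF regular_rows gr_module_regular[OF R.gr_ring_axioms]
        gr_module_dsum[OF R.gr_ring_axioms finite_idx2 fgproj_module[OF Bf]]])
  finally have DS: "K0_class S ?D = K0_class S (regular_module S)" by (simp add: funit)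
  have D: "gr_module S ?D" by (rule gr_module_dsum[OF Sg finite_idx2 Mm])
  have reg: "gr_module S (regular_module S)" by (rule gr_module_regular[OF Sg])
  \<comment> \<open>The classes of S and of the sum of the M t agree because f sends [R] to [S];
    cancellation over S turns this into an isomorphism.\<close>
  have "gr_isomorphic S (regular_module S) ?D"
    by (rule SB.K0_class_eq_imp_iso[OF fgproj_regular[OF Sg] fgproj_dsum[OF Sg finite_idx2 Mf] DS[symmetric]])
  then obtain G H where G: "G \<in> gr_module_hom S (regular_module S) ?D" and H: "H \<in> gr_module_hom S ?D (regular_module S)"
    and HG: "\<And>s. s \<in> carrier (regular_module S) \<Longrightarrow> H (G s) = s" and GH: "\<And>d. d \<in> carrier ?D \<Longrightarrow> G (H d) = d"
    using gr_isomorphicE[OF _ reg D] by metis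
  \<comment> \<open>Under the isomorphism, \<open>v t\<close> is the projection of S onto M t and
    \<open>u t\<close> the inclusion of M t into S.\<close>
  define v where "v t s = G s t" for t s
  define u where "u t q = H (\<lambda>j\<in>idx2. if j = t then q else \<one>\<^bsub>M j\<^esub>)" for t q
  have v: "v t \<in> gr_module_hom S (regular_module S) (M t)" if "t \<in> idx2" for t
    unfolding v_def by (rule gmh_comp[OF G gmh_dproj[OF that]])
  have inj: "(\<lambda>m. \<lambda>j\<in>idx2. if j = t then m else \<one>\<^bsub>M j\<^esub>) \<in> gr_module_hom S (M t) ?D" if "t \<in> idx2" for t
    by (rule gmh_dinj[where M=M]) (use Mm that in auto)
  have u: "u t \<in> gr_module_hom S (M t) (regular_module S)" if "t \<in> idx2" for t
    unfolding u_def by (rule gmh_comp[OF inj[OF that] H])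
  have vu: "v t (u t' q) = (if t = t' then q else \<one>\<^bsub>M t\<^esub>)" if "t \<in> idx2" "t' \<in> idx2" "q \<in> carrier (M t')" for t t' q
    unfolding v_def u_def using GH[OF gmh_closed[OF inj[OF that(2)] that(3)]] that by simp
  have uv: "finsum S (\<lambda>t. u t (v t s)) idx2 = s" if s: "s \<in> carrier S" for s
  proof -
    have Gs: "G s \<in> carrier ?D" using gmh_closed[OF G] s by simp
    have "H (finprod ?D (\<lambda>t. \<lambda>j\<in>idx2. if j = t then G s t else \<one>\<^bsub>M j\<^esub>) idx2) = finprod (regular_module S) (\<lambda>t. u t (v t s)) idx2"
      unfolding u_def v_def
    proof (rule gmh_finprod[OF H D reg], rule funcsetI)
      fix t assume t: "t \<in> idx2"
      have "G s t \<in> carrier (M t)" using Gs t by auto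
      then show "(\<lambda>j\<in>idx2. if j = t then G s t else \<one>\<^bsub>M j\<^esub>) \<in> carrier ?D"
        by (rule gmh_closed[OF inj[OF t]])
    qed
    then show ?thesis
      using HG s by (simp only: dsum_decomp[OF Sg finite_idx2 Mm Gs] finprod_regular regular_module_simps)
  qed
  \<comment> \<open>For fixed k the modules M (k, i) have the same elements, those of Q k, and
    differ in their grading only. So u (k, i) can be applied after v (k, j); the composite is linear
    over S, hence left multiplication by its value at 1.\<close>
  define E where "E k i j = u (k, i) (v (k, j) \<one>\<^bsub>S\<^esub>)" for k i j
  have Mc: "carrier (M (k, i)) = carrier (Q k)" for k i by (simp add: M_def)
  have vc: "v (k, j) s \<in> carrier (M (k, i))" if "k < length \<Delta>" "j < dim k" "s \<in> carrier S" for k i j s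
    using gmh_closed[OF v[of "(k, j)"], of s] that by (simp add: Mc idx2_def)
  have uc: "u (k, i) q \<in> carrier S" if "k < length \<Delta>" "i < dim k" "q \<in> carrier (M (k, j))" for k i j q
    using gmh_closed[OF u[of "(k, i)"], of q] that by (simp add: Mc idx2_def)
  have E_mult: "E k i j \<otimes>\<^bsub>S\<^esub> s = u (k, i) (v (k, j) s)"
    if k: "k < length \<Delta>" "i < dim k" "j < dim k" and s: "s \<in> carrier S" for k i j s
  proof -
    have t: "(k, i) \<in> idx2" "(k, j) \<in> idx2" using k by (simp_all add: idx2_def)
    have "u (k, i) (v (k, j) \<one>\<^bsub>S\<^esub> \<star>\<^bsub>M (k, i)\<^esub> s) = u (k, i) (v (k, j) \<one>\<^bsub>S\<^esub>) \<otimes>\<^bsub>S\<^esub> s"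
      using gmh_ract[OF u[OF t(1)] vc[OF k(1,3)], of "\<one>\<^bsub>S\<^esub>" s] s by simp
    moreover have "v (k, j) \<one>\<^bsub>S\<^esub> \<star>\<^bsub>M (k, i)\<^esub> s = v (k, j) s"
      using gmh_ract[OF v[OF t(2)], of "\<one>\<^bsub>S\<^esub>" s] s by (simp add: M_def)
    ultimately show ?thesis by (simp add: E_def)
  qed
  have Ec: "E k i j \<in> carrier S" if "k < length \<Delta>" "i < dim k" "j < dim k" for k i j
    unfolding E_def using that by (intro uc vc) auto
  have EE: "E k i j \<otimes>\<^bsub>S\<^esub> E k' i' j' = (if k' = k \<and> i' = j then E k i j' else \<zero>\<^bsub>S\<^esub>)"
    if k: "k < length \<Delta>" "i < dim k" "j < dim k" and k': "k' < length \<Delta>" "i' < dim k'" "j' < dim k'" for k i j k' i' j'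
  proof -
    have t: "(k, i) \<in> idx2" "(k, j) \<in> idx2" "(k', i') \<in> idx2" using k k' by (simp_all add: idx2_def)
    have "E k i j \<otimes>\<^bsub>S\<^esub> E k' i' j' = u (k, i) (v (k, j) (u (k', i') (v (k', j') \<one>\<^bsub>S\<^esub>)))"
      using E_mult[OF k Ec[OF k']] by (simp add: E_def)
    also have "v (k, j) (u (k', i') (v (k', j') \<one>\<^bsub>S\<^esub>)) = (if (k, j) = (k', i') then v (k', j') \<one>\<^bsub>S\<^esub> else \<one>\<^bsub>M (k, j)\<^esub>)"
      by (rule vu[OF t(2,3) vc[OF k'(1,3)]]) simp
    also have "u (k, i) (if (k, j) = (k', i') then v (k', j') \<one>\<^bsub>S\<^esub> else \<one>\<^bsub>M (k, j)\<^esub>) = (if k' = k \<and> i' = j then E k i j' else \<zero>\<^bsub>S\<^esub>)"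
      using gmh_one[OF u[OF t(1)] Mm[OF t(1)] reg] by (auto simp: E_def M_def)
    finally show ?thesis .
  qed
  have "finsum S (\<lambda>(k, i). E k i i) idx2 = \<one>\<^bsub>S\<^esub>"
    using uv[OF S.one_closed] by (simp add: E_def case_prod_unfold)
  then have EU: "matrix_units S E"
    unfolding matrix_units_def using Ec EE by blast
  have Eg: "E k i j \<in> grade S (\<Delta> ! k ! i - \<Delta> ! k ! j)" if k: "k < length \<Delta>" "i < dim k" "j < dim k" for k i j
  proof -
    have t: "(k, i) \<in> idx2" "(k, j) \<in> idx2" using k by (simp_all add: idx2_def)
    \<comment> \<open>Degree 0 in M (k, j) is degree \<delta>_0 - \<delta>_j in Q k, which is degree
      \<delta>_i - \<delta>_j in M (k, i).\<close>
    have "v (k, j) \<one>\<^bsub>S\<^esub> \<in> mgrade (M (k, j)) 0"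
      using gmh_grade[OF v[OF t(2)], of "\<one>\<^bsub>S\<^esub>" 0] S.one_grade by simp
    then have "v (k, j) \<one>\<^bsub>S\<^esub> \<in> mgrade (M (k, i)) (\<Delta> ! k ! i - \<Delta> ! k ! j)"
      by (simp add: M_def)
    then show ?thesis
      using gmh_grade[OF u[OF t(1)]] by (simp add: E_def)
  qed
  obtain \<phi> where \<phi>: "\<phi> \<in> gr_alg_hom A R S"
    and \<phi>E: "\<And>k i j. \<lbrakk>k < length \<Delta>; i < dim k; j < dim k\<rbrakk> \<Longrightarrow> \<phi> (unit_mat \<one> k i j) = E k i j"
    using matrix_units_alg_hom[OF S EU Eg] by blast
  interpret h: gr_hom R S \<phi> by (rule gr_alg_hom_gr_hom[OF \<phi> R.gr_ring_axioms Sg])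
  have K: "K0_map R S \<phi> \<in> pogroup_hom (K0_obj R) (K0_obj S)" by (rule h.K0_map_pogroup_hom)
  then have Kact: "\<And>\<alpha> x. x \<in> carrier (K0_group R) \<Longrightarrow> K0_map R S \<phi> (act (K0_group R) \<alpha> x) = act (K0_group S) \<alpha> (K0_map R S \<phi> x)"
    by (auto simp: pogroup_hom_def K0_obj_def)
  \<comment> \<open>Left multiplication by E k 0 0 is u (k, 0) after v (k, 0), the projection of S
    onto its copy of Q k; so the right ideal of E k 0 0 is isomorphic to Q k.\<close>
  have base: "K0_map R S \<phi> (K0_class R (row k 0)) = f (K0_class R (row k 0))" if k: "k < length \<Delta>" for k
  proof -
    have d: "0 < dim k" by (rule pos[OF k])
    have t: "(k, 0) \<in> idx2" using k d by (simp add: idx2_def)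
    have E0: "E k 0 0 \<in> grade S 0" "E k 0 0 \<otimes>\<^bsub>S\<^esub> E k 0 0 = E k 0 0"
      using Eg[OF k d d] EE[OF k d d k d d] by auto
    have im: "gr_module S (idem_module S (E k 0 0))" by (rule S.gr_module_idem[OF E0(1)])
    have "K0_map R S \<phi> (K0_class R (row k 0)) = K0_class S (idem_module S (E k 0 0))"
      using h.K0_map_class[OF h.ext_scalars_idem[OF one_grade_unit[of k 0 0, simplified] unit_idem[OF d]]] \<phi>E[OF k d d] by simp
    also have "\<dots> = K0_class S (Q k)"
    proof (rule K0_class_cong[OF _ im fgproj_module[OF Qf[OF k]]], rule gr_isomorphicI2)
      have inc: "(\<lambda>s. s) \<in> gr_module_hom S (idem_module S (E k 0 0)) (regular_module S)"
        by (rule gr_module_homI) auto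
      show "v (k, 0) \<in> gr_module_hom S (idem_module S (E k 0 0)) (Q k)"
        using gmh_comp[OF inc v[OF t]] by (simp add: M0)
      have Eu: "E k 0 0 \<otimes>\<^bsub>S\<^esub> u (k, 0) q = u (k, 0) q" if "q \<in> carrier (Q k)" for q
        using E_mult[OF k d d, of "u (k, 0) q"] vu[OF t t, of q] uc[OF k d, of q 0] that by (simp add: M0)
      show "u (k, 0) \<in> gr_module_hom S (Q k) (idem_module S (E k 0 0))"
        unfolding idem_module_def
        by (rule gmh_into_equalizer[OF fgproj_module[OF Qf[OF k]] u[OF t, unfolded M0]]) (rule Eu)
      show "u (k, 0) (v (k, 0) s) = s" if "s \<in> carrier (idem_module S (E k 0 0))" for s
        using E_mult[OF k d d, of s] that by simp
      show "v (k, 0) (u (k, 0) q) = q" if "q \<in> carrier (Q k)" for q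
        using vu[OF t t, of q] that by (simp add: M0)
    qed
    finally show ?thesis by (simp add: fQ[OF k])
  qed
  have "K0_map R S \<phi> = f"
  proof (rule extensionalityI[OF _ fext])
    show "K0_map R S \<phi> \<in> extensional (carrier (K0_group R))" by (simp add: K0_map_def)
    fix x assume x: "x \<in> carrier (K0_group R)"
    show "K0_map R S \<phi> x = f x"
    proof (rule BR.K0_hom_eq_atoms[OF h.K0_map_hom fh S.K0.is_group _ x])
      fix \<alpha> t assume "t \<in> idx2"
      then obtain k i where t: "t = (k, i)" "k < length \<Delta>" "i < dim k" by (auto simp: idx2_def)
      \<comment> \<open>An atom is the class of a shifted row, hence lies in the \<Gamma>-orbit of
        the class of a first row, and both maps commute with the action.\<close>
      have "K0_class R (shift \<alpha> (?B t)) = act (K0_group R) \<alpha> (act (K0_group R) (\<Delta> ! k ! 0 - \<Delta> ! k ! i) (K0_class R (row k 0)))"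
        using R.act_class[OF row_fgproj[OF t(3)], of \<alpha>] rowK[OF t(2,3)] by (simp add: t)
      moreover have "act (K0_group R) (\<Delta> ! k ! 0 - \<Delta> ! k ! i) (K0_class R (row k 0)) \<in> carrier (K0_group R)"
        using R.act_hom rc[OF t(2)] by (auto simp: hom_def)
      ultimately show "K0_map R S \<phi> (K0_class R (shift \<alpha> (?B t))) = f (K0_class R (shift \<alpha> (?B t)))"
        using rc[OF t(2)] by (simp add: Kact f_act base[OF t(2)])
    qed
  qed
  then show ?thesis using \<phi> by blast
qed

end

section \<open>The quotient category and the assembly of the functor\<close>

section \<open>The categories\<close>

lemma matricial_algebrasE:
  assumes "gr_field A" "R \<in> matricial_algebras A"
  obtains \<Delta> where "R = gr_prod (map (gr_mat A) \<Delta>)" "matricial A" "\<And>k. k < length \<Delta> \<Longrightarrow> 0 < length (\<Delta> ! k)"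
proof -
  obtain \<Delta> where "R = gr_prod (map (gr_mat A) \<Delta>)" "[] \<notin> set \<Delta>"
    using assms(2) by (auto simp: matricial_algebras_def)
  then show ?thesis
    using that[of \<Delta>] assms(1) by (fastforce simp: matricial_def in_set_conv_nth)
qed

context
  fixes A :: "('g::ab_group_add, 'a) gring"
  assumes A: "gr_field A"
begin

lemma matricial_algebra_gr_algebra: "R \<in> matricial_algebras A \<Longrightarrow> gr_algebra A R"
proof (erule matricial_algebrasE[OF A])
  fix \<Delta> assume R: "R = gr_prod (map (gr_mat A) \<Delta>)" and "matricial A"
  then interpret matricial A \<Delta> by simp
  show "gr_algebra A R" unfolding R by (rule R.gr_algebra_axioms)
qed

lemma matricial_algebra_gr_ring: "R \<in> matricial_algebras A \<Longrightarrow> gr_ring R"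
  using matricial_algebra_gr_algebra gr_algebra.axioms(2) by blast

lemma alg_hom_gr_hom: "\<lbrakk>R \<in> matricial_algebras A; S \<in> matricial_algebras A; \<phi> \<in> gr_alg_hom A R S\<rbrakk> \<Longrightarrow> gr_hom R S \<phi>"
  by (rule gr_alg_hom_gr_hom) (auto intro: matricial_algebra_gr_ring)

lemma K0_map_faithful:
  assumes R: "R \<in> matricial_algebras A" and S: "S \<in> matricial_algebras A"
    and \<phi>: "\<phi> \<in> gr_alg_hom A R S" and \<psi>: "\<psi> \<in> gr_alg_hom A R S"
  shows "(\<exists>x\<in>Units S. x \<in> grade S 0 \<and> (\<forall>r\<in>carrier R. \<phi> r = x \<otimes>\<^bsub>S\<^esub> \<psi> r \<otimes>\<^bsub>S\<^esub> inv\<^bsub>S\<^esub> x)) \<longleftrightarrow>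
    K0_map R S \<phi> = K0_map R S \<psi>"
proof
  assume "\<exists>x\<in>Units S. x \<in> grade S 0 \<and> (\<forall>r\<in>carrier R. \<phi> r = x \<otimes>\<^bsub>S\<^esub> \<psi> r \<otimes>\<^bsub>S\<^esub> inv\<^bsub>S\<^esub> x)"
  then show "K0_map R S \<phi> = K0_map R S \<psi>"
    using K0_map_inner[OF alg_hom_gr_hom[OF R S \<phi>] alg_hom_gr_hom[OF R S \<psi>]] by blast
next
  assume eq: "K0_map R S \<phi> = K0_map R S \<psi>"
  obtain \<Delta> where RD: "R = gr_prod (map (gr_mat A) \<Delta>)" and mR: "matricial A"
    using matricial_algebrasE[OF A R] by blast
  obtain \<Delta>' where SD: "S = gr_prod (map (gr_mat A) \<Delta>')" and mS: "matricial A"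
    using matricial_algebrasE[OF A S] by blast
  interpret R: matricial A \<Delta> by (rule mR)
  interpret S: matricial A \<Delta>' by (rule mS)
  show "\<exists>x\<in>Units S. x \<in> grade S 0 \<and> (\<forall>r\<in>carrier R. \<phi> r = x \<otimes>\<^bsub>S\<^esub> \<psi> r \<otimes>\<^bsub>S\<^esub> inv\<^bsub>S\<^esub> x)"
    using R.faithful[OF S.R.gr_algebra_axioms S.BR.K0_class_eq_imp_iso, folded SD RD] \<phi> \<psi> eq by blast
qed

lemma K0_map_full:
  assumes R: "R \<in> matricial_algebras A" and S: "S \<in> matricial_algebras A"
    and f: "f \<in> pogroup_hom (K0_obj R) (K0_obj S)"
  shows "\<exists>\<phi>\<in>gr_alg_hom A R S. K0_map R S \<phi> = f"
proof -
  obtain \<Delta> where RD: "R = gr_prod (map (gr_mat A) \<Delta>)" and mR: "matricial A" and pos: "\<And>k. k < length \<Delta> \<Longrightarrow> 0 < length (\<Delta> ! k)"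
    using matricial_algebrasE[OF A R] by blast
  obtain \<Delta>' where SD: "S = gr_prod (map (gr_mat A) \<Delta>')" and mS: "matricial A"
    using matricial_algebrasE[OF A S] by blast
  interpret R: matricial A \<Delta> by (rule mR)
  interpret S: matricial A \<Delta>' by (rule mS)
  show ?thesis
    using R.full[OF S.R.gr_algebra_axioms S.BR.brick_ring_axioms pos, folded SD RD, OF _ f] by blast
qed

text \<open>The two directions of \<open>K0_map_faithful\<close> together. Described as the kernel
  of \<open>K0_map\<close>, the relation is visibly an equivalence, and its compatibility with
  composition follows from functoriality instead of computations with inner automorphisms.\<close>

lemma inner_rel_kernel:
  assumes "R \<in> matricial_algebras A" "S \<in> matricial_algebras A"
  shows "inner_rel A R S = {(\<phi>, \<psi>). \<phi> \<in> gr_alg_hom A R S \<and> \<psi> \<in> gr_alg_hom A R S \<and> K0_map R S \<phi> = K0_map R S \<psi>}"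
  using K0_map_faithful[OF assms] unfolding inner_rel_def by blast

lemma alg_hom_ident: "R \<in> matricial_algebras A \<Longrightarrow> (\<lambda>r\<in>carrier R. r) \<in> gr_alg_hom A R R"
proof -
  assume "R \<in> matricial_algebras A"
  then interpret gr_algebra A R by (rule matricial_algebra_gr_algebra)
  show ?thesis
    using grade_carrier by (auto simp: gr_alg_hom_def ring_hom_def scale_closed)
qed

lemma alg_hom_compose:
  assumes R: "R \<in> matricial_algebras A" and S: "S \<in> matricial_algebras A" and T: "T \<in> matricial_algebras A"
    and f: "f \<in> gr_alg_hom A R S" and g: "g \<in> gr_alg_hom A S T"
  shows "compose (carrier R) g f \<in> gr_alg_hom A R T"
proof -
  interpret R: gr_algebra A R by (rule matricial_algebra_gr_algebra[OF R])
  interpret f: gr_hom R S f by (rule alg_hom_gr_hom[OF R S f])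
  interpret g: gr_hom S T g by (rule alg_hom_gr_hom[OF S T g])
  have c: "compose (carrier R) g f r = g (f r)" if "r \<in> carrier R" for r
    using that by (simp add: compose_def)
  have "gr_hom R T (compose (carrier R) g f)"
    by (rule gr_hom_cong[OF gr_hom_comp[OF f.gr_hom_axioms g.gr_hom_axioms] c])
  then interpret h: gr_hom R T "compose (carrier R) g f" .
  have "g (f (scale R a r)) = scale T a (g (f r))" if "a \<in> carrier A" "r \<in> carrier R" for a r
    using f g that f.\<phi>_closed by (simp add: gr_alg_hom_def)
  then show ?thesis
    using h.ring_hom h.hom_grade by (auto simp: gr_alg_hom_def c R.scale_closed)
qed

abbreviation "inner_class R S \<phi> \<equiv> inner_rel A R S `` {\<phi>}"

lemma inner_class_eq:
  assumes "R \<in> matricial_algebras A" "S \<in> matricial_algebras A" "\<phi> \<in> gr_alg_hom A R S"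
  shows "inner_class R S \<phi> = {\<psi> \<in> gr_alg_hom A R S. K0_map R S \<psi> = K0_map R S \<phi>}"
  using assms(3) by (auto simp: inner_rel_kernel[OF assms(1,2)])

lemma matricial_cat_out_simps:
  "Obj (matricial_cat_out A) = matricial_algebras A"
  "Hom (matricial_cat_out A) R S = {inner_class R S \<phi> | \<phi>. \<phi> \<in> gr_alg_hom A R S}"
  "Ident (matricial_cat_out A) R = inner_class R R (\<lambda>r\<in>carrier R. r)"
  by (auto simp: matricial_cat_out_def matricial_cat_def Let_def quotient_def)

text \<open>The union over representatives collapses because the value of \<open>K0_map\<close> on a
  composite depends only on its values on the two factors.\<close>

lemma matricial_cat_out_Comp:
  assumes R: "R \<in> matricial_algebras A" and S: "S \<in> matricial_algebras A" and T: "T \<in> matricial_algebras A"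
    and f: "f \<in> gr_alg_hom A R S" and g: "g \<in> gr_alg_hom A S T"
  shows "Comp (matricial_cat_out A) R S T (inner_class S T g) (inner_class R S f) =
    inner_class R T (compose (carrier R) g f)"
proof -
  have e: "inner_class R T (compose (carrier R) g' f') = inner_class R T (compose (carrier R) g f)"
    if g': "g' \<in> inner_class S T g" and f': "f' \<in> inner_class R S f" for g' f'
  proof -
    have h: "f' \<in> gr_alg_hom A R S" "K0_map R S f' = K0_map R S f" "g' \<in> gr_alg_hom A S T" "K0_map S T g' = K0_map S T g"
      using f' g' by (simp_all add: inner_class_eq[OF R S f] inner_class_eq[OF S T g])
    show ?thesis
      using h K0_map_compose[OF alg_hom_gr_hom[OF R S h(1)] alg_hom_gr_hom[OF S T h(3)]]
        K0_map_compose[OF alg_hom_gr_hom[OF R S f] alg_hom_gr_hom[OF S T g]]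
      by (simp add: inner_class_eq[OF R T] alg_hom_compose[OF R S T] f g)
  qed
  have "f \<in> inner_class R S f" "g \<in> inner_class S T g"
    using f g by (simp_all add: inner_class_eq R S T)
  moreover have "Comp (matricial_cat_out A) R S T (inner_class S T g) (inner_class R S f) =
      (\<Union>g'\<in>inner_class S T g. \<Union>f'\<in>inner_class R S f. inner_class R T (compose (carrier R) g' f'))"
    by (simp add: matricial_cat_out_def matricial_cat_def Let_def)
  moreover have "\<dots> = (\<Union>g'\<in>inner_class S T g. \<Union>f'\<in>inner_class R S f. inner_class R T (compose (carrier R) g f))"
    using e by (intro SUP_cong refl) auto
  ultimately show ?thesis by auto
qed

lemma K0_map_out_class:
  assumes "R \<in> matricial_algebras A" "S \<in> matricial_algebras A" "\<phi> \<in> gr_alg_hom A R S"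
  shows "K0_map_out R S (inner_class R S \<phi>) = K0_map R S \<phi>"
proof -
  have "K0_map R S ` inner_class R S \<phi> = {K0_map R S \<phi>}"
    using assms(3) by (auto simp: inner_class_eq[OF assms])
  then show ?thesis by (simp add: K0_map_out_def)
qed

lemma alg_hom_extensional: "\<phi> \<in> gr_alg_hom A R S \<Longrightarrow> \<phi> \<in> extensional (carrier R) \<and> \<phi> \<in> carrier R \<rightarrow> carrier S"
  by (auto simp: gr_alg_hom_def ring_hom_def)

lemma category_matricial_out: "category (matricial_cat_out A)"
proof
  fix X assume "X \<in> Obj (matricial_cat_out A)"
  then show "Ident (matricial_cat_out A) X \<in> Hom (matricial_cat_out A) X X"
    using alg_hom_ident by (auto simp: matricial_cat_out_simps)
next
  fix X Y f assume "X \<in> Obj (matricial_cat_out A)" "Y \<in> Obj (matricial_cat_out A)" "f \<in> Hom (matricial_cat_out A) X Y"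
  then obtain \<phi> where X: "X \<in> matricial_algebras A" and Y: "Y \<in> matricial_algebras A"
    and \<phi>: "\<phi> \<in> gr_alg_hom A X Y" and f: "f = inner_class X Y \<phi>"
    by (auto simp: matricial_cat_out_simps)
  note \<phi>e = alg_hom_extensional[OF \<phi>]
  have "compose (carrier X) \<phi> (\<lambda>x\<in>carrier X. x) = \<phi>"
    by (rule extensionalityI[of _ "carrier X"]) (use \<phi>e in \<open>auto simp: compose_def\<close>)
  then show "Comp (matricial_cat_out A) X X Y f (Ident (matricial_cat_out A) X) = f"
    using matricial_cat_out_Comp[OF X X Y alg_hom_ident[OF X] \<phi>] by (simp add: matricial_cat_out_simps f)
  have "compose (carrier X) (\<lambda>y\<in>carrier Y. y) \<phi> = \<phi>"
    by (rule extensionalityI[of _ "carrier X"]) (use \<phi>e in \<open>auto simp: compose_def\<close>)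
  then show "Comp (matricial_cat_out A) X Y Y (Ident (matricial_cat_out A) Y) f = f"
    using matricial_cat_out_Comp[OF X Y Y \<phi> alg_hom_ident[OF Y]] by (simp add: matricial_cat_out_simps f)
  fix Z g assume "Z \<in> Obj (matricial_cat_out A)" "g \<in> Hom (matricial_cat_out A) Y Z"
  then obtain \<psi> where Z: "Z \<in> matricial_algebras A" and \<psi>: "\<psi> \<in> gr_alg_hom A Y Z" and g: "g = inner_class Y Z \<psi>"
    by (auto simp: matricial_cat_out_simps)
  show "Comp (matricial_cat_out A) X Y Z g f \<in> Hom (matricial_cat_out A) X Z"
    using matricial_cat_out_Comp[OF X Y Z \<phi> \<psi>] alg_hom_compose[OF X Y Z \<phi> \<psi>]
    by (auto simp: matricial_cat_out_simps f g)
  fix W h assume "W \<in> Obj (matricial_cat_out A)" "h \<in> Hom (matricial_cat_out A) Z W"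
  then obtain \<chi> where W: "W \<in> matricial_algebras A" and \<chi>: "\<chi> \<in> gr_alg_hom A Z W" and h: "h = inner_class Z W \<chi>"
    by (auto simp: matricial_cat_out_simps)
  have "compose (carrier X) \<chi> (compose (carrier X) \<psi> \<phi>) = compose (carrier X) (compose (carrier Y) \<chi> \<psi>) \<phi>"
    by (rule compose_assoc) (use \<phi>e in blast)
  then show "Comp (matricial_cat_out A) X Z W h (Comp (matricial_cat_out A) X Y Z g f) =
      Comp (matricial_cat_out A) X Y W (Comp (matricial_cat_out A) Y Z W h g) f"
    using matricial_cat_out_Comp[OF X Y Z \<phi> \<psi>] matricial_cat_out_Comp[OF Y Z W \<psi> \<chi>]
      matricial_cat_out_Comp[OF X Z W alg_hom_compose[OF X Y Z \<phi> \<psi>] \<chi>]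
      matricial_cat_out_Comp[OF X Y W \<phi> alg_hom_compose[OF Y Z W \<psi> \<chi>]]
    by (simp add: f g h)
qed

end

lemma pogroup_hom_compose:
  assumes "f \<in> pogroup_hom (G, u) (H, v)" "g \<in> pogroup_hom (H, v) (K, w)"
    and "preordered_group G" "order_unit G u"
  shows "compose (carrier G) g f \<in> pogroup_hom (G, u) (K, w)"
proof -
  interpret G: preordered_group G by fact
  have f: "f \<in> hom G H" "\<And>\<alpha> x. x \<in> carrier G \<Longrightarrow> f (act G \<alpha> x) = act H \<alpha> (f x)" "f ` pos_cone G \<subseteq> pos_cone H" "f u = v"
    and g: "g \<in> hom H K" "\<And>\<alpha> x. x \<in> carrier H \<Longrightarrow> g (act H \<alpha> x) = act K \<alpha> (g x)" "g ` pos_cone H \<subseteq> pos_cone K" "g v = w"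
    using assms(1,2) by (auto simp: pogroup_hom_def)
  have fc: "f x \<in> carrier H" if "x \<in> carrier G" for x using f(1) that by (auto simp: hom_def)
  have c: "compose (carrier G) g f x = g (f x)" if "x \<in> carrier G" for x
    using that by (simp add: compose_def)
  have "compose (carrier G) g f \<in> hom G K"
  proof (rule homI)
    fix x assume "x \<in> carrier G"
    then show "compose (carrier G) g f x \<in> carrier K"
      using g(1) fc by (auto simp: c hom_def)
    fix y assume "y \<in> carrier G"
    then show "compose (carrier G) g f (x \<otimes>\<^bsub>G\<^esub> y) = compose (carrier G) g f x \<otimes>\<^bsub>K\<^esub> compose (carrier G) g f y"
      using \<open>x \<in> carrier G\<close> fc by (simp add: c hom_mult[OF f(1)] hom_mult[OF g(1)])
  qed
  moreover have "compose (carrier G) g f ` pos_cone G \<subseteq> pos_cone K"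
    using f(3) g(3) by (auto simp: c pos_cone_def)
  moreover have "u \<in> carrier G"
    using assms(4) by (simp add: order_unit_def pos_cone_def)
  ultimately show ?thesis
    using f g fc by (simp add: pogroup_hom_def c G.act_closed)
qed

lemma category_pogroup: "category (pogroup_cat :: (('g::ab_group_add, 'k) pogroup \<times> 'k, 'k \<Rightarrow> 'k) cat)"
proof
  fix X :: "('g, 'k) pogroup \<times> 'k" assume "X \<in> Obj pogroup_cat"
  then obtain G u where X: "X = (G, u)" "preordered_group G" "order_unit G u"
    by (auto simp: pogroup_cat_def)
  interpret G: preordered_group G by (rule X)
  show "Ident pogroup_cat X \<in> Hom pogroup_cat X X"
    using X(3) by (auto simp: pogroup_cat_def pogroup_hom_def X(1) hom_def G.act_closed order_unit_def pos_cone_def)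
next
  fix X Y :: "('g, 'k) pogroup \<times> 'k" and f
  assume "X \<in> Obj pogroup_cat" "Y \<in> Obj pogroup_cat" and "f \<in> Hom pogroup_cat X Y"
  then obtain G u H v where X: "X = (G, u)" "preordered_group G" "order_unit G u"
    and Y: "Y = (H, v)" "preordered_group H" "order_unit H v" and f: "f \<in> pogroup_hom (G, u) (H, v)"
    by (auto simp: pogroup_cat_def)
  have fe: "f \<in> extensional (carrier G)" "f \<in> carrier G \<rightarrow> carrier H"
    using f by (auto simp: pogroup_hom_def hom_def)
  show "Comp pogroup_cat X X Y f (Ident pogroup_cat X) = f"
    by (rule extensionalityI[of _ "carrier G"]) (use fe in \<open>auto simp: pogroup_cat_def X Y compose_def\<close>)
  show "Comp pogroup_cat X Y Y (Ident pogroup_cat Y) f = f"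
    by (rule extensionalityI[of _ "carrier G"]) (use fe in \<open>auto simp: pogroup_cat_def X Y compose_def\<close>)
  fix Z :: "('g, 'k) pogroup \<times> 'k" and g assume "Z \<in> Obj pogroup_cat" "g \<in> Hom pogroup_cat Y Z"
  then obtain K w where Z: "Z = (K, w)" "preordered_group K" "order_unit K w" and g: "g \<in> pogroup_hom (H, v) (K, w)"
    by (auto simp: pogroup_cat_def Y)
  show "Comp pogroup_cat X Y Z g f \<in> Hom pogroup_cat X Z"
    using pogroup_hom_compose[OF f g X(2,3)] by (simp add: pogroup_cat_def X Y Z)
  fix W :: "('g, 'k) pogroup \<times> 'k" and h assume "W \<in> Obj pogroup_cat" "h \<in> Hom pogroup_cat Z W"
  then obtain L y where W: "W = (L, y)" by (auto simp: pogroup_cat_def)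
  show "Comp pogroup_cat X Z W h (Comp pogroup_cat X Y Z g f) =
      Comp pogroup_cat X Y W (Comp pogroup_cat Y Z W h g) f"
    using compose_assoc[OF fe(2)] by (simp add: pogroup_cat_def X Y Z W)
qed

theorem theorem2p13:
  fixes A :: "('g::ab_group_add, 'a) gring"
  assumes "gr_field A"
  shows "fully_faithful_functor (matricial_cat_out A) pogroup_cat K0_obj K0_map_out \<and>
    (\<forall>R\<in>matricial_algebras A. \<forall>S\<in>matricial_algebras A.
       \<forall>\<phi>\<in>gr_alg_hom A R S. \<forall>\<psi>\<in>gr_alg_hom A R S.
         (\<exists>x\<in>Units S. x \<in> grade S 0 \<and>
            (\<forall>r\<in>carrier R. \<phi> r = x \<otimes>\<^bsub>S\<^esub> \<psi> r \<otimes>\<^bsub>S\<^esub> inv\<^bsub>S\<^esub> x))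
         \<longleftrightarrow> K0_map R S \<phi> = K0_map R S \<psi>) \<and>
    (\<forall>R\<in>matricial_algebras A. \<forall>S\<in>matricial_algebras A.
       \<forall>f\<in>pogroup_hom (K0_obj R) (K0_obj S). \<exists>\<phi>\<in>gr_alg_hom A R S. K0_map R S \<phi> = f)"
proof (intro conjI ballI)
  note [simp] = matricial_cat_out_simps[OF assms]
  have hom: "Hom pogroup_cat X Y = pogroup_hom X Y" for X Y :: "('g, 'k) pogroup \<times> 'k"
    by (simp add: pogroup_cat_def)
  show "fully_faithful_functor (matricial_cat_out A) pogroup_cat K0_obj K0_map_out"
  proof (intro fully_faithful_functor.intro cat_functor.intro category_matricial_out[OF assms] category_pogroup
      cat_functor_axioms.intro fully_faithful_functor_axioms.intro)
    fix X assume "X \<in> Obj (matricial_cat_out A)"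
    then have X: "X \<in> matricial_algebras A" by simp
    then interpret X: gr_ring X by (rule matricial_algebra_gr_ring[OF assms])
    show "K0_obj X \<in> Obj pogroup_cat"
      using X.preordered_K0 X.order_unit_K0 by (simp add: K0_obj_def pogroup_cat_def)
    show "K0_map_out X X (Ident (matricial_cat_out A) X) = Ident pogroup_cat (K0_obj X)"
      using K0_map_out_class[OF assms X X alg_hom_ident[OF assms X]] K0_map_ident[OF X.gr_ring_axioms]
      by (simp add: pogroup_cat_def K0_obj_def)
    fix Y assume "Y \<in> Obj (matricial_cat_out A)"
    then have Y: "Y \<in> matricial_algebras A" by simp
    show "inj_on (K0_map_out X Y) (Hom (matricial_cat_out A) X Y)"
    proof
      fix f g assume "f \<in> Hom (matricial_cat_out A) X Y" "g \<in> Hom (matricial_cat_out A) X Y"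
        and eq: "K0_map_out X Y f = K0_map_out X Y g"
      then obtain \<phi> \<psi> where \<phi>: "\<phi> \<in> gr_alg_hom A X Y" "f = inner_rel A X Y `` {\<phi>}"
        and \<psi>: "\<psi> \<in> gr_alg_hom A X Y" "g = inner_rel A X Y `` {\<psi>}" by auto
      then show "f = g"
        using eq K0_map_out_class[OF assms X Y \<phi>(1)] K0_map_out_class[OF assms X Y \<psi>(1)]
          inner_class_eq[OF assms X Y \<phi>(1)] inner_class_eq[OF assms X Y \<psi>(1)] by simp
    qed
    show "K0_map_out X Y ` Hom (matricial_cat_out A) X Y = Hom pogroup_cat (K0_obj X) (K0_obj Y)"
      unfolding hom
    proof safe
      fix f assume "f \<in> Hom (matricial_cat_out A) X Y"
      then obtain \<phi> where \<phi>: "\<phi> \<in> gr_alg_hom A X Y" "f = inner_rel A X Y `` {\<phi>}" by auto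
      then show "K0_map_out X Y f \<in> pogroup_hom (K0_obj X) (K0_obj Y)"
        using K0_map_out_class[OF assms X Y \<phi>(1)] gr_hom.K0_map_pogroup_hom[OF alg_hom_gr_hom[OF assms X Y \<phi>(1)]] by simp
    next
      fix f assume "f \<in> pogroup_hom (K0_obj X) (K0_obj Y)"
      then obtain \<phi> where \<phi>: "\<phi> \<in> gr_alg_hom A X Y" "K0_map X Y \<phi> = f"
        using K0_map_full[OF assms X Y] by blast
      then show "f \<in> K0_map_out X Y ` Hom (matricial_cat_out A) X Y"
        using K0_map_out_class[OF assms X Y \<phi>(1)]
        by (intro image_eqI[of _ _ "inner_rel A X Y `` {\<phi>}"]) auto
    qed
    fix f assume "f \<in> Hom (matricial_cat_out A) X Y"
    then obtain \<phi> where \<phi>: "\<phi> \<in> gr_alg_hom A X Y" "f = inner_rel A X Y `` {\<phi>}" by auto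
    then show "K0_map_out X Y f \<in> Hom pogroup_cat (K0_obj X) (K0_obj Y)"
      unfolding hom
      using K0_map_out_class[OF assms X Y \<phi>(1)] gr_hom.K0_map_pogroup_hom[OF alg_hom_gr_hom[OF assms X Y \<phi>(1)]] by simp
    fix Z g assume "Z \<in> Obj (matricial_cat_out A)" "g \<in> Hom (matricial_cat_out A) Y Z"
    then obtain \<psi> where Z: "Z \<in> matricial_algebras A" and \<psi>: "\<psi> \<in> gr_alg_hom A Y Z" "g = inner_rel A Y Z `` {\<psi>}" by auto
    show "K0_map_out X Z (Comp (matricial_cat_out A) X Y Z g f) =
        Comp pogroup_cat (K0_obj X) (K0_obj Y) (K0_obj Z) (K0_map_out Y Z g) (K0_map_out X Y f)"
      using matricial_cat_out_Comp[OF assms X Y Z \<phi>(1) \<psi>(1)] K0_map_out_class[OF assms X Y \<phi>(1)]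
        K0_map_out_class[OF assms Y Z \<psi>(1)] K0_map_out_class[OF assms X Z alg_hom_compose[OF assms X Y Z \<phi>(1) \<psi>(1)]]
        K0_map_compose[OF alg_hom_gr_hom[OF assms X Y \<phi>(1)] alg_hom_gr_hom[OF assms Y Z \<psi>(1)]]
      by (simp add: \<phi> \<psi> pogroup_cat_def K0_obj_def)
  qed
qed (use K0_map_faithful[OF assms] K0_map_full[OF assms] in blast)+

end
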